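(* The coefficients of the Sklyanin determinants $\mathrm{sdet}\,(S+q^{-1}u^{-1}\overline S)$ and $\mathrm{sdet}\,(S+q\,u^{-1}\overline S)$ are central elements in the algebras $\mathrm U^{\rm tw}_q(\mathfrak o_N)$ and $\mathrm U^{\rm tw}_q(\mathfrak{sp}_{2n})$, respectively.
   Context: Fix $q\in\mathbb C$, nonzero and not a root of unity. $E_{ij}$ are the matrix units of $\mathrm{End}\,\mathbb C^N$; a matrix $M=(m_{ij})$ over an algebra is identified with $\sum m_{ij}\otimes E_{ij}$, $M^t$ is its transpose; subscripts indicate the copies of $\mathrm{End}\,\mathbb C^N$ in which an element acts. Let $R=q\sum_iE_{ii}\otimes E_{ii}+\sum_{i\ne j}E_{ii}\otimes E_{jj}+(q-q^{-1})\sum_{i<j}E_{ij}\otimes E_{ji}$. $\mathrm U_q(\mathfrak{gl}_N)$ is the algebra generated by $t_{ij},\bar t_{ij}$ ($1\le i,j\le N$) with relations $t_{ij}=\bar t_{ji}=0$ for $i<j$; $t_{ii}\bar t_{ii}=\bar t_{ii}t_{ii}=1$; $RT_1T_2=T_2T_1R$, $R\overline T_1\overline T_2=\overline T_2\overline T_1R$, $R\overline T_1T_2=T_2\overline T_1R$, where $T=(t_{ij})$, $\overline T=(\bar t_{ij})$. Orthogonal case: $S=T\,\overline T^{\,t}$, $\overline S=\overline T\,T^t$, and $\mathrm U^{\rm tw}_q(\mathfrak o_N)$ is the subalgebra of $\mathrm U_q(\mathfrak{gl}_N)$ generated by the entries of $S$; it contains the entries of $\overline S$. Symplectic case ($N=2n$):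 $G=q\sum_{k=1}^nE_{2k-1,2k}-\sum_{k=1}^nE_{2k,2k-1}$, $S=T\,G\,\overline T^{\,t}=(s_{ij})$, $\overline S=\overline T\,G\,T^t$, and $\mathrm U^{\rm tw}_q(\mathfrak{sp}_{2n})$ is the subalgebra of $\mathrm U_q(\mathfrak{gl}_{2n})$ generated by the entries of $S$ and the inverses of the invertible elements $s_{2k-1,2k}$, $k=1,\dots,n$; it contains the entries of $\overline S$. Sklyanin determinant: let $$R(u,v)=(u-v)\sum_{i\ne j}E_{ii}\otimes E_{jj}+(q^{-1}u-qv)\sum_iE_{ii}\otimes E_{ii}+(q^{-1}-q)u\sum_{i>j}E_{ij}\otimes E_{ji}+(q^{-1}-q)v\sum_{i<j}E_{ij}\otimes E_{ji},$$ and let $R^t(u,v)$ be obtained from it by transposition in the first tensor factor. Let $P^q=\sum_iE_{ii}\otimes E_{ii}+q\sum_{i>j}E_{ij}\otimes E_{ji}+q^{-1}\sum_{i<j}E_{ij}\otimes E_{ji}$. The assignment $(i,i+1)\mapsto P^q_{i,i+1}$ defines an action $\sigma\mapsto P^q_\sigma$ of $\mathfrak S_N$ on $(\mathbb C^N)^{\otimes N}$; put $A^q_N=\sum_{\sigma\in\mathfrak S_N}\mathrm{sgn}\,\sigma\cdot P^q_\sigma$. Put $u_i=q^{-2i+2}u$ and $R^t_{ij}=R^t_{ij}(u_i^{-1},u_j)$. If $S(u)$ is an $N\times N$ matrix of series in $u^{-1}$ satisfying $R(u,v)S_1(u)R^t(u^{-1},v)S_2(v)=S_2(v)R^t(u^{-1},v)S_1(u)R(u,v)$,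 then $$A^q_N\,S_1(u_1)R^t_{12}\cdots R^t_{1N}\,S_2(u_2)R^t_{23}\cdots R^t_{2N}\,S_3(u_3)\cdots R^t_{N-1,N}\,S_N(u_N)$$ equals $A^q_N$ times a scalar series, denoted $\mathrm{sdet}\,S(u)$. The matrices $S(u)=S+q^{-1}u^{-1}\overline S$ (orthogonal case) and $S(u)=S+q\,u^{-1}\overline S$ (symplectic case) satisfy this equation, and $\mathrm{sdet}(S+q^{\mp1}u^{-1}\overline S)$ is the corresponding series, with coefficients in $\mathrm U^{\rm tw}_q(\mathfrak o_N)$, respectively $\mathrm U^{\rm tw}_q(\mathfrak{sp}_{2n})$. *)

theory Defs
  imports
    "HOL-Library.Poly_Mapping"
    "HOL-Combinatorics.Permutations"
    "HOL-Algebra.QuotRing"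
    "HOL-Algebra.Generated_Rings"
    "HOL-Algebra.Algebraic_Closure_Type"
begin

section \<open>Free associative algebras over the complex numbers\<close>

text \<open>The free monoid is written additively, so that the convolution product of
  \<open>'g fmon \<Rightarrow>\<^sub>0 complex\<close> becomes the product of noncommutative polynomials.\<close>

datatype 'g fmon = Fmon (letters: "'g list")

instantiation fmon :: (type) monoid_add
begin

definition zero_fmon :: "'a fmon" where "0 = Fmon []"

definition plus_fmon :: "'a fmon \<Rightarrow> 'a fmon \<Rightarrow> 'a fmon" where
  "x + y = Fmon (letters x @ letters y)"

instance
  by intro_classes (simp_all add: zero_fmon_def plus_fmon_def)

end

lemma letters_zero [simp]: "letters 0 = []"
  and letters_plus [simp]: "letters (x + y) = letters x @ letters y"
  by (simp_all add: zero_fmon_def plus_fmon_def)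

type_synonym 'g fpoly = "'g fmon \<Rightarrow>\<^sub>0 complex"

definition free_algebra :: "'g set \<Rightarrow> 'g fpoly ring" where
  "free_algebra A =
     ring_of_type_algebra \<lparr>carrier := {p. \<forall>w\<in>Poly_Mapping.keys p. set (letters w) \<subseteq> A}\<rparr>"

lemma carrier_free_algebra:
  "carrier (free_algebra A) = {p. \<forall>w\<in>Poly_Mapping.keys p. set (letters w) \<subseteq> A}"
  by (simp add: free_algebra_def)

lemma free_algebra_simps [simp]:
  "x \<otimes>\<^bsub>free_algebra A\<^esub> y = x * y" "\<one>\<^bsub>free_algebra A\<^esub> = 1"
  "x \<oplus>\<^bsub>free_algebra A\<^esub> y = x + y" "\<zero>\<^bsub>free_algebra A\<^esub> = 0"
  by (simp_all add: free_algebra_def ring_of_type_algebra_def)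

lemma free_algebra_closed:
  "0 \<in> carrier (free_algebra A)" "1 \<in> carrier (free_algebra A)"
  "x \<in> carrier (free_algebra A) \<Longrightarrow> - x \<in> carrier (free_algebra A)"
  "x \<in> carrier (free_algebra A) \<Longrightarrow> y \<in> carrier (free_algebra A) \<Longrightarrow>
     x + y \<in> carrier (free_algebra A)"
  "x \<in> carrier (free_algebra A) \<Longrightarrow> y \<in> carrier (free_algebra A) \<Longrightarrow>
     x * y \<in> carrier (free_algebra A)"
proof -
  show "0 \<in> carrier (free_algebra A)" "1 \<in> carrier (free_algebra A)"
    by (simp_all add: carrier_free_algebra)
  show "x \<in> carrier (free_algebra A) \<Longrightarrow> - x \<in> carrier (free_algebra A)"
    by (simp add: carrier_free_algebra)
  show "x \<in> carrier (free_algebra A) \<Longrightarrow> y \<in> carrier (free_algebra A) \<Longrightarrow>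
     x + y \<in> carrier (free_algebra A)"
    using Poly_Mapping.keys_add[of x y] by (auto simp: carrier_free_algebra)
  show "x \<in> carrier (free_algebra A) \<Longrightarrow> y \<in> carrier (free_algebra A) \<Longrightarrow>
     x * y \<in> carrier (free_algebra A)"
    using Poly_Mapping.keys_mult[of x y] by (fastforce simp: carrier_free_algebra)
qed

lemma ring_free_algebra: "ring (free_algebra A)"
proof (rule ringI)
  show "abelian_group (free_algebra A)"
  proof (rule abelian_groupI)
    fix x assume "x \<in> carrier (free_algebra A)"
    then show "\<exists>y\<in>carrier (free_algebra A). y \<oplus>\<^bsub>free_algebra A\<^esub> x = \<zero>\<^bsub>free_algebra A\<^esub>"
      by (intro bexI[of _ "- x"]) (simp_all add: free_algebra_closed)
  qed (simp_all add: free_algebra_closed algebra_simps)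
  show "Group.monoid (free_algebra A)"
    by (rule Group.monoidI) (simp_all add: free_algebra_closed algebra_simps)
qed (simp_all add: algebra_simps)

definition fgen :: "'g \<Rightarrow> 'g fpoly" where
  "fgen g = Poly_Mapping.single (Fmon [g]) 1"

definition fscal :: "complex \<Rightarrow> 'g fpoly" where
  "fscal c = Poly_Mapping.single 0 c"

lemma fscal_closed: "fscal c \<in> carrier (free_algebra A)"
  by (simp add: fscal_def carrier_free_algebra)

lemma fgen_closed: "g \<in> A \<Longrightarrow> fgen g \<in> carrier (free_algebra A)"
  by (simp add: fgen_def carrier_free_algebra)


section \<open>Matrices and tensor products of matrix algebras\<close>

text \<open>
  A complex algebra is given by a ring \<open>R\<close> together with its structure map
  \<open>\<iota>\<close> from the complex numbers.

  \<^item> \<open>'a mat\<close>: \<open>M i j\<close> is the coefficient of \<open>E\<^sub>i\<^sub>j\<close>, for \<open>1 \<le> i, j \<le> N\<close>.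
  \<^item> \<open>'a mat2\<close>: \<open>M i j k l\<close> is the coefficient of \<open>E\<^sub>i\<^sub>j \<otimes> E\<^sub>k\<^sub>l\<close>.
  \<^item> \<open>'a tmat\<close>: elements of \<open>R \<otimes> (End \<complex>\<^sup>N)\<^sup>\<otimes>\<^sup>m\<close>; \<open>A I J\<close> is the coefficient of
    \<open>E\<^bsub>I 1,J 1\<^esub> \<otimes> \<dots> \<otimes> E\<^bsub>I m,J m\<^esub>\<close>, for \<open>I\<close> and \<open>J\<close> in \<open>tidx m N\<close>.

  Only the values at indices in the stated ranges are meaningful.
\<close>

type_synonym 'a mat = "nat \<Rightarrow> nat \<Rightarrow> 'a"
type_synonym 'a mat2 = "nat \<Rightarrow> nat \<Rightarrow> nat \<Rightarrow> nat \<Rightarrow> 'a"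
type_synonym 'a tmat = "(nat \<Rightarrow> nat) \<Rightarrow> (nat \<Rightarrow> nat) \<Rightarrow> 'a"

definition mat_mul :: "'a ring \<Rightarrow> nat \<Rightarrow> 'a mat \<Rightarrow> 'a mat \<Rightarrow> 'a mat" where
  "mat_mul R N A B = (\<lambda>i j. \<Oplus>\<^bsub>R\<^esub>k\<in>{1..N}. A i k \<otimes>\<^bsub>R\<^esub> B k j)"

definition mat_transpose :: "'a mat \<Rightarrow> 'a mat" where
  "mat_transpose A = (\<lambda>i j. A j i)"

definition transpose_fst :: "'a mat2 \<Rightarrow> 'a mat2" where
  "transpose_fst M = (\<lambda>i j k l. M j i k l)"

definition tidx :: "nat \<Rightarrow> nat \<Rightarrow> (nat \<Rightarrow> nat) set" where
  "tidx m N = {1..m} \<rightarrow>\<^sub>E {1..N}"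

definition tone :: "'a ring \<Rightarrow> 'a tmat" where
  "tone R = (\<lambda>I J. if I = J then \<one>\<^bsub>R\<^esub> else \<zero>\<^bsub>R\<^esub>)"

definition tmul :: "'a ring \<Rightarrow> nat \<Rightarrow> nat \<Rightarrow> 'a tmat \<Rightarrow> 'a tmat \<Rightarrow> 'a tmat" where
  "tmul R m N A B = (\<lambda>I J. \<Oplus>\<^bsub>R\<^esub>K\<in>tidx m N. A I K \<otimes>\<^bsub>R\<^esub> B K J)"

definition tprod :: "'a ring \<Rightarrow> nat \<Rightarrow> nat \<Rightarrow> 'a tmat list \<Rightarrow> 'a tmat" where
  "tprod R m N As = foldr (tmul R m N) As (tone R)"

lemma tmul_closed:
  assumes "ring R"
    and "\<And>I J. I \<in> tidx m N \<Longrightarrow> J \<in> tidx m N \<Longrightarrow> A I J \<in> carrier R"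
    and "\<And>I J. I \<in> tidx m N \<Longrightarrow> J \<in> tidx m N \<Longrightarrow> B I J \<in> carrier R"
    and "I \<in> tidx m N" and "J \<in> tidx m N"
  shows "tmul R m N A B I J \<in> carrier R"
proof -
  interpret ring R by fact
  show ?thesis
    unfolding tmul_def using assms by (intro finsum_closed) auto
qed

lemma tprod_closed:
  assumes "ring R"
    and "\<And>A I J. A \<in> set As \<Longrightarrow> I \<in> tidx m N \<Longrightarrow> J \<in> tidx m N \<Longrightarrow> A I J \<in> carrier R"
    and "I \<in> tidx m N" and "J \<in> tidx m N"
  shows "tprod R m N As I J \<in> carrier R"
  using assms(2-)
proof (induction As arbitrary: I J)
  case Nil
  interpret ring R by fact
  show ?case by (simp add: tprod_def tone_def)
next
  case (Cons A As)
  have "tmul R m N A (tprod R m N As) I J \<in> carrier R"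
    using Cons by (intro tmul_closed assms(1)) auto
  then show ?case by (simp add: tprod_def)
qed

text \<open>\<open>M\<^sub>a\<close> and \<open>M\<^sub>a\<^sub>b\<close>: the element \<open>M\<close> acting in the indicated copies among the
  \<open>m\<close> copies of \<open>End \<complex>\<^sup>N\<close>.\<close>

definition in_copy :: "'a ring \<Rightarrow> nat \<Rightarrow> nat \<Rightarrow> 'a mat \<Rightarrow> 'a tmat" where
  "in_copy R m a M =
     (\<lambda>I J. if \<forall>c\<in>{1..m} - {a}. I c = J c then M (I a) (J a) else \<zero>\<^bsub>R\<^esub>)"

definition in_copies :: "'a ring \<Rightarrow> nat \<Rightarrow> nat \<Rightarrow> nat \<Rightarrow> 'a mat2 \<Rightarrow> 'a tmat" where
  "in_copies R m a b M =
     (\<lambda>I J. if \<forall>c\<in>{1..m} - {a, b}. I c = J c then M (I a) (J a) (I b) (J b) else \<zero>\<^bsub>R\<^esub>)"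


section \<open>The quantized enveloping algebra of \<open>gl\<^sub>N\<close>\<close>

definition Rmat :: "complex \<Rightarrow> complex mat2" where
  "Rmat q = (\<lambda>i j k l.
     if i = j \<and> k = l then (if i = k then q else 1)
     else if k = j \<and> l = i \<and> i < j then q - inverse q
     else 0)"

datatype uq_gen = Tgen nat nat | Tbgen nat nat

definition uq_gens :: "nat \<Rightarrow> uq_gen set" where
  "uq_gens N = {Tgen i j | i j. i \<in> {1..N} \<and> j \<in> {1..N}} \<union>
               {Tbgen i j | i j. i \<in> {1..N} \<and> j \<in> {1..N}}"

abbreviation uq_free :: "nat \<Rightarrow> uq_gen fpoly ring" where
  "uq_free N \<equiv> free_algebra (uq_gens N)"

abbreviation fT :: "uq_gen fpoly mat" where "fT \<equiv> (\<lambda>i j. fgen (Tgen i j))"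
abbreviation fTb :: "uq_gen fpoly mat" where "fTb \<equiv> (\<lambda>i j. fgen (Tbgen i j))"

text \<open>The entries of \<open>R A\<^sub>1 B\<^sub>2 - B\<^sub>2 A\<^sub>1 R\<close>.\<close>

definition rtt_relators ::
    "complex \<Rightarrow> nat \<Rightarrow> uq_gen fpoly mat \<Rightarrow> uq_gen fpoly mat \<Rightarrow> uq_gen fpoly set" where
  "rtt_relators q N A B =
    (let F = uq_free N;
         R = in_copies F 2 1 2 (\<lambda>i j k l. fscal (Rmat q i j k l));
         A1 = in_copy F 2 1 A;
         B2 = in_copy F 2 2 B
     in {tprod F 2 N [R, A1, B2] I J - tprod F 2 N [B2, A1, R] I J | I J.
           I \<in> tidx 2 N \<and> J \<in> tidx 2 N})"

lemma rtt_relators_closed: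
  assumes "\<And>i j. i \<in> {1..N} \<Longrightarrow> j \<in> {1..N} \<Longrightarrow> A i j \<in> carrier (uq_free N)"
    and "\<And>i j. i \<in> {1..N} \<Longrightarrow> j \<in> {1..N} \<Longrightarrow> B i j \<in> carrier (uq_free N)"
  shows "rtt_relators q N A B \<subseteq> carrier (uq_free N)"
proof -
  have idx: "I 1 \<in> {1..N}" "I 2 \<in> {1..N}" if "I \<in> tidx 2 N" for I
    using that by (simp_all add: tidx_def PiE_def Pi_def)
  have mat: "in_copy (uq_free N) 2 a C I J \<in> carrier (uq_free N)"
    if "I \<in> tidx 2 N" "J \<in> tidx 2 N" "a = 1 \<or> a = 2"
      "\<And>i j. i \<in> {1..N} \<Longrightarrow> j \<in> {1..N} \<Longrightarrow> C i j \<in> carrier (uq_free N)" for a C I J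
    using that(3) idx[OF that(1)] idx[OF that(2)] that(4)
    by (auto simp: in_copy_def free_algebra_closed)
  have R: "in_copies (uq_free N) 2 1 2 (\<lambda>i j k l. fscal (Rmat q i j k l)) I J
      \<in> carrier (uq_free N)" for I J
    by (simp add: in_copies_def fscal_closed free_algebra_closed)
  have diff: "x - y \<in> carrier (uq_free N)"
    if "x \<in> carrier (uq_free N)" "y \<in> carrier (uq_free N)" for x y
    using free_algebra_closed(4)[OF that(1) free_algebra_closed(3)[OF that(2)]] by simp
  show ?thesis
    unfolding rtt_relators_def Let_def
    using R mat[of _ _ 1 A] mat[of _ _ 2 B] assms
    by (auto intro!: diff tprod_closed ring_free_algebra simp del: One_nat_def)
qed

definition uq_relators :: "complex \<Rightarrow> nat \<Rightarrow> uq_gen fpoly set" where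
  "uq_relators q N =
     {fT i j | i j. i \<in> {1..N} \<and> j \<in> {1..N} \<and> i < j} \<union>
     {fTb j i | i j. i \<in> {1..N} \<and> j \<in> {1..N} \<and> i < j} \<union>
     {fT i i * fTb i i - 1 | i. i \<in> {1..N}} \<union>
     {fTb i i * fT i i - 1 | i. i \<in> {1..N}} \<union>
     rtt_relators q N fT fT \<union> rtt_relators q N fTb fTb \<union> rtt_relators q N fTb fT"

lemma uq_relators_closed: "uq_relators q N \<subseteq> carrier (uq_free N)"
proof -
  have gens: "fT i j \<in> carrier (uq_free N)" "fTb i j \<in> carrier (uq_free N)"
    if "i \<in> {1..N}" "j \<in> {1..N}" for i j
    using that by (auto intro!: fgen_closed simp: uq_gens_def)
  have diff: "x - 1 \<in> carrier (uq_free N)" if "x \<in> carrier (uq_free N)" for x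
    using free_algebra_closed(4)[OF that free_algebra_closed(3)[OF free_algebra_closed(2)]] by simp
  have "rtt_relators q N fT fT \<subseteq> carrier (uq_free N)"
    "rtt_relators q N fTb fTb \<subseteq> carrier (uq_free N)"
    "rtt_relators q N fTb fT \<subseteq> carrier (uq_free N)"
    by (intro rtt_relators_closed gens; assumption)+
  moreover have "{fT i j | i j. i \<in> {1..N} \<and> j \<in> {1..N} \<and> i < j} \<subseteq> carrier (uq_free N)"
    "{fTb j i | i j. i \<in> {1..N} \<and> j \<in> {1..N} \<and> i < j} \<subseteq> carrier (uq_free N)"
    "{fT i i * fTb i i - 1 | i. i \<in> {1..N}} \<subseteq> carrier (uq_free N)"
    "{fTb i i * fT i i - 1 | i. i \<in> {1..N}} \<subseteq> carrier (uq_free N)"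
    using gens by (auto intro!: diff free_algebra_closed(5))
  ultimately show ?thesis
    unfolding uq_relators_def by (intro Un_least)
qed

definition uq_ideal :: "complex \<Rightarrow> nat \<Rightarrow> uq_gen fpoly set" where
  "uq_ideal q N = Idl\<^bsub>uq_free N\<^esub> (uq_relators q N)"

type_synonym uq_elem = "uq_gen fpoly set"

definition Uq_gl :: "complex \<Rightarrow> nat \<Rightarrow> uq_elem ring" where
  "Uq_gl q N = uq_free N Quot uq_ideal q N"

lemma ideal_uq_ideal: "ideal (uq_ideal q N) (uq_free N)"
  unfolding uq_ideal_def by (rule ring.genideal_ideal[OF ring_free_algebra uq_relators_closed])

lemma ring_Uq_gl: "ring (Uq_gl q N)"
  unfolding Uq_gl_def by (rule ideal.quotient_is_ring[OF ideal_uq_ideal])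

definition uq_class :: "complex \<Rightarrow> nat \<Rightarrow> uq_gen fpoly \<Rightarrow> uq_elem" where
  "uq_class q N p = uq_ideal q N +>\<^bsub>uq_free N\<^esub> p"

definition uq_scal :: "complex \<Rightarrow> nat \<Rightarrow> complex \<Rightarrow> uq_elem" where
  "uq_scal q N c = uq_class q N (fscal c)"

definition Tmat :: "complex \<Rightarrow> nat \<Rightarrow> uq_elem mat" where
  "Tmat q N = (\<lambda>i j. uq_class q N (fT i j))"

definition Tbmat :: "complex \<Rightarrow> nat \<Rightarrow> uq_elem mat" where
  "Tbmat q N = (\<lambda>i j. uq_class q N (fTb i j))"


section \<open>The twisted quantized enveloping algebras\<close>

definition subalgebra_generated ::
    "'a ring \<Rightarrow> (complex \<Rightarrow> 'a) \<Rightarrow> 'a set \<Rightarrow> 'a ring" where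
  "subalgebra_generated R \<iota> A = R\<lparr>carrier := generate_ring R (range \<iota> \<union> A)\<rparr>"

definition ring_center :: "'a ring \<Rightarrow> 'a set" where
  "ring_center R = {z \<in> carrier R. \<forall>x\<in>carrier R. z \<otimes>\<^bsub>R\<^esub> x = x \<otimes>\<^bsub>R\<^esub> z}"

definition S_o :: "complex \<Rightarrow> nat \<Rightarrow> uq_elem mat" where
  "S_o q N = mat_mul (Uq_gl q N) N (Tmat q N) (mat_transpose (Tbmat q N))"

definition Sb_o :: "complex \<Rightarrow> nat \<Rightarrow> uq_elem mat" where
  "Sb_o q N = mat_mul (Uq_gl q N) N (Tbmat q N) (mat_transpose (Tmat q N))"

definition Utw_o :: "complex \<Rightarrow> nat \<Rightarrow> uq_elem ring" where
  "Utw_o q N = subalgebra_generated (Uq_gl q N) (uq_scal q N)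
     {S_o q N i j | i j. i \<in> {1..N} \<and> j \<in> {1..N}}"

definition Gmat :: "complex \<Rightarrow> complex mat" where
  "Gmat q = (\<lambda>i j. if odd i \<and> j = i + 1 then q else if odd j \<and> i = j + 1 then - 1 else 0)"

definition S_sp :: "complex \<Rightarrow> nat \<Rightarrow> uq_elem mat" where
  "S_sp q n = (let U = Uq_gl q (2*n); G = (\<lambda>i j. uq_scal q (2*n) (Gmat q i j)) in
     mat_mul U (2*n) (mat_mul U (2*n) (Tmat q (2*n)) G) (mat_transpose (Tbmat q (2*n))))"

definition Sb_sp :: "complex \<Rightarrow> nat \<Rightarrow> uq_elem mat" where
  "Sb_sp q n = (let U = Uq_gl q (2*n); G = (\<lambda>i j. uq_scal q (2*n) (Gmat q i j)) in
     mat_mul U (2*n) (mat_mul U (2*n) (Tbmat q (2*n)) G) (mat_transpose (Tmat q (2*n))))"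

definition Utw_sp :: "complex \<Rightarrow> nat \<Rightarrow> uq_elem ring" where
  "Utw_sp q n = subalgebra_generated (Uq_gl q (2*n)) (uq_scal q (2*n))
     ({S_sp q n i j | i j. i \<in> {1..2*n} \<and> j \<in> {1..2*n}} \<union>
      {inv\<^bsub>Uq_gl q (2*n)\<^esub> (S_sp q n (2*k - 1) (2*k)) | k. k \<in> {1..n}})"


section \<open>Laurent series in \<open>u\<^sup>-\<^sup>1\<close>\<close>

text \<open>\<open>f k\<close> is the coefficient of \<open>u\<^sup>k\<close>. Positive powers of \<open>u\<close> are needed because they occur
  in \<open>R\<^sup>t(u\<^sub>i\<^sup>-\<^sup>1, u\<^sub>j)\<close>; the exponents are bounded above.\<close>

definition laurent :: "'a ring \<Rightarrow> (int \<Rightarrow> 'a) ring" where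
  "laurent R = \<lparr>
     carrier = {f. (\<forall>k. f k \<in> carrier R) \<and> (\<exists>K. \<forall>k>K. f k = \<zero>\<^bsub>R\<^esub>)},
     monoid.mult = (\<lambda>f g k. \<Oplus>\<^bsub>R\<^esub>i\<in>{i. f i \<noteq> \<zero>\<^bsub>R\<^esub> \<and> g (k - i) \<noteq> \<zero>\<^bsub>R\<^esub>}. f i \<otimes>\<^bsub>R\<^esub> g (k - i)),
     one = (\<lambda>k. if k = 0 then \<one>\<^bsub>R\<^esub> else \<zero>\<^bsub>R\<^esub>),
     ring.zero = (\<lambda>k. \<zero>\<^bsub>R\<^esub>),
     add = (\<lambda>f g k. f k \<oplus>\<^bsub>R\<^esub> g k)\<rparr>"

definition lmonom :: "'a ring \<Rightarrow> 'a \<Rightarrow> int \<Rightarrow> (int \<Rightarrow> 'a)" where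
  "lmonom R a k = (\<lambda>j. if j = k then a else \<zero>\<^bsub>R\<^esub>)"

text \<open>The substitution \<open>u \<mapsto> c u\<close>.\<close>

definition lscale :: "'a ring \<Rightarrow> (complex \<Rightarrow> 'a) \<Rightarrow> complex \<Rightarrow> (int \<Rightarrow> 'a) \<Rightarrow> (int \<Rightarrow> 'a)" where
  "lscale R \<iota> c f = (\<lambda>k. \<iota> (c powi k) \<otimes>\<^bsub>R\<^esub> f k)"


section \<open>The Sklyanin determinant\<close>

text \<open>\<open>R(u,v)\<close> for elements \<open>u\<close>, \<open>v\<close> of the algebra \<open>(R, \<iota>)\<close>.\<close>

definition Ruv :: "'a ring \<Rightarrow> (complex \<Rightarrow> 'a) \<Rightarrow> complex \<Rightarrow> 'a \<Rightarrow> 'a \<Rightarrow> 'a mat2" where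
  "Ruv R \<iota> q u v = (\<lambda>i j k l.
     if i = j \<and> k = l then
       (if i = k then (\<iota> (inverse q) \<otimes>\<^bsub>R\<^esub> u) \<ominus>\<^bsub>R\<^esub> (\<iota> q \<otimes>\<^bsub>R\<^esub> v) else u \<ominus>\<^bsub>R\<^esub> v)
     else if k = j \<and> l = i then
       (if i > j then \<iota> (inverse q - q) \<otimes>\<^bsub>R\<^esub> u else \<iota> (inverse q - q) \<otimes>\<^bsub>R\<^esub> v)
     else \<zero>\<^bsub>R\<^esub>)"

definition Pq :: "complex \<Rightarrow> complex mat2" where
  "Pq q = (\<lambda>i j k l.
     if k = j \<and> l = i then (if i = j then 1 else if i > j then q else inverse q) else 0)"

text \<open>\<open>P\<^sup>q\<^sub>\<sigma>\<close> is the product of the \<open>P\<^sup>q\<^bsub>a,a+1\<^esub>\<close> along a factorization of \<open>\<sigma>\<close> into adjacent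
  transpositions \<open>(a,a+1)\<close>. It does not depend on the choice of the factorization, because
  the \<open>P\<^sup>q\<^bsub>a,a+1\<^esub>\<close> satisfy the Coxeter relations of the symmetric group.\<close>

definition adjacent_word :: "nat \<Rightarrow> (nat \<Rightarrow> nat) \<Rightarrow> nat list" where
  "adjacent_word N \<sigma> = (SOME w. set w \<subseteq> {1..<N} \<and>
     foldr (\<lambda>a \<tau>. Transposition.transpose a (a + 1) \<circ> \<tau>) w id = \<sigma>)"

definition Pq_perm :: "complex \<Rightarrow> nat \<Rightarrow> (nat \<Rightarrow> nat) \<Rightarrow> complex tmat" where
  "Pq_perm q N \<sigma> = tprod ring_of_type_algebra N N
     (map (\<lambda>a. in_copies ring_of_type_algebra N a (a + 1) (Pq q)) (adjacent_word N \<sigma>))"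

definition Aq :: "complex \<Rightarrow> nat \<Rightarrow> complex tmat" where
  "Aq q N = (\<lambda>I J. \<Sum>\<sigma> | \<sigma> permutes {1..N}. of_int (sign \<sigma>) * Pq_perm q N \<sigma> I J)"

text \<open>\<open>S\<close> is a matrix over \<open>laurent R\<close>, and \<open>u\<^sub>i = q\<^bsup>-2i+2\<^esup> u\<close>.\<close>

definition sklyanin_product ::
    "'a ring \<Rightarrow> (complex \<Rightarrow> 'a) \<Rightarrow> complex \<Rightarrow> nat \<Rightarrow> (int \<Rightarrow> 'a) mat \<Rightarrow> (int \<Rightarrow> 'a) tmat" where
  "sklyanin_product R \<iota> q N S =
    (let L = laurent R;
         \<iota>L = (\<lambda>c. lmonom R (\<iota> c) 0);
         c = (\<lambda>i::nat. q powi (2 - 2 * int i));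
         u = (\<lambda>i. lmonom R (\<iota> (c i)) 1);
         u_inv = (\<lambda>i. lmonom R (\<iota> (inverse (c i))) (- 1));
         Si = (\<lambda>i. in_copy L N i (\<lambda>a b. lscale R \<iota> (c i) (S a b)));
         Rt = (\<lambda>i j. in_copies L N i j (transpose_fst (Ruv L \<iota>L q (u_inv i) (u j))))
     in tprod L N N ((\<lambda>I J. \<iota>L (Aq q N I J)) #
          concat (map (\<lambda>i. Si i # map (Rt i) [i + 1..<N + 1]) [1..<N + 1])))"

definition sdet ::
    "'a ring \<Rightarrow> (complex \<Rightarrow> 'a) \<Rightarrow> complex \<Rightarrow> nat \<Rightarrow> (int \<Rightarrow> 'a) mat \<Rightarrow> (int \<Rightarrow> 'a)" where
  "sdet R \<iota> q N S = (THE d. d \<in> carrier (laurent R) \<and>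
     (\<forall>I\<in>tidx N N. \<forall>J\<in>tidx N N. sklyanin_product R \<iota> q N S I J =
        lmonom R (\<iota> (Aq q N I J)) 0 \<otimes>\<^bsub>laurent R\<^esub> d))"

text \<open>\<open>S + c u\<^sup>-\<^sup>1 S'\<close>\<close>

definition S_series ::
    "'a ring \<Rightarrow> (complex \<Rightarrow> 'a) \<Rightarrow> complex \<Rightarrow> 'a mat \<Rightarrow> 'a mat \<Rightarrow> (int \<Rightarrow> 'a) mat" where
  "S_series R \<iota> c S S' = (\<lambda>i j.
     lmonom R (S i j) 0 \<oplus>\<^bsub>laurent R\<^esub> lmonom R (\<iota> c \<otimes>\<^bsub>R\<^esub> S' i j) (- 1))"

definition sdet_o :: "complex \<Rightarrow> nat \<Rightarrow> int \<Rightarrow> uq_elem" where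
  "sdet_o q N = sdet (Uq_gl q N) (uq_scal q N) q N
     (S_series (Uq_gl q N) (uq_scal q N) (inverse q) (S_o q N) (Sb_o q N))"

definition sdet_sp :: "complex \<Rightarrow> nat \<Rightarrow> int \<Rightarrow> uq_elem" where
  "sdet_sp q n = sdet (Uq_gl q (2*n)) (uq_scal q (2*n)) q (2*n)
     (S_series (Uq_gl q (2*n)) (uq_scal q (2*n)) q (S_sp q n) (Sb_sp q n))"

end

theory Submission
  imports Defs "HOL-Library.Function_Algebras"
begin

text \<open>
  All matrices act from the right on row vectors over the coefficient ring. Let \<open>X\<close> be the product
  \<open>S\<^sub>1 R\<^sup>t\<^sub>1\<^sub>2 \<dots> S\<^sub>N\<close> in the definition of the Sklyanin determinant. A row \<open>\<eta>\<close> of \<open>A\<^sup>q\<^sub>N\<close> is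
  \<open>q\<close>-antisymmetric. The reflection equation and the specialization \<open>u\<^bsub>i+1\<^esub> = q\<^sup>-\<^sup>2 u\<^sub>i\<close>, at which
  \<open>R(u\<^sub>i, u\<^bsub>i+1\<^esub>)\<close> is proportional to a \<open>q\<close>-antisymmetrizer, show that \<open>X\<close> preserves
  \<open>q\<close>-antisymmetry. These vectors form a module of rank one, hence \<open>\<eta> X = d \<eta>\<close>, and \<open>d\<close> is the Sklyanin
  determinant. For centrality, add a copy of \<open>\<complex>\<^sup>N\<close> with label \<open>0\<close> and fuse the constant reflection
  equation with the Yang--Baxter equation to obtain
  \<open>R\<^sub>1\<^sub>0 \<dots> R\<^sub>N\<^sub>0 X R\<^sup>t\<^sub>1\<^sub>0 \<dots> R\<^sup>t\<^sub>N\<^sub>0 S\<^sub>0 = S\<^sub>0 R\<^sup>t\<^sub>1\<^sub>0 \<dots> R\<^sup>t\<^sub>N\<^sub>0 X R\<^sub>1\<^sub>0 \<dots> R\<^sub>N\<^sub>0\<close>.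
  The products of the \<open>R\<^sub>i\<^sub>0\<close> and of the \<open>R\<^sup>t\<^sub>i\<^sub>0\<close> multiply \<open>q\<close>-antisymmetric vectors by \<open>q\<close>,
  so applying both sides to \<open>\<eta>\<close> gives \<open>d S\<^sub>0 = S\<^sub>0 d\<close>.
\<close>

section \<open>Operators on row vectors\<close>

text \<open>The entries of the matrices do not commute, so eigenvalues have to be handled
  one-sidedly. Operators act from the right because left multiplication by ring elements then
  commutes with all of them: an eigenvalue \<open>d\<close> with noncommuting coefficients makes
  sense and can be pulled out on the left. Everything else is kept in a commutative ring of central
  scalars: q, the spectral parameters and the entries of all R-matrices; only T, Tbar, S and Sbar
  have noncommuting entries. The reflection equation with parameters is itself derived: it is
  assembled from four constant reflection equations for S and Sbar and from a linear relation
  between the two matrices. That relation also places the entries of Sbar, and hence the Sklyanin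
  determinant, in the subalgebra generated by S. All factors of the Sklyanin product are Laurent
  polynomials in u, so the operator calculus runs over Laurent polynomials with coefficients in a
  type-class ring. The Laurent series of the statement enter only at the end, when the unique scalar
  series is identified.\<close>

typedef (overloaded) 'v endo = "{f :: 'v::ab_group_add \<Rightarrow> 'v. \<forall>x y. f (x + y) = f x + f y}"
  by (rule exI[of _ "\<lambda>x. x"]) simp

definition act :: "'v::ab_group_add \<Rightarrow> 'v endo \<Rightarrow> 'v"  (infixl "\<triangleleft>" 75) where
  "w \<triangleleft> A = Rep_endo A w"

lemma act_Abs_endo: "(\<And>x y. f (x + y) = f x + f y) \<Longrightarrow> w \<triangleleft> Abs_endo f = f w"
  by (simp add: act_def Abs_endo_inverse)

lemma act_add_left: "(v + w) \<triangleleft> A = v \<triangleleft> A + w \<triangleleft> A"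
  using Rep_endo[of A] by (simp add: act_def)

lemma endo_eqI: "(\<And>w. w \<triangleleft> A = w \<triangleleft> B) \<Longrightarrow> A = B"
  by (metis Rep_endo_inject act_def ext)

instantiation endo :: (ab_group_add) "{ring, monoid_mult}"
begin

definition zero_endo :: "'a endo" where "0 = Abs_endo (\<lambda>_. 0)"
definition one_endo :: "'a endo" where "1 = Abs_endo (\<lambda>w. w)"
definition plus_endo :: "'a endo \<Rightarrow> 'a endo \<Rightarrow> 'a endo" where
  "A + B = Abs_endo (\<lambda>w. w \<triangleleft> A + w \<triangleleft> B)"
definition uminus_endo :: "'a endo \<Rightarrow> 'a endo" where "- A = Abs_endo (\<lambda>w. - (w \<triangleleft> A))"
definition minus_endo :: "'a endo \<Rightarrow> 'a endo \<Rightarrow> 'a endo" where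
  "A - B = Abs_endo (\<lambda>w. w \<triangleleft> A - w \<triangleleft> B)"
definition times_endo :: "'a endo \<Rightarrow> 'a endo \<Rightarrow> 'a endo" where
  "A * B = Abs_endo (\<lambda>w. w \<triangleleft> A \<triangleleft> B)"

lemma act_simps [simp]:
  "w \<triangleleft> 0 = 0" "w \<triangleleft> 1 = w" "w \<triangleleft> (A + B) = w \<triangleleft> A + w \<triangleleft> B" "w \<triangleleft> (- A) = - (w \<triangleleft> A)"
  "w \<triangleleft> (A - B) = w \<triangleleft> A - w \<triangleleft> B" "w \<triangleleft> (A * B) = w \<triangleleft> A \<triangleleft> B"
  for w :: 'a
  by (simp_all add: zero_endo_def one_endo_def plus_endo_def uminus_endo_def minus_endo_def
      times_endo_def act_Abs_endo act_add_left)

instance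
  by intro_classes (rule endo_eqI; simp add: act_add_left algebra_simps)+

end

text \<open>There are two main instances: \<open>fscal\<close>, which extracts the defining
  relations of U_q(gl_N) entry by entry inside the free algebra, and \<open>iotaL\<close>, over
  which the argument itself is carried out.\<close>

locale central_scalars =
  fixes iota :: "'s::comm_ring_1 \<Rightarrow> 'c::ring_1"
  assumes iota_add: "iota (s + t) = iota s + iota t"
    and iota_mult: "iota (s * t) = iota s * iota t"
    and iota_one [simp]: "iota 1 = 1"
    and iota_comm: "x * iota s = iota s * x"
begin

lemma iota_zero [simp]: "iota 0 = 0"
  using iota_add[of 0 0] by simp

lemma iota_uminus: "iota (- s) = - iota s"
  using iota_add[of s "- s"] by (simp add: eq_neg_iff_add_eq_0 add.commute)

lemma iota_diff: "iota (s - t) = iota s - iota t"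
  using iota_add[of s "- t"] by (simp add: iota_uminus)

lemma iota_swap: "iota s * (iota t * x) = iota t * (iota s * x)"
  by (metis iota_comm mult.assoc)

lemma iota_pull: "x * (iota s * y) = iota s * (x * y)"
  by (metis iota_comm mult.assoc)

lemma iota_sum: "iota (sum f A) = (\<Sum>x\<in>A. iota (f x))"
  by (induction A rule: infinite_finite_induct) (simp_all add: iota_add)

lemma iota_cancel: "s * t = 1 \<Longrightarrow> iota t * x = iota t * y \<Longrightarrow> x = y"
  by (metis iota_mult iota_one mult.assoc mult_1)

lemmas iota_hom = iota_add iota_mult iota_uminus iota_diff

end

section \<open>Matrices acting in chosen tensor copies\<close>

locale tensor_operators = central_scalars iota
  for iota :: "'s::comm_ring_1 \<Rightarrow> 'c::ring_1" +
  fixes N :: nat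
begin

text \<open>Row vectors are functions of indices \<open>nat \<Rightarrow> nat\<close> with infinitely many copies of \<open>\<complex>\<^sup>N\<close>, so that
  every operator lives on the same space; the results of the operators below are cut off to \<open>0\<close> outside
  the index range. The constants \<open>opS a\<close>, \<open>op2 a b\<close> are \<open>A\<^sub>a\<close>, \<open>M\<^sub>a\<^sub>b\<close> in the usual notation.\<close>

definition in_range :: "(nat \<Rightarrow> nat) \<Rightarrow> bool" where
  "in_range J \<longleftrightarrow> (\<forall>c. J c \<in> {1..N})"

lemma in_range_upd [intro]: "in_range J \<Longrightarrow> k \<in> {1..N} \<Longrightarrow> in_range (J(a := k))"
  by (simp add: in_range_def)

lemma in_rangeD: "in_range J \<Longrightarrow> J c \<in> {1..N}" "in_range J \<Longrightarrow> Suc 0 \<le> J c" "in_range J \<Longrightarrow> J c \<le> N"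
  by (auto simp: in_range_def Suc_le_eq)

definition left_scale :: "'c \<Rightarrow> ((nat \<Rightarrow> nat) \<Rightarrow> 'c) endo" where
  "left_scale d = Abs_endo (\<lambda>w J. d * w J)"

definition scal :: "'s \<Rightarrow> ((nat \<Rightarrow> nat) \<Rightarrow> 'c) endo" where
  "scal s = left_scale (iota s)"

definition opS :: "nat \<Rightarrow> 'c mat \<Rightarrow> ((nat \<Rightarrow> nat) \<Rightarrow> 'c) endo" where
  "opS a A = Abs_endo (\<lambda>w J. if in_range J then \<Sum>k=1..N. w (J(a := k)) * A k (J a) else 0)"

definition op2 :: "nat \<Rightarrow> nat \<Rightarrow> 'c mat2 \<Rightarrow> ((nat \<Rightarrow> nat) \<Rightarrow> 'c) endo" where
  "op2 a b M = Abs_endo (\<lambda>w J. if in_range J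
     then \<Sum>k=1..N. \<Sum>l=1..N. w (J(a := k, b := l)) * M k (J a) l (J b) else 0)"

text \<open>Scalar kernels are singled out because they commute with operators in disjoint copies,
  whereas two \<open>opS\<close> in different copies need not commute.\<close>

definition op2s :: "nat \<Rightarrow> nat \<Rightarrow> 's mat2 \<Rightarrow> ((nat \<Rightarrow> nat) \<Rightarrow> 'c) endo" where
  "op2s a b K = op2 a b (\<lambda>i j k l. iota (K i j k l))"

lemma act_left_scale: "(w \<triangleleft> left_scale d) J = d * w J"
  unfolding left_scale_def by (subst act_Abs_endo) (auto simp: algebra_simps)

lemma act_scal: "(w \<triangleleft> scal s) J = iota s * w J"
  by (simp add: scal_def act_left_scale)

lemma act_opS:
  "(w \<triangleleft> opS a A) J = (if in_range J then \<Sum>k=1..N. w (J(a := k)) * A k (J a) else 0)"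
  unfolding opS_def by (subst act_Abs_endo) (auto simp: algebra_simps sum.distrib)

lemma act_op2:
  "(w \<triangleleft> op2 a b M) J = (if in_range J
     then \<Sum>k=1..N. \<Sum>l=1..N. w (J(a := k, b := l)) * M k (J a) l (J b) else 0)"
  unfolding op2_def by (subst act_Abs_endo) (auto simp: algebra_simps sum.distrib)

lemma endo_fun_eqI: "(\<And>w J. (w \<triangleleft> A) J = (w \<triangleleft> B) J) \<Longrightarrow> A = B"
  by (intro endo_eqI ext)

lemma op2_cong:
  "(\<And>i j k l. i \<in> {1..N} \<Longrightarrow> j \<in> {1..N} \<Longrightarrow> k \<in> {1..N} \<Longrightarrow> l \<in> {1..N} \<Longrightarrow>
      M i j k l = M' i j k l) \<Longrightarrow> op2 a b M = op2 a b M'"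
  by (intro endo_fun_eqI) (auto simp: act_op2 in_rangeD intro!: sum.cong)

lemma left_scale_opS: "opS a A * left_scale d = left_scale d * opS a A"
  by (intro endo_fun_eqI) (simp add: act_opS act_left_scale sum_distrib_left mult.assoc)

lemma left_scale_op2: "op2 a b M * left_scale d = left_scale d * op2 a b M"
  by (intro endo_fun_eqI) (simp add: act_op2 act_left_scale sum_distrib_left mult.assoc)

lemma left_scale_op2s: "op2s a b M * left_scale d = left_scale d * op2s a b M"
  by (simp add: op2s_def left_scale_op2)

lemma scal_comm:
  "opS a A * scal s = scal s * opS a A" "op2 a b M * scal s = scal s * op2 a b M"
  "op2s a b K * scal s = scal s * op2s a b K"
  by (simp_all add: scal_def left_scale_opS left_scale_op2 op2s_def)

lemma left_scale_scal: "left_scale d * scal s = scal s * left_scale d"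
  by (intro endo_fun_eqI) (simp add: act_scal act_left_scale iota_pull)

lemma scal_hom:
  "scal (s + t) = scal s + scal t" "scal (s - t) = scal s - scal t" "scal (- s) = - scal s"
  "scal (s * t) = scal s * scal t" "scal 0 = 0" "scal 1 = 1"
  by (intro endo_fun_eqI; simp add: act_scal iota_hom algebra_simps iota_swap)+

lemma scal_scal: "scal s * scal t = scal t * scal s"
  by (intro endo_fun_eqI) (simp add: act_scal iota_swap)

lemma scal_pull:
  "opS a A * (scal s * Z) = scal s * (opS a A * Z)"
  "op2s a b K * (scal s * Z) = scal s * (op2s a b K * Z)"
  by (simp_all add: scal_comm flip: mult.assoc)

lemma opS_add: "opS a (\<lambda>i j. A i j + B i j) = opS a A + opS a B"
  by (intro endo_fun_eqI) (simp add: act_opS algebra_simps sum.distrib)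

lemma opS_scal: "opS a (\<lambda>i j. iota s * A i j) = scal s * opS a A"
  by (intro endo_fun_eqI) (simp add: act_opS act_scal sum_distrib_left iota_pull mult.assoc)

lemma op2_add: "op2 a b (\<lambda>i j k l. M i j k l + M' i j k l) = op2 a b M + op2 a b M'"
  by (intro endo_fun_eqI) (simp add: act_op2 algebra_simps sum.distrib)

lemma op2_scal: "op2 a b (\<lambda>i j k l. iota s * M i j k l) = scal s * op2 a b M"
  by (intro endo_fun_eqI) (simp add: act_op2 act_scal sum_distrib_left iota_pull mult.assoc)

lemma opS_opS_same:
  "opS a A * opS a B = opS a (\<lambda>i j. \<Sum>k=1..N. A i k * B k j)"
proof (intro endo_fun_eqI)
  fix w and J :: "nat \<Rightarrow> nat"
  show "(w \<triangleleft> (opS a A * opS a B)) J = (w \<triangleleft> opS a (\<lambda>i j. \<Sum>k=1..N. A i k * B k j)) J"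
  proof (cases "in_range J")
    case True
    then have "(w \<triangleleft> (opS a A * opS a B)) J
        = (\<Sum>k=1..N. \<Sum>l=1..N. w (J(a := l)) * A l k * B k (J a))"
      by (auto simp: act_opS in_range_upd sum_distrib_right intro!: sum.cong)
    also have "\<dots> = (\<Sum>l=1..N. \<Sum>k=1..N. w (J(a := l)) * A l k * B k (J a))"
      by (rule sum.swap)
    finally show ?thesis
      using True by (simp add: act_opS sum_distrib_left mult.assoc)
  qed (simp add: act_opS)
qed

text \<open>The two orders of the operators differ exactly in the order of the entries, so exchange
  relations between generators become equalities of kernels over one pair of copies.\<close>

lemma opS_opS:
  assumes "a \<noteq> b"
  shows "opS a A * opS b B = op2 a b (\<lambda>i j k l. A i j * B k l)"
    and "opS b B * opS a A = op2 a b (\<lambda>i j k l. B k l * A i j)"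
proof -
  have eq: "J(b := l, a := k) = J(a := k, b := l)" for J :: "nat \<Rightarrow> nat" and k l
    using assms by (rule fun_upd_twist[symmetric])
  show "opS a A * opS b B = op2 a b (\<lambda>i j k l. A i j * B k l)"
  proof (intro endo_fun_eqI)
    fix w J
    show "(w \<triangleleft> (opS a A * opS b B)) J = (w \<triangleleft> op2 a b (\<lambda>i j k l. A i j * B k l)) J"
    proof (cases "in_range J")
      case True
      then have "(w \<triangleleft> (opS a A * opS b B)) J
          = (\<Sum>l=1..N. \<Sum>k=1..N. w (J(a := k, b := l)) * (A k (J a) * B l (J b)))"
        using assms by (auto simp: act_opS in_range_upd sum_distrib_right eq mult.assoc intro!: sum.cong)
      then show ?thesis
        using True by (simp add: act_op2) (rule sum.swap)
    qed (simp add: act_opS act_op2)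
  qed
  show "opS b B * opS a A = op2 a b (\<lambda>i j k l. B k l * A i j)"
  proof (intro endo_fun_eqI)
    fix w J
    show "(w \<triangleleft> (opS b B * opS a A)) J = (w \<triangleleft> op2 a b (\<lambda>i j k l. B k l * A i j)) J"
      using assms
      by (auto simp: act_opS act_op2 in_range_upd sum_distrib_right eq mult.assoc intro!: sum.cong)
  qed
qed

lemma opS_scalar_comm:
  assumes "a \<noteq> b"
  shows "opS a A * opS b (\<lambda>i j. iota (G i j)) = opS b (\<lambda>i j. iota (G i j)) * opS a A"
  by (simp add: opS_opS[OF assms] iota_comm)

lemma op2_flip:
  assumes "a \<noteq> b"
  shows "op2 b a M = op2 a b (\<lambda>i j k l. M k l i j)"
proof (intro endo_fun_eqI)
  fix w and J :: "nat \<Rightarrow> nat"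
  have eq: "J(b := l, a := k) = J(a := k, b := l)" for k l
    using assms by (rule fun_upd_twist[symmetric])
  have "(\<Sum>l=1..N. \<Sum>k=1..N. w (J(a := k, b := l)) * M l (J b) k (J a))
      = (\<Sum>k=1..N. \<Sum>l=1..N. w (J(a := k, b := l)) * M l (J b) k (J a))"
    by (rule sum.swap)
  then show "(w \<triangleleft> op2 b a M) J = (w \<triangleleft> op2 a b (\<lambda>i j k l. M k l i j)) J"
    by (simp add: act_op2 eq)
qed

lemma opS_op2s_comm:
  assumes "c \<noteq> a" "c \<noteq> b"
  shows "opS c A * op2s a b K = op2s a b K * opS c A"
proof (intro endo_fun_eqI)
  fix w and J :: "nat \<Rightarrow> nat"
  have eq: "J(a := k, b := l, c := m) = J(c := m, a := k, b := l)" for k l m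
    using assms by (auto simp: fun_eq_iff)
  show "(w \<triangleleft> (opS c A * op2s a b K)) J = (w \<triangleleft> (op2s a b K * opS c A)) J"
  proof (cases "in_range J")
    case True
    have "(w \<triangleleft> (opS c A * op2s a b K)) J
      = (\<Sum>k=1..N. \<Sum>l=1..N. \<Sum>m=1..N. w (J(c := m, a := k, b := l)) * A m (J c)
           * iota (K k (J a) l (J b)))"
      using True assms by (auto simp: op2s_def act_opS act_op2 in_range_upd sum_distrib_right eq intro!: sum.cong)
    also have "\<dots> = (\<Sum>k=1..N. \<Sum>m=1..N. \<Sum>l=1..N. w (J(c := m, a := k, b := l)) * A m (J c)
           * iota (K k (J a) l (J b)))"
      by (intro sum.cong refl sum.swap)
    also have "\<dots> = (\<Sum>m=1..N. \<Sum>k=1..N. \<Sum>l=1..N. w (J(c := m, a := k, b := l)) * A m (J c)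
           * iota (K k (J a) l (J b)))"
      by (rule sum.swap)
    also have "\<dots> = (\<Sum>m=1..N. \<Sum>k=1..N. \<Sum>l=1..N. w (J(c := m, a := k, b := l))
           * iota (K k (J a) l (J b)) * A m (J c))"
      by (simp add: mult.assoc iota_comm)
    also have "\<dots> = (w \<triangleleft> (op2s a b K * opS c A)) J"
      using True assms by (auto simp: op2s_def act_opS act_op2 in_range_upd sum_distrib_right intro!: sum.cong)
    finally show ?thesis .
  qed (simp add: op2s_def act_opS act_op2)
qed

lemma op2s_comm:
  assumes "a \<noteq> c" "a \<noteq> d" "b \<noteq> c" "b \<noteq> d"
  shows "op2s a b K * op2s c d K' = op2s c d K' * op2s a b K"
proof (intro endo_fun_eqI)
  fix w and J :: "nat \<Rightarrow> nat"
  have eq: "J(c := m, d := n, a := k, b := l) = J(a := k, b := l, c := m, d := n)" for k l m n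
    using assms by (auto simp: fun_eq_iff)
  show "(w \<triangleleft> (op2s a b K * op2s c d K')) J = (w \<triangleleft> (op2s c d K' * op2s a b K)) J"
  proof (cases "in_range J")
    case True
    have "(w \<triangleleft> (op2s a b K * op2s c d K')) J
      = (\<Sum>m=1..N. \<Sum>n=1..N. \<Sum>k=1..N. \<Sum>l=1..N. w (J(a := k, b := l, c := m, d := n))
           * iota (K k (J a) l (J b)) * iota (K' m (J c) n (J d)))"
      using True assms by (auto simp: op2s_def act_op2 in_range_upd sum_distrib_right eq intro!: sum.cong)
    also have "\<dots> = (\<Sum>m=1..N. \<Sum>k=1..N. \<Sum>n=1..N. \<Sum>l=1..N. w (J(a := k, b := l, c := m, d := n))
           * iota (K k (J a) l (J b)) * iota (K' m (J c) n (J d)))"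
      by (intro sum.cong refl sum.swap)
    also have "\<dots> = (\<Sum>k=1..N. \<Sum>m=1..N. \<Sum>n=1..N. \<Sum>l=1..N. w (J(a := k, b := l, c := m, d := n))
           * iota (K k (J a) l (J b)) * iota (K' m (J c) n (J d)))"
      by (rule sum.swap)
    also have "\<dots> = (\<Sum>k=1..N. \<Sum>m=1..N. \<Sum>l=1..N. \<Sum>n=1..N. w (J(a := k, b := l, c := m, d := n))
           * iota (K k (J a) l (J b)) * iota (K' m (J c) n (J d)))"
      by (intro sum.cong refl sum.swap)
    also have "\<dots> = (\<Sum>k=1..N. \<Sum>l=1..N. \<Sum>m=1..N. \<Sum>n=1..N. w (J(a := k, b := l, c := m, d := n))
           * iota (K k (J a) l (J b)) * iota (K' m (J c) n (J d)))"
      by (intro sum.cong refl sum.swap)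
    also have "\<dots> = (\<Sum>k=1..N. \<Sum>l=1..N. \<Sum>m=1..N. \<Sum>n=1..N. w (J(a := k, b := l, c := m, d := n))
           * iota (K' m (J c) n (J d)) * iota (K k (J a) l (J b)))"
      by (intro sum.cong refl) (simp add: mult.assoc iota_comm iota_swap)
    also have "\<dots> = (w \<triangleleft> (op2s c d K' * op2s a b K)) J"
      using True assms by (auto simp: op2s_def act_op2 in_range_upd sum_distrib_right intro!: sum.cong)
    finally show ?thesis .
  qed (simp add: op2s_def act_op2)
qed

lemma op2_op2:
  assumes "a \<noteq> b"
  shows "op2 a b M * op2 a b M'
    = op2 a b (\<lambda>i j k l. \<Sum>m=1..N. \<Sum>n=1..N. M i m k n * M' m j n l)"
proof (intro endo_fun_eqI)
  fix w and J :: "nat \<Rightarrow> nat"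
  have eq: "J(a := m, b := n, a := k, b := l) = J(a := k, b := l)" for k l m n
    using assms by (auto simp: fun_eq_iff)
  show "(w \<triangleleft> (op2 a b M * op2 a b M')) J
    = (w \<triangleleft> op2 a b (\<lambda>i j k l. \<Sum>m=1..N. \<Sum>n=1..N. M i m k n * M' m j n l)) J"
  proof (cases "in_range J")
    case True
    have "(w \<triangleleft> (op2 a b M * op2 a b M')) J
      = (\<Sum>m=1..N. \<Sum>n=1..N. \<Sum>k=1..N. \<Sum>l=1..N. w (J(a := k, b := l)) * M k m l n * M' m (J a) n (J b))"
      using True assms by (auto simp: act_op2 in_range_upd sum_distrib_right eq intro!: sum.cong)
    also have "\<dots> = (\<Sum>m=1..N. \<Sum>k=1..N. \<Sum>n=1..N. \<Sum>l=1..N. w (J(a := k, b := l)) * M k m l n * M' m (J a) n (J b))"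
      by (intro sum.cong refl sum.swap)
    also have "\<dots> = (\<Sum>k=1..N. \<Sum>m=1..N. \<Sum>n=1..N. \<Sum>l=1..N. w (J(a := k, b := l)) * M k m l n * M' m (J a) n (J b))"
      by (rule sum.swap)
    also have "\<dots> = (\<Sum>k=1..N. \<Sum>m=1..N. \<Sum>l=1..N. \<Sum>n=1..N. w (J(a := k, b := l)) * M k m l n * M' m (J a) n (J b))"
      by (intro sum.cong refl sum.swap)
    also have "\<dots> = (\<Sum>k=1..N. \<Sum>l=1..N. \<Sum>m=1..N. \<Sum>n=1..N. w (J(a := k, b := l)) * M k m l n * M' m (J a) n (J b))"
      by (intro sum.cong refl sum.swap)
    also have "\<dots> = (w \<triangleleft> op2 a b (\<lambda>i j k l. \<Sum>m=1..N. \<Sum>n=1..N. M i m k n * M' m j n l)) J"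
      using True by (simp add: act_op2 sum_distrib_left mult.assoc)
    finally show ?thesis .
  qed (simp add: act_op2)
qed

lemma opS_op2:
  assumes "a \<noteq> b"
  shows "opS a A * op2 a b M = op2 a b (\<lambda>i j k l. \<Sum>m=1..N. A i m * M m j k l)"
proof (intro endo_fun_eqI)
  fix w and J :: "nat \<Rightarrow> nat"
  have eq: "J(a := m, b := n, a := k) = J(a := k, b := n)" for k m n
    using assms by (auto simp: fun_eq_iff)
  show "(w \<triangleleft> (opS a A * op2 a b M)) J
    = (w \<triangleleft> op2 a b (\<lambda>i j k l. \<Sum>m=1..N. A i m * M m j k l)) J"
  proof (cases "in_range J")
    case True
    have "(w \<triangleleft> (opS a A * op2 a b M)) J
      = (\<Sum>m=1..N. \<Sum>l=1..N. \<Sum>k=1..N. w (J(a := k, b := l)) * A k m * M m (J a) l (J b))"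
      using True assms by (auto simp: act_opS act_op2 in_range_upd sum_distrib_right eq intro!: sum.cong)
    also have "\<dots> = (\<Sum>m=1..N. \<Sum>k=1..N. \<Sum>l=1..N. w (J(a := k, b := l)) * A k m * M m (J a) l (J b))"
      by (intro sum.cong refl sum.swap)
    also have "\<dots> = (\<Sum>k=1..N. \<Sum>m=1..N. \<Sum>l=1..N. w (J(a := k, b := l)) * A k m * M m (J a) l (J b))"
      by (rule sum.swap)
    also have "\<dots> = (\<Sum>k=1..N. \<Sum>l=1..N. \<Sum>m=1..N. w (J(a := k, b := l)) * A k m * M m (J a) l (J b))"
      by (intro sum.cong refl sum.swap)
    also have "\<dots> = (w \<triangleleft> op2 a b (\<lambda>i j k l. \<Sum>m=1..N. A i m * M m j k l)) J"
      using True by (simp add: act_op2 sum_distrib_left mult.assoc)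
    finally show ?thesis .
  qed (simp add: act_opS act_op2)
qed

lemma op2_opS:
  assumes "a \<noteq> b"
  shows "op2 a b M * opS b B = op2 a b (\<lambda>i j k l. \<Sum>m=1..N. M i j k m * B m l)"
proof (intro endo_fun_eqI)
  fix w and J :: "nat \<Rightarrow> nat"
  have eq: "J(b := m, a := k, b := l) = J(a := k, b := l)" for k l m
    using assms by (auto simp: fun_eq_iff)
  show "(w \<triangleleft> (op2 a b M * opS b B)) J
    = (w \<triangleleft> op2 a b (\<lambda>i j k l. \<Sum>m=1..N. M i j k m * B m l)) J"
  proof (cases "in_range J")
    case True
    have "(w \<triangleleft> (op2 a b M * opS b B)) J
      = (\<Sum>m=1..N. \<Sum>k=1..N. \<Sum>l=1..N. w (J(a := k, b := l)) * M k (J a) l m * B m (J b))"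
      using True assms by (auto simp: act_opS act_op2 in_range_upd sum_distrib_right eq intro!: sum.cong)
    also have "\<dots> = (\<Sum>k=1..N. \<Sum>m=1..N. \<Sum>l=1..N. w (J(a := k, b := l)) * M k (J a) l m * B m (J b))"
      by (rule sum.swap)
    also have "\<dots> = (\<Sum>k=1..N. \<Sum>l=1..N. \<Sum>m=1..N. w (J(a := k, b := l)) * M k (J a) l m * B m (J b))"
      by (intro sum.cong refl sum.swap)
    also have "\<dots> = (w \<triangleleft> op2 a b (\<lambda>i j k l. \<Sum>m=1..N. M i j k m * B m l)) J"
      using True by (simp add: act_op2 sum_distrib_left mult.assoc)
    finally show ?thesis .
  qed (simp add: act_opS act_op2)
qed

end

context tensor_operators
begin

lemma sum2_single:
  assumes "i \<in> {1..N}" "k \<in> {1..N}"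
  shows "(\<Sum>m=1..N. \<Sum>n=1..N. if m = i \<and> n = k then f m n else 0) = (f i k :: 'd::comm_monoid_add)"
proof -
  have "(\<Sum>n=1..N. if m = i \<and> n = k then f m n else 0) = (if m = i then f m k else 0)" for m
    using assms by (simp add: sum.delta)
  then show ?thesis
    using assms by (simp add: sum.delta)
qed

text \<open>Evaluation at a delta vector isolates one entry. This turns an operator identity
  obtained by inverting R back into relations between entries.\<close>

lemma op2_inject:
  assumes eq: "op2 a b M = op2 a b M'" and "a \<noteq> b"
    and "i \<in> {1..N}" "j \<in> {1..N}" "k \<in> {1..N}" "l \<in> {1..N}"
  shows "M i j k l = M' i j k l"
proof -
  define J :: "nat \<Rightarrow> nat" where "J = (\<lambda>_. j)(b := l)"
  define w :: "(nat \<Rightarrow> nat) \<Rightarrow> 'c" where "w = (\<lambda>K. if K = J(a := i, b := k) then 1 else 0)"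
  have J: "in_range J" "J a = j" "J b = l"
    using assms by (auto simp: J_def in_range_def)
  have upd: "J(a := m, b := n) = J(a := i, b := k) \<longleftrightarrow> m = i \<and> n = k" for m n
    using \<open>a \<noteq> b\<close> by (metis fun_upd_same fun_upd_other)
  have "(w \<triangleleft> op2 a b L) J = L i j k l" for L
  proof -
    have "(w \<triangleleft> op2 a b L) J = (\<Sum>m=1..N. \<Sum>n=1..N. if m = i \<and> n = k then L m j n l else 0)"
      using J by (auto simp: act_op2 w_def upd intro!: sum.cong)
    then show ?thesis
      using sum2_single assms by simp
  qed
  then show ?thesis
    using eq by metis
qed

end

section \<open>The constant R-matrix\<close>

locale hecke_operators = tensor_operators iota N
  for iota :: "'s::comm_ring_1 \<Rightarrow> 'c::ring_1" and N +
  fixes q q' :: 's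
  assumes q_inverse: "q * q' = 1"
begin

definition h :: 's where "h = q - q'"

lemma iota_q_inverse [simp]:
  "iota q * iota q' = 1" "iota q * (iota q' * x) = x" "iota q' * iota q = 1" "iota q' * (iota q * x) = x"
  by (simp_all add: q_inverse mult.commute flip: iota_mult mult.assoc)

definition qd :: "nat \<Rightarrow> nat \<Rightarrow> 's" where "qd i j = (if i = j then q else 1)"

definition rK :: "'s mat2" where
  "rK = (\<lambda>i j k l. if i = j \<and> k = l then (if i = k then q else 1)
     else if k = j \<and> l = i \<and> i < j then h else 0)"

definition pK :: "'s mat2" where
  "pK = (\<lambda>i j k l. if k = j \<and> l = i then 1 else 0)"

definition opR :: "nat \<Rightarrow> nat \<Rightarrow> ((nat \<Rightarrow> nat) \<Rightarrow> 'c) endo" where "opR a b = op2s a b rK"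
definition opP :: "nat \<Rightarrow> nat \<Rightarrow> ((nat \<Rightarrow> nat) \<Rightarrow> 'c) endo" where "opP a b = op2s a b pK"
definition opRt :: "nat \<Rightarrow> nat \<Rightarrow> ((nat \<Rightarrow> nat) \<Rightarrow> 'c) endo" where
  "opRt a b = op2s a b (transpose_fst rK)"
text \<open>The partial transpose of the permutation, that is, the sum of all E_ij \<otimes>
  E_ij.\<close>

definition opQ :: "nat \<Rightarrow> nat \<Rightarrow> ((nat \<Rightarrow> nat) \<Rightarrow> 'c) endo" where
  "opQ a b = op2s a b (transpose_fst pK)"

lemma rK_row: "rK i m k n = (if m = i \<and> n = k then qd i k else 0)
    + (if m = k \<and> n = i then (if i < k then h else 0) else 0)"
  unfolding rK_def qd_def by (cases "i = k"; cases "m = i"; cases "n = k"; simp)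

lemma rK_col: "rK m j n l = (if m = j \<and> n = l then qd j l else 0)
    + (if m = l \<and> n = j then (if l < j then h else 0) else 0)"
  unfolding rK_def qd_def by (cases "j = l"; cases "m = j"; cases "n = l"; simp)

text \<open>R from the left mixes only the row indices \<open>i\<close>, \<open>k\<close> of a
  kernel, R from the right (\<open>op2_opR\<close>) only the column indices \<open>j\<close>,
  \<open>l\<close>. All exchange relations below are compared kernel by kernel with these
  rules.\<close>

lemma opR_op2:
  assumes "a \<noteq> b"
  shows "opR a b * op2 a b M = op2 a b (\<lambda>i j k l. iota (qd i k) * M i j k l
     + (if i < k then iota h * M k j i l else 0))"
  unfolding opR_def op2s_def op2_op2[OF assms]
proof (rule op2_cong)
  fix i j k l assume *: "i \<in> {1..N}" "j \<in> {1..N}" "k \<in> {1..N}" "l \<in> {1..N}"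
  have "(\<Sum>m=1..N. \<Sum>n=1..N. iota (rK i m k n) * M m j n l)
    = (\<Sum>m=1..N. \<Sum>n=1..N. (if m = i \<and> n = k then iota (qd i k) * M m j n l else 0)
        + (if m = k \<and> n = i then (if i < k then iota h * M m j n l else 0) else 0))"
    by (intro sum.cong refl; cases "i = k") (auto simp: rK_row iota_add)
  then show "(\<Sum>m=1..N. \<Sum>n=1..N. iota (rK i m k n) * M m j n l)
    = iota (qd i k) * M i j k l + (if i < k then iota h * M k j i l else 0)"
    by (simp only: sum.distrib sum2_single[OF *(1,3)] sum2_single[OF *(3,1)])
qed

lemma op2_opR:
  assumes "a \<noteq> b"
  shows "op2 a b M * opR a b = op2 a b (\<lambda>i j k l. iota (qd j l) * M i j k l
     + (if l < j then iota h * M i l k j else 0))"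
  unfolding opR_def op2s_def op2_op2[OF assms]
proof (rule op2_cong)
  fix i j k l assume *: "i \<in> {1..N}" "j \<in> {1..N}" "k \<in> {1..N}" "l \<in> {1..N}"
  have "(\<Sum>m=1..N. \<Sum>n=1..N. M i m k n * iota (rK m j n l))
    = (\<Sum>m=1..N. \<Sum>n=1..N. (if m = j \<and> n = l then iota (qd j l) * M i m k n else 0)
        + (if m = l \<and> n = j then (if l < j then iota h * M i m k n else 0) else 0))"
    by (intro sum.cong refl; cases "j = l") (auto simp: rK_col iota_add iota_comm)
  then show "(\<Sum>m=1..N. \<Sum>n=1..N. M i m k n * iota (rK m j n l))
    = iota (qd j l) * M i j k l + (if l < j then iota h * M i l k j else 0)"
    by (simp only: sum.distrib sum2_single[OF *(2,4)] sum2_single[OF *(4,2)])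
qed

lemma opP_op2:
  assumes "a \<noteq> b"
  shows "opP a b * op2 a b M = op2 a b (\<lambda>i j k l. M k j i l)"
  unfolding opP_def op2s_def op2_op2[OF assms]
proof (rule op2_cong)
  fix i j k l assume *: "i \<in> {1..N}" "j \<in> {1..N}" "k \<in> {1..N}" "l \<in> {1..N}"
  have "(\<Sum>m=1..N. \<Sum>n=1..N. iota (pK i m k n) * M m j n l)
    = (\<Sum>m=1..N. \<Sum>n=1..N. (if m = k \<and> n = i then M m j n l else 0))"
    by (intro sum.cong refl) (auto simp: pK_def)
  then show "(\<Sum>m=1..N. \<Sum>n=1..N. iota (pK i m k n) * M m j n l) = M k j i l"
    by (simp only: sum2_single[OF *(3,1)])
qed

lemma op2_opP:
  assumes "a \<noteq> b"
  shows "op2 a b M * opP a b = op2 a b (\<lambda>i j k l. M i l k j)"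
  unfolding opP_def op2s_def op2_op2[OF assms]
proof (rule op2_cong)
  fix i j k l assume *: "i \<in> {1..N}" "j \<in> {1..N}" "k \<in> {1..N}" "l \<in> {1..N}"
  have "(\<Sum>m=1..N. \<Sum>n=1..N. M i m k n * iota (pK m j n l))
    = (\<Sum>m=1..N. \<Sum>n=1..N. (if m = l \<and> n = j then M i m k n else 0))"
    by (intro sum.cong refl) (auto simp: pK_def)
  then show "(\<Sum>m=1..N. \<Sum>n=1..N. M i m k n * iota (pK m j n l)) = M i l k j"
    by (simp only: sum2_single[OF *(4,2)])
qed

text \<open>The off-diagonal part of R^t is a combination of terms E_ij \<otimes> E_ij and its
  diagonal part is symmetric. Unlike R, it therefore does not see the order of the copies.\<close>

lemma opRt_flip: "a \<noteq> b \<Longrightarrow> opRt b a = opRt a b"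
  unfolding opRt_def op2s_def
  by (subst op2_flip, assumption, rule op2_cong) (auto simp: transpose_fst_def rK_def)

lemma opQ_flip: "a \<noteq> b \<Longrightarrow> opQ b a = opQ a b"
  unfolding opQ_def op2s_def
  by (subst op2_flip, assumption, rule op2_cong) (auto simp: transpose_fst_def pK_def)

text \<open>Standing in the middle, R^t mixes the inner indices of the kernel: the column index
  \<open>j\<close> of copy \<open>a\<close> and the row index \<open>k\<close> of copy
  \<open>b\<close>.\<close>

lemma opS_opRt_opS:
  assumes "a \<noteq> b"
  shows "opS a A * opRt a b * opS b B = op2 a b (\<lambda>i j k l. iota (qd j k) * (A i j * B k l)
     + (if j < k then iota h * (A i k * B j l) else 0))"
  unfolding opRt_def op2s_def opS_op2[OF assms] op2_opS[OF assms]
proof (rule op2_cong)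
  fix i j k l assume *: "i \<in> {1..N}" "j \<in> {1..N}" "k \<in> {1..N}" "l \<in> {1..N}"
  have "(\<Sum>n=1..N. (\<Sum>m=1..N. A i m * iota (transpose_fst rK m j k n)) * B n l)
    = (\<Sum>n=1..N. \<Sum>m=1..N. (if n = k \<and> m = j then iota (qd j k) * (A i m * B n l) else 0)
        + (if n = j \<and> m = k then (if j < k then iota h * (A i m * B n l) else 0) else 0))"
    unfolding sum_distrib_right transpose_fst_def
    by (intro sum.cong refl; cases "j = k") (auto simp: rK_row iota_add iota_comm mult.assoc iota_pull)
  then show "(\<Sum>n=1..N. (\<Sum>m=1..N. A i m * iota (transpose_fst rK m j k n)) * B n l)
    = iota (qd j k) * (A i j * B k l) + (if j < k then iota h * (A i k * B j l) else 0)"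
    by (simp only: sum.distrib sum2_single[OF *(3,2)] sum2_single[OF *(2,3)])
qed

lemma opS_opQ_opS:
  assumes "a \<noteq> b"
  shows "opS a A * opQ a b * opS b B = op2 a b (\<lambda>i j k l. A i k * B j l)"
  unfolding opQ_def op2s_def opS_op2[OF assms] op2_opS[OF assms]
proof (rule op2_cong)
  fix i j k l assume *: "i \<in> {1..N}" "j \<in> {1..N}" "k \<in> {1..N}" "l \<in> {1..N}"
  have "(\<Sum>n=1..N. (\<Sum>m=1..N. A i m * iota (transpose_fst pK m j k n)) * B n l)
    = (\<Sum>n=1..N. \<Sum>m=1..N. (if n = j \<and> m = k then (A i m * B n l) else 0))"
    unfolding sum_distrib_right transpose_fst_def
    by (intro sum.cong refl) (auto simp: pK_def)
  then show "(\<Sum>n=1..N. (\<Sum>m=1..N. A i m * iota (transpose_fst pK m j k n)) * B n l) = A i k * B j l"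
    by (simp only: sum2_single[OF *(2,3)])
qed

lemma opS_opRt_opS':
  assumes "a \<noteq> b"
  shows "opS b B * opRt a b * opS a A = op2 a b (\<lambda>i j k l. iota (qd l i) * (B k l * A i j)
     + (if l < i then iota h * (B k i * A l j) else 0))"
proof -
  have "opS b B * opRt b a * opS a A = op2 b a (\<lambda>i j k l. iota (qd j k) * (B i j * A k l)
     + (if j < k then iota h * (B i k * A j l) else 0))"
    using assms by (intro opS_opRt_opS) simp
  then show ?thesis
    by (simp add: opRt_flip[OF assms] op2_flip[OF assms])
qed

lemma opS_opQ_opS':
  assumes "a \<noteq> b"
  shows "opS b B * opQ a b * opS a A = op2 a b (\<lambda>i j k l. B k i * A l j)"
proof -
  have "opS b B * opQ b a * opS a A = op2 b a (\<lambda>i j k l. B i k * A j l)"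
    using assms by (intro opS_opQ_opS) simp
  then show ?thesis
    by (simp add: opQ_flip[OF assms] op2_flip[OF assms])
qed

text \<open>The entries of \<open>R A\<^sub>1 B\<^sub>2 = B\<^sub>2 A\<^sub>1 R\<close>.\<close>

definition RTT :: "'c mat \<Rightarrow> 'c mat \<Rightarrow> bool" where
  "RTT A B \<longleftrightarrow> (\<forall>i\<in>{1..N}. \<forall>j\<in>{1..N}. \<forall>a\<in>{1..N}. \<forall>b\<in>{1..N}.
     iota (qd i j) * (A i a * B j b) + (if i < j then iota h * (A j a * B i b) else 0)
     = iota (qd a b) * (B j b * A i a) + (if b < a then iota h * (B j a * A i b) else 0))"

lemma RTTD:
  "RTT A B \<Longrightarrow> i \<in> {1..N} \<Longrightarrow> j \<in> {1..N} \<Longrightarrow> a \<in> {1..N} \<Longrightarrow> b \<in> {1..N} \<Longrightarrow>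
     iota (qd i j) * (A i a * B j b) + (if i < j then iota h * (A j a * B i b) else 0)
     = iota (qd a b) * (B j b * A i a) + (if b < a then iota h * (B j a * A i b) else 0)"
  unfolding RTT_def by blast

lemma qd_sym: "qd i j = qd j i"
  by (simp add: qd_def)

lemma RTT_opS:
  assumes "RTT A B" "a \<noteq> b"
  shows "opR a b * (opS a A * opS b B) = opS b B * opS a A * opR a b"
  unfolding opS_opS[OF assms(2)] opR_op2[OF assms(2)] op2_opR[OF assms(2)]
  using RTTD[OF assms(1)] by (intro op2_cong) simp

text \<open>Partial transposition of the exchange relation in copy \<open>a\<close>. Entrywise it is
  a renaming of indices: the row pair on which R acts becomes the inner pair on which R^t
  acts.\<close>

lemma RTT_Rt:
  assumes "RTT A B" "a \<noteq> b"
  shows "opS a (mat_transpose A) * opRt a b * opS b B = opS b B * opRt a b * opS a (mat_transpose A)"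
  unfolding opS_opRt_opS[OF assms(2)] opS_opRt_opS'[OF assms(2)] mat_transpose_def
proof (rule op2_cong)
  fix i j k l assume "i \<in> {1..N}" "j \<in> {1..N}" "k \<in> {1..N}" "l \<in> {1..N}"
  from RTTD[OF assms(1) this(2,3,1,4)]
  show "iota (qd j k) * (A j i * B k l) + (if j < k then iota h * (A k i * B j l) else 0)
    = iota (qd l i) * (B k l * A j i) + (if l < i then iota h * (B k i * A j l) else 0)"
    by (simp only: qd_sym[of l i])
qed

text \<open>Transposing both copies reverses the matrix factors and turns R into R_21; renaming the
  copies restores R and makes A and B change places.\<close>

lemma RTT_transpose:
  assumes "RTT A B" "a \<noteq> b"
  shows "opR a b * (opS a (mat_transpose B) * opS b (mat_transpose A))
    = opS b (mat_transpose A) * opS a (mat_transpose B) * opR a b"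
  unfolding opS_opS[OF assms(2)] opR_op2[OF assms(2)] op2_opR[OF assms(2)] mat_transpose_def
proof (rule op2_cong)
  fix i j k l assume "i \<in> {1..N}" "j \<in> {1..N}" "k \<in> {1..N}" "l \<in> {1..N}"
  from RTTD[OF assms(1) this(4,2,3,1)]
  show "iota (qd i k) * (B j i * A l k) + (if i < k then iota h * (B j k * A l i) else 0)
    = iota (qd j l) * (A l k * B j i) + (if l < j then iota h * (A j k * B l i) else 0)"
    by (simp only: qd_sym[of k i] qd_sym[of l j])
qed

text \<open>By the Hecke relation, \<open>opRi a b\<close> is the inverse of \<open>opR b a\<close>.\<close>

definition opRi :: "nat \<Rightarrow> nat \<Rightarrow> ((nat \<Rightarrow> nat) \<Rightarrow> 'c) endo" where
  "opRi a b = opR a b - scal h * opP a b"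

text \<open>The partial transpose of \<open>opRi\<close>. It is needed where T in the first copy has
  to be exchanged with Tbar in the second, which only the inverse of R permits.\<close>

definition opRti :: "nat \<Rightarrow> nat \<Rightarrow> ((nat \<Rightarrow> nat) \<Rightarrow> 'c) endo" where
  "opRti a b = opRt a b - scal h * opQ a b"

lemma opRi_op2:
  assumes "a \<noteq> b"
  shows "opRi a b * op2 a b M = op2 a b (\<lambda>i j k l. iota (qd i k) * M i j k l
     + (if i < k then iota h * M k j i l else 0) + iota (- h) * M k j i l)"
  unfolding opRi_def op2_add op2_scal left_diff_distrib opR_op2[OF assms] mult.assoc opP_op2[OF assms]
  by (simp add: scal_hom)

lemma op2_opRi:
  assumes "a \<noteq> b"
  shows "op2 a b M * opRi a b = op2 a b (\<lambda>i j k l. iota (qd j l) * M i j k l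
     + (if l < j then iota h * M i l k j else 0) + iota (- h) * M i l k j)"
proof -
  have "op2 a b M * (scal h * opP a b) = scal h * op2 a b (\<lambda>i j k l. M i l k j)"
    unfolding mult.assoc[symmetric] scal_comm(2) unfolding mult.assoc op2_opP[OF assms] ..
  then show ?thesis
    unfolding opRi_def op2_add op2_scal right_diff_distrib op2_opR[OF assms]
    by (simp add: scal_hom)
qed

text \<open>The factor \<open>op2 a b M\<close> stays in the statement because all these operators
  cut off to 0 outside the index range, so \<open>opRi a b * opR b a\<close> is the identity only on
  indices in range. The computation rests on the Hecke identity q^2 = 1 + h q.\<close>

lemma opR_opRi:
  assumes "a \<noteq> b"
  shows "opRi a b * (opR b a * op2 a b M) = op2 a b M" "op2 a b M * (opR b a * opRi a b) = op2 a b M"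
    "op2 a b M * opR b a * opRi a b = op2 a b M"
proof -
  have 1: "opR b a * op2 a b M = op2 a b (\<lambda>i j k l. iota (qd i k) * M i j k l
     + (if k < i then iota h * M k j i l else 0))" for M
    using opR_op2[of b a "\<lambda>i j k l. M k l i j"] assms by (simp add: op2_flip[OF assms] qd_sym)
  have 2: "op2 a b M * opR b a = op2 a b (\<lambda>i j k l. iota (qd j l) * M i j k l
     + (if j < l then iota h * M i l k j else 0))" for M
    using op2_opR[of b a "\<lambda>i j k l. M k l i j"] assms by (simp add: op2_flip[OF assms] qd_sym)
  have q: "iota q * (iota q * x) = x + iota h * (iota q * x)" for x
    by (simp add: h_def iota_diff left_diff_distrib)
  show "opRi a b * (opR b a * op2 a b M) = op2 a b M"
    unfolding 1 opRi_op2[OF assms]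
    by (rule op2_cong) (auto simp: qd_def q iota_uminus algebra_simps)
  show "op2 a b M * opR b a * opRi a b = op2 a b M"
    unfolding 2 op2_opRi[OF assms]
    by (rule op2_cong) (auto simp: qd_def q iota_uminus algebra_simps)
  then show "op2 a b M * (opR b a * opRi a b) = op2 a b M"
    by (simp add: mult.assoc)
qed

lemma opRi_conjugate:
  assumes "opR b a * (opS b A * opS a B) = opS a B * opS b A * opR b a" "a \<noteq> b"
  shows "opRi a b * (opS a B * opS b A) = opS b A * opS a B * opRi a b"
proof -
  have 1: "opRi a b * (opR b a * (opS b A * opS a B)) = opS b A * opS a B"
    unfolding opS_opS[OF assms(2)] opR_opRi[OF assms(2)] by simp
  have 2: "opRi a b * (opS a B * opS b A * opR b a) * opRi a b = opRi a b * (opS a B * opS b A)"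
    by (simp only: mult.assoc[of "opRi a b"] opS_opS[OF assms(2)] opR_opRi[OF assms(2)])
  have "opRi a b * (opS a B * opS b A) = opRi a b * (opR b a * (opS b A * opS a B)) * opRi a b"
    unfolding assms(1) by (rule 2[symmetric])
  then show ?thesis
    unfolding 1 .
qed

text \<open>The defining mixed relation has Tbar in the first copy and T in the second. The version
  with the roles reversed arises by exchanging the copies and inverting R.\<close>

lemma RTT_opS_inverse:
  assumes "RTT A B" "a \<noteq> b"
  shows "opRi a b * (opS a B * opS b A) = opS b A * opS a B * opRi a b"
  using RTT_opS[of A B b a] assms by (intro opRi_conjugate) simp_all

text \<open>The partial transpose of \<open>RTT_opS_inverse\<close>: since that relation was
  obtained by inversion, its entries are first recovered with \<open>op2_inject\<close> and then
  renamed.\<close>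

lemma RTT_Rti:
  assumes "RTT A B" "a \<noteq> b"
  shows "opS a (mat_transpose B) * opRti a b * opS b A = opS b A * opRti a b * opS a (mat_transpose B)"
proof -
  have L: "opS a C * opRti a b * opS b D = op2 a b (\<lambda>i j k l. iota (qd j k) * (C i j * D k l)
     + (if j < k then iota h * (C i k * D j l) else 0) + iota (- h) * (C i k * D j l))" for C D
  proof -
    have "opS a C * opRti a b * opS b D
      = opS a C * opRt a b * opS b D + scal (- h) * (opS a C * opQ a b * opS b D)"
      by (simp add: opRti_def algebra_simps scal_hom opQ_def scal_pull)
    then show ?thesis
      by (simp only: opS_opRt_opS[OF assms(2)] opS_opQ_opS[OF assms(2)] op2_add op2_scal)
  qed
  have L': "opS b D * opRti a b * opS a C = op2 a b (\<lambda>i j k l. iota (qd l i) * (D k l * C i j)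
     + (if l < i then iota h * (D k i * C l j) else 0) + iota (- h) * (D k i * C l j))" for C D
  proof -
    have "opS b D * opRti a b * opS a C
      = opS b D * opRt a b * opS a C + scal (- h) * (opS b D * opQ a b * opS a C)"
      by (simp add: opRti_def algebra_simps scal_hom opQ_def scal_pull)
    then show ?thesis
      by (simp only: opS_opRt_opS'[OF assms(2)] opS_opQ_opS'[OF assms(2)] op2_add op2_scal)
  qed
  have eq: "iota (qd i k) * (B i j * A k l) + (if i < k then iota h * (B k j * A i l) else 0)
      + iota (- h) * (B k j * A i l)
    = iota (qd j l) * (A k l * B i j) + (if l < j then iota h * (A k j * B i l) else 0)
      + iota (- h) * (A k j * B i l)"
    if "i \<in> {1..N}" "j \<in> {1..N}" "k \<in> {1..N}" "l \<in> {1..N}" for i j k l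
    using op2_inject[OF RTT_opS_inverse[OF assms, unfolded opS_opS[OF assms(2)]
        opRi_op2[OF assms(2)] op2_opRi[OF assms(2)]] assms(2) that] .
  show ?thesis
    unfolding L L' mat_transpose_def
  proof (rule op2_cong)
    fix i j k l assume "i \<in> {1..N}" "j \<in> {1..N}" "k \<in> {1..N}" "l \<in> {1..N}"
    from eq[OF this(2,1,3,4)]
    show "iota (qd j k) * (B j i * A k l) + (if j < k then iota h * (B k i * A j l) else 0)
        + iota (- h) * (B k i * A j l)
      = iota (qd l i) * (A k l * B j i) + (if l < i then iota h * (A k i * B j l) else 0)
        + iota (- h) * (A k i * B j l)"
      by (simp only: qd_sym[of l i])
  qed
qed

end

text \<open>Read A, B as T and Tbar^t in the first copy, C, D as the same matrices in the second
  copy, g and g' as the two copies of G, Y as R^t and Z as R. The reflection equation for G then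
  spreads to T G Tbar^t by moving factors through exchange relations. The abstract form covers all
  four combinations of S and Sbar, with R or R^t replaced where necessary.\<close>

lemma fused_reflection:
  fixes A B C D g g' Y Z :: "'a::semigroup_mult"
  assumes "Z * (A * C) = C * A * Z" "B * Y * C = C * Y * B" "Z * (B * D) = D * B * Z"
    "A * Y * D = D * Y * A" "Z * (g * Y * g') = g' * Y * g * Z"
    "g * C = C * g" "B * g' = g' * B" "A * g' = g' * A" "g * D = D * g"
  shows "Z * (A * g * B * Y * (C * g' * D)) = C * g' * D * Y * (A * g * B) * Z"
proof -
  have "Z * (A * g * B * Y * (C * g' * D)) = Z * (A * g * (B * Y * C) * g' * D)"
    by (simp only: mult.assoc)
  also have "\<dots> = Z * (A * (g * C) * Y * (B * g') * D)"
    unfolding assms(2) unfolding mult.assoc ..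
  also have "\<dots> = Z * (A * C) * (g * Y * g') * (B * D)"
    unfolding assms(6,7) unfolding mult.assoc ..
  also have "\<dots> = C * A * (Z * (g * Y * g')) * (B * D)"
    unfolding assms(1) unfolding mult.assoc ..
  also have "\<dots> = C * A * g' * Y * g * (Z * (B * D))"
    unfolding assms(5) unfolding mult.assoc ..
  also have "\<dots> = C * (A * g') * Y * (g * D) * B * Z"
    unfolding assms(3) unfolding mult.assoc ..
  also have "\<dots> = C * g' * (A * Y * D) * g * B * Z"
    unfolding assms(8,9) unfolding mult.assoc ..
  also have "\<dots> = C * g' * D * Y * (A * g * B) * Z"
    unfolding assms(4) unfolding mult.assoc ..
  finally show ?thesis .
qed

context tensor_operators
begin

text \<open>This holds for matrices acting from the right even if their entries do not commute, and
  it is what allows an eigenvalue to be pulled out on the left.\<close>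

definition llin :: "((nat \<Rightarrow> nat) \<Rightarrow> 'c) endo \<Rightarrow> bool" where
  "llin A \<longleftrightarrow> (\<forall>d. A * left_scale d = left_scale d * A)"

lemma llin_opS [intro, simp]: "llin (opS a A)"
  and llin_op2 [intro, simp]: "llin (op2 a b M)"
  and llin_op2s [intro, simp]: "llin (op2s a b K)"
  by (simp_all add: llin_def left_scale_opS left_scale_op2 left_scale_op2s)

lemma llin_scal [intro, simp]: "llin (scal s)"
  by (simp add: llin_def left_scale_scal)

lemma llin_mult [intro, simp]: "llin A \<Longrightarrow> llin B \<Longrightarrow> llin (A * B)"
  unfolding llin_def by (metis mult.assoc)

lemma llin_add [intro, simp]: "llin A \<Longrightarrow> llin B \<Longrightarrow> llin (A + B)"
  and llin_diff [intro, simp]: "llin A \<Longrightarrow> llin B \<Longrightarrow> llin (A - B)"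
  by (simp_all add: llin_def algebra_simps)

lemma llin_one [intro, simp]: "llin 1"
  by (simp add: llin_def)

lemma llin_scal_comm: "llin A \<Longrightarrow> A * scal s = scal s * A"
  by (simp add: llin_def scal_def)

lemma llin_scal_pull: "llin A \<Longrightarrow> A * (scal s * Z) = scal s * (A * Z)"
  by (simp add: llin_scal_comm flip: mult.assoc)

lemma scal_swap: "scal s * (scal t * Z) = scal t * (scal s * Z)"
  by (simp add: scal_scal flip: mult.assoc)

lemma llin_act: "llin A \<Longrightarrow> (\<lambda>J. d * w J) \<triangleleft> A = (\<lambda>J. d * (w \<triangleleft> A) J)"
proof -
  assume "llin A"
  then have "w \<triangleleft> left_scale d \<triangleleft> A = w \<triangleleft> A \<triangleleft> left_scale d"
    by (metis llin_def act_simps(6))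
  moreover have "v \<triangleleft> left_scale d = (\<lambda>J. d * v J)" for v
    by (rule ext) (simp add: act_left_scale)
  ultimately show ?thesis
    by simp
qed

end

context hecke_operators
begin

lemma llin_hecke [intro, simp]:
  "llin (opR a b)" "llin (opP a b)" "llin (opRt a b)" "llin (opQ a b)" "llin (opRi a b)" "llin (opRti a b)"
  by (simp_all add: opR_def opP_def opRt_def opQ_def opRi_def opRti_def)

lemma RTT_Rt':
  assumes "RTT A B" "a \<noteq> b"
  shows "opS a B * opRt a b * opS b (mat_transpose A) = opS b (mat_transpose A) * opRt a b * opS a B"
  using RTT_Rt[of A B b a] assms by (simp add: opRt_flip[OF assms(2)])

lemma RTT_Rti':
  assumes "RTT A B" "a \<noteq> b"
  shows "opS a A * opRti a b * opS b (mat_transpose B) = opS b (mat_transpose B) * opRti a b * opS a A"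
  using RTT_Rti[of A B b a] assms by (simp add: opRti_def opRt_flip[OF assms(2)] opQ_flip[OF assms(2)])

text \<open>Conjugation by P exchanges the copies, and R^t is symmetric under this exchange. In the
  products of entries A stays in front of B.\<close>

lemma opP_reflect_Rt:
  assumes "a \<noteq> b"
  shows "opP a b * (opS a A * opRt a b * opS b B) = opS b A * opRt a b * opS a B * opP a b"
  unfolding opS_opRt_opS[OF assms] opS_opRt_opS'[OF assms] opP_op2[OF assms] op2_opP[OF assms]
  by (rule op2_cong) (simp add: qd_sym)

lemma opP_reflect_Q:
  assumes "a \<noteq> b"
  shows "opP a b * (opS a A * opQ a b * opS b B) = opS b A * opQ a b * opS a B * opP a b"
  unfolding opS_opQ_opS[OF assms] opS_opQ_opS'[OF assms] opP_op2[OF assms] op2_opP[OF assms]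
  by (rule op2_cong) simp

lemma opP_reflect_Rti:
  assumes "a \<noteq> b"
  shows "opP a b * (opS a A * opRti a b * opS b B) = opS b A * opRti a b * opS a B * opP a b"
proof -
  have "opS c C * opRti a b * opS d D = opS c C * opRt a b * opS d D - scal h * (opS c C * opQ a b * opS d D)"
    for C D c d
    by (simp add: opRti_def algebra_simps llin_scal_pull)
  then show ?thesis
    using opP_reflect_Rt[OF assms, of A B] opP_reflect_Q[OF assms, of A B]
    by (simp add: right_diff_distrib left_diff_distrib llin_scal_pull mult.assoc)
qed

end

section \<open>The reflection equation\<close>

text \<open>The parameters are \<open>\<kappa> = q\<close>, \<open>c = q\<^sup>-\<^sup>1\<close> in the orthogonal and \<open>\<kappa> = -q\<^sup>-\<^sup>1\<close>, \<open>c = q\<close> in the symplectic case.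
  The assumption \<open>G_reflection\<close> says \<open>R G\<^sub>1 R\<^sup>t G\<^sub>2 = G\<^sub>2 R\<^sup>t G\<^sub>1 R\<close>.\<close>

locale reflection_operators = hecke_operators iota N q q'
  for iota :: "'s::comm_ring_1 \<Rightarrow> 'c::ring_1" and N q q' +
  fixes T Tb :: "'c mat" and G :: "'s mat" and \<kappa> \<kappa>' c :: 's
  assumes RTT_T: "RTT T T" and RTT_Tb: "RTT Tb Tb" and RTT_TbT: "RTT Tb T"
    and G_symmetric: "\<And>x y. x \<in> {1..N} \<Longrightarrow> y \<in> {1..N} \<Longrightarrow>
      qd x y * G y x + (if y < x then h * G x y else 0) = \<kappa> * G x y"
    and G_reflection: "\<And>i j k l. i \<in> {1..N} \<Longrightarrow> j \<in> {1..N} \<Longrightarrow> k \<in> {1..N} \<Longrightarrow> l \<in> {1..N} \<Longrightarrow>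
      qd i k * (qd j k * (G i j * G k l) + (if j < k then h * (G i k * G j l) else 0))
      + (if i < k then h * (qd j i * (G k j * G i l) + (if j < i then h * (G k i * G j l) else 0)) else 0)
      = qd j l * (qd l i * (G k l * G i j) + (if l < i then h * (G k i * G l j) else 0))
      + (if l < j then h * (qd j i * (G k j * G i l) + (if j < i then h * (G k i * G j l) else 0)) else 0)"
    and kappa_inverse: "\<kappa> * \<kappa>' = 1"
    and c_kappa: "c * c * \<kappa> = \<kappa>'"
begin

abbreviation Gi :: "'c mat" where "Gi \<equiv> \<lambda>i j. iota (G i j)"

definition Sm :: "'c mat" where
  "Sm = (\<lambda>i j. \<Sum>k=1..N. (\<Sum>m=1..N. T i m * Gi m k) * Tb j k)"

definition Sbm :: "'c mat" where
  "Sbm = (\<lambda>i j. \<Sum>k=1..N. (\<Sum>m=1..N. Tb i m * Gi m k) * T j k)"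

lemma opS_Sm: "opS a Sm = opS a T * opS a Gi * opS a (mat_transpose Tb)"
  by (simp add: opS_opS_same Sm_def mat_transpose_def)

lemma opS_Sbm: "opS a Sbm = opS a Tb * opS a Gi * opS a (mat_transpose T)"
  by (simp add: opS_opS_same Sbm_def mat_transpose_def)

lemma G_Rt:
  assumes "a \<noteq> b"
  shows "opR a b * (opS a Gi * opRt a b * opS b Gi) = opS b Gi * opRt a b * opS a Gi * opR a b"
  unfolding opS_opRt_opS[OF assms] opS_opRt_opS'[OF assms] opR_op2[OF assms] op2_opR[OF assms]
proof (rule op2_cong)
  fix i j k l assume "i \<in> {1..N}" "j \<in> {1..N}" "k \<in> {1..N}" "l \<in> {1..N}"
  from arg_cong[OF G_reflection[OF this], of iota]
  show "iota (qd i k) * (iota (qd j k) * (iota (G i j) * iota (G k l))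
       + (if j < k then iota h * (iota (G i k) * iota (G j l)) else 0))
     + (if i < k then iota h * (iota (qd j i) * (iota (G k j) * iota (G i l))
         + (if j < i then iota h * (iota (G k i) * iota (G j l)) else 0)) else 0)
     = iota (qd j l) * (iota (qd l i) * (iota (G k l) * iota (G i j))
       + (if l < i then iota h * (iota (G k i) * iota (G l j)) else 0))
     + (if l < j then iota h * (iota (qd j i) * (iota (G k j) * iota (G i l))
         + (if j < i then iota h * (iota (G k i) * iota (G j l)) else 0)) else 0)"
    by (simp only: iota_add iota_mult if_distrib[of iota] iota_zero)
qed

text \<open>In a term with Q both row indices belong to one factor G and both column indices to the
  other. So \<open>G_symmetric\<close> applies on each side, once to rows and once to columns, and
  yields the same scalar \<open>\<kappa>\<close>.\<close>

lemma G_Q: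
  assumes "a \<noteq> b"
  shows "opR a b * (opS a Gi * opQ a b * opS b Gi) = opS b Gi * opQ a b * opS a Gi * opR a b"
  unfolding opS_opQ_opS[OF assms] opS_opQ_opS'[OF assms] opR_op2[OF assms] op2_opR[OF assms]
proof (rule op2_cong)
  fix i j k l assume *: "i \<in> {1..N}" "j \<in> {1..N}" "k \<in> {1..N}" "l \<in> {1..N}"
  have 1: "qd i k * (G i k * G j l) + (if i < k then h * (G k i * G j l) else 0) = \<kappa> * (G k i * G j l)"
    using arg_cong[OF G_symmetric[OF *(3,1)], of "\<lambda>z. z * G j l"] by (auto simp: algebra_simps qd_sym)
  have 2: "qd j l * (G k i * G l j) + (if l < j then h * (G k i * G j l) else 0) = \<kappa> * (G k i * G j l)"
    using arg_cong[OF G_symmetric[OF *(2,4)], of "\<lambda>z. z * G k i"] by (auto simp: algebra_simps)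
  from arg_cong[OF trans[OF 1 2[symmetric]], of iota]
  show "iota (qd i k) * (iota (G i k) * iota (G j l)) + (if i < k then iota h * (iota (G k i) * iota (G j l)) else 0)
    = iota (qd j l) * (iota (G k i) * iota (G l j)) + (if l < j then iota h * (iota (G k i) * iota (G j l)) else 0)"
    by (simp only: iota_add iota_mult if_distrib[of iota] iota_zero)
qed

lemma G_Rti:
  assumes "a \<noteq> b"
  shows "opR a b * (opS a Gi * opRti a b * opS b Gi) = opS b Gi * opRti a b * opS a Gi * opR a b"
proof -
  have "opS c Gi * opRti a b * opS d Gi = opS c Gi * opRt a b * opS d Gi - scal h * (opS c Gi * opQ a b * opS d Gi)"
    for c d
    by (simp add: opRti_def algebra_simps llin_scal_pull)
  then show ?thesis
    using G_Rt[OF assms] G_Q[OF assms]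
    by (simp add: right_diff_distrib left_diff_distrib llin_scal_pull mult.assoc)
qed

lemma G_Rt_inverse:
  assumes "a \<noteq> b"
  shows "opRi a b * (opS a Gi * opRt a b * opS b Gi) = opS b Gi * opRt a b * opS a Gi * opRi a b"
  unfolding opRi_def left_diff_distrib right_diff_distrib G_Rt[OF assms] mult.assoc[of "scal h"]
    opP_reflect_Rt[OF assms]
  by (simp add: llin_scal_pull mult.assoc)

lemma refl_SS:
  assumes "a \<noteq> b"
  shows "opR a b * (opS a Sm * opRt a b * opS b Sm) = opS b Sm * opRt a b * opS a Sm * opR a b"
  unfolding opS_Sm
  by (rule fused_reflection[OF RTT_opS[OF RTT_T assms] RTT_Rt[OF RTT_TbT assms]
    RTT_transpose[OF RTT_Tb assms] RTT_Rt'[OF RTT_TbT assms] G_Rt[OF assms]])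
    (use assms in \<open>simp_all add: opS_scalar_comm\<close>)

lemma refl_SbS:
  assumes "a \<noteq> b"
  shows "opR a b * (opS a Sbm * opRt a b * opS b Sm) = opS b Sm * opRt a b * opS a Sbm * opR a b"
  unfolding opS_Sm opS_Sbm
  by (rule fused_reflection[OF RTT_opS[OF RTT_TbT assms] RTT_Rt[OF RTT_T assms]
    RTT_transpose[OF RTT_TbT assms] RTT_Rt'[OF RTT_Tb assms] G_Rt[OF assms]])
    (use assms in \<open>simp_all add: opS_scalar_comm\<close>)

text \<open>The inverse of R is forced here, because the T of the first factor has to pass the Tbar
  of the second.\<close>

lemma refl_SSb:
  assumes "a \<noteq> b"
  shows "opRi a b * (opS a Sm * opRt a b * opS b Sbm) = opS b Sbm * opRt a b * opS a Sm * opRi a b"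
  unfolding opS_Sm opS_Sbm
  by (rule fused_reflection[OF RTT_opS_inverse[OF RTT_TbT assms] RTT_Rt[OF RTT_Tb assms]
    opRi_conjugate[OF RTT_transpose[OF RTT_TbT assms[symmetric]] assms] RTT_Rt'[OF RTT_T assms]
    G_Rt_inverse[OF assms]])
    (use assms in \<open>simp_all add: opS_scalar_comm\<close>)

text \<open>Here R survives, but R^t is replaced: in the middle, T^t of the first factor meets Tbar
  of the second.\<close>

lemma refl_SbSb:
  assumes "a \<noteq> b"
  shows "opR a b * (opS a Sbm * opRti a b * opS b Sbm) = opS b Sbm * opRti a b * opS a Sbm * opR a b"
  unfolding opS_Sbm
  by (rule fused_reflection[OF RTT_opS[OF RTT_Tb assms] RTT_Rti[OF RTT_TbT assms]
    RTT_transpose[OF RTT_T assms] RTT_Rti'[OF RTT_TbT assms] G_Rti[OF assms]])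
    (use assms in \<open>simp_all add: opS_scalar_comm\<close>)

text \<open>Contract the relation R Tbar_1 T_2 = T_2 Tbar_1 R with G; on the right
  \<open>G_symmetric\<close> turns R into a scalar. The result evaluates R against Q below, and it
  expresses Sbar through S, which later keeps the Sklyanin determinant inside the twisted
  algebra.\<close>

lemma Sbm_symmetry:
  assumes "i \<in> {1..N}" "j \<in> {1..N}"
  shows "iota (qd i j) * Sbm i j + (if i < j then iota h * Sbm j i else 0) = iota \<kappa> * Sm j i"
proof -
  have "iota (qd i j) * Sbm i j + (if i < j then iota h * Sbm j i else 0)
    = (\<Sum>k=1..N. \<Sum>m=1..N. iota (G m k) * (iota (qd i j) * (Tb i m * T j k)
        + (if i < j then iota h * (Tb j m * T i k) else 0)))"
    by (simp add: Sbm_def sum_distrib_left sum_distrib_right distrib_left sum.distrib iota_comm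
        iota_swap mult.assoc)
  also have "\<dots> = (\<Sum>k=1..N. \<Sum>m=1..N. iota (G m k) * (iota (qd m k) * (T j k * Tb i m)
        + (if k < m then iota h * (T j m * Tb i k) else 0)))"
    by (intro sum.cong refl, subst RTTD[OF RTT_TbT]) (use assms in auto)
  also have "\<dots> = (\<Sum>k=1..N. \<Sum>m=1..N. iota (G m k) * (iota (qd m k) * (T j k * Tb i m)))
      + (\<Sum>k=1..N. \<Sum>m=1..N. if k < m then iota (G m k) * (iota h * (T j m * Tb i k)) else 0)"
    unfolding sum.distrib[symmetric] by (intro sum.cong refl) (simp add: distrib_left)
  \<comment> \<open>Renaming the summation indices of the off-diagonal part aligns the products of
    generators, so that the coefficients combine to the left side of
    \<open>G_symmetric\<close>.\<close>
  also have "(\<Sum>k=1..N. \<Sum>m=1..N. if k < m then iota (G m k) * (iota h * (T j m * Tb i k)) else 0)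
      = (\<Sum>k=1..N. \<Sum>m=1..N. if m < k then iota (G k m) * (iota h * (T j k * Tb i m)) else 0)"
    by (rule sum.swap)
  also have "(\<Sum>k=1..N. \<Sum>m=1..N. iota (G m k) * (iota (qd m k) * (T j k * Tb i m))) + \<dots>
      = (\<Sum>k=1..N. \<Sum>m=1..N. iota (qd k m * G m k + (if m < k then h * G k m else 0)) * (T j k * Tb i m))"
    unfolding sum.distrib[symmetric]
    by (intro sum.cong refl) (simp add: iota_add iota_mult distrib_right mult.assoc iota_swap qd_sym)
  also have "\<dots> = (\<Sum>k=1..N. \<Sum>m=1..N. iota (\<kappa> * G k m) * (T j k * Tb i m))"
    by (intro sum.cong refl, subst G_symmetric) auto
  also have "\<dots> = (\<Sum>m=1..N. \<Sum>k=1..N. iota (\<kappa> * G k m) * (T j k * Tb i m))"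
    by (rule sum.swap)
  also have "\<dots> = iota \<kappa> * Sm j i"
    unfolding Sm_def sum_distrib_left sum_distrib_right
    by (intro sum.cong refl) (simp add: iota_mult mult.assoc iota_pull[of "T j k" for k])
  finally show ?thesis .
qed

lemma iota_kappa_inverse: "iota \<kappa>' * (iota \<kappa> * x) = x"
  by (simp add: kappa_inverse mult.commute flip: iota_mult mult.assoc)

text \<open>The inverse of the previous relation, brought back to R; the term
  \<open>iota h * Sm j i\<close> is the contribution of h P, the difference between R and the
  inverse of R_21.\<close>

lemma Sm_symmetry:
  assumes "i \<in> {1..N}" "j \<in> {1..N}"
  shows "iota (qd i j) * Sm i j + (if i < j then iota h * Sm j i else 0)
    = iota \<kappa>' * Sbm j i + iota h * Sm j i"
proof -
  have 1: "Sm i j = iota \<kappa>' * (iota (qd j i) * Sbm j i + (if j < i then iota h * Sbm i j else 0))"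
    unfolding Sbm_symmetry[OF assms(2,1)] iota_kappa_inverse ..
  have 2: "Sm j i = iota \<kappa>' * (iota (qd i j) * Sbm i j + (if i < j then iota h * Sbm j i else 0))"
    unfolding Sbm_symmetry[OF assms] iota_kappa_inverse ..
  consider "i < j" | "i = j" | "j < i" by linarith
  then show ?thesis
  proof cases
    case 1
    then show ?thesis
      using \<open>Sm i j = _\<close> by (simp add: qd_def)
  next
    case 2
    have "iota \<kappa>' * Sbm j j = iota q' * Sm j j"
      unfolding \<open>Sm j i = _\<close>[unfolded 2] by (simp add: qd_def iota_swap[of q'])
    then show ?thesis
      using 2 by (simp add: qd_def h_def iota_diff algebra_simps)
  next
    case 3
    then show ?thesis
      using 1 2 by (simp add: qd_def algebra_simps iota_swap)
  qed
qed

end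

section \<open>Spectral parameters and the reflection equation for S(u)\<close>

context hecke_operators
begin

text \<open>\<open>R(u,v)\<close> and \<open>R\<^sup>t(x,y)\<close>, in terms of the constant R-matrix and the permutation.\<close>

definition opRuv :: "nat \<Rightarrow> nat \<Rightarrow> 's \<Rightarrow> 's \<Rightarrow> ((nat \<Rightarrow> nat) \<Rightarrow> 'c) endo" where
  "opRuv a b u v = scal (u - v) * opR a b - scal (u * h) * opP a b"

definition opRtxy :: "nat \<Rightarrow> nat \<Rightarrow> 's \<Rightarrow> 's \<Rightarrow> ((nat \<Rightarrow> nat) \<Rightarrow> 'c) endo" where
  "opRtxy a b x y = scal (x - y) * opRt a b - scal (x * h) * opQ a b"

lemmas op_pull = llin_opS[THEN llin_scal_pull] llin_hecke[THEN llin_scal_pull]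

lemma llin_opRtxy [intro, simp]: "llin (opRtxy a b x y)"
  by (simp add: opRtxy_def)

end

context reflection_operators
begin

text \<open>The argument of \<open>Su\<close> is \<open>u\<^sup>-\<^sup>1\<close>.\<close>

definition Su :: "'s \<Rightarrow> 'c mat" where
  "Su u' = (\<lambda>i j. Sm i j + iota (c * u') * Sbm i j)"

lemma opS_Su: "opS a (Su u') = opS a Sm + scal (c * u') * opS a Sbm"
  by (simp add: Su_def opS_add opS_scal)

text \<open>In a product A Q B both row indices belong to A and both column indices to B. Hence R
  acts on it only through the linear relations between S and Sbar; this and the next three lemmas
  are the four cases.\<close>

lemma opR_Sm_Q:
  assumes "a \<noteq> b"
  shows "opR a b * (opS a Sm * opQ a b * opS b B) = scal \<kappa>' * op2 a b (\<lambda>i j k l. Sbm k i * B j l)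
     + scal h * op2 a b (\<lambda>i j k l. Sm k i * B j l)"
  unfolding opS_opQ_opS[OF assms] opR_op2[OF assms] op2_scal[symmetric] op2_add[symmetric]
proof (rule op2_cong)
  fix i j k l assume "i \<in> {1..N}" "j \<in> {1..N}" "k \<in> {1..N}" "l \<in> {1..N}"
  from arg_cong[OF Sm_symmetry[OF this(1,3)], of "\<lambda>z. z * B j l"]
  show "iota (qd i k) * (Sm i k * B j l) + (if i < k then iota h * (Sm k i * B j l) else 0)
    = iota \<kappa>' * (Sbm k i * B j l) + iota h * (Sm k i * B j l)"
    by (cases "i < k") (simp_all add: distrib_right mult.assoc)
qed

lemma opR_Sbm_Q:
  assumes "a \<noteq> b"
  shows "opR a b * (opS a Sbm * opQ a b * opS b B) = scal \<kappa> * op2 a b (\<lambda>i j k l. Sm k i * B j l)"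
  unfolding opS_opQ_opS[OF assms] opR_op2[OF assms] op2_scal[symmetric] op2_add[symmetric]
proof (rule op2_cong)
  fix i j k l assume "i \<in> {1..N}" "j \<in> {1..N}" "k \<in> {1..N}" "l \<in> {1..N}"
  from arg_cong[OF Sbm_symmetry[OF this(1,3)], of "\<lambda>z. z * B j l"]
  show "iota (qd i k) * (Sbm i k * B j l) + (if i < k then iota h * (Sbm k i * B j l) else 0)
    = iota \<kappa> * (Sm k i * B j l)"
    by (cases "i < k") (simp_all add: distrib_right mult.assoc)
qed

lemma Q_Sm_opR:
  assumes "a \<noteq> b"
  shows "opS b B * opQ a b * opS a Sm * opR a b = scal \<kappa>' * op2 a b (\<lambda>i j k l. B k i * Sbm j l)
     + scal h * op2 a b (\<lambda>i j k l. B k i * Sm j l)"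
  unfolding opS_opQ_opS'[OF assms] op2_opR[OF assms] op2_scal[symmetric] op2_add[symmetric]
proof (rule op2_cong)
  fix i j k l assume "i \<in> {1..N}" "j \<in> {1..N}" "k \<in> {1..N}" "l \<in> {1..N}"
  from arg_cong[OF Sm_symmetry[OF this(4,2)], of "\<lambda>z. B k i * z"]
  show "iota (qd j l) * (B k i * Sm l j) + (if l < j then iota h * (B k i * Sm j l) else 0)
    = iota \<kappa>' * (B k i * Sbm j l) + iota h * (B k i * Sm j l)"
    by (cases "l < j") (simp_all add: distrib_left iota_pull[of "B k i"] qd_sym)
qed

lemma Q_Sbm_opR:
  assumes "a \<noteq> b"
  shows "opS b B * opQ a b * opS a Sbm * opR a b = scal \<kappa> * op2 a b (\<lambda>i j k l. B k i * Sm j l)"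
  unfolding opS_opQ_opS'[OF assms] op2_opR[OF assms] op2_scal[symmetric] op2_add[symmetric]
proof (rule op2_cong)
  fix i j k l assume "i \<in> {1..N}" "j \<in> {1..N}" "k \<in> {1..N}" "l \<in> {1..N}"
  from arg_cong[OF Sbm_symmetry[OF this(4,2)], of "\<lambda>z. B k i * z"]
  show "iota (qd j l) * (B k i * Sbm l j) + (if l < j then iota h * (B k i * Sbm j l) else 0)
    = iota \<kappa> * (B k i * Sm j l)"
    by (cases "l < j") (simp_all add: distrib_left iota_pull[of "B k i"] qd_sym)
qed

lemma opP_S_Q:
  assumes "a \<noteq> b"
  shows "opP a b * (opS a A * opQ a b * opS b B) = op2 a b (\<lambda>i j k l. A k i * B j l)"
    and "opS b A * opQ a b * opS a B * opP a b = op2 a b (\<lambda>i j k l. A k i * B j l)"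
  unfolding opS_opQ_opS[OF assms] opS_opQ_opS'[OF assms] opP_op2[OF assms] op2_opP[OF assms]
  by simp_all

text \<open>Both sides are expanded and sorted into four groups, each of which satisfies the
  equation separately: S S, Sbar Sbar, the mixed terms \<open>\<beta>\<close>, and all terms with Q,
  collected in \<open>\<gamma>\<close>. The mixed terms stay together because P exchanges them; the
  Q-terms stay together because R and P send all of them to the common kernels \<open>x1\<close> to
  \<open>x4\<close>.\<close>

lemma reflection_equation:
  assumes ab: "a \<noteq> b" and u: "u * u' = 1" and v: "v * v' = 1"
  shows "opRuv a b u v * (opS a (Su u') * opRtxy a b u' v * opS b (Su v'))
    = opS b (Su v') * opRtxy a b u' v * opS a (Su u') * opRuv a b u v"
proof -
  define R P where "R = opR a b" and "P = opP a b"
  define t1 t2 t3 t4 where "t1 = opS a Sm * opRt a b * opS b Sm" and "t2 = opS a Sm * opRt a b * opS b Sbm"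
    and "t3 = opS a Sbm * opRt a b * opS b Sm" and "t4 = opS a Sbm * opRti a b * opS b Sbm"
  define t1' t2' t3' t4' where "t1' = opS b Sm * opRt a b * opS a Sm" and "t2' = opS b Sbm * opRt a b * opS a Sm"
    and "t3' = opS b Sm * opRt a b * opS a Sbm" and "t4' = opS b Sbm * opRti a b * opS a Sbm"
  define q1 q2 q3 q4 where "q1 = opS a Sm * opQ a b * opS b Sm" and "q2 = opS a Sm * opQ a b * opS b Sbm"
    and "q3 = opS a Sbm * opQ a b * opS b Sm" and "q4 = opS a Sbm * opQ a b * opS b Sbm"
  define q1' q2' q3' q4' where "q1' = opS b Sm * opQ a b * opS a Sm" and "q2' = opS b Sbm * opQ a b * opS a Sm"
    and "q3' = opS b Sm * opQ a b * opS a Sbm" and "q4' = opS b Sbm * opQ a b * opS a Sbm"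
  define x1 x2 x3 x4 where "x1 = op2 a b (\<lambda>i j k l. Sm k i * Sm j l)"
    and "x2 = op2 a b (\<lambda>i j k l. Sm k i * Sbm j l)"
    and "x3 = op2 a b (\<lambda>i j k l. Sbm k i * Sm j l)" and "x4 = op2 a b (\<lambda>i j k l. Sbm k i * Sbm j l)"
  note defs = t1_def t2_def t3_def t4_def t1'_def t2'_def t3'_def t4'_def q1_def q2_def q3_def q4_def
    q1'_def q2'_def q3'_def q4'_def x1_def x2_def x3_def x4_def
  have lin: "llin R" "llin P" "llin t1" "llin t2" "llin t3" "llin t4" "llin t1'" "llin t2'" "llin t3'" "llin t4'"
    "llin q1" "llin q2" "llin q3" "llin q4" "llin q1'" "llin q2'" "llin q3'" "llin q4'"
    "llin x1" "llin x2" "llin x3" "llin x4"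
    by (simp_all add: defs R_def P_def)
  note pull = lin[THEN llin_scal_pull]
  note nf = algebra_simps pull scal_hom scal_swap scal_scal

  define \<beta> \<beta>' where "\<beta> = scal v' * t2 + scal u' * t3" and "\<beta>' = scal v' * t2' + scal u' * t3'"
  define \<gamma> \<gamma>' where "\<gamma> = q1 + scal (c * v') * q2 + scal (c * u') * q3 + scal (c * c) * q4"
    and "\<gamma>' = q1' + scal (c * v') * q2' + scal (c * u') * q3' + scal (c * c) * q4'"
  let ?RR = "scal (u - v) * R - scal (u * h) * P"
  let ?M = "\<lambda>t1 \<beta> t4 \<gamma>. scal (u' - v) * t1 + scal ((u' - v) * c) * \<beta> + scal ((u' - v) * (c * (c * (u' * v')))) * t4
    - scal (u' * h) * \<gamma>"

  \<comment> \<open>The constant equation for Sbar Sbar is known for \<open>opRti\<close>. Replacing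
    R^t by \<open>opRti\<close> plus h Q changes the coefficient of \<open>q4\<close>, which loses
    its dependence on v because \<open>v * v' = 1\<close>.\<close>
  have q4_coeff: "(u' - v) * (c * (c * (u' * v'))) * h - u' * h * (c * u' * (c * v')) = - (u' * h * (c * c))"
  proof -
    have "(u' - v) * (c * (c * (u' * v'))) * h - u' * h * (c * u' * (c * v')) = - (u' * h * (c * c)) * (v * v')"
      by (simp add: algebra_simps)
    then show ?thesis using v by simp
  qed
  have M: "opS a (Su u') * opRtxy a b u' v * opS b (Su v') = ?M t1 \<beta> t4 \<gamma>"
  proof -
    have "opS a (Su u') * opRtxy a b u' v * opS b (Su v')
      = scal (u' - v) * t1 + scal ((u' - v) * c) * \<beta>
        + scal ((u' - v) * (c * (c * (u' * v')))) * (opS a Sbm * opRt a b * opS b Sbm)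
        - scal (u' * h) * (q1 + scal (c * v') * q2 + scal (c * u') * q3 + scal (c * u' * (c * v')) * q4)"
      by (simp add: opS_Su opRtxy_def \<beta>_def t1_def t2_def t3_def q1_def q2_def q3_def q4_def
          algebra_simps op_pull scal_hom scal_swap scal_scal)
    also have "opS a Sbm * opRt a b * opS b Sbm = t4 + scal h * q4"
      by (simp add: t4_def q4_def opRti_def algebra_simps op_pull)
    also have "scal (u' - v) * t1 + scal ((u' - v) * c) * \<beta>
        + scal ((u' - v) * (c * (c * (u' * v')))) * (t4 + scal h * q4)
        - scal (u' * h) * (q1 + scal (c * v') * q2 + scal (c * u') * q3 + scal (c * u' * (c * v')) * q4)
      = scal (u' - v) * t1 + scal ((u' - v) * c) * \<beta> + scal ((u' - v) * (c * (c * (u' * v')))) * t4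
        - scal (u' * h) * (q1 + scal (c * v') * q2 + scal (c * u') * q3)
        + scal ((u' - v) * (c * (c * (u' * v'))) * h - u' * h * (c * u' * (c * v'))) * q4"
      by (simp add: nf)
    also have "\<dots> = ?M t1 \<beta> t4 \<gamma>"
      unfolding q4_coeff \<gamma>_def by (simp add: nf)
    finally show ?thesis .
  qed
  have M': "opS b (Su v') * opRtxy a b u' v * opS a (Su u') = ?M t1' \<beta>' t4' \<gamma>'"
  proof -
    have "opS b (Su v') * opRtxy a b u' v * opS a (Su u')
      = scal (u' - v) * t1' + scal ((u' - v) * c) * \<beta>'
        + scal ((u' - v) * (c * (c * (u' * v')))) * (opS b Sbm * opRt a b * opS a Sbm)
        - scal (u' * h) * (q1' + scal (c * v') * q2' + scal (c * u') * q3' + scal (c * u' * (c * v')) * q4')"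
      by (simp add: opS_Su opRtxy_def \<beta>'_def t1'_def t2'_def t3'_def q1'_def q2'_def q3'_def q4'_def
          algebra_simps op_pull scal_hom scal_swap scal_scal)
    also have "opS b Sbm * opRt a b * opS a Sbm = t4' + scal h * q4'"
      by (simp add: t4'_def q4'_def opRti_def algebra_simps op_pull)
    also have "scal (u' - v) * t1' + scal ((u' - v) * c) * \<beta>'
        + scal ((u' - v) * (c * (c * (u' * v')))) * (t4' + scal h * q4')
        - scal (u' * h) * (q1' + scal (c * v') * q2' + scal (c * u') * q3' + scal (c * u' * (c * v')) * q4')
      = scal (u' - v) * t1' + scal ((u' - v) * c) * \<beta>' + scal ((u' - v) * (c * (c * (u' * v')))) * t4'
        - scal (u' * h) * (q1' + scal (c * v') * q2' + scal (c * u') * q3')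
        + scal ((u' - v) * (c * (c * (u' * v'))) * h - u' * h * (c * u' * (c * v'))) * q4'"
      by (simp add: nf)
    also have "\<dots> = ?M t1' \<beta>' t4' \<gamma>'"
      unfolding q4_coeff \<gamma>'_def by (simp add: nf)
    finally show ?thesis .
  qed

  have c1: "?RR * t1 = t1' * ?RR"
    using refl_SS[OF ab, folded defs R_def P_def] opP_reflect_Rt[OF ab, of Sm Sm, folded defs R_def P_def]
    by (simp add: left_diff_distrib right_diff_distrib mult.assoc pull)
  have c4: "?RR * t4 = t4' * ?RR"
    using refl_SbSb[OF ab, folded defs R_def P_def] opP_reflect_Rti[OF ab, of Sbm Sbm, folded defs R_def P_def]
    by (simp add: left_diff_distrib right_diff_distrib mult.assoc pull)
  have P2: "P * t2 = t3' * P" and P3: "P * t3 = t2' * P"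
    using opP_reflect_Rt[OF ab] by (simp_all add: t2_def t3_def t2'_def t3'_def P_def)
  have R3: "R * t3 = t3' * R"
    using refl_SbS[OF ab] by (simp add: t3_def t3'_def R_def)
  \<comment> \<open>The inverse of R in \<open>refl_SSb\<close> contributes terms with P, and these
    couple \<open>t2\<close> with \<open>t3\<close>.\<close>
  have "(R - scal h * P) * t2 = t2' * (R - scal h * P)"
    using refl_SSb[OF ab] by (simp add: t2_def t2'_def R_def P_def opRi_def)
  then have R2: "R * t2 = t2' * R + scal h * (t3' * P) - scal h * (t2' * P)"
    by (simp add: left_diff_distrib right_diff_distrib mult.assoc pull P2 diff_eq_eq)
  have cb: "?RR * \<beta> = \<beta>' * ?RR"
  proof -
    have "?RR * \<beta> = scal ((u - v) * v') * (t2' * R) + scal ((u - v) * u') * (t3' * R)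
      + scal ((u - v) * v' * h - u * h * v') * (t3' * P) + scal (- ((u - v) * v' * h) - u * h * u') * (t2' * P)"
      unfolding \<beta>_def by (simp add: nf R2 R3 P2 P3)
    also have "(u - v) * v' * h - u * h * v' = - (u * u' * h)"
    proof -
      have "(u - v) * v' * h - u * h * v' = - (v * v' * h)"
        by (simp add: algebra_simps)
      then show ?thesis using u v by simp
    qed
    also have "- ((u - v) * v' * h) - u * h * u' = - (u * v' * h)"
    proof -
      have "- ((u - v) * v' * h) - u * h * u' = - (u * v' * h) + v * v' * h - u * u' * h"
        by (simp add: algebra_simps)
      then show ?thesis using u v by simp
    qed
    also have "scal ((u - v) * v') * (t2' * R) + scal ((u - v) * u') * (t3' * R)
      + scal (- (u * u' * h)) * (t3' * P) + scal (- (u * v' * h)) * (t2' * P) = \<beta>' * ?RR"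
      unfolding \<beta>'_def by (simp add: nf)
    finally show ?thesis .
  qed
  have Rq: "R * q1 = scal \<kappa>' * x3 + scal h * x1" "R * q2 = scal \<kappa>' * x4 + scal h * x2"
    "R * q3 = scal \<kappa> * x1" "R * q4 = scal \<kappa> * x2"
    by (simp_all add: defs R_def opR_Sm_Q[OF ab] opR_Sbm_Q[OF ab])
  have Pq: "P * q1 = x1" "P * q2 = x2" "P * q3 = x3" "P * q4 = x4"
    "q1' * P = x1" "q2' * P = x3" "q3' * P = x2" "q4' * P = x4"
    by (simp_all add: defs P_def opP_S_Q[OF ab])
  have qR: "q1' * R = scal \<kappa>' * x2 + scal h * x1" "q2' * R = scal \<kappa>' * x4 + scal h * x3"
    "q3' * R = scal \<kappa> * x1" "q4' * R = scal \<kappa> * x3"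
    by (simp_all add: defs R_def Q_Sm_opR[OF ab] Q_Sbm_opR[OF ab])
  have cg: "?RR * \<gamma> = \<gamma>' * ?RR"
  proof -
    \<comment> \<open>The coefficients of \<open>x2\<close> and \<open>x3\<close> come out
      interchanged on the two sides. The difference of the two expressions is a multiple of
      \<open>c * c * \<kappa> - \<kappa>'\<close>; this is the origin of the constant c, which over
      the complex numbers is thereby fixed up to sign.\<close>
    have coeff: "(u - v) * (c * v' * h + c * c * \<kappa>) - u * h * (c * v') = (u - v) * \<kappa>' - u * h * (c * u')"
    proof -
      have "(u - v) * (c * v' * h + c * c * \<kappa>) - u * h * (c * v') = (u - v) * (c * c * \<kappa>) - v * v' * (h * c)"
        by (simp add: algebra_simps)
      moreover have "(u - v) * \<kappa>' - u * h * (c * u') = (u - v) * \<kappa>' - u * u' * (h * c)"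
        by (simp add: algebra_simps)
      ultimately show ?thesis
        using u v c_kappa by simp
    qed
    have "?RR * \<gamma> = scal ((u - v) * (h + c * u' * \<kappa>) - u * h) * x1
      + scal ((u - v) * (c * v' * h + c * c * \<kappa>) - u * h * (c * v')) * x2
      + scal ((u - v) * \<kappa>' - u * h * (c * u')) * x3
      + scal ((u - v) * (c * v' * \<kappa>') - u * h * (c * c)) * x4"
      unfolding \<gamma>_def by (simp add: nf Rq Pq)
    also have "\<dots> = scal ((u - v) * (h + c * u' * \<kappa>) - u * h) * x1
      + scal ((u - v) * \<kappa>' - u * h * (c * u')) * x2
      + scal ((u - v) * (c * v' * h + c * c * \<kappa>) - u * h * (c * v')) * x3
      + scal ((u - v) * (c * v' * \<kappa>') - u * h * (c * c)) * x4"
      unfolding coeff ..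
    also have "\<dots> = \<gamma>' * ?RR"
      unfolding \<gamma>'_def by (simp add: nf qR Pq)
    finally show ?thesis .
  qed
  have "llin ?RR"
    using lin by simp
  then have "?RR * ?M t1 \<beta> t4 \<gamma> = scal (u' - v) * (?RR * t1) + scal ((u' - v) * c) * (?RR * \<beta>)
      + scal ((u' - v) * (c * (c * (u' * v')))) * (?RR * t4) - scal (u' * h) * (?RR * \<gamma>)"
    by (simp only: distrib_left right_diff_distrib llin_scal_pull)
  also have "\<dots> = ?M t1' \<beta>' t4' \<gamma>' * ?RR"
    unfolding c1 cb c4 cg by (simp only: distrib_right left_diff_distrib mult.assoc)
  finally show ?thesis
    unfolding M M' opRuv_def R_def P_def .
qed

text \<open>\<open>refl_SS\<close> and \<open>refl_SbS\<close> share the same R and R^t, so the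
  equation is linear in the first matrix and extends to S(u). It is used with copy 0, which carries
  no spectral parameter.\<close>

lemma reflection_constant:
  assumes "a \<noteq> b"
  shows "opR a b * (opS a (Su u') * opRt a b * opS b Sm) = opS b Sm * opRt a b * opS a (Su u') * opR a b"
proof -
  have "opR a b * (opS a (Su u') * opRt a b * opS b Sm)
    = opR a b * (opS a Sm * opRt a b * opS b Sm) + scal (c * u') * (opR a b * (opS a Sbm * opRt a b * opS b Sm))"
    by (simp add: opS_Su distrib_left distrib_right mult.assoc op_pull)
  also have "\<dots> = opS b Sm * opRt a b * opS a (Su u') * opR a b"
    unfolding refl_SS[OF assms] refl_SbS[OF assms]
    by (simp add: opS_Su distrib_left distrib_right mult.assoc op_pull)
  finally show ?thesis .
qed

end

section \<open>The Yang--Baxter equation and antisymmetric vectors\<close>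

lemma sum_split_at:
  fixes g :: "nat \<Rightarrow> 'd::ab_group_add"
  shows "m \<in> {1..n} \<Longrightarrow> sum g {1..n} = sum g {1..<m} + g m + sum g {m<..n}"
    and "1 \<le> i \<Longrightarrow> i < m \<Longrightarrow> sum g {1..<m} = sum g {1..<i} + g i + sum g {i<..<m}"
    and "i < m \<Longrightarrow> m \<le> n \<Longrightarrow> sum g {i<..n} = sum g {i<..<m} + g m + sum g {m<..n}"
proof -
  have *: "sum g D = sum g A + g k + sum g B"
    if "D = insert k (A \<union> B)" "finite A" "finite B" "k \<notin> A" "k \<notin> B" "A \<inter> B = {}" for A B D k
    using that by (simp add: sum.union_disjoint)
  show "m \<in> {1..n} \<Longrightarrow> sum g {1..n} = sum g {1..<m} + g m + sum g {m<..n}"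
    by (rule *) auto
  show "1 \<le> i \<Longrightarrow> i < m \<Longrightarrow> sum g {1..<m} = sum g {1..<i} + g i + sum g {i<..<m}"
    by (rule *) auto
  show "i < m \<Longrightarrow> m \<le> n \<Longrightarrow> sum g {i<..n} = sum g {i<..<m} + g m + sum g {m<..n}"
    by (rule *) auto
qed

context hecke_operators
begin

lemma act_opR:
  assumes "in_range J" "a \<noteq> b"
  shows "(w \<triangleleft> opR a b) J = iota (qd (J a) (J b)) * w J
    + (if J b < J a then iota h * w (J(a := J b, b := J a)) else 0)"
proof -
  have "(w \<triangleleft> opR a b) J = (\<Sum>k=1..N. \<Sum>l=1..N.
      (if k = J a \<and> l = J b then iota (qd (J a) (J b)) * w (J(a := k, b := l)) else 0)
      + (if k = J b \<and> l = J a then (if J b < J a then iota h * w (J(a := k, b := l)) else 0) else 0))"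
    unfolding opR_def op2s_def act_op2 using assms
    by (cases "J a = J b") (auto simp: rK_col iota_add iota_comm intro!: sum.cong)
  also have "\<dots> = iota (qd (J a) (J b)) * w (J(a := J a, b := J b))
    + (if J b < J a then iota h * w (J(a := J b, b := J a)) else 0)"
    using assms by (simp only: sum.distrib sum2_single in_rangeD)
  finally show ?thesis by simp
qed

lemma act_opP:
  assumes "in_range J" "a \<noteq> b"
  shows "(w \<triangleleft> opP a b) J = w (J(a := J b, b := J a))"
proof -
  have "(w \<triangleleft> opP a b) J = (\<Sum>k=1..N. \<Sum>l=1..N.
      (if k = J b \<and> l = J a then w (J(a := k, b := l)) else 0))"
    unfolding opP_def op2s_def act_op2 using assms
    by (auto simp: pK_def intro!: sum.cong)
  also have "\<dots> = w (J(a := J b, b := J a))"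
    using assms by (simp only: sum2_single in_rangeD)
  finally show ?thesis .
qed

lemma act_opQ:
  assumes "in_range J" "a \<noteq> b"
  shows "(w \<triangleleft> opQ a b) J = (if J a = J b then \<Sum>k=1..N. w (J(a := k, b := k)) else 0)"
proof -
  have "(w \<triangleleft> opQ a b) J = (\<Sum>k=1..N. \<Sum>l=1..N.
      (if l = k then (if J a = J b then w (J(a := k, b := l)) else 0) else 0))"
    unfolding opQ_def op2s_def act_op2 if_P[OF assms(1)]
    by (intro sum.cong refl) (auto simp: pK_def transpose_fst_def)
  also have "\<dots> = (\<Sum>k=1..N. (if J a = J b then w (J(a := k, b := k)) else 0))"
    by (intro sum.cong refl) (simp add: sum.delta)
  finally show ?thesis by simp
qed

lemma act_opRt:
  assumes "in_range J" "a \<noteq> b"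
  shows "(w \<triangleleft> opRt a b) J = iota (qd (J a) (J b)) * w J
    + (if J a = J b then iota h * (\<Sum>k\<in>{J a<..N}. w (J(a := k, b := k))) else 0)"
proof -
  have "(w \<triangleleft> opRt a b) J = (\<Sum>k=1..N. \<Sum>l=1..N.
      (if k = J a \<and> l = J b then iota (qd (J a) (J b)) * w (J(a := k, b := l)) else 0)
      + (if l = k then (if J a = J b \<and> J a < k then iota h * w (J(a := k, b := l)) else 0) else 0))"
    unfolding opRt_def op2s_def act_op2 transpose_fst_def if_P[OF assms(1)]
    by (intro sum.cong refl; cases "J a = J b") (auto simp: rK_row iota_add iota_comm)
  also have "\<dots> = iota (qd (J a) (J b)) * w (J(a := J a, b := J b))
      + (\<Sum>k=1..N. if J a = J b \<and> J a < k then iota h * w (J(a := k, b := k)) else 0)"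
    using assms by (simp only: sum.distrib sum2_single in_rangeD) (simp add: sum.delta)
  also have "(\<Sum>k=1..N. if J a = J b \<and> J a < k then iota h * w (J(a := k, b := k)) else 0)
      = (if J a = J b then iota h * (\<Sum>k\<in>{J a<..N}. w (J(a := k, b := k))) else 0)"
    by (auto simp: sum_distrib_left intro!: sum.mono_neutral_cong_right)
  finally show ?thesis by simp
qed

lemma opRtxy_flip: "a \<noteq> b \<Longrightarrow> opRtxy b a x y = opRtxy a b x y"
  by (simp add: opRtxy_def opRt_flip opQ_flip)

text \<open>Through this specialization, facts about R^t(x,y) also serve for the constant
  R^t.\<close>

lemma opRtxy_const: "opRtxy a b 0 (- 1) = opRt a b"
  by (simp add: opRtxy_def scal_hom)

lemma act_scal_first: "llin A \<Longrightarrow> (w \<triangleleft> scal s \<triangleleft> A) J = iota s * (w \<triangleleft> A) J"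
  by (metis act_scal act_simps(6) llin_scal_comm)

lemma act_opRtxy_linear:
  "(w \<triangleleft> opRtxy a b x y) J = iota (x - y) * (w \<triangleleft> opRt a b) J - iota (x * h) * (w \<triangleleft> opQ a b) J"
  by (simp add: opRtxy_def act_scal_first)

lemma act_opRuv:
  "(w \<triangleleft> opRuv a b u v) J = iota (u - v) * (w \<triangleleft> opR a b) J - iota (u * h) * (w \<triangleleft> opP a b) J"
  by (simp add: opRuv_def act_scal_first)

lemma act_opRtxy:
  assumes "in_range J" "a \<noteq> b"
  shows "(w \<triangleleft> opRtxy a b x y) J = (if J a = J b
    then iota (q' * x - q * y) * w J - iota (x * h) * (\<Sum>k\<in>{1..<J a}. w (J(a := k, b := k)))
      - iota (y * h) * (\<Sum>k\<in>{J a<..N}. w (J(a := k, b := k)))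
    else iota (x - y) * w J)"
proof (cases "J a = J b")
  case True
  have J: "J(a := J a, b := J a) = J"
    using True by (simp add: fun_eq_iff)
  have s: "(\<Sum>k=1..N. w (J(a := k, b := k))) = (\<Sum>k\<in>{1..<J a}. w (J(a := k, b := k))) + w J
      + (\<Sum>k\<in>{J a<..N}. w (J(a := k, b := k)))"
    using sum_split_at(1)[OF in_rangeD(1)[OF assms(1)], of "\<lambda>k. w (J(a := k, b := k))" a]
    by (simp only: J)
  show ?thesis
    using True assms unfolding act_opRtxy_linear
    by (simp add: act_opRt act_opQ s[unfolded One_nat_def True]) (simp add: qd_def h_def iota_hom algebra_simps
        mult.assoc iota_swap)
next
  case False
  then show ?thesis
    using assms by (simp add: act_opRtxy_linear act_opRt act_opQ qd_def)
qed

text \<open>Antisymmetry with respect to \<open>P\<^sup>q\<^sub>a\<^sub>b\<close>.\<close>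

definition qalt :: "nat \<Rightarrow> nat \<Rightarrow> ((nat \<Rightarrow> nat) \<Rightarrow> 'c) \<Rightarrow> bool" where
  "qalt a b w \<longleftrightarrow> (\<forall>J. in_range J \<longrightarrow> (J a = J b \<longrightarrow> w J = 0)
     \<and> (J a < J b \<longrightarrow> w J = - (iota q * w (J(a := J b, b := J a)))))"

lemma qaltD:
  "qalt a b w \<Longrightarrow> in_range J \<Longrightarrow> J a = J b \<Longrightarrow> w J = 0"
  "qalt a b w \<Longrightarrow> in_range J \<Longrightarrow> J a < J b \<Longrightarrow> w J = - (iota q * w (J(a := J b, b := J a)))"
  by (auto simp: qalt_def)

text \<open>At v = q^{-2} u one has R(u,v) = (1 - q^{-2}) u (1 - P^q), so the image consists of
  vectors antisymmetric with respect to P^q.\<close>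

lemma qalt_opRuv:
  assumes "a \<noteq> b" "v = q' * q' * u"
  shows "qalt a b (z \<triangleleft> opRuv a b u v)"
  unfolding qalt_def
proof (intro allI impI conjI)
  fix J assume J: "in_range J"
  have J': "in_range (J(a := J b, b := J a))"
    using J by (simp add: in_range_def)
  note simps = act_opRuv act_opR act_opP assms qd_def h_def iota_hom algebra_simps
    mult.assoc iota_swap
  show "(z \<triangleleft> opRuv a b u v) J = 0" if "J a = J b"
  proof -
    have "J(a := J b, b := J b) = J"
      using that by auto
    then show ?thesis
      using J that assms(1) by (simp add: simps)
  qed
  show "(z \<triangleleft> opRuv a b u v) J = - (iota q * (z \<triangleleft> opRuv a b u v) (J(a := J b, b := J a)))" if "J a < J b"
  proof -
    have "J(a := J b, b := J a, a := J a, b := J b) = J"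
      using assms(1) by auto
    then show ?thesis
      using J J' that assms(1) by (simp add: simps del: fun_upd_apply) (simp add: simps)
  qed
qed

text \<open>On antisymmetric vectors 1 - P^q is multiplication by 2; hence the factor 2 that has to
  be invertible later.\<close>

lemma opRuv_qalt:
  assumes "a \<noteq> b" "v = q' * q' * u" "qalt a b w" "in_range J"
  shows "(w \<triangleleft> opRuv a b u v) J = iota (2 * (1 - q' * q') * u) * w J"
proof -
  have J': "in_range (J(a := J b, b := J a))"
    using assms by (simp add: in_range_def)
  have JJ: "J(a := J b, b := J a, a := J a, b := J b) = J"
    using assms(1) by auto
  have two: "iota 2 * z = z + z" for z
    using iota_add[of 1 1] by (simp add: mult_2)
  note simps = act_opRuv act_opR act_opP assms(1,2,4) two qd_def h_def iota_hom algebra_simps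
    mult.assoc iota_swap
  consider "J a = J b" | "J a < J b" | "J b < J a" by linarith
  then show ?thesis
  proof cases
    case 1
    then have "w J = 0" "J(a := J b, b := J b) = J"
      using qaltD[OF assms(3,4)] by auto
    then show ?thesis
      using 1 by (simp add: simps)
  next
    case 2
    have "iota q' * w J = - w (J(a := J b, b := J a))"
      using qaltD(2)[OF assms(3,4) 2] by simp
    then have e: "w (J(a := J b, b := J a)) = - (iota q' * w J)"
      by simp
    show ?thesis
      using 2 by (simp add: simps e)
  next
    case 3
    have "w (J(a := J b, b := J a)) = - (iota q * w J)"
      using qaltD(2)[OF assms(3) J'] 3 assms(1) JJ by simp
    then show ?thesis
      using 3 by (simp add: simps)
  qed
qed

text \<open>Coordinates in three copies. With J fixed as a spectator, an identity in the copies a,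
  b, d becomes one between functions of three indices.\<close>

definition upd3 :: "nat \<Rightarrow> nat \<Rightarrow> nat \<Rightarrow> (nat \<Rightarrow> nat) \<Rightarrow> nat \<Rightarrow> nat \<Rightarrow> nat \<Rightarrow> (nat \<Rightarrow> nat)" where
  "upd3 a b d J i j m = J(a := i, b := j, d := m)"

lemma act_upd3:
  assumes "a \<noteq> b" "a \<noteq> d" "b \<noteq> d" "in_range J" "i \<in> {1..N}" "j \<in> {1..N}" "m \<in> {1..N}"
  defines "E \<equiv> upd3 a b d J"
  shows "(w \<triangleleft> opR a b) (E i j m) = iota (qd i j) * w (E i j m) + (if j < i then iota h * w (E j i m) else 0)"
    and "(w \<triangleleft> opR a d) (E i j m) = iota (qd i m) * w (E i j m) + (if m < i then iota h * w (E m j i) else 0)"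
    and "(w \<triangleleft> opR b d) (E i j m) = iota (qd j m) * w (E i j m) + (if m < j then iota h * w (E i m j) else 0)"
    and "(w \<triangleleft> opRtxy a d x y) (E i j m) = (if i = m
      then iota (q' * x - q * y) * w (E m j m) - iota (x * h) * (\<Sum>k\<in>{1..<m}. w (E k j k))
        - iota (y * h) * (\<Sum>k\<in>{m<..N}. w (E k j k))
      else iota (x - y) * w (E i j m))"
    and "(w \<triangleleft> opRtxy b d x y) (E i j m) = (if j = m
      then iota (q' * x - q * y) * w (E i m m) - iota (x * h) * (\<Sum>k\<in>{1..<m}. w (E i k k))
        - iota (y * h) * (\<Sum>k\<in>{m<..N}. w (E i k k))
      else iota (x - y) * w (E i j m))"
proof -
  have g: "in_range (E i j m)"
    using assms by (simp add: in_range_def upd3_def)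
  have v: "E i j m a = i" "E i j m b = j" "E i j m d = m"
    using assms by (simp_all add: upd3_def)
  have u: "(E i j m)(a := k, b := l) = E k l m" "(E i j m)(a := k, d := l) = E k j l"
    "(E i j m)(b := k, d := l) = E i k l" for k l
    using assms by (auto simp: upd3_def)
  show "(w \<triangleleft> opR a b) (E i j m) = iota (qd i j) * w (E i j m) + (if j < i then iota h * w (E j i m) else 0)"
    using act_opR[OF g assms(1), of w] by (simp add: u v)
  show "(w \<triangleleft> opR a d) (E i j m) = iota (qd i m) * w (E i j m) + (if m < i then iota h * w (E m j i) else 0)"
    using act_opR[OF g assms(2), of w] by (simp add: u v)
  show "(w \<triangleleft> opR b d) (E i j m) = iota (qd j m) * w (E i j m) + (if m < j then iota h * w (E i m j) else 0)"
    using act_opR[OF g assms(3), of w] by (simp add: u v)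
  show "(w \<triangleleft> opRtxy a d x y) (E i j m) = (if i = m
      then iota (q' * x - q * y) * w (E m j m) - iota (x * h) * (\<Sum>k\<in>{1..<m}. w (E k j k))
        - iota (y * h) * (\<Sum>k\<in>{m<..N}. w (E k j k))
      else iota (x - y) * w (E i j m))"
    using act_opRtxy[OF g assms(2), of w x y, unfolded u v] by (cases "i = m") simp_all
  show "(w \<triangleleft> opRtxy b d x y) (E i j m) = (if j = m
      then iota (q' * x - q * y) * w (E i m m) - iota (x * h) * (\<Sum>k\<in>{1..<m}. w (E i k k))
        - iota (y * h) * (\<Sum>k\<in>{m<..N}. w (E i k k))
      else iota (x - y) * w (E i j m))"
    using act_opRtxy[OF g assms(3), of w x y, unfolded u v] by (cases "j = m") simp_all
qed

lemma qalt_upd3: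
  assumes "qalt a b w" "a \<noteq> b" "a \<noteq> d" "b \<noteq> d" "in_range J" "i \<in> {1..N}" "j \<in> {1..N}" "m \<in> {1..N}"
  shows "w (upd3 a b d J i i m) = 0"
    and "i < j \<Longrightarrow> w (upd3 a b d J i j m) = - (iota q * w (upd3 a b d J j i m))"
proof -
  have g: "in_range (upd3 a b d J i j m)"
    if "i \<in> {1..N}" "j \<in> {1..N}" for i j
    using assms that by (simp add: in_range_def upd3_def)
  have u: "(upd3 a b d J i j m)(a := j, b := i) = upd3 a b d J j i m"
    using assms by (auto simp: upd3_def)
  show "w (upd3 a b d J i i m) = 0"
    by (rule qaltD(1)[OF assms(1) g]) (use assms in \<open>simp_all add: upd3_def\<close>)
  show "w (upd3 a b d J i j m) = - (iota q * w (upd3 a b d J j i m))" if "i < j"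
    using qaltD(2)[OF assms(1) g[OF assms(6,7)]] that assms u by (simp add: upd3_def)
qed

lemma qalt_upd3_same:
  assumes "qalt a b w" "a \<noteq> b" "a \<noteq> d" "b \<noteq> d" "in_range J" "i \<in> {1..N}" "m \<in> {1..N}"
  shows "w (upd3 a b d J i i m) = 0"
  using qalt_upd3(1)[OF assms(1-6) assms(6,7)] .

lemma qalt_upd3I:
  assumes "a \<noteq> b" "a \<noteq> d" "b \<noteq> d"
    and "\<And>J i m. in_range J \<Longrightarrow> i \<in> {1..N} \<Longrightarrow> m \<in> {1..N} \<Longrightarrow> w (upd3 a b d J i i m) = 0"
    and "\<And>J i j m. in_range J \<Longrightarrow> i \<in> {1..N} \<Longrightarrow> j \<in> {1..N} \<Longrightarrow> m \<in> {1..N} \<Longrightarrow> i < j \<Longrightarrow>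
      w (upd3 a b d J i j m) = - (iota q * w (upd3 a b d J j i m))"
  shows "qalt a b w"
  unfolding qalt_def
proof (intro allI impI conjI)
  fix J assume J: "in_range J"
  have u: "upd3 a b d J (J a) (J b) (J d) = J" "upd3 a b d J (J b) (J a) (J d) = J(a := J b, b := J a)"
    using assms by (auto simp: upd3_def)
  show "w J = 0" if "J a = J b"
    using assms(4)[OF J, of "J a" "J d"] J that u by (simp add: in_rangeD)
  show "w J = - (iota q * w (J(a := J b, b := J a)))" if "J a < J b"
    using assms(5)[OF J _ _ _ that, of "J d"] J u by (simp add: in_rangeD)
qed

text \<open>An antisymmetric w satisfies w R_ba = -q^{-1} w P_ab, and abstractly the Yang-Baxter
  equation for R_ba, R_bd, R_ad carries this over to the product. Here the five positions of the
  third index relative to i < j are checked directly.\<close>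

lemma qalt_opR_opR:
  assumes w: "qalt a b w" and ab: "a \<noteq> b" "a \<noteq> d" "b \<noteq> d"
  shows "qalt a b (w \<triangleleft> opR a d \<triangleleft> opR b d)"
proof (rule qalt_upd3I[OF ab])
  fix J i m assume J: "in_range J" "i \<in> {1..N}" "m \<in> {1..N}"
  have b: "Suc 0 \<le> i" "i \<le> N" "Suc 0 \<le> m" "m \<le> N"
    using J by auto
  note [simp] = act_upd3[OF ab J(1)] b qalt_upd3_same[OF w ab J(1)]
  have "w (upd3 a b d J m i i) = - (iota q * w (upd3 a b d J i m i))" if "m < i"
    using qalt_upd3(2)[OF w ab J(1) _ _ _ that] J by simp
  then show "(w \<triangleleft> opR a d \<triangleleft> opR b d) (upd3 a b d J i i m) = 0"
    by (auto simp: qd_def iota_swap)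
next
  fix J i j m assume J: "in_range J" "i \<in> {1..N}" "j \<in> {1..N}" "m \<in> {1..N}" and "i < j"
  have s: "w (upd3 a b d J k l n) = - (iota q * w (upd3 a b d J l k n))"
    if "k < l" "k \<in> {1..N}" "l \<in> {1..N}" "n \<in> {1..N}" for k l n
    using qalt_upd3(2)[OF w ab J(1) _ _ _ that(1)] that by simp
  have b: "Suc 0 \<le> i" "i \<le> N" "Suc 0 \<le> j" "j \<le> N" "Suc 0 \<le> m" "m \<le> N"
    using J by auto
  note [simp] = act_upd3[OF ab J(1)] b qalt_upd3_same[OF w ab J(1)]
  note nf = qd_def h_def iota_hom algebra_simps mult.assoc iota_swap
  consider "m < i" | "m = i" | "i < m" "m < j" | "m = j" | "j < m" by linarith
  then show "(w \<triangleleft> opR a d \<triangleleft> opR b d) (upd3 a b d J i j m)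
    = - (iota q * (w \<triangleleft> opR a d \<triangleleft> opR b d) (upd3 a b d J j i m))"
  proof cases
    case 1
    then show ?thesis
      using \<open>i < j\<close> s[of i j m] s[of m j i] s[of m i j] by (simp add: nf)
  next
    case 2
    then show ?thesis
      using \<open>i < j\<close> s[of i j m] s[of m j i] s[of m i j] by (simp add: nf)
  next
    case 3
    then show ?thesis
      using \<open>i < j\<close> s[of i j m] s[of m j i] s[of i m j] by (simp add: nf)
  next
    case 4
    then show ?thesis
      using \<open>i < j\<close> s[of i j m] s[of m j i] s[of i m j] by (simp add: nf)
  next
    case 5
    then show ?thesis
      using \<open>i < j\<close> s[of i j m] s[of m j i] s[of i m j] by (simp add: nf)
  qed
qed

end

context hecke_operators
begin

lemma act_bad [simp]:
  "\<not> in_range J \<Longrightarrow> (w \<triangleleft> opR a b) J = 0" "\<not> in_range J \<Longrightarrow> (w \<triangleleft> opRt a b) J = 0"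
  by (simp_all add: opR_def opRt_def op2s_def act_op2)

lemma act_upd3_Rt:
  assumes "a \<noteq> b" "a \<noteq> d" "b \<noteq> d" "in_range J" "i \<in> {1..N}" "j \<in> {1..N}" "m \<in> {1..N}"
  defines "E \<equiv> upd3 a b d J"
  shows "(w \<triangleleft> opRt b d) (E i j m) = (if j = m
      then iota q * w (E i m m) + iota h * (\<Sum>k\<in>{m<..N}. w (E i k k)) else w (E i j m))"
  unfolding opRtxy_const[symmetric] E_def act_upd3(5)[OF assms(1-7)]
  by (simp add: iota_uminus)

text \<open>Only the factor in the copies a, d carries parameters: in the fusion with copy 0 the
  factors R^t_ij of the Sklyanin product meet constant R-matrices.\<close>

lemma yang_baxter:
  assumes ab: "a \<noteq> b" "a \<noteq> d" "b \<noteq> d"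
  shows "opR a b * opRtxy a d x y * opRt b d = opRt b d * opRtxy a d x y * opR a b"
proof (intro endo_fun_eqI)
  fix w J
  show "(w \<triangleleft> (opR a b * opRtxy a d x y * opRt b d)) J = (w \<triangleleft> (opRt b d * opRtxy a d x y * opR a b)) J"
  proof (cases "in_range J")
    case False
    then show ?thesis by simp
  next
    case J: True
    define E where "E = upd3 a b d J"
    define i j m where "i = J a" and "j = J b" and "m = J d"
    have JE: "J = E i j m"
      using ab by (auto simp: E_def upd3_def i_def j_def m_def)
    have b: "Suc 0 \<le> i" "i \<le> N" "Suc 0 \<le> j" "j \<le> N" "Suc 0 \<le> m" "m \<le> N"
      using in_rangeD(2,3)[OF J] by (simp_all add: i_def j_def m_def)
    define W1 where "W1 = w \<triangleleft> opR a b"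
    define W2 where "W2 = W1 \<triangleleft> opRtxy a d x y"
    define V1 where "V1 = w \<triangleleft> opRt b d"
    define V2 where "V2 = V1 \<triangleleft> opRtxy a d x y"
    have rg: "k \<in> {1..N}" if "Suc 0 \<le> k" "k \<le> N" for k
      using that by simp
    have W1: "W1 (E i j m) = iota (qd i j) * w (E i j m) + (if j < i then iota h * w (E j i m) else 0)"
      if "Suc 0 \<le> i" "i \<le> N" "Suc 0 \<le> j" "j \<le> N" "Suc 0 \<le> m" "m \<le> N" for i j m
      unfolding W1_def E_def using that by (intro act_upd3(1)[OF ab J] rg)
    have V1: "V1 (E i j m) = (if j = m
      then iota q * w (E i m m) + iota h * (\<Sum>k\<in>{m<..N}. w (E i k k)) else w (E i j m))"
      if "Suc 0 \<le> i" "i \<le> N" "Suc 0 \<le> j" "j \<le> N" "Suc 0 \<le> m" "m \<le> N" for i j m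
      unfolding V1_def E_def using that by (intro act_upd3_Rt[OF ab J] rg)
    have A: "(v \<triangleleft> opRtxy a d x y) (E i j m) = (if i = m
      then iota (q' * x - q * y) * v (E m j m) - iota (x * h) * (\<Sum>k\<in>{1..<m}. v (E k j k))
        - iota (y * h) * (\<Sum>k\<in>{m<..N}. v (E k j k))
      else iota (x - y) * v (E i j m))"
      if "Suc 0 \<le> i" "i \<le> N" "Suc 0 \<le> j" "j \<le> N" "Suc 0 \<le> m" "m \<le> N" for i j m v
      unfolding E_def using that by (intro act_upd3(4)[OF ab J] rg)
    note W2 = A[of _ _ _ W1, folded W2_def] and V2 = A[of _ _ _ V1, folded V2_def]
    have L: "(w \<triangleleft> (opR a b * opRtxy a d x y * opRt b d)) J = (if j = m
      then iota q * W2 (E i m m) + iota h * (\<Sum>k\<in>{m<..N}. W2 (E i k k)) else W2 (E i j m))"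
      unfolding JE using act_upd3_Rt[OF ab J rg rg rg, of i j m W2] b
      by (simp add: W2_def W1_def E_def)
    have R: "(w \<triangleleft> (opRt b d * opRtxy a d x y * opR a b)) J
      = iota (qd i j) * V2 (E i j m) + (if j < i then iota h * V2 (E j i m) else 0)"
      unfolding JE using act_upd3(1)[OF ab J rg rg rg, of i j m V2] b
      by (simp add: V2_def V1_def E_def)
    note nf = qd_def h_def iota_hom algebra_simps mult.assoc iota_swap
    show ?thesis
      unfolding L R
    proof (cases "m = i \<or> m = j")
      \<comment> \<open>If the index of copy d differs from both others, the transposed factors act
        by scalars and R_ab passes through.\<close>
      case False
      then show "(if j = m
          then iota q * W2 (E i m m) + iota h * (\<Sum>k\<in>{m<..N}. W2 (E i k k)) else W2 (E i j m))
        = iota (qd i j) * V2 (E i j m) + (if j < i then iota h * V2 (E j i m) else 0)"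
        using b by (auto simp: W2 V2 W1 V1 nf)
    next
      case True
      \<comment> \<open>The remaining coincidences. The sums over the contracted index are split at
        the other index, since the values of R_ab change form there.\<close>
      then consider "i = j" "m = i" | "i < j" "m = i" | "i < j" "m = j" | "j < i" "m = i" | "j < i" "m = j"
        by fastforce
      then show "(if j = m
          then iota q * W2 (E i m m) + iota h * (\<Sum>k\<in>{m<..N}. W2 (E i k k)) else W2 (E i j m))
        = iota (qd i j) * V2 (E i j m) + (if j < i then iota h * V2 (E j i m) else 0)"
      proof cases
        case 1
        have "(\<Sum>k\<in>{1..<m}. W1 (E k m k)) = (\<Sum>k\<in>{1..<m}. w (E k m k))"
          "(\<Sum>k\<in>{m<..N}. W1 (E k m k)) = (\<Sum>k\<in>{m<..N}. w (E k m k)) + iota h * (\<Sum>k\<in>{m<..N}. w (E m k k))"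
          "(\<Sum>k\<in>{m<..N}. W2 (E m k k)) = iota (x - y) * (\<Sum>k\<in>{m<..N}. w (E m k k))"
          "(\<Sum>k\<in>{1..<m}. V1 (E k m k)) = (\<Sum>k\<in>{1..<m}. w (E k m k))"
          "(\<Sum>k\<in>{m<..N}. V1 (E k m k)) = (\<Sum>k\<in>{m<..N}. w (E k m k))"
          unfolding sum_distrib_left sum.distrib[symmetric] using b
          by (auto intro!: sum.cong simp: W1 W2 V1 qd_def)
        then show ?thesis
          using 1 b by (simp add: W2 V2) (simp add: W1 V1 nf)
      next
        case 2
        have "(\<Sum>k\<in>{1..<i}. W1 (E k j k)) = (\<Sum>k\<in>{1..<i}. w (E k j k))"
          "(\<Sum>k\<in>{i<..<j}. W1 (E k j k)) = (\<Sum>k\<in>{i<..<j}. w (E k j k))"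
          "(\<Sum>k\<in>{j<..N}. W1 (E k j k)) = (\<Sum>k\<in>{j<..N}. w (E k j k)) + iota h * (\<Sum>k\<in>{j<..N}. w (E j k k))"
          "(\<Sum>k\<in>{1..<i}. V1 (E k j k)) = (\<Sum>k\<in>{1..<i}. w (E k j k))"
          "(\<Sum>k\<in>{i<..<j}. V1 (E k j k)) = (\<Sum>k\<in>{i<..<j}. w (E k j k))"
          "(\<Sum>k\<in>{j<..N}. V1 (E k j k)) = (\<Sum>k\<in>{j<..N}. w (E k j k))"
          unfolding sum_distrib_left sum.distrib[symmetric] using b 2
          by (auto intro!: sum.cong simp: W1 W2 V1 qd_def)
        then show ?thesis
          using 2 b by (simp add: W2 V2 sum_split_at(3)[of i j N]) (simp add: W1 V1 nf)
      next
        case 3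
        have "(\<Sum>k\<in>{j<..N}. W2 (E i k k)) = iota (x - y) * (\<Sum>k\<in>{j<..N}. w (E i k k))"
          unfolding sum_distrib_left sum.distrib[symmetric] using b 3
          by (auto intro!: sum.cong simp: W1 W2 V1 qd_def)
        then show ?thesis
          using 3 b by (simp add: W2 V2) (simp add: W1 V1 nf)
      next
        case 4
        have "(\<Sum>k\<in>{1..<j}. W1 (E k j k)) = (\<Sum>k\<in>{1..<j}. w (E k j k))"
          "(\<Sum>k\<in>{j<..<i}. W1 (E k j k)) = (\<Sum>k\<in>{j<..<i}. w (E k j k)) + iota h * (\<Sum>k\<in>{j<..<i}. w (E j k k))"
          "(\<Sum>k\<in>{i<..N}. W1 (E k j k)) = (\<Sum>k\<in>{i<..N}. w (E k j k)) + iota h * (\<Sum>k\<in>{i<..N}. w (E j k k))"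
          "(\<Sum>k\<in>{1..<j}. V1 (E k j k)) = (\<Sum>k\<in>{1..<j}. w (E k j k))"
          "(\<Sum>k\<in>{j<..<i}. V1 (E k j k)) = (\<Sum>k\<in>{j<..<i}. w (E k j k))"
          "(\<Sum>k\<in>{i<..N}. V1 (E k j k)) = (\<Sum>k\<in>{i<..N}. w (E k j k))"
          unfolding sum_distrib_left sum.distrib[symmetric] using b 4
          by (auto intro!: sum.cong simp: W1 W2 V1 qd_def)
        then show ?thesis
          using 4 b by (simp add: W2 V2 sum_split_at(2)[of j i, unfolded One_nat_def])
            (simp add: W1 V1 sum_split_at(3)[of j i N] nf)
      next
        case 5
        have "(\<Sum>k\<in>{j<..<i}. W2 (E i k k)) = iota (x - y) * (\<Sum>k\<in>{j<..<i}. w (E i k k))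
            + iota ((x - y) * h) * (\<Sum>k\<in>{j<..<i}. w (E k i k))"
          "(\<Sum>k\<in>{i<..N}. W2 (E i k k)) = iota (x - y) * (\<Sum>k\<in>{i<..N}. w (E i k k))"
          "(\<Sum>k\<in>{1..<i}. W1 (E k i k)) = (\<Sum>k\<in>{1..<i}. w (E k i k))"
          "(\<Sum>k\<in>{i<..N}. W1 (E k i k)) = (\<Sum>k\<in>{i<..N}. w (E k i k)) + iota h * (\<Sum>k\<in>{i<..N}. w (E i k k))"
          "(\<Sum>k\<in>{1..<j}. V1 (E k i k)) = (\<Sum>k\<in>{1..<j}. w (E k i k))"
          "(\<Sum>k\<in>{j<..<i}. V1 (E k i k)) = (\<Sum>k\<in>{j<..<i}. w (E k i k))"
          "(\<Sum>k\<in>{i<..N}. V1 (E k i k)) = (\<Sum>k\<in>{i<..N}. w (E k i k))"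
          unfolding sum_distrib_left sum.distrib[symmetric] using b 5
          by (auto intro!: sum.cong simp: W1 W2 V1 qd_def distrib_left iota_mult mult.assoc)
        then show ?thesis
          using 5 b by (simp add: sum_split_at(3)[of j i N], simp add: W2 V2 sum_split_at(3)[of j i N])
            (simp add: W1 V1 sum_split_at(3)[of j i N] sum_split_at(2)[of j i, unfolded One_nat_def] nf)
      qed
    qed
  qed
qed

text \<open>The ratio q^2 is that of consecutive parameters u_i^{-1}; it makes the contracted sums
  cancel.\<close>

lemma qalt_opRtxy:
  assumes w: "qalt a b w" and ab: "a \<noteq> b" "a \<noteq> d" "b \<noteq> d" and x': "x' = q * q * x"
  shows "qalt a b (w \<triangleleft> opRtxy a d x y \<triangleleft> opRtxy b d x' y)"
proof -
  have main: "(w \<triangleleft> opRtxy a d x y \<triangleleft> opRtxy b d x' y) (upd3 a b d J i i m) = 0"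
    "i < j \<Longrightarrow> (w \<triangleleft> opRtxy a d x y \<triangleleft> opRtxy b d x' y) (upd3 a b d J i j m)
      = - (iota q * (w \<triangleleft> opRtxy a d x y \<triangleleft> opRtxy b d x' y) (upd3 a b d J j i m))"
    if J: "in_range J" and b: "Suc 0 \<le> i" "i \<le> N" "Suc 0 \<le> j" "j \<le> N" "Suc 0 \<le> m" "m \<le> N" for J i j m
  proof -
    define E where "E = upd3 a b d J"
    define W1 where "W1 = w \<triangleleft> opRtxy a d x y"
    define W2 where "W2 = W1 \<triangleleft> opRtxy b d x' y"
    have rg: "k \<in> {1..N}" if "Suc 0 \<le> k" "k \<le> N" for k
      using that by simp
    have W1: "W1 (E i j m) = (if i = m
      then iota (q' * x - q * y) * w (E m j m) - iota (x * h) * (\<Sum>k\<in>{1..<m}. w (E k j k))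
        - iota (y * h) * (\<Sum>k\<in>{m<..N}. w (E k j k))
      else iota (x - y) * w (E i j m))"
      if "Suc 0 \<le> i" "i \<le> N" "Suc 0 \<le> j" "j \<le> N" "Suc 0 \<le> m" "m \<le> N" for i j m
      unfolding E_def W1_def using that by (intro act_upd3(4)[OF ab J] rg)
    have W2: "W2 (E i j m) = (if j = m
      then iota (q' * x' - q * y) * W1 (E i m m) - iota (x' * h) * (\<Sum>k\<in>{1..<m}. W1 (E i k k))
        - iota (y * h) * (\<Sum>k\<in>{m<..N}. W1 (E i k k))
      else iota (x' - y) * W1 (E i j m))"
      if "Suc 0 \<le> i" "i \<le> N" "Suc 0 \<le> j" "j \<le> N" "Suc 0 \<le> m" "m \<le> N" for i j m
      unfolding E_def W2_def using that by (intro act_upd3(5)[OF ab J] rg)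
    have w0: "w (E i i m) = 0" if "Suc 0 \<le> i" "i \<le> N" "Suc 0 \<le> m" "m \<le> N" for i m
      unfolding E_def using that by (intro qalt_upd3_same[OF w ab J] rg)
    have w1: "w (E i j m) = - (iota q * w (E j i m))"
      if "i < j" "Suc 0 \<le> i" "i \<le> N" "Suc 0 \<le> j" "j \<le> N" "Suc 0 \<le> m" "m \<le> N" for i j m
      unfolding E_def using that(2-) by (intro qalt_upd3(2)[OF w ab J _ _ _ that(1)] rg)
    have w2: "w (E j i m) = - (iota q' * w (E i j m))"
      if "i < j" "Suc 0 \<le> i" "i \<le> N" "Suc 0 \<le> j" "j \<le> N" "Suc 0 \<le> m" "m \<le> N" for i j m
      using w1[OF that] by simp
    note nf = x' h_def iota_hom algebra_simps mult.assoc iota_swap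
    \<comment> \<open>Antisymmetry moves the contracted index from copy a to copy b, at the price of
      -q below \<open>j\<close> and of -q^{-1} above \<open>j\<close> (\<open>gt\<close>).\<close>
    have lt: "(\<Sum>k\<in>D. w (E k j k)) = - (iota q * (\<Sum>k\<in>D. w (E j k k)))"
      if "D \<subseteq> {1..<j}" "Suc 0 \<le> j" "j \<le> N" for D j
      unfolding sum_distrib_left sum_negf[symmetric] using that
      by (intro sum.cong refl w1) auto
    have gt: "(\<Sum>k\<in>D. w (E k j k)) = - (iota q' * (\<Sum>k\<in>D. w (E j k k)))"
      if "D \<subseteq> {j<..N}" "Suc 0 \<le> j" "j \<le> N" for D j
      unfolding sum_distrib_left sum_negf[symmetric] using that
      by (intro sum.cong refl w2) auto
    have ne: "(\<Sum>k\<in>D. W1 (E j k k)) = iota (x - y) * (\<Sum>k\<in>D. w (E j k k))"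
      if "D \<subseteq> {1..N} - {j}" "Suc 0 \<le> j" "j \<le> N" for D j
      unfolding sum_distrib_left
    proof (intro sum.cong refl)
      fix k assume "k \<in> D"
      then have "k \<noteq> j" "Suc 0 \<le> k" "k \<le> N"
        using that by auto
      then show "W1 (E j k k) = iota (x - y) * w (E j k k)"
        using that by (simp add: W1)
    qed
    have same: "W1 (E j j j) = iota (x * h * q) * (\<Sum>k\<in>{1..<j}. w (E j k k))
        + iota (y * h * q') * (\<Sum>k\<in>{j<..N}. w (E j k k))" if "Suc 0 \<le> j" "j \<le> N" for j
      using that by (simp add: W1 w0 lt gt iota_mult mult.assoc)
    show "(w \<triangleleft> opRtxy a d x y \<triangleleft> opRtxy b d x' y) (upd3 a b d J i i m) = 0"
      unfolding E_def[symmetric] W1_def[symmetric] W2_def[symmetric]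
    proof (cases "i = m")
      case True
      \<comment> \<open>After these substitutions the lower sum has the coefficient (q^{-1} x' - q
        y) x h q - x' h (x - y), which vanishes for x' = q^2 x; the upper sum vanishes in the same
        way.\<close>
      have s: "(\<Sum>k\<in>{1..<m}. W1 (E m k k)) = iota (x - y) * (\<Sum>k\<in>{1..<m}. w (E m k k))"
        "(\<Sum>k\<in>{m<..N}. W1 (E m k k)) = iota (x - y) * (\<Sum>k\<in>{m<..N}. w (E m k k))"
        using b by (auto intro!: ne)
      show "W2 (E i i m) = 0"
        using True b s[unfolded One_nat_def] same[of m]
        by (simp add: W2) (simp add: nf)
    next
      case False
      then show "W2 (E i i m) = 0"
        using b by (simp add: W2 W1 w0)
    qed
    show "(w \<triangleleft> opRtxy a d x y \<triangleleft> opRtxy b d x' y) (upd3 a b d J i j m)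
      = - (iota q * (w \<triangleleft> opRtxy a d x y \<triangleleft> opRtxy b d x' y) (upd3 a b d J j i m))" if ij: "i < j"
      unfolding E_def[symmetric] W1_def[symmetric] W2_def[symmetric]
    proof -
      consider "m \<noteq> i" "m \<noteq> j" | "m = i" | "m = j" by blast
      then show "W2 (E i j m) = - (iota q * W2 (E j i m))"
      proof cases
        case 1
        then show ?thesis
          using b ij w1[of i j m] by (simp add: W2 W1) (simp add: nf)
      next
        case 2
        have s: "(\<Sum>k\<in>{1..<i}. W1 (E j k k)) = iota (x - y) * (\<Sum>k\<in>{1..<i}. w (E j k k))"
          "(\<Sum>k\<in>{i<..<j}. W1 (E j k k)) = iota (x - y) * (\<Sum>k\<in>{i<..<j}. w (E j k k))"
          "(\<Sum>k\<in>{j<..N}. W1 (E j k k)) = iota (x - y) * (\<Sum>k\<in>{j<..N}. w (E j k k))"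
          "(\<Sum>k\<in>{1..<i}. w (E k j k)) = - (iota q * (\<Sum>k\<in>{1..<i}. w (E j k k)))"
          "(\<Sum>k\<in>{i<..<j}. w (E k j k)) = - (iota q * (\<Sum>k\<in>{i<..<j}. w (E j k k)))"
          "(\<Sum>k\<in>{j<..N}. w (E k j k)) = - (iota q' * (\<Sum>k\<in>{j<..N}. w (E j k k)))"
          using b ij by (auto intro!: ne lt gt)
        note split = sum_split_at(3)[of i j N] sum_split_at(2)[of i j, unfolded One_nat_def]
        have v: "W1 (E j i i) = iota (x - y) * w (E j i i)"
          using b ij by (simp add: W1)
        have v': "W1 (E i j i) = iota (q' * x - q * y) * - (iota q * w (E j i i))
          - iota (x * h) * - (iota q * (\<Sum>k\<in>{1..<i}. w (E j k k)))
          - iota (y * h) * (- (iota q * (\<Sum>k\<in>{i<..<j}. w (E j k k))) - (iota q' * (\<Sum>k\<in>{j<..N}. w (E j k k))))"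
          using b ij w1[of i j i] s[unfolded One_nat_def] by (simp add: W1 split w0)
        show ?thesis
          using 2 b ij s[unfolded One_nat_def] same[of j, unfolded One_nat_def]
          by (simp add: W2 v v' split) (simp add: nf)
      next
        case 3
        have s: "(\<Sum>k\<in>{1..<i}. W1 (E i k k)) = iota (x - y) * (\<Sum>k\<in>{1..<i}. w (E i k k))"
          "(\<Sum>k\<in>{i<..<j}. W1 (E i k k)) = iota (x - y) * (\<Sum>k\<in>{i<..<j}. w (E i k k))"
          "(\<Sum>k\<in>{j<..N}. W1 (E i k k)) = iota (x - y) * (\<Sum>k\<in>{j<..N}. w (E i k k))"
          "(\<Sum>k\<in>{1..<i}. w (E k i k)) = - (iota q * (\<Sum>k\<in>{1..<i}. w (E i k k)))"
          "(\<Sum>k\<in>{i<..<j}. w (E k i k)) = - (iota q' * (\<Sum>k\<in>{i<..<j}. w (E i k k)))"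
          "(\<Sum>k\<in>{j<..N}. w (E k i k)) = - (iota q' * (\<Sum>k\<in>{j<..N}. w (E i k k)))"
          using b ij by (auto intro!: ne lt gt)
        note split = sum_split_at(3)[of i j N] sum_split_at(2)[of i j, unfolded One_nat_def]
        have v: "W1 (E i j j) = iota (x - y) * w (E i j j)"
          using b ij by (simp add: W1)
        have v': "W1 (E j i j) = iota (q' * x - q * y) * - (iota q' * w (E i j j))
          - iota (x * h) * (- (iota q * (\<Sum>k\<in>{1..<i}. w (E i k k))) - (iota q' * (\<Sum>k\<in>{i<..<j}. w (E i k k))))
          - iota (y * h) * - (iota q' * (\<Sum>k\<in>{j<..N}. w (E i k k)))"
          using b ij w2[of i j j] s[unfolded One_nat_def] by (simp add: W1 split w0)
        show ?thesis
          using 3 b ij s[unfolded One_nat_def] same[of i, unfolded One_nat_def]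
          by (simp add: W2 v v' split) (simp add: nf)
      qed
    qed
  qed
  show ?thesis
    by (rule qalt_upd3I[OF ab]) (use main in auto)
qed

end

section \<open>Words in adjacent transpositions and reordering of products\<close>

definition adj_prod :: "nat list \<Rightarrow> nat \<Rightarrow> nat" where
  "adj_prod ws = foldr (\<lambda>a \<tau>. Transposition.transpose a (a + 1) \<circ> \<tau>) ws id"

lemma adj_prod_append: "adj_prod (us @ vs) = adj_prod us \<circ> adj_prod vs"
  by (induction us) (simp_all add: adj_prod_def comp_assoc)

lemma transposition_adjacent_word:
  assumes "1 \<le> a" "a < b" "b \<le> N"
  shows "\<exists>ws. set ws \<subseteq> {1..<N} \<and> adj_prod ws = Transposition.transpose a b"
  using assms(2,3)
proof (induction b rule: less_induct)
  case (less b)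
  show ?case
  proof (cases "b = Suc a")
    case True
    then show ?thesis
      using less assms by (intro exI[of _ "[a]"]) (simp add: adj_prod_def)
  next
    case False
    then obtain b' where b': "b = Suc b'" "a < b'"
      using less.prems by (cases b) auto
    then obtain ws where ws: "set ws \<subseteq> {1..<N}" "adj_prod ws = Transposition.transpose a b'"
      using less.IH[of b'] less.prems by auto
    have "Transposition.transpose a b = Transposition.transpose b' (b' + 1)
        \<circ> (Transposition.transpose a b' \<circ> Transposition.transpose b' (b' + 1))"
      using b' by (auto simp: fun_eq_iff Transposition.transpose_def)
    then have "adj_prod ([b'] @ ws @ [b']) = Transposition.transpose a b"
      unfolding adj_prod_append ws(2) by (simp add: adj_prod_def)
    then show ?thesis
      using ws(1) b' less.prems assms(1) by (intro exI[of _ "[b'] @ ws @ [b']"]) auto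
  qed
qed

lemma permutes_adjacent_word:
  assumes "\<sigma> permutes {1..N}"
  shows "\<exists>ws. set ws \<subseteq> {1..<N} \<and> adj_prod ws = \<sigma>"
  using assms finite_atLeastAtMost[of 1 N]
proof (induction \<sigma> rule: permutes_induct)
  case id
  show ?case by (intro exI[of _ "[]"]) (simp add: adj_prod_def)
next
  case (swap a b p)
  then obtain ws where ws: "set ws \<subseteq> {1..<N}" "adj_prod ws = p"
    by blast
  have "\<exists>vs. set vs \<subseteq> {1..<N} \<and> adj_prod vs = Transposition.transpose a b"
  proof -
    consider "a = b" | "a < b" | "b < a" by linarith
    then show ?thesis
    proof cases
      case 1
      then show ?thesis by (intro exI[of _ "[]"]) (simp add: adj_prod_def)
    next
      case 2
      then show ?thesis using swap by (intro transposition_adjacent_word) auto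
    next
      case 3
      then have "\<exists>vs. set vs \<subseteq> {1..<N} \<and> adj_prod vs = Transposition.transpose b a"
        using swap by (intro transposition_adjacent_word) auto
      then show ?thesis by (simp add: transpose_commute)
    qed
  qed
  then obtain vs where "set vs \<subseteq> {1..<N}" "adj_prod vs = Transposition.transpose a b"
    by blast
  then show ?case
    using ws by (intro exI[of _ "vs @ ws"]) (auto simp: adj_prod_append)
qed

text \<open>This pairs the factors that share a third copy, R^t_am with R^t_bm for b = a + 1; only
  jointly do they preserve antisymmetry.\<close>

lemma prod_list_interleave:
  fixes f g :: "'i \<Rightarrow> 'a::monoid_mult"
  assumes "distinct ms" "\<And>m n. m \<in> set ms \<Longrightarrow> n \<in> set ms \<Longrightarrow> m \<noteq> n \<Longrightarrow> f m * g n = g n * f m"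
  shows "prod_list (map f ms) * prod_list (map g ms) = prod_list (map (\<lambda>m. f m * g m) ms)"
  using assms
proof (induction ms)
  case (Cons m ms)
  have "prod_list (map f ns) * g m = g m * prod_list (map f ns)" if "set ns \<subseteq> set ms" for ns
    using that
  proof (induction ns)
    case (Cons n ns)
    then show ?case
      using Cons.prems Cons.IH \<open>distinct (m # ms)\<close>
        \<open>\<And>m' n. m' \<in> set (m # ms) \<Longrightarrow> n \<in> set (m # ms) \<Longrightarrow> m' \<noteq> n \<Longrightarrow> f m' * g n = g n * f m'\<close>[of n m]
      by (auto simp: mult.assoc) (metis mult.assoc)
  qed simp
  then have "prod_list (map f ms) * g m = g m * prod_list (map f ms)"
    by blast
  then have "f m * prod_list (map f ms) * (g m * prod_list (map g ms))
      = f m * g m * (prod_list (map f ms) * prod_list (map g ms))"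
    by (metis mult.assoc)
  then show ?case
    using Cons by (simp add: mult.assoc)
qed simp

lemma prod_list_comm:
  fixes f :: "'i \<Rightarrow> 'a::monoid_mult"
  assumes "\<And>m. m \<in> set ms \<Longrightarrow> f m * z = z * f m"
  shows "prod_list (map f ms) * z = z * prod_list (map f ms)"
  using assms
proof (induction ms)
  case (Cons m ms)
  then have "f m * (prod_list (map f ms) * z) = z * f m * prod_list (map f ms)"
    by (simp flip: mult.assoc)
  then show ?case by (simp add: mult.assoc)
qed simp

section \<open>Vectors antisymmetric in all copies 1,...,N\<close>

context hecke_operators
begin

lemma in_range_transpose: "in_range J \<Longrightarrow> in_range (J(a := J b, b := J a))"
  by (simp add: in_range_def)

lemma swap_as_transpose: "J(a := J b, b := J a) = J \<circ> Transposition.transpose a b"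
  by (auto simp: fun_eq_iff Transposition.transpose_def)

lemma qalt_act_opS:
  assumes "qalt a b w" "d \<noteq> a" "d \<noteq> b"
  shows "qalt a b (w \<triangleleft> opS d A)"
  unfolding qalt_def
proof (intro allI impI conjI)
  fix J assume J: "in_range J"
  have g: "in_range (J(d := k))" if "k \<in> {1..N}" for k
    using J that by auto
  have eq: "J(a := J b, b := J a, d := k) = J(d := k, a := J b, b := J a)" for k
    using assms by (auto simp: fun_eq_iff)
  show "(w \<triangleleft> opS d A) J = 0" if "J a = J b"
  proof -
    have "w (J(d := k)) = 0" if "k \<in> {1..N}" for k
      using qaltD(1)[OF assms(1) g[OF that]] assms \<open>J a = J b\<close> by simp
    then show ?thesis
      by (simp add: act_opS)
  qed
  show "(w \<triangleleft> opS d A) J = - (iota q * (w \<triangleleft> opS d A) (J(a := J b, b := J a)))" if "J a < J b"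
  proof -
    have "w (J(d := k)) = - (iota q * w (J(d := k, a := J b, b := J a)))" if "k \<in> {1..N}" for k
      using qaltD(2)[OF assms(1) g[OF that]] assms \<open>J a < J b\<close> by simp
    then have "(\<Sum>k=1..N. w (J(d := k)) * A k (J d))
        = (\<Sum>k=1..N. - (iota q * (w (J(d := k, a := J b, b := J a)) * A k (J d))))"
      by (intro sum.cong refl) (simp add: mult.assoc)
    then show ?thesis
      using J in_range_transpose[OF J] assms by (simp add: act_opS eq sum_negf sum_distrib_left)
  qed
qed

lemma qalt_act_op2:
  assumes "qalt a b w" "d \<noteq> a" "d \<noteq> b" "e \<noteq> a" "e \<noteq> b"
  shows "qalt a b (w \<triangleleft> op2 d e M)"
  unfolding qalt_def
proof (intro allI impI conjI)
  fix J assume J: "in_range J"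
  have g: "in_range (J(d := k, e := l))" if "k \<in> {1..N}" "l \<in> {1..N}" for k l
    using J that by (intro in_range_upd)
  have eq: "J(a := J b, b := J a, d := k, e := l) = J(d := k, e := l, a := J b, b := J a)" for k l
    using assms by (auto simp: fun_eq_iff)
  show "(w \<triangleleft> op2 d e M) J = 0" if "J a = J b"
  proof -
    have "w (J(d := k, e := l)) = 0" if "k \<in> {1..N}" "l \<in> {1..N}" for k l
      using qaltD(1)[OF assms(1) g[OF that]] assms \<open>J a = J b\<close> by simp
    then show ?thesis
      by (simp add: act_op2)
  qed
  show "(w \<triangleleft> op2 d e M) J = - (iota q * (w \<triangleleft> op2 d e M) (J(a := J b, b := J a)))" if "J a < J b"
  proof -
    have "w (J(d := k, e := l)) = - (iota q * w (J(d := k, e := l, a := J b, b := J a)))"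
      if "k \<in> {1..N}" "l \<in> {1..N}" for k l
      using qaltD(2)[OF assms(1) g[OF that]] assms \<open>J a < J b\<close> by simp
    then have "(\<Sum>k=1..N. \<Sum>l=1..N. w (J(d := k, e := l)) * M k (J d) l (J e))
        = (\<Sum>k=1..N. \<Sum>l=1..N. - (iota q * (w (J(d := k, e := l, a := J b, b := J a)) * M k (J d) l (J e))))"
      by (intro sum.cong refl) (simp add: mult.assoc)
    then show ?thesis
      using J in_range_transpose[OF J] assms by (simp add: act_op2 eq sum_negf sum_distrib_left)
  qed
qed

lemma opRtxy_op2s:
  "opRtxy a b x y = op2 a b (\<lambda>i j k l. iota (x - y) * iota (transpose_fst rK i j k l)
     + iota (- (x * h)) * iota (transpose_fst pK i j k l))"
  unfolding op2_add op2_scal opRtxy_def opRt_def opQ_def op2s_def by (simp add: scal_hom)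

lemma opRtxy_opS_comm:
  assumes "d \<noteq> a" "d \<noteq> b"
  shows "opS d A * opRtxy a b x y = opRtxy a b x y * opS d A"
  unfolding opRtxy_def opRt_def opQ_def
  by (simp add: algebra_simps llin_opS[THEN llin_scal_pull] opS_op2s_comm[OF assms])

lemma opRtxy_comm:
  assumes "a \<noteq> d" "a \<noteq> e" "b \<noteq> d" "b \<noteq> e"
  shows "op2s a b K * opRtxy d e x y = opRtxy d e x y * op2s a b K"
  unfolding opRtxy_def opRt_def opQ_def
  by (simp add: algebra_simps llin_op2s[THEN llin_scal_pull] op2s_comm[OF assms])

lemma opRtxy_opRtxy_comm:
  assumes "a \<noteq> d" "a \<noteq> e" "b \<noteq> d" "b \<noteq> e"
  shows "opRtxy a b x y * opRtxy d e x' y' = opRtxy d e x' y' * opRtxy a b x y"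
proof -
  have "op2s a b K * opRtxy d e x' y' = opRtxy d e x' y' * op2s a b K" for K
    by (rule opRtxy_comm[OF assms])
  then show ?thesis
    unfolding opRtxy_def[of a b] opRt_def[of a b] opQ_def[of a b]
    by (simp add: left_diff_distrib right_diff_distrib mult.assoc llin_opRtxy[THEN llin_scal_pull])
qed

lemma qalt_scale: "qalt a b w \<Longrightarrow> qalt a b (\<lambda>J. d * w J)"
  unfolding qalt_def by (auto simp: iota_pull)

lemma qalt_diff: "qalt a b v \<Longrightarrow> qalt a b w \<Longrightarrow> qalt a b (\<lambda>J. v J - w J)"
  unfolding qalt_def by (simp add: right_diff_distrib)

definition preserves :: "nat \<Rightarrow> ((nat \<Rightarrow> nat) \<Rightarrow> 'c) endo \<Rightarrow> bool" where
  "preserves a A \<longleftrightarrow> (\<forall>w. qalt a (Suc a) w \<longrightarrow> qalt a (Suc a) (w \<triangleleft> A))"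

lemma preserves_mult: "preserves a A \<Longrightarrow> preserves a B \<Longrightarrow> preserves a (A * B)"
  by (simp add: preserves_def)

lemma preserves_one: "preserves a 1"
  by (simp add: preserves_def)

lemma preserves_prod_list: "(\<And>A. A \<in> set As \<Longrightarrow> preserves a A) \<Longrightarrow> preserves a (prod_list As)"
  by (induction As) (auto intro: preserves_mult preserves_one)

lemma preserves_opS: "d \<noteq> a \<Longrightarrow> d \<noteq> Suc a \<Longrightarrow> preserves a (opS d A)"
  by (simp add: preserves_def qalt_act_opS)

lemma preserves_opRtxy:
  "d \<noteq> a \<Longrightarrow> d \<noteq> Suc a \<Longrightarrow> e \<noteq> a \<Longrightarrow> e \<noteq> Suc a \<Longrightarrow> preserves a (opRtxy d e x y)"
  by (simp add: preserves_def opRtxy_op2s qalt_act_op2)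

lemma preserves_opR:
  "d \<noteq> a \<Longrightarrow> d \<noteq> Suc a \<Longrightarrow> e \<noteq> a \<Longrightarrow> e \<noteq> Suc a \<Longrightarrow> preserves a (opR d e)"
  by (simp add: preserves_def opR_def op2s_def qalt_act_op2)

lemma preserves_opR_pair: "d \<noteq> a \<Longrightarrow> d \<noteq> Suc a \<Longrightarrow> preserves a (opR a d * opR (Suc a) d)"
  by (auto simp: preserves_def intro!: qalt_opR_opR)

lemma preserves_opRtxy_pair:
  "d \<noteq> a \<Longrightarrow> d \<noteq> Suc a \<Longrightarrow> preserves a (opRtxy a d x y * opRtxy (Suc a) d (q * q * x) y)"
  by (auto simp: preserves_def intro!: qalt_opRtxy)

lemma opRtxy_scale: "opRtxy a b (s * x) (s * y) = scal s * opRtxy a b x y"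
  by (simp add: opRtxy_def scal_hom algebra_simps)

text \<open>R^t(x,y) is homogeneous, so lowering y by q^{-2} amounts to raising x by q^2 up to a
  scalar; the symmetry of R^t under the flip of copies then reduces the claim to the previous
  pair.\<close>

lemma preserves_opRtxy_pair':
  assumes "d \<noteq> a" "d \<noteq> Suc a"
  shows "preserves a (opRtxy d a x y * opRtxy d (Suc a) x (q' * q' * y))"
proof -
  have "q' * q' * (q * q * x) = (q * q') * (q * q') * x"
    by (simp only: ac_simps)
  then have "opRtxy d (Suc a) x (q' * q' * y) = opRtxy (Suc a) d (q' * q' * (q * q * x)) (q' * q' * y)"
    using assms opRtxy_flip[of d "Suc a"] q_inverse by simp
  then have eq: "opRtxy d a x y * opRtxy d (Suc a) x (q' * q' * y)
      = scal (q' * q') * (opRtxy a d x y * opRtxy (Suc a) d (q * q * x) y)"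
    using assms opRtxy_flip[of d a] by (simp add: opRtxy_scale llin_opRtxy[THEN llin_scal_pull])
  have "preserves a (scal s)" for s
  proof -
    have "w \<triangleleft> scal s = (\<lambda>J. iota s * w J)" for w
      by (rule ext) (simp add: act_scal)
    then show ?thesis
      by (simp add: preserves_def qalt_scale)
  qed
  then show ?thesis
    unfolding eq by (intro preserves_mult preserves_opRtxy_pair assms)
qed

definition qalt_all :: "((nat \<Rightarrow> nat) \<Rightarrow> 'c) \<Rightarrow> bool" where
  "qalt_all w \<longleftrightarrow> (\<forall>a\<in>{1..<N}. qalt a (Suc a) w)"

lemma qalt_zero_iff:
  assumes "qalt a (Suc a) w" "in_range J"
  shows "w (J \<circ> Transposition.transpose a (a + 1)) = 0 \<longleftrightarrow> w J = 0"
proof -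
  let ?K = "J(a := J (Suc a), Suc a := J a)"
  have K: "in_range ?K"
    by (rule in_range_transpose[OF assms(2)])
  consider "J a = J (Suc a)" | "J a < J (Suc a)" | "J (Suc a) < J a" by linarith
  then have "w ?K = 0 \<longleftrightarrow> w J = 0"
  proof cases
    case 1
    then have "?K = J" by auto
    then show ?thesis by simp
  next
    case 2
    then have "w J = - (iota q * w ?K)"
      using qaltD(2)[OF assms] by simp
    then show ?thesis
      using iota_cancel[of q' q "w ?K" 0] q_inverse by (auto simp: mult.commute)
  next
    case 3
    have "?K(a := J a, Suc a := J (Suc a)) = J" by auto
    then have "w ?K = - (iota q * w J)"
      using qaltD(2)[OF assms(1) K] 3 by simp
    then show ?thesis
      using iota_cancel[of q' q "w J" 0] q_inverse by (auto simp: mult.commute)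
  qed
  then show ?thesis
    by (simp add: swap_as_transpose)
qed

lemma in_range_comp: "in_range J \<Longrightarrow> in_range (J \<circ> f)"
  by (simp add: in_range_def)

lemma qalt_all_zero_iff:
  assumes "qalt_all w" "in_range J" "\<sigma> permutes {1..N}"
  shows "w (J \<circ> \<sigma>) = 0 \<longleftrightarrow> w J = 0"
proof -
  obtain ws where ws: "set ws \<subseteq> {1..<N}" "adj_prod ws = \<sigma>"
    using permutes_adjacent_word[OF assms(3)] by blast
  have "w (J \<circ> adj_prod ws) = 0 \<longleftrightarrow> w J = 0"
    using ws(1) assms(2)
  proof (induction ws arbitrary: J)
    case (Cons a ws)
    have "J \<circ> adj_prod (a # ws) = (J \<circ> Transposition.transpose a (a + 1)) \<circ> adj_prod ws"
      by (simp add: adj_prod_def comp_assoc)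
    then have "w (J \<circ> adj_prod (a # ws)) = 0 \<longleftrightarrow> w (J \<circ> Transposition.transpose a (a + 1)) = 0"
      by (simp only:) (rule Cons.IH; use Cons.prems in \<open>simp add: in_range_def\<close>)
    also have "\<dots> \<longleftrightarrow> w J = 0"
      using Cons.prems assms(1) by (intro qalt_zero_iff) (auto simp: qalt_all_def)
    finally show ?case .
  qed (simp add: adj_prod_def)
  then show ?thesis
    using ws by simp
qed

text \<open>A permutation brings the second of the two equal indices next to the first without
  affecting vanishing, and equal neighbours give 0.\<close>

lemma qalt_all_repeated:
  assumes "qalt_all w" "in_range J" "a \<in> {1..N}" "b \<in> {1..N}" "a \<noteq> b" "J a = J b"
  shows "w J = 0"
proof -
  have *: "w J = 0" if "a < b" "a \<in> {1..N}" "b \<in> {1..N}" "J a = J b" for a b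
  proof -
    let ?\<sigma> = "Transposition.transpose (Suc a) b"
    have p: "?\<sigma> permutes {1..N}"
      using that by (intro permutes_swap_id) auto
    have "(J \<circ> ?\<sigma>) a = (J \<circ> ?\<sigma>) (Suc a)"
      using that by (auto simp: Transposition.transpose_def)
    moreover have "qalt a (Suc a) w"
      using assms(1) that by (auto simp: qalt_all_def)
    ultimately have "w (J \<circ> ?\<sigma>) = 0"
      using qaltD(1)[of a "Suc a" w "J \<circ> ?\<sigma>"] in_range_comp[OF assms(2)] by blast
    then show ?thesis
      using qalt_all_zero_iff[OF assms(1,2) p] by simp
  qed
  show ?thesis
    using *[of a b] *[of b a] assms by (cases "a < b") auto
qed

definition idx_id :: "(nat \<Rightarrow> nat) \<Rightarrow> nat \<Rightarrow> nat" where
  "idx_id J = (\<lambda>c. if c \<in> {1..N} then c else J c)"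

lemma in_range_idx_id: "in_range J \<Longrightarrow> in_range (idx_id J)"
  by (auto simp: in_range_def idx_id_def)

text \<open>N indices with values in 1,...,N either repeat or form a permutation, and permuting
  copies does not affect vanishing. This is where the rank one property comes from; the copies
  outside 1,...,N are spectators.\<close>

lemma qalt_all_zero:
  assumes "qalt_all w" "in_range J" "w (idx_id J) = 0"
  shows "w J = 0"
proof (cases "inj_on J {1..N}")
  case False
  then show ?thesis
    using qalt_all_repeated[OF assms(1,2)] by (auto simp: inj_on_def)
next
  case True
  define \<sigma> where "\<sigma> = (\<lambda>c. if c \<in> {1..N} then J c else c)"
  have "J ` {1..N} = {1..N}"
    using True in_rangeD(1)[OF assms(2)] by (intro endo_inj_surj) auto
  with True have "bij_betw J {1..N} {1..N}"
    by (simp add: bij_betw_def)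
  then have "bij_betw \<sigma> {1..N} {1..N}"
    by (rule bij_betw_cong[THEN iffD1, rotated]) (simp add: \<sigma>_def)
  then have p: "\<sigma> permutes {1..N}"
    by (rule bij_imp_permutes) (auto simp: \<sigma>_def)
  have "idx_id J \<circ> \<sigma> = J"
    using in_rangeD(1)[OF assms(2)] by (auto simp: idx_id_def \<sigma>_def fun_eq_iff)
  then show ?thesis
    using qalt_all_zero_iff[OF assms(1) in_range_idx_id[OF assms(2)] p] assms(3) by simp
qed

text \<open>Every eigenvalue below is computed with this criterion: antisymmetry of both sides is
  checked abstractly, and only the identity index is evaluated.\<close>

lemma qalt_all_eqI:
  assumes "qalt_all v" "qalt_all w" "in_range J" "v (idx_id J) = w (idx_id J)"
  shows "v J = w J"
proof -
  have "qalt_all (\<lambda>J. v J - w J)"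
    using assms(1,2) by (auto simp: qalt_all_def intro: qalt_diff)
  from qalt_all_zero[OF this assms(3)] assms(4) show ?thesis by simp
qed

text \<open>The factors belonging to the copies a and a + 1 are neighbours, and they have to
  preserve antisymmetry only jointly.\<close>

lemma preserves_pairs_prod_list:
  assumes a: "a \<in> {1..<N}" and lo: "lo \<le> a"
    and other: "\<And>k. k \<noteq> a \<Longrightarrow> k \<noteq> Suc a \<Longrightarrow> k \<in> {lo..N} \<Longrightarrow> preserves a (f k)"
    and pair: "preserves a (f a * f (Suc a))"
  shows "preserves a (prod_list (map f [lo..<Suc N]))"
proof -
  have "[lo..<Suc N] = [lo..<a] @ [a, Suc a] @ [Suc (Suc a)..<Suc N]"
    using a lo upt_add_eq_append[of lo a "Suc N - a"] upt_conv_Cons[of a "Suc N"]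
      upt_conv_Cons[of "Suc a" "Suc N"] by (simp del: upt_Suc)
  then have "prod_list (map f [lo..<Suc N])
      = prod_list (map f [lo..<a]) * ((f a * f (Suc a)) * prod_list (map f [Suc (Suc a)..<Suc N]))"
    by (simp add: mult.assoc del: upt_Suc)
  moreover have "preserves a (prod_list (map f [lo..<a]))" "preserves a (prod_list (map f [Suc (Suc a)..<Suc N]))"
    using a lo by (auto intro!: preserves_prod_list other simp del: upt_Suc)
  ultimately show ?thesis
    by (simp add: preserves_mult pair)
qed

definition rr :: "nat \<Rightarrow> ((nat \<Rightarrow> nat) \<Rightarrow> 'c) endo" where
  "rr i = prod_list (map (\<lambda>k. opR k 0) [i..<Suc N])"

definition tt :: "nat \<Rightarrow> ((nat \<Rightarrow> nat) \<Rightarrow> 'c) endo" where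
  "tt i = prod_list (map (\<lambda>k. opRt k 0) [i..<Suc N])"

lemma preserves_all: "qalt_all w \<Longrightarrow> (\<And>a. a \<in> {1..<N} \<Longrightarrow> preserves a A) \<Longrightarrow> qalt_all (w \<triangleleft> A)"
  by (simp add: qalt_all_def preserves_def)

lemma preserves_rr: "a \<in> {1..<N} \<Longrightarrow> preserves a (rr 1)"
  unfolding rr_def by (rule preserves_pairs_prod_list) (auto intro: preserves_opR preserves_opR_pair)

lemma preserves_tt: "a \<in> {1..<N} \<Longrightarrow> preserves a (tt 1)"
  unfolding tt_def
  by (rule preserves_pairs_prod_list)
    (auto simp: opRtxy_const[symmetric] intro: preserves_opRtxy preserves_opRtxy_pair[of _ _ 0, simplified])

lemma act_rr_trivial:
  assumes "in_range J" "\<And>k. k \<in> {1..<b} \<Longrightarrow> J k < J 0"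
  shows "(w \<triangleleft> prod_list (map (\<lambda>k. opR k 0) [1..<b])) J = w J"
  using assms(2)
proof (induction b)
  case (Suc b)
  show ?case
  proof (cases "b = 0")
    case False
    then have "J b < J 0"
      using Suc.prems[of b] by simp
    moreover have "(w \<triangleleft> prod_list (map (\<lambda>k. opR k 0) [1..<b])) J = w J"
      using Suc by simp
    ultimately show ?thesis
      using False assms(1) by (simp add: act_opR qd_def)
  qed simp
qed simp

lemma act_tt_trivial:
  assumes "in_range J" "\<And>k. k \<in> {1..<b} \<Longrightarrow> J k \<noteq> J 0"
  shows "(w \<triangleleft> prod_list (map (\<lambda>k. opRt k 0) [1..<b])) J = w J"
  using assms(2)
proof (induction b)
  case (Suc b)
  show ?case
  proof (cases "b = 0")
    case False
    then have "J b \<noteq> J 0"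
      using Suc.prems[of b] by simp
    moreover have "(w \<triangleleft> prod_list (map (\<lambda>k. opRt k 0) [1..<b])) J = w J"
      using Suc by simp
    ultimately show ?thesis
      using False assms(1) by (simp add: act_opRt qd_def)
  qed simp
qed simp

text \<open>At the index 1,...,N every off-diagonal contribution vanishes, and the diagonal part of
  R_k0 is 1 except for the single k equal to the index of copy 0, where it is q.\<close>

lemma act_rr_id:
  assumes w: "qalt_all w" and J: "in_range J" "\<And>k. k \<in> {1..N} \<Longrightarrow> J k = k"
  shows "b \<le> Suc N \<Longrightarrow> (w \<triangleleft> prod_list (map (\<lambda>k. opR k 0) [1..<b])) J = iota (if J 0 < b then q else 1) * w J"
proof (induction b)
  case 0
  then show ?case by simp
next
  case (Suc b)
  show ?case
  proof (cases "b = 0")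
    case True
    then show ?thesis
      using in_rangeD(2)[OF J(1), of 0] by simp
  next
    case False
    have b: "J b = b" "1 \<le> b" "b \<le> N"
      using Suc.prems False by (auto intro: J)
    let ?W = "w \<triangleleft> prod_list (map (\<lambda>k. opR k 0) [1..<b])"
    \<comment> \<open>The exchange puts the value \<open>J 0\<close> into copy b, where it repeats
      the value of the earlier copy with number \<open>J 0\<close>.\<close>
    have z: "?W (J(b := J 0, 0 := b)) = 0" if "J 0 < b"
    proof -
      let ?K = "J(b := J 0, 0 := b)"
      have K: "in_range ?K"
        using J(1) b by (auto simp: in_range_def)
      have "?W ?K = w ?K"
        using b J(2) by (intro act_rr_trivial K) auto
      also have "\<dots> = 0"
        using b that in_rangeD[OF J(1), of 0] J(2)[of "J 0"]
        by (intro qalt_all_repeated[OF w K, of b "J 0"]) auto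
      finally show ?thesis .
    qed
    have "(w \<triangleleft> prod_list (map (\<lambda>k. opR k 0) [1..<Suc b])) J = (?W \<triangleleft> opR b 0) J"
      using False by simp
    also have "\<dots> = iota (qd b (J 0)) * ?W J"
      using J(1) False b z by (simp add: act_opR)
    also have "?W J = iota (if J 0 < b then q else 1) * w J"
      using Suc by simp
    finally show ?thesis
      by (auto simp: qd_def)
  qed
qed

lemma act_tt_id:
  assumes w: "qalt_all w" and J: "in_range J" "\<And>k. k \<in> {1..N} \<Longrightarrow> J k = k"
  shows "b \<le> Suc N \<Longrightarrow> (w \<triangleleft> prod_list (map (\<lambda>k. opRt k 0) [1..<b])) J = iota (if J 0 < b then q else 1) * w J"
proof (induction b)
  case 0
  then show ?case by simp
next
  case (Suc b)
  show ?case
  proof (cases "b = 0")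
    case True
    then show ?thesis
      using in_rangeD(2)[OF J(1), of 0] by simp
  next
    case False
    have b: "J b = b" "1 \<le> b" "b \<le> N"
      using Suc.prems False by (auto intro: J)
    let ?W = "w \<triangleleft> prod_list (map (\<lambda>k. opRt k 0) [1..<b])"
    \<comment> \<open>The contraction puts k into copy b, where it repeats the value of the later
      copy k.\<close>
    have z: "?W (J(b := k, 0 := k)) = 0" if "k \<in> {b<..N}" for k
    proof -
      let ?K = "J(b := k, 0 := k)"
      have K: "in_range ?K"
        using J(1) b that by (auto simp: in_range_def)
      have "?W ?K = w ?K"
        using b J(2) that by (intro act_tt_trivial K) auto
      also have "\<dots> = 0"
        using b that J(2)[of k]
        by (intro qalt_all_repeated[OF w K, of b k]) auto
      finally show ?thesis .
    qed
    have "(w \<triangleleft> prod_list (map (\<lambda>k. opRt k 0) [1..<Suc b])) J = (?W \<triangleleft> opRt b 0) J"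
      using False by simp
    also have "\<dots> = iota (qd b (J 0)) * ?W J"
    proof -
      have s0: "(\<Sum>k\<in>{J b<..N}. ?W (J(b := k, 0 := k))) = 0"
        using z unfolding b(1) by (intro sum.neutral) blast
      show ?thesis
        unfolding act_opRt[OF J(1) False] s0 by (simp add: b(1))
    qed
    also have "?W J = iota (if J 0 < b then q else 1) * w J"
      using Suc by simp
    finally show ?thesis
      by (auto simp: qd_def)
  qed
qed

lemma qalt_all_rr:
  assumes "qalt_all w" "in_range J"
  shows "(w \<triangleleft> rr 1) J = iota q * w J"
proof (rule qalt_all_eqI[OF _ _ assms(2)])
  show "qalt_all (w \<triangleleft> rr 1)"
    using assms(1) preserves_rr by (rule preserves_all)
  show "qalt_all (\<lambda>J. iota q * w J)"
    using assms(1) by (auto simp: qalt_all_def qalt_scale)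
  have "(w \<triangleleft> rr 1) (idx_id J) = iota (if idx_id J 0 < Suc N then q else 1) * w (idx_id J)"
    unfolding rr_def by (rule act_rr_id[OF assms(1) in_range_idx_id[OF assms(2)]]) (simp_all add: idx_id_def)
  then show "(w \<triangleleft> rr 1) (idx_id J) = iota q * w (idx_id J)"
    using in_rangeD(3)[OF in_range_idx_id[OF assms(2)], of 0] by simp
qed

lemma qalt_all_tt:
  assumes "qalt_all w" "in_range J"
  shows "(w \<triangleleft> tt 1) J = iota q * w J"
proof (rule qalt_all_eqI[OF _ _ assms(2)])
  show "qalt_all (w \<triangleleft> tt 1)"
    using assms(1) preserves_tt by (rule preserves_all)
  show "qalt_all (\<lambda>J. iota q * w J)"
    using assms(1) by (auto simp: qalt_all_def qalt_scale)
  have "(w \<triangleleft> tt 1) (idx_id J) = iota (if idx_id J 0 < Suc N then q else 1) * w (idx_id J)"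
    unfolding tt_def by (rule act_tt_id[OF assms(1) in_range_idx_id[OF assms(2)]]) (simp_all add: idx_id_def)
  then show "(w \<triangleleft> tt 1) (idx_id J) = iota q * w (idx_id J)"
    using in_rangeD(3)[OF in_range_idx_id[OF assms(2)], of 0] by simp
qed

end

lemma act_commute: "A * B = C * D \<Longrightarrow> w \<triangleleft> A \<triangleleft> B = w \<triangleleft> C \<triangleleft> D"
  by (simp only: act_simps(6)[symmetric])

context tensor_operators
begin

lemma llin_act_apply: "llin A \<Longrightarrow> ((\<lambda>J. d * w J) \<triangleleft> A) J = d * (w \<triangleleft> A) J"
  by (simp only: llin_act[of A d w])

text \<open>Operators cut off outside the index range, so an identity valid only in range may be
  used in front of one of them.\<close>

lemma opS_in_range_cong:
  "(\<And>J. in_range J \<Longrightarrow> v J = w J) \<Longrightarrow> v \<triangleleft> opS a A = w \<triangleleft> opS a A"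
  by (rule ext) (auto simp: act_opS in_range_upd intro!: sum.cong)

text \<open>Freezing the copies beyond \<open>N\<close> makes a \<open>q\<close>-antisymmetric vector unique up to its dependence on copy \<open>0\<close>.\<close>

definition framed :: "(nat \<Rightarrow> nat) \<Rightarrow> bool" where
  "framed J \<longleftrightarrow> in_range J \<and> (\<forall>c>N. J c = 1)"

definition local_op :: "((nat \<Rightarrow> nat) \<Rightarrow> 'c) endo \<Rightarrow> bool" where
  "local_op A \<longleftrightarrow> (\<forall>v w. (\<forall>J. framed J \<longrightarrow> v J = w J) \<longrightarrow> (\<forall>J. framed J \<longrightarrow> (v \<triangleleft> A) J = (w \<triangleleft> A) J))"

lemma local_opD: "local_op A \<Longrightarrow> (\<And>J. framed J \<Longrightarrow> v J = w J) \<Longrightarrow> framed J \<Longrightarrow> (v \<triangleleft> A) J = (w \<triangleleft> A) J"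
  by (simp add: local_op_def)

lemma local_op_mult: "local_op A \<Longrightarrow> local_op B \<Longrightarrow> local_op (A * B)"
  by (simp add: local_op_def)

lemma local_op_prod_list: "(\<And>A. A \<in> set As \<Longrightarrow> local_op A) \<Longrightarrow> local_op (prod_list As)"
  by (induction As) (auto intro: local_op_mult simp: local_op_def[of 1])

lemma framed_upd: "framed J \<Longrightarrow> a \<le> N \<Longrightarrow> k \<in> {1..N} \<Longrightarrow> framed (J(a := k))"
  by (auto simp: framed_def in_range_def)

lemma local_op_opS: "a \<le> N \<Longrightarrow> local_op (opS a A)"
  by (auto simp: local_op_def act_opS framed_upd intro!: sum.cong)

lemma local_op_op2: "a \<le> N \<Longrightarrow> b \<le> N \<Longrightarrow> local_op (op2 a b M)"
  unfolding local_op_def act_op2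
  by (intro allI impI if_cong sum.cong refl arg_cong2[of _ _ _ _ "(*)"]) (metis framed_upd)

end

section \<open>The eigenvalue of the Sklyanin product is central\<close>

text \<open>\<open>U i\<close> and \<open>U' i\<close> stand for \<open>u\<^sub>i\<close> and \<open>u\<^sub>i\<^sup>-\<^sup>1\<close>. The invertibility of \<open>2 (1 - q\<^sup>-\<^sup>2)\<close> is needed because
  \<open>R(u\<^sub>i, u\<^bsub>i+1\<^esub>)\<close> acts on \<open>q\<close>-antisymmetric vectors by \<open>2 (1 - q\<^sup>-\<^sup>2) u\<^sub>i\<close>.\<close>

locale sklyanin_operators = reflection_operators iota N q q' T Tb G \<kappa> \<kappa>' c
  for iota :: "'s::comm_ring_1 \<Rightarrow> 'c::ring_1" and N q q' T Tb G \<kappa> \<kappa>' c +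
  fixes U U' :: "nat \<Rightarrow> 's" and e :: 's
  assumes U_inverse: "U i * U' i = 1"
    and U_Suc: "U (Suc i) = q' * q' * U i"
    and U'_Suc: "U' (Suc i) = q * q * U' i"
    and e_inverse: "e * (2 * (1 - q' * q')) = 1"
    and N_pos: "N \<ge> 1"
begin

definition St :: "nat \<Rightarrow> ((nat \<Rightarrow> nat) \<Rightarrow> 'c) endo" where "St i = opS i (Su (U' i))"

definition Rij :: "nat \<Rightarrow> nat \<Rightarrow> ((nat \<Rightarrow> nat) \<Rightarrow> 'c) endo" where
  "Rij i j = opRtxy i j (U' i) (U j)"

definition Cb :: "nat \<Rightarrow> ((nat \<Rightarrow> nat) \<Rightarrow> 'c) endo" where
  "Cb i = prod_list (map (Rij i) [Suc i..<Suc N])"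

text \<open>The tail of the Sklyanin product that begins with S_i; the variable starting point
  serves the descending induction in \<open>fused\<close>.\<close>

definition Xb :: "nat \<Rightarrow> ((nat \<Rightarrow> nat) \<Rightarrow> 'c) endo" where
  "Xb i = prod_list (map (\<lambda>k. St k * Cb k) [i..<Suc N])"

text \<open>Applied to w, one side of the reflection equation is an invertible scalar times the
  vector in question, and the other side lies in the image of R(u, q^{-2} u), hence is
  antisymmetric.\<close>

lemma preserves_reflection: "preserves a (St a * Rij a (Suc a) * St (Suc a))"
  unfolding preserves_def
proof (intro allI impI)
  fix w assume w: "qalt a (Suc a) w"
  let ?u = "U a" and ?v = "U (Suc a)"
  let ?M = "St a * Rij a (Suc a) * St (Suc a)"
  let ?M' = "St (Suc a) * Rij a (Suc a) * St a"
  let ?RR = "opRuv a (Suc a) ?u ?v"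
  have eq: "?RR * ?M = ?M' * ?RR"
    unfolding St_def Rij_def by (rule reflection_equation) (simp_all add: U_inverse)
  define f where "f = 2 * (1 - q' * q') * ?u"
  have f: "e * U' a * f = 1"
  proof -
    have "e * U' a * f = (e * (2 * (1 - q' * q'))) * (U a * U' a)"
      unfolding f_def by (simp only: ac_simps)
    then show ?thesis unfolding e_inverse U_inverse by simp
  qed
  \<comment> \<open>The eigenvalue equation for w holds only at indices in range; the leading factor
    \<open>St a\<close> hides the others.\<close>
  have "w \<triangleleft> ?RR \<triangleleft> ?M = (\<lambda>J. iota f * w J) \<triangleleft> ?M"
  proof -
    have "w \<triangleleft> ?RR \<triangleleft> St a = (\<lambda>J. iota f * w J) \<triangleleft> St a"
      unfolding St_def f_def
      by (rule opS_in_range_cong) (rule opRuv_qalt[OF _ U_Suc w], simp_all)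
    then show ?thesis by simp
  qed
  also have "\<dots> = (\<lambda>J. iota f * (w \<triangleleft> ?M) J)"
    by (rule llin_act) (simp add: St_def Rij_def)
  finally have "(\<lambda>J. iota f * (w \<triangleleft> ?M) J) = w \<triangleleft> ?M' \<triangleleft> ?RR"
    unfolding act_commute[OF eq] by (rule sym)
  then have "qalt a (Suc a) (\<lambda>J. iota f * (w \<triangleleft> ?M) J)"
    using qalt_opRuv[of a "Suc a" ?v ?u "w \<triangleleft> ?M'"] U_Suc by simp
  from qalt_scale[OF this, of "iota (e * U' a)"]
  show "qalt a (Suc a) (w \<triangleleft> ?M)"
    by (simp add: f flip: mult.assoc iota_mult)
qed

lemma preserves_St: "k \<noteq> a \<Longrightarrow> k \<noteq> Suc a \<Longrightarrow> preserves a (St k)"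
  by (simp add: St_def preserves_opS)

lemma preserves_Rij: "k \<noteq> a \<Longrightarrow> k \<noteq> Suc a \<Longrightarrow> l \<noteq> a \<Longrightarrow> l \<noteq> Suc a \<Longrightarrow> preserves a (Rij k l)"
  by (simp add: Rij_def preserves_opRtxy)

lemma St_Rij_comm: "k \<noteq> i \<Longrightarrow> k \<noteq> j \<Longrightarrow> St k * Rij i j = Rij i j * St k"
  by (simp add: St_def Rij_def opRtxy_opS_comm)

text \<open>Blocks k > a + 1 do not involve the two copies, a block k < a involves them through
  R^t_ka and its right neighbour, and the blocks a and a + 1 have to be merged.\<close>

lemma preserves_X:
  assumes a: "a \<in> {1..<N}"
  shows "preserves a (Xb 1)"
  unfolding Xb_def
proof (rule preserves_pairs_prod_list[OF a])
  show "1 \<le> a" using a by simp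
next
  fix k assume k: "k \<noteq> a" "k \<noteq> Suc a" "k \<in> {1..N}"
  have "preserves a (Cb k)"
  proof (cases "k < a")
    case True
    show ?thesis
      unfolding Cb_def
    proof (rule preserves_pairs_prod_list[OF a])
      show "Suc k \<le> a" using True by simp
      show "preserves a (Rij k l)" if "l \<noteq> a" "l \<noteq> Suc a" for l
        using k that by (intro preserves_Rij)
      \<comment> \<open>The copies a and a + 1 stand in the second place here, so it is the
        parameter u_j that is shifted, by q^{-2}.\<close>
      show "preserves a (Rij k a * Rij k (Suc a))"
        using k by (simp add: Rij_def U_Suc preserves_opRtxy_pair')
    qed
  next
    case False
    then show ?thesis
      unfolding Cb_def using k by (auto intro!: preserves_prod_list preserves_Rij simp del: upt_Suc)
  qed
  then show "preserves a (St k * Cb k)"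
    using k by (intro preserves_mult preserves_St)
next
  let ?ms = "[Suc (Suc a)..<Suc N]"
  have Ca: "Cb a = Rij a (Suc a) * prod_list (map (Rij a) ?ms)"
    using a by (simp add: Cb_def upt_conv_Cons[of "Suc a"] del: upt_Suc)
  \<comment> \<open>Moving S_b with b = a + 1 to the left isolates S_a R^t_ab S_b, to which the
    reflection equation applies, and leaves the pairs R^t_am R^t_bm.\<close>
  have cm: "prod_list (map (Rij a) ?ms) * St (Suc a) = St (Suc a) * prod_list (map (Rij a) ?ms)"
    by (rule prod_list_comm) (auto simp: St_Rij_comm)
  have "St a * Cb a * (St (Suc a) * Cb (Suc a)) = St a * Rij a (Suc a)
      * (prod_list (map (Rij a) ?ms) * St (Suc a)) * prod_list (map (Rij (Suc a)) ?ms)"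
    unfolding Ca Cb_def[of "Suc a"] by (simp only: mult.assoc)
  then have "St a * Cb a * (St (Suc a) * Cb (Suc a))
      = St a * Rij a (Suc a) * St (Suc a) * (prod_list (map (Rij a) ?ms) * prod_list (map (Rij (Suc a)) ?ms))"
    unfolding cm by (simp only: mult.assoc)
  also have "prod_list (map (Rij a) ?ms) * prod_list (map (Rij (Suc a)) ?ms)
      = prod_list (map (\<lambda>m. Rij a m * Rij (Suc a) m) ?ms)"
    by (rule prod_list_interleave) (auto simp: Rij_def simp del: upt_Suc intro!: opRtxy_opRtxy_comm)
  finally have eq: "St a * Cb a * (St (Suc a) * Cb (Suc a))
      = St a * Rij a (Suc a) * St (Suc a) * prod_list (map (\<lambda>m. Rij a m * Rij (Suc a) m) ?ms)" .
  have "preserves a (prod_list (map (\<lambda>m. Rij a m * Rij (Suc a) m) ?ms))"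
    by (rule preserves_prod_list) (auto simp: Rij_def U'_Suc simp del: upt_Suc intro!: preserves_opRtxy_pair)
  then show "preserves a (St a * Cb a * (St (Suc a) * Cb (Suc a)))"
    unfolding eq by (intro preserves_mult preserves_reflection)
qed

section \<open>Fusion with the additional copy 0\<close>

abbreviation S0 :: "((nat \<Rightarrow> nat) \<Rightarrow> 'c) endo" where "S0 \<equiv> opS 0 Sm"

lemma opR_Rij_comm: "a \<noteq> i \<Longrightarrow> a \<noteq> j \<Longrightarrow> b \<noteq> i \<Longrightarrow> b \<noteq> j \<Longrightarrow> opR a b * Rij i j = Rij i j * opR a b"
  by (simp add: opR_def Rij_def opRtxy_comm)

lemma opRt_Rij_comm: "a \<noteq> i \<Longrightarrow> a \<noteq> j \<Longrightarrow> b \<noteq> i \<Longrightarrow> b \<noteq> j \<Longrightarrow> opRt a b * Rij i j = Rij i j * opRt a b"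
  by (simp add: opRt_def Rij_def opRtxy_comm)

lemma opR_St_comm: "k \<noteq> a \<Longrightarrow> k \<noteq> b \<Longrightarrow> St k * opR a b = opR a b * St k"
  by (simp add: opR_def St_def opS_op2s_comm)

lemma opRt_St_comm: "k \<noteq> a \<Longrightarrow> k \<noteq> b \<Longrightarrow> St k * opRt a b = opRt a b * St k"
  by (simp add: opRt_def St_def opS_op2s_comm)

lemma yang_baxter_Rij:
  assumes "i \<noteq> m" "i \<noteq> 0" "m \<noteq> 0"
  shows "opR m 0 * Rij i m * opRt i 0 = opRt i 0 * Rij i m * opR m 0"
    and "opR i 0 * Rij i m * opRt m 0 = opRt m 0 * Rij i m * opR i 0"
  using yang_baxter[of m 0 i "U' i" "U m"] yang_baxter[of i 0 m "U' i" "U m"] assms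
  by (simp_all add: Rij_def opRtxy_flip[of m i] opRt_flip[of i 0] opRt_flip[of m 0])

lemma comm_prod_list:
  fixes z :: "'a::monoid_mult"
  assumes "\<And>m. m \<in> set ms \<Longrightarrow> z * f m = f m * z"
  shows "z * prod_list (map f ms) = prod_list (map f ms) * z"
  using prod_list_comm[of ms f z] assms by metis

text \<open>Iterated Yang-Baxter equation: R^t_i0 travels through the column of pairs R_m0, R^t_im.
  In \<open>r_C_tt\<close> it is R_i0 that travels, through R^t_im and R^t_m0.\<close>

lemma rr_C_t:
  assumes "distinct ms" "i \<notin> set ms" "0 \<notin> set ms" "i \<noteq> 0"
  shows "prod_list (map (\<lambda>k. opR k 0) ms) * (prod_list (map (Rij i) ms) * opRt i 0)
    = opRt i 0 * prod_list (map (Rij i) ms) * prod_list (map (\<lambda>k. opR k 0) ms)"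
  using assms
proof (induction ms)
  case (Cons m ms)
  let ?r = "prod_list (map (\<lambda>k. opR k 0) ms)" and ?C = "prod_list (map (Rij i) ms)"
  have c1: "?r * Rij i m = Rij i m * ?r"
    using Cons.prems by (intro prod_list_comm opR_Rij_comm) auto
  have c2: "opR m 0 * ?C = ?C * opR m 0"
    using Cons.prems by (intro comm_prod_list opR_Rij_comm) (auto intro: gr0I)
  have IH: "?r * (?C * opRt i 0) = opRt i 0 * ?C * ?r"
    using Cons by simp
  have yb: "opR m 0 * Rij i m * opRt i 0 = opRt i 0 * Rij i m * opR m 0"
    using Cons.prems by (intro yang_baxter_Rij) auto
  have "opR m 0 * ?r * (Rij i m * ?C * opRt i 0) = opR m 0 * (?r * Rij i m) * (?C * opRt i 0)"
    by (simp only: mult.assoc)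
  also have "\<dots> = opR m 0 * Rij i m * (?r * (?C * opRt i 0))"
    unfolding c1 by (simp only: mult.assoc)
  also have "\<dots> = (opR m 0 * Rij i m * opRt i 0) * ?C * ?r"
    unfolding IH by (simp only: mult.assoc)
  also have "\<dots> = opRt i 0 * Rij i m * (opR m 0 * ?C) * ?r"
    unfolding yb by (simp only: mult.assoc)
  also have "\<dots> = opRt i 0 * (Rij i m * ?C) * (opR m 0 * ?r)"
    unfolding c2 by (simp only: mult.assoc)
  finally show ?case by simp
qed simp

lemma r_C_tt:
  assumes "distinct ms" "i \<notin> set ms" "0 \<notin> set ms" "i \<noteq> 0"
  shows "opR i 0 * (prod_list (map (Rij i) ms) * prod_list (map (\<lambda>k. opRt k 0) ms))
    = prod_list (map (\<lambda>k. opRt k 0) ms) * prod_list (map (Rij i) ms) * opR i 0"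
  using assms
proof (induction ms)
  case (Cons m ms)
  let ?t = "prod_list (map (\<lambda>k. opRt k 0) ms)" and ?C = "prod_list (map (Rij i) ms)"
  have c1: "?t * Rij i m = Rij i m * ?t"
    using Cons.prems by (intro prod_list_comm opRt_Rij_comm) auto
  have c2: "opRt m 0 * ?C = ?C * opRt m 0"
    using Cons.prems by (intro comm_prod_list opRt_Rij_comm) (auto intro: gr0I)
  have IH: "opR i 0 * (?C * ?t) = ?t * ?C * opR i 0"
    using Cons by simp
  have yb: "opR i 0 * Rij i m * opRt m 0 = opRt m 0 * Rij i m * opR i 0"
    using Cons.prems by (intro yang_baxter_Rij) auto
  have "opR i 0 * (Rij i m * ?C * (opRt m 0 * ?t)) = opR i 0 * Rij i m * (?C * opRt m 0) * ?t"
    by (simp only: mult.assoc)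
  also have "\<dots> = (opR i 0 * Rij i m * opRt m 0) * ?C * ?t"
    unfolding c2[symmetric] by (simp only: mult.assoc)
  also have "\<dots> = opRt m 0 * Rij i m * (opR i 0 * (?C * ?t))"
    unfolding yb by (simp only: mult.assoc)
  also have "\<dots> = opRt m 0 * (Rij i m * ?t) * ?C * opR i 0"
    unfolding IH by (simp only: mult.assoc)
  also have "\<dots> = opRt m 0 * ?t * (Rij i m * ?C) * opR i 0"
    unfolding c1[symmetric] by (simp only: mult.assoc)
  finally show ?case by simp
qed simp

lemma commute_X:
  assumes "\<And>k. k > i \<Longrightarrow> z * St k = St k * z" "\<And>k l. k > i \<Longrightarrow> l > i \<Longrightarrow> z * Rij k l = Rij k l * z"
  shows "z * Xb (Suc i) = Xb (Suc i) * z"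
proof -
  have "z * Cb k = Cb k * z" if "k > i" for k
    unfolding Cb_def using that by (intro comm_prod_list assms) auto
  then have "z * (St k * Cb k) = (St k * Cb k) * z" if "k > i" for k
    unfolding mult.assoc[symmetric, of z] assms(1)[OF that]
    using that by (simp add: mult.assoc)
  then show ?thesis
    unfolding Xb_def by (intro comm_prod_list) auto
qed

text \<open>Descending induction; at i = N + 1 all products are empty. In the step the new S_i meets
  S_0 through \<open>reflection_constant\<close>, and the factors R^t_ik are carried past copy 0 by
  the Yang-Baxter equation.\<close>

lemma fused:
  assumes "1 \<le> i" "i \<le> Suc N"
  shows "rr i * (Xb i * tt i * S0) = S0 * tt i * Xb i * rr i"
  using assms(2,1)
proof (induction i rule: inc_induct)
  case base
  then show ?case by (simp add: rr_def Xb_def tt_def)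
next
  case (step i)
  let ?r = "opR i 0" and ?t = "opRt i 0" and ?rr = "rr (Suc i)" and ?tt = "tt (Suc i)"
  let ?X = "Xb (Suc i)" and ?C = "Cb i" and ?S = "St i"
  have split: "rr i = ?r * ?rr" "tt i = ?t * ?tt" "Xb i = ?S * ?C * ?X"
    using step by (simp_all add: rr_def tt_def Xb_def upt_conv_Cons del: upt_Suc)
  have ms: "distinct [Suc i..<Suc N]" "i \<notin> set [Suc i..<Suc N]" "0 \<notin> set [Suc i..<Suc N]" "i \<noteq> 0"
    using step by auto
  have f1: "?t * ?X = ?X * ?t"
    using step.prems by (intro commute_X opRt_Rij_comm opRt_St_comm[symmetric]) auto
  have f1': "?r * ?X = ?X * ?r"
    using step.prems by (intro commute_X opR_Rij_comm opR_St_comm[symmetric]) auto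
  have f2: "?rr * ?S = ?S * ?rr"
    unfolding rr_def using step.prems by (intro prod_list_comm opR_St_comm[symmetric]) auto
  have f3: "?rr * (?C * ?t) = ?t * ?C * ?rr"
    unfolding rr_def Cb_def by (rule rr_C_t[OF ms])
  have f4: "?C * S0 = S0 * ?C"
    unfolding Cb_def Rij_def using step.prems by (intro prod_list_comm opRtxy_opS_comm[symmetric]) auto
  have f5: "?r * (?S * ?t * S0) = S0 * ?t * ?S * ?r"
    unfolding St_def using step.prems by (intro reflection_constant) auto
  have f6: "?r * (?C * ?tt) = ?tt * ?C * ?r"
    unfolding tt_def Cb_def by (rule r_C_tt[OF ms])
  have f7: "?S * ?tt = ?tt * ?S"
    unfolding tt_def using step.prems by (intro comm_prod_list opRt_St_comm) auto
  have IH: "?rr * (?X * ?tt * S0) = S0 * ?tt * ?X * ?rr"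
    using step by simp
  have "rr i * (Xb i * tt i * S0) = ?r * (?rr * ?S) * ?C * (?X * ?t) * ?tt * S0"
    unfolding split by (simp only: mult.assoc)
  also have "\<dots> = ?r * ?S * (?rr * (?C * ?t)) * ?X * ?tt * S0"
    unfolding f2 f1[symmetric] by (simp only: mult.assoc)
  also have "\<dots> = ?r * ?S * ?t * ?C * (?rr * (?X * ?tt * S0))"
    unfolding f3 by (simp only: mult.assoc)
  also have "\<dots> = ?r * ?S * ?t * (?C * S0) * ?tt * ?X * ?rr"
    unfolding IH by (simp only: mult.assoc)
  also have "\<dots> = (?r * (?S * ?t * S0)) * ?C * ?tt * ?X * ?rr"
    unfolding f4 by (simp only: mult.assoc)
  also have "\<dots> = S0 * ?t * ?S * (?r * (?C * ?tt)) * ?X * ?rr"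
    unfolding f5 by (simp only: mult.assoc)
  also have "\<dots> = S0 * ?t * (?S * ?tt) * ?C * (?r * ?X) * ?rr"
    unfolding f6 by (simp only: mult.assoc)
  also have "\<dots> = S0 * (?t * ?tt) * (?S * ?C * ?X) * (?r * ?rr)"
    unfolding f7 f1' by (simp only: mult.assoc)
  finally show ?case
    unfolding split .
qed

lemma llin_X: "llin (Xb i)"
proof -
  have p: "llin (prod_list As)" if "\<And>A. A \<in> set As \<Longrightarrow> llin A" for As
    using that by (induction As) auto
  have "llin (Cb k)" for k
    unfolding Cb_def by (rule p) (auto simp: Rij_def)
  then show ?thesis
    unfolding Xb_def by (intro p) (auto simp: St_def)
qed

lemma local_op_X: "local_op (Xb 1)"
proof -
  have "local_op (Cb k)" if "k \<le> N" for k
    unfolding Cb_def using that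
    by (intro local_op_prod_list) (auto simp: Rij_def opRtxy_op2s less_Suc_eq_le simp del: upt_Suc intro!: local_op_op2)
  then show ?thesis
    unfolding Xb_def
    by (intro local_op_prod_list) (auto simp: St_def simp del: upt_Suc intro!: local_op_mult local_op_opS)
qed

text \<open>A matrix unit in copy 0, where the Sklyanin product does not act. Applied to a vector
  that ignores copy 0, \<open>unit_op p p\<close> attaches the basis vector e_p in that
  copy.\<close>

definition unit_op :: "nat \<Rightarrow> nat \<Rightarrow> ((nat \<Rightarrow> nat) \<Rightarrow> 'c) endo" where
  "unit_op p r = opS 0 (\<lambda>k l. iota (if k = p \<and> l = r then 1 else 0))"

lemma act_unit_op:
  assumes "in_range J" "p \<in> {1..N}"
  shows "(w \<triangleleft> unit_op p r) J = (if J 0 = r then w (J(0 := p)) else 0)"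
proof -
  have "(w \<triangleleft> unit_op p r) J = (\<Sum>k=1..N. if k = p then (if J 0 = r then w (J(0 := k)) else 0) else 0)"
    unfolding unit_op_def act_opS if_P[OF assms(1)] by (intro sum.cong refl) auto
  then show ?thesis
    using assms by (simp add: sum.delta)
qed

lemma X_unit_op_comm: "unit_op p r * Xb 1 = Xb 1 * unit_op p r"
proof -
  have "unit_op p r * Xb (Suc 0) = Xb (Suc 0) * unit_op p r"
    unfolding unit_op_def
    by (rule commute_X) (auto simp: St_def Rij_def opS_scalar_comm opRtxy_opS_comm)
  then show ?thesis by simp
qed

section \<open>The eigenvector and its eigenvalue\<close>

context
  fixes \<eta> :: "(nat \<Rightarrow> nat) \<Rightarrow> 's"
  assumes eta_qalt: "qalt_all (\<lambda>J. iota (\<eta> J))"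
    and eta_id: "\<And>J. in_range J \<Longrightarrow> \<eta> (idx_id J) = 1"
    and eta_indep: "\<And>J k. \<eta> (J(0 := k)) = \<eta> J"
begin

abbreviation J1 :: "nat \<Rightarrow> nat" where "J1 \<equiv> \<lambda>c. if c \<in> {1..N} then c else 1"

abbreviation eta :: "(nat \<Rightarrow> nat) \<Rightarrow> 'c" where "eta \<equiv> \<lambda>J. iota (\<eta> J)"

definition eigval :: 'c where "eigval = (eta \<triangleleft> Xb 1) J1"

lemma framed_J1: "k \<in> {1..N} \<Longrightarrow> framed (J1(0 := k))"
  using N_pos by (auto simp: framed_def in_range_def)

lemma idx_id_framed: "framed J \<Longrightarrow> idx_id J = J1(0 := J 0)"
  by (auto simp: framed_def idx_id_def fun_eq_iff)

text \<open>The product commutes with the matrix units of copy 0, and \<open>eta\<close> does not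
  depend on copy 0, so two matrix units with the same target have the same effect on it.\<close>

lemma X_indep:
  assumes "in_range J" "p \<in> {1..N}"
  shows "(eta \<triangleleft> Xb 1) (J(0 := p)) = (eta \<triangleleft> Xb 1) J"
proof -
  let ?r = "J 0"
  have r: "?r \<in> {1..N}" using in_rangeD(1)[OF assms(1)] .
  have "Xb 1 = St 1 * Cb 1 * Xb (Suc 1)"
    using N_pos by (simp add: Xb_def upt_conv_Cons del: upt_Suc)
  moreover have "eta \<triangleleft> unit_op p ?r \<triangleleft> St 1 = eta \<triangleleft> unit_op ?r ?r \<triangleleft> St 1"
    unfolding St_def by (rule opS_in_range_cong) (simp only: act_unit_op assms r eta_indep)
  ultimately have "eta \<triangleleft> unit_op p ?r \<triangleleft> Xb 1 = eta \<triangleleft> unit_op ?r ?r \<triangleleft> Xb 1"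
    by simp
  then have "eta \<triangleleft> Xb 1 \<triangleleft> unit_op p ?r = eta \<triangleleft> Xb 1 \<triangleleft> unit_op ?r ?r"
    by (simp only: act_commute[OF X_unit_op_comm])
  then have "(eta \<triangleleft> Xb 1 \<triangleleft> unit_op p ?r) J = (eta \<triangleleft> Xb 1 \<triangleleft> unit_op ?r ?r) J"
    by simp
  then show ?thesis
    using assms r by (simp add: act_unit_op)
qed

text \<open>By rank one the quotient could still depend on the spectator copies:
  \<open>X_indep\<close> takes care of copy 0, the restriction to \<open>framed\<close> indices of
  the copies beyond N.\<close>

lemma X_eigen:
  assumes "framed J"
  shows "(eta \<triangleleft> Xb 1) J = eigval * eta J"
proof -
  have g: "in_range J" using assms by (simp add: framed_def)
  have "in_range J1"
    using framed_J1[of 1] N_pos by (auto simp: framed_def in_range_def)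
  then have d: "(eta \<triangleleft> Xb 1) (idx_id J) = eigval"
    unfolding idx_id_framed[OF assms] eigval_def by (rule X_indep) (rule in_rangeD(1)[OF g])
  show ?thesis
  proof (rule qalt_all_eqI[OF _ _ g])
    show "qalt_all (eta \<triangleleft> Xb 1)"
      using eta_qalt preserves_X by (rule preserves_all)
    show "qalt_all (\<lambda>J. eigval * eta J)"
      using eta_qalt by (auto simp: qalt_all_def qalt_scale)
    show "(eta \<triangleleft> Xb 1) (idx_id J) = eigval * eta (idx_id J)"
      using d eta_id[OF g] by simp
  qed
qed

text \<open>Apply both sides of \<open>fused\<close> to \<open>eta\<close> \<otimes> e_p and read
  off the coefficient at the index 1,...,N with r in copy 0: the left side gives q^2 d S_pr, the
  right side q^2 S_pr d.\<close>

lemma eigval_central: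
  assumes p: "p \<in> {1..N}" and r: "r \<in> {1..N}"
  shows "eigval * Sm p r = Sm p r * eigval"
proof -
  define w where "w = eta \<triangleleft> unit_op p p"
  define J where "J = J1(0 := r)"
  have fJ: "framed J" and J0: "J 0 = r"
    using framed_J1[OF r] by (simp_all add: J_def)
  have gf: "in_range K" if "framed K" for K using that by (simp add: framed_def)
  have etaJ: "eta (J(0 := k)) = 1" for k
  proof -
    have "eta (J(0 := k)) = eta J" by (simp only: eta_indep)
    also have "eta J = eta (idx_id J)"
      using idx_id_framed[OF fJ] by (simp add: J_def)
    finally show ?thesis using eta_id[OF gf[OF fJ]] by simp
  qed
  have l: "local_op (rr 1)" "local_op (tt 1)" "local_op S0" "local_op (unit_op k k)" for k
    unfolding rr_def tt_def unit_op_def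
    by (auto simp: opR_def opRt_def op2s_def simp del: upt_Suc intro!: local_op_prod_list local_op_op2 local_op_opS)
  have ll: "llin (rr 1)" "llin (tt 1)" "llin S0" "llin (unit_op k k)" for k
  proof -
    have p: "llin (prod_list As)" if "\<And>A. A \<in> set As \<Longrightarrow> llin A" for As
      using that by (induction As) auto
    show "llin (rr 1)" "llin (tt 1)"
      unfolding rr_def tt_def by (auto intro!: p simp del: upt_Suc)
    show "llin S0" "llin (unit_op k k)" by (simp_all add: unit_op_def)
  qed
  have qa: "qalt_all (v \<triangleleft> opS 0 A)" if "qalt_all v" for v A
    using that by (rule preserves_all) (auto intro: preserves_opS)
  have w_qalt: "qalt_all w"
    unfolding w_def unit_op_def by (rule qa[OF eta_qalt])
  have E: "(eta \<triangleleft> unit_op k k \<triangleleft> Xb 1) K = eigval * (eta \<triangleleft> unit_op k k) K" if "framed K" for k K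
  proof -
    have 1: "eta \<triangleleft> unit_op k k \<triangleleft> Xb 1 = eta \<triangleleft> Xb 1 \<triangleleft> unit_op k k"
      by (rule act_commute[OF X_unit_op_comm])
    have 2: "(eta \<triangleleft> Xb 1 \<triangleleft> unit_op k k) K = ((\<lambda>K. eigval * eta K) \<triangleleft> unit_op k k) K"
      by (rule local_opD[OF l(4) _ that]) (rule X_eigen)
    have 3: "((\<lambda>K. eigval * eta K) \<triangleleft> unit_op k k) K = eigval * (eta \<triangleleft> unit_op k k) K"
      by (rule llin_act_apply[OF ll(4)])
    show ?thesis
      unfolding 1 2 3 ..
  qed
  have wS: "(w \<triangleleft> S0) K = Sm p (K 0) * eta K" if "in_range K" for K
  proof -
    have "(w \<triangleleft> S0) K = (\<Sum>k=1..N. if k = p then eta K * Sm k (K 0) else 0)"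
      unfolding act_opS if_P[OF that] w_def
      by (intro sum.cong refl) (use that p in \<open>auto simp: act_unit_op in_range_upd eta_indep\<close>)
    then show ?thesis
      using p by (simp add: sum.delta iota_comm)
  qed

  have "(w \<triangleleft> rr 1 \<triangleleft> (Xb 1 * tt 1 * S0)) J = ((\<lambda>K. iota q * w K) \<triangleleft> (Xb 1 * tt 1 * S0)) J"
    by (rule local_opD[OF _ _ fJ]) (auto intro!: local_op_mult local_op_X l qalt_all_rr w_qalt gf simp del: One_nat_def)
  also have "\<dots> = iota q * (w \<triangleleft> Xb 1 \<triangleleft> (tt 1 * S0)) J"
    using llin_act_apply[OF llin_mult[OF llin_mult[OF llin_X[of 1] ll(2)] ll(3)], where d = "iota q" and w = w and J = J] by simp
  also have "(w \<triangleleft> Xb 1 \<triangleleft> (tt 1 * S0)) J = ((\<lambda>K. eigval * w K) \<triangleleft> (tt 1 * S0)) J"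
    by (rule local_opD[OF local_op_mult[OF l(2,3)] _ fJ]) (use E in \<open>simp add: w_def\<close>)
  also have "\<dots> = eigval * (w \<triangleleft> tt 1 \<triangleleft> S0) J"
    using llin_act_apply[OF llin_mult[OF ll(2,3)], where d = eigval and w = w and J = J] by simp
  also have "(w \<triangleleft> tt 1 \<triangleleft> S0) J = ((\<lambda>K. iota q * w K) \<triangleleft> S0) J"
    by (rule local_opD[OF l(3) _ fJ]) (auto intro!: qalt_all_tt w_qalt gf simp del: One_nat_def)
  also have "\<dots> = iota q * (w \<triangleleft> S0) J"
    by (rule llin_act_apply[OF ll(3)])
  also have "(w \<triangleleft> S0) J = Sm p r"
    using wS[OF gf[OF fJ]] J0 etaJ[of r] by (simp add: J_def)
  finally have lhs: "(w \<triangleleft> (rr 1 * (Xb 1 * tt 1 * S0))) J = iota q * (eigval * (iota q * Sm p r))"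
    by simp

  define v where "v = w \<triangleleft> S0"
  have v_qalt: "qalt_all v"
    unfolding v_def by (rule qa[OF w_qalt])
  have vX_qalt: "qalt_all (v \<triangleleft> Xb 1)"
    using v_qalt preserves_X by (rule preserves_all)
  \<comment> \<open>The vector \<open>v\<close> is not a left multiple of \<open>eta\<close>, since
    its coefficient varies with copy 0. Projecting copy 0 to r makes it one, and the projection
    commutes with the product.\<close>
  have vX: "(v \<triangleleft> Xb 1) J = Sm p r * eigval"
  proof -
    have 1: "(v \<triangleleft> Xb 1 \<triangleleft> unit_op r r) J = (v \<triangleleft> Xb 1) J"
      using act_unit_op[OF gf[OF fJ] r, of "v \<triangleleft> Xb 1" r] J0 by (simp add: J_def)
    have 2: "v \<triangleleft> Xb 1 \<triangleleft> unit_op r r = v \<triangleleft> unit_op r r \<triangleleft> Xb 1"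
      by (rule act_commute[OF X_unit_op_comm, symmetric])
    have 3: "(v \<triangleleft> unit_op r r \<triangleleft> Xb 1) J = ((\<lambda>K. Sm p r * (eta \<triangleleft> unit_op r r) K) \<triangleleft> Xb 1) J"
    proof (rule local_opD[OF local_op_X _ fJ])
      fix K assume "framed K"
      then have "in_range K" "in_range (K(0 := r))" using gf r by auto
      then show "(v \<triangleleft> unit_op r r) K = Sm p r * (eta \<triangleleft> unit_op r r) K"
        using r by (simp add: act_unit_op v_def wS)
    qed
    have 4: "((\<lambda>K. Sm p r * (eta \<triangleleft> unit_op r r) K) \<triangleleft> Xb 1) J = Sm p r * (eta \<triangleleft> unit_op r r \<triangleleft> Xb 1) J"
      by (rule llin_act_apply[OF llin_X])
    have 5: "(eta \<triangleleft> unit_op r r) J = 1"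
      using act_unit_op[OF gf[OF fJ] r, of eta r] J0 etaJ by simp
    have "(v \<triangleleft> Xb 1) J = Sm p r * (eigval * 1)"
      unfolding 1[symmetric] 2 3 4 E[OF fJ] 5 ..
    then show ?thesis by simp
  qed
  have "(v \<triangleleft> tt 1 \<triangleleft> (Xb 1 * rr 1)) J = ((\<lambda>K. iota q * v K) \<triangleleft> (Xb 1 * rr 1)) J"
    by (rule local_opD[OF _ _ fJ]) (auto intro!: local_op_mult local_op_X l qalt_all_tt v_qalt gf simp del: One_nat_def)
  also have "\<dots> = iota q * (v \<triangleleft> Xb 1 \<triangleleft> rr 1) J"
    using llin_act_apply[OF llin_mult[OF llin_X[of 1] ll(1)], where d = "iota q" and w = v and J = J] by simp
  also have "(v \<triangleleft> Xb 1 \<triangleleft> rr 1) J = iota q * (v \<triangleleft> Xb 1) J"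
    by (rule qalt_all_rr[OF vX_qalt gf[OF fJ]])
  finally have rhs: "(w \<triangleleft> (S0 * tt 1 * Xb 1 * rr 1)) J = iota q * (iota q * (Sm p r * eigval))"
    unfolding vX by (simp add: v_def)
  have "iota q * (iota q * (eigval * Sm p r)) = iota q * (iota q * (Sm p r * eigval))"
  proof -
    have "rr 1 * (Xb 1 * tt 1 * S0) = S0 * tt 1 * Xb 1 * rr 1"
      using N_pos by (intro fused) simp_all
    from lhs[unfolded this rhs] show ?thesis
      by (simp add: iota_pull[of eigval])
  qed
  then show ?thesis
    by (metis iota_q_inverse(4))
qed

end

end

section \<open>Tensor matrices and the antisymmetrizer\<close>

text \<open>The tensor operations of the statement, repeated over a type-class ring;
  \<open>tprod_eq\<close> transports results back.\<close>

definition tmulc :: "nat \<Rightarrow> nat \<Rightarrow> 'a::ring_1 tmat \<Rightarrow> 'a tmat \<Rightarrow> 'a tmat" where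
  "tmulc m N A B = (\<lambda>I J. \<Sum>K\<in>tidx m N. A I K * B K J)"

definition tonec :: "'a::ring_1 tmat" where
  "tonec = (\<lambda>I J. if I = J then 1 else 0)"

definition tprodc :: "nat \<Rightarrow> nat \<Rightarrow> 'a::ring_1 tmat list \<Rightarrow> 'a tmat" where
  "tprodc m N As = foldr (tmulc m N) As tonec"

definition in_copyc :: "nat \<Rightarrow> nat \<Rightarrow> 'a::ring_1 mat \<Rightarrow> 'a tmat" where
  "in_copyc m a M = (\<lambda>I J. if \<forall>c\<in>{1..m} - {a}. I c = J c then M (I a) (J a) else 0)"

definition in_copiesc :: "nat \<Rightarrow> nat \<Rightarrow> nat \<Rightarrow> 'a::ring_1 mat2 \<Rightarrow> 'a tmat" where
  "in_copiesc m a b M =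
     (\<lambda>I J. if \<forall>c\<in>{1..m} - {a, b}. I c = J c then M (I a) (J a) (I b) (J b) else 0)"

lemma finite_tidx [simp]: "finite (tidx m N)"
  by (simp add: tidx_def finite_PiE)

lemma tidx_range: "I \<in> tidx m N \<Longrightarrow> c \<in> {1..m} \<Longrightarrow> I c \<in> {1..N}"
  by (auto simp: tidx_def)

lemma tprodc_Nil [simp]: "tprodc m N [] = tonec"
  and tprodc_Cons [simp]: "tprodc m N (A # As) = tmulc m N A (tprodc m N As)"
  by (simp_all add: tprodc_def)

text \<open>The domain D is needed in two ways: as the free algebra on given generators inside all
  polynomials, and as the Laurent polynomials with components in a given subring. Therefore
  \<open>tprod_eq\<close> delivers membership in D together with equality.\<close>

locale ring_realization =
  fixes L :: "'b ring" and D :: "'a::ring_1 set" and \<phi> :: "'a \<Rightarrow> 'b"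
  assumes abelian: "abelian_monoid L"
    and D_closed: "0 \<in> D" "1 \<in> D" "x \<in> D \<Longrightarrow> y \<in> D \<Longrightarrow> x + y \<in> D" "x \<in> D \<Longrightarrow> y \<in> D \<Longrightarrow> x * y \<in> D"
    and phi_closed: "x \<in> D \<Longrightarrow> \<phi> x \<in> carrier L"
    and phi_zero: "\<phi> 0 = \<zero>\<^bsub>L\<^esub>" and phi_one: "\<phi> 1 = \<one>\<^bsub>L\<^esub>"
    and phi_add: "x \<in> D \<Longrightarrow> y \<in> D \<Longrightarrow> \<phi> (x + y) = \<phi> x \<oplus>\<^bsub>L\<^esub> \<phi> y"
    and phi_mult: "x \<in> D \<Longrightarrow> y \<in> D \<Longrightarrow> \<phi> (x * y) = \<phi> x \<otimes>\<^bsub>L\<^esub> \<phi> y"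
begin

lemma sum_closed: "(\<And>x. x \<in> A \<Longrightarrow> f x \<in> D) \<Longrightarrow> sum f A \<in> D"
  by (induction A rule: infinite_finite_induct) (auto intro: D_closed)

lemma phi_sum:
  assumes "\<And>x. x \<in> A \<Longrightarrow> f x \<in> D" "finite A"
  shows "\<phi> (sum f A) = finsum L (\<lambda>x. \<phi> (f x)) A"
proof -
  interpret abelian_monoid L by (rule abelian)
  show ?thesis
    using assms(2,1)
  proof (induction A)
    case empty
    then show ?case by (simp add: phi_zero)
  next
    case (insert x A)
    then have "finsum L (\<lambda>x. \<phi> (f x)) (insert x A) = \<phi> (f x) \<oplus>\<^bsub>L\<^esub> finsum L (\<lambda>x. \<phi> (f x)) A"
      by (intro finsum_insert) (auto intro: phi_closed)
    then show ?case
      using insert by (simp add: phi_add sum_closed)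
  qed
qed

lemma tprod_eq:
  assumes "list_all2 (\<lambda>A B. \<forall>I\<in>tidx m N. \<forall>J\<in>tidx m N. B I J \<in> D \<and> A I J = \<phi> (B I J)) As Bs"
    and "I \<in> tidx m N" "J \<in> tidx m N"
  shows "tprod L m N As I J = \<phi> (tprodc m N Bs I J) \<and> tprodc m N Bs I J \<in> D"
  using assms
proof (induction As Bs arbitrary: I J rule: list_all2_induct)
  case Nil
  then show ?case
    by (simp add: tprod_def tone_def tonec_def phi_zero phi_one D_closed)
next
  case (Cons A As B Bs)
  interpret abelian_monoid L by (rule abelian)
  have B: "B I K \<in> D" "A I K = \<phi> (B I K)" if "K \<in> tidx m N" for K
    using Cons that by auto
  have IH: "tprod L m N As K J = \<phi> (tprodc m N Bs K J)" "tprodc m N Bs K J \<in> D" if "K \<in> tidx m N" for K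
    using Cons.IH[OF that Cons.prems(2)] by auto
  have "tprod L m N (A # As) I J = (\<Oplus>\<^bsub>L\<^esub>K\<in>tidx m N. A I K \<otimes>\<^bsub>L\<^esub> tprod L m N As K J)"
    by (simp add: tprod_def tmul_def)
  also have "\<dots> = (\<Oplus>\<^bsub>L\<^esub>K\<in>tidx m N. \<phi> (B I K * tprodc m N Bs K J))"
    using B IH by (intro finsum_cong') (auto simp: phi_mult intro!: phi_closed D_closed)
  also have "\<dots> = \<phi> (\<Sum>K\<in>tidx m N. B I K * tprodc m N Bs K J)"
    using B IH by (intro phi_sum[symmetric]) (auto intro: D_closed)
  finally show ?case
    using B IH by (auto simp: tmulc_def intro!: sum_closed D_closed)
qed

end

text \<open>Indices in \<open>tidx\<close> are undefined outside 1,...,m, whereas the operators need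
  values in range in every copy.\<close>

definition ext_idx :: "nat \<Rightarrow> (nat \<Rightarrow> nat) \<Rightarrow> (nat \<Rightarrow> nat)" where
  "ext_idx m J = (\<lambda>c. if c \<in> {1..m} then J c else 1)"

context tensor_operators
begin

text \<open>Since w is arbitrary, products of matrices correspond to products of operators in the
  same order; this is \<open>tprodc_linked\<close>.\<close>

definition linked :: "nat \<Rightarrow> 'c tmat \<Rightarrow> ((nat \<Rightarrow> nat) \<Rightarrow> 'c) endo \<Rightarrow> bool" where
  "linked m A Z \<longleftrightarrow> (\<forall>w. \<forall>J\<in>tidx m N. (\<Sum>K\<in>tidx m N. w (ext_idx m K) * A K J) = (w \<triangleleft> Z) (ext_idx m J))"

lemma in_range_ext_idx: "J \<in> tidx m N \<Longrightarrow> N \<ge> 1 \<Longrightarrow> in_range (ext_idx m J)"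
  using tidx_range[of J m N] by (auto simp: in_range_def ext_idx_def)

lemma ext_idx_upd: "a \<in> {1..m} \<Longrightarrow> ext_idx m (J(a := k)) = (ext_idx m J)(a := k)"
  by (auto simp: ext_idx_def)

lemma ext_idx_apply: "a \<in> {1..m} \<Longrightarrow> ext_idx m J a = J a"
  by (simp add: ext_idx_def)

lemma tidx_upd: "J \<in> tidx m N \<Longrightarrow> a \<in> {1..m} \<Longrightarrow> k \<in> {1..N} \<Longrightarrow> J(a := k) \<in> tidx m N"
  by (auto simp: tidx_def PiE_def extensional_def)

lemma linked_opS:
  assumes "a \<in> {1..m}" "N \<ge> 1"
  shows "linked m (in_copyc m a M) (opS a M)"
  unfolding linked_def
proof (intro allI ballI)
  fix w J assume J: "J \<in> tidx m N"
  have "(\<Sum>K\<in>tidx m N. w (ext_idx m K) * in_copyc m a M K J)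
      = (\<Sum>K\<in>(\<lambda>k. J(a := k)) ` {1..N}. w (ext_idx m K) * in_copyc m a M K J)"
  proof (rule sum.mono_neutral_right)
    show "(\<lambda>k. J(a := k)) ` {1..N} \<subseteq> tidx m N"
      using J assms tidx_upd by auto
    show "\<forall>K\<in>tidx m N - (\<lambda>k. J(a := k)) ` {1..N}. w (ext_idx m K) * in_copyc m a M K J = 0"
    proof
      fix K assume K: "K \<in> tidx m N - (\<lambda>k. J(a := k)) ` {1..N}"
      have "\<not> (\<forall>c\<in>{1..m} - {a}. K c = J c)"
      proof
        assume eq: "\<forall>c\<in>{1..m} - {a}. K c = J c"
        have "K = J(a := K a)"
        proof
          fix c
          show "K c = (J(a := K a)) c"
            using eq K J assms by (cases "c \<in> {1..m}") (auto simp: tidx_def PiE_def extensional_def)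
        qed
        then show False
          using K tidx_range[of K m N a] assms by blast
      qed
      then show "w (ext_idx m K) * in_copyc m a M K J = 0"
        by (auto simp: in_copyc_def)
    qed
  qed simp
  also have "\<dots> = (\<Sum>k=1..N. w (ext_idx m (J(a := k))) * in_copyc m a M (J(a := k)) J)"
    by (subst sum.reindex) (auto simp: inj_on_def dest: fun_cong[of _ _ a])
  also have "\<dots> = (w \<triangleleft> opS a M) (ext_idx m J)"
    using J assms in_range_ext_idx[OF J assms(2)]
    by (auto simp: act_opS in_copyc_def ext_idx_upd ext_idx_apply intro!: sum.cong)
  finally show "(\<Sum>K\<in>tidx m N. w (ext_idx m K) * in_copyc m a M K J) = (w \<triangleleft> opS a M) (ext_idx m J)" .
qed

lemma linked_op2:
  assumes "a \<in> {1..m}" "b \<in> {1..m}" "a \<noteq> b" "N \<ge> 1"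
  shows "linked m (in_copiesc m a b M) (op2 a b M)"
  unfolding linked_def
proof (intro allI ballI)
  fix w J assume J: "J \<in> tidx m N"
  let ?u = "\<lambda>(k, l). J(a := k, b := l)"
  have inj: "inj_on ?u ({1..N} \<times> {1..N})"
  proof (rule inj_onI, clarify)
    fix k l k' l' assume "J(a := k, b := l) = J(a := k', b := l')"
    from fun_cong[OF this, of a] fun_cong[OF this, of b] show "k = k' \<and> l = l'"
      using assms by simp
  qed
  have "(\<Sum>K\<in>tidx m N. w (ext_idx m K) * in_copiesc m a b M K J)
      = (\<Sum>K\<in>?u ` ({1..N} \<times> {1..N}). w (ext_idx m K) * in_copiesc m a b M K J)"
  proof (rule sum.mono_neutral_right)
    show "?u ` ({1..N} \<times> {1..N}) \<subseteq> tidx m N"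
      using J assms tidx_upd by auto
    show "\<forall>K\<in>tidx m N - ?u ` ({1..N} \<times> {1..N}). w (ext_idx m K) * in_copiesc m a b M K J = 0"
    proof
      fix K assume K: "K \<in> tidx m N - ?u ` ({1..N} \<times> {1..N})"
      have "\<not> (\<forall>c\<in>{1..m} - {a, b}. K c = J c)"
      proof
        assume eq: "\<forall>c\<in>{1..m} - {a, b}. K c = J c"
        have "K = J(a := K a, b := K b)"
        proof
          fix c
          show "K c = (J(a := K a, b := K b)) c"
            using eq K J assms by (cases "c \<in> {1..m}") (auto simp: tidx_def PiE_def extensional_def)
        qed
        then have "K = ?u (K a, K b)" by simp
        moreover have "(K a, K b) \<in> {1..N} \<times> {1..N}"
          using K tidx_range[of K m N] assms by blast
        ultimately show False
          using K by blast
      qed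
      then show "w (ext_idx m K) * in_copiesc m a b M K J = 0"
        by (auto simp: in_copiesc_def)
    qed
  qed simp
  also have "\<dots> = (\<Sum>(k, l)\<in>{1..N} \<times> {1..N}. w (ext_idx m (J(a := k, b := l)))
      * in_copiesc m a b M (J(a := k, b := l)) J)"
    by (subst sum.reindex[OF inj]) (simp add: case_prod_unfold o_def)
  also have "\<dots> = (\<Sum>k=1..N. \<Sum>l=1..N. w (ext_idx m (J(a := k, b := l)))
      * in_copiesc m a b M (J(a := k, b := l)) J)"
    by (rule sum.cartesian_product[symmetric])
  also have "\<dots> = (w \<triangleleft> op2 a b M) (ext_idx m J)"
    using J assms in_range_ext_idx[OF J assms(4)]
    by (auto simp: act_op2 in_copiesc_def ext_idx_upd ext_idx_apply intro!: sum.cong)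
  finally show "(\<Sum>K\<in>tidx m N. w (ext_idx m K) * in_copiesc m a b M K J) = (w \<triangleleft> op2 a b M) (ext_idx m J)" .
qed

lemma tprodc_linked:
  assumes "list_all2 (linked m) As Zs" "J \<in> tidx m N"
  shows "(\<Sum>K\<in>tidx m N. w (ext_idx m K) * tprodc m N As K J) = (w \<triangleleft> prod_list Zs) (ext_idx m J)"
  using assms
proof (induction As Zs arbitrary: w rule: list_all2_induct)
  case Nil
  have "(\<Sum>K\<in>tidx m N. w (ext_idx m K) * tprodc m N [] K J)
      = (\<Sum>K\<in>tidx m N. if K = J then w (ext_idx m K) else 0)"
    unfolding tprodc_Nil tonec_def by (intro sum.cong refl) auto
  then show ?case
    using Nil by (simp add: sum.delta)
next
  case (Cons A As Z Zs)
  have "(\<Sum>K\<in>tidx m N. w (ext_idx m K) * tprodc m N (A # As) K J)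
      = (\<Sum>K\<in>tidx m N. \<Sum>K'\<in>tidx m N. w (ext_idx m K) * A K K' * tprodc m N As K' J)"
    by (simp add: tmulc_def sum_distrib_left mult.assoc)
  also have "\<dots> = (\<Sum>K'\<in>tidx m N. \<Sum>K\<in>tidx m N. w (ext_idx m K) * A K K' * tprodc m N As K' J)"
    by (rule sum.swap)
  also have "\<dots> = (\<Sum>K'\<in>tidx m N. (w \<triangleleft> Z) (ext_idx m K') * tprodc m N As K' J)"
    using Cons(1) by (intro sum.cong refl) (simp add: linked_def flip: sum_distrib_right)
  also have "\<dots> = (w \<triangleleft> Z \<triangleleft> prod_list Zs) (ext_idx m J)"
    using Cons by blast
  finally show ?case by simp
qed

end

section \<open>Rows of the antisymmetrizer\<close>

definition inv_weight :: "complex \<Rightarrow> nat \<Rightarrow> (nat \<Rightarrow> nat) \<Rightarrow> complex" where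
  "inv_weight q N I = (\<Prod>(x, y)\<in>{(x, y). 1 \<le> x \<and> x < y \<and> y \<le> N}. if I x > I y then q else 1)"

lemma inv_weight_nonzero: "q \<noteq> 0 \<Longrightarrow> inv_weight q N I \<noteq> 0"
proof -
  assume q: "q \<noteq> 0"
  have "finite {(x, y). 1 \<le> x \<and> x < y \<and> y \<le> N}"
    by (rule finite_subset[of _ "{1..N} \<times> {1..N}"]) auto
  then show ?thesis
    using q by (auto simp: inv_weight_def prod_zero_iff split: if_splits)
qed

text \<open>The weight is q to the number of inversions. An adjacent transposition changes the
  status of the pair (a, a + 1) only and permutes the remaining pairs.\<close>

lemma inv_weight_swap:
  assumes a: "a \<in> {1..<N}" and q: "q \<noteq> 0"
  defines "s \<equiv> Transposition.transpose a (a + 1)"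
  shows "inv_weight q N I / inv_weight q N (I \<circ> s)
    = (if I a = I (a + 1) then 1 else if I a > I (a + 1) then q else inverse q)"
proof -
  define D where "D = {(x, y). 1 \<le> x \<and> x < y \<and> y \<le> N}"
  define f where "f I = (\<lambda>(x, y). if I x > (I y :: nat) then q else 1)" for I :: "nat \<Rightarrow> nat"
  have fin: "finite D"
    unfolding D_def by (rule finite_subset[of _ "{1..N} \<times> {1..N}"]) auto
  have aD: "(a, a + 1) \<in> D"
    using a by (auto simp: D_def)
  have w: "inv_weight q N I = f I (a, a + 1) * prod (f I) (D - {(a, a + 1)})" for I
    unfolding inv_weight_def D_def[symmetric] f_def[symmetric] using prod.remove[OF fin aD] .
  have s: "s x = (if x = a then a + 1 else if x = a + 1 then a else x)" for x
    by (auto simp: s_def Transposition.transpose_def)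
  have "prod (f I) (D - {(a, a + 1)}) = prod (f (I \<circ> s)) (D - {(a, a + 1)})"
    by (rule prod.reindex_bij_witness[of _ "map_prod s s" "map_prod s s"])
      (use a in \<open>auto simp: D_def s f_def split: if_splits\<close>)
  moreover have "prod (f I) (D - {(a, a + 1)}) \<noteq> 0"
    using q fin by (auto simp: f_def prod_zero_iff split: if_splits)
  moreover have "f (I \<circ> s) (a, a + 1) = (if I (a + 1) > I a then q else 1)"
    by (simp add: f_def s)
  ultimately show ?thesis
    using q by (auto simp: w[of I] w[of "I \<circ> s"] f_def field_simps)
qed

lemma tidx_comp:
  assumes "I \<in> tidx N M" "\<sigma> permutes {1..N}"
  shows "I \<circ> \<sigma> \<in> tidx N M"
  using assms permutes_in_image[OF assms(2)] permutes_not_in[OF assms(2)]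
  by (fastforce simp: tidx_def PiE_def extensional_def Pi_def)

lemma ring_realization_type:
  "ring_realization (ring_of_type_algebra :: 'a::comm_ring_1 ring) UNIV (\<lambda>x. x)"
proof -
  interpret ring "ring_of_type_algebra :: 'a ring" by (rule ring_from_type_algebra)
  show ?thesis
    by unfold_locales (simp_all add: ring_of_type_algebra_def)
qed

text \<open>P^q is the plain permutation operator conjugated by the diagonal matrix of the weights,
  and the weights telescope along a word. So only the permutation matters, not the word picked in
  \<open>adjacent_word\<close>.\<close>

lemma Pq_word:
  assumes q: "q \<noteq> 0" and "set ws \<subseteq> {1..<N}" "I \<in> tidx N N" "J \<in> tidx N N"
  shows "tprodc N N (map (\<lambda>a. in_copiesc N a (a + 1) (Pq q)) ws) I J
    = (if J = I \<circ> adj_prod ws then inv_weight q N I / inv_weight q N J else 0)"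
  using assms(2-)
proof (induction ws arbitrary: I)
  case Nil
  then show ?case
    using inv_weight_nonzero[OF q] by (auto simp: tonec_def adj_prod_def)
next
  case (Cons a ws)
  let ?s = "Transposition.transpose a (a + 1)"
  have a: "a \<in> {1..<N}" "a \<in> {1..N}" "a + 1 \<in> {1..N}"
    using Cons.prems by auto
  have p: "?s permutes {1..N}"
    using a by (intro permutes_swap_id) auto
  have Is: "I \<circ> ?s \<in> tidx N N"
    using tidx_comp[OF Cons.prems(2) p] .
  have P: "in_copiesc N a (a + 1) (Pq q) I K
      = (if K = I \<circ> ?s then inv_weight q N I / inv_weight q N (I \<circ> ?s) else 0)" if K: "K \<in> tidx N N" for K
  proof (cases "K = I \<circ> ?s")
    case True
    have s: "?s a = a + 1" "?s (a + 1) = a" "c \<noteq> a \<Longrightarrow> c \<noteq> a + 1 \<Longrightarrow> ?s c = c" for c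
      by (simp_all add: Transposition.transpose_def)
    have "in_copiesc N a (a + 1) (Pq q) I K
        = (if I a = I (a + 1) then 1 else if I a > I (a + 1) then q else inverse q)"
      unfolding True by (auto simp: in_copiesc_def Pq_def s)
    then show ?thesis
      using True inv_weight_swap[OF a(1) q, of I] by simp
  next
    case False
    have "\<not> ((\<forall>c\<in>{1..N} - {a, a + 1}. I c = K c) \<and> I (a + 1) = K a \<and> K (a + 1) = I a)"
    proof
      assume h: "(\<forall>c\<in>{1..N} - {a, a + 1}. I c = K c) \<and> I (a + 1) = K a \<and> K (a + 1) = I a"
      have "K = I \<circ> ?s"
      proof
        fix c
        show "K c = (I \<circ> ?s) c"
          using h K Cons.prems(2) a
          by (cases "c \<in> {1..N}") (auto simp: tidx_def PiE_def extensional_def Transposition.transpose_def)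
      qed
      then show False using False by simp
    qed
    then show ?thesis
      using False by (auto simp: in_copiesc_def Pq_def)
  qed
  let ?rest = "tprodc N N (map (\<lambda>a. in_copiesc N a (a + 1) (Pq q)) ws)"
  have "tprodc N N (map (\<lambda>a. in_copiesc N a (a + 1) (Pq q)) (a # ws)) I J
      = (\<Sum>K\<in>tidx N N. if K = I \<circ> ?s then inv_weight q N I / inv_weight q N (I \<circ> ?s) * ?rest K J else 0)"
    unfolding list.map tprodc_Cons tmulc_def by (intro sum.cong refl, subst P) auto
  also have "\<dots> = inv_weight q N I / inv_weight q N (I \<circ> ?s) * ?rest (I \<circ> ?s) J"
    using Is by (simp add: sum.delta)
  also have "?rest (I \<circ> ?s) J = (if J = I \<circ> ?s \<circ> adj_prod ws
      then inv_weight q N (I \<circ> ?s) / inv_weight q N J else 0)"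
    using Cons.prems by (intro Cons.IH Is) auto
  also have "I \<circ> ?s \<circ> adj_prod ws = I \<circ> adj_prod (a # ws)"
    by (simp add: adj_prod_def comp_assoc)
  also have "v / w * (if P then w / z else 0) = (if P then v / z else 0)" if "w \<noteq> 0" for v w z :: complex and P
    using that by simp
  finally show ?case
    using inv_weight_nonzero[OF q] .
qed

lemma Pq_perm_eq:
  assumes "q \<noteq> 0" "\<sigma> permutes {1..N}" "I \<in> tidx N N" "J \<in> tidx N N"
  shows "Pq_perm q N \<sigma> I J = (if J = I \<circ> \<sigma> then inv_weight q N I / inv_weight q N J else 0)"
proof -
  interpret ring_realization "ring_of_type_algebra :: complex ring" UNIV "\<lambda>x. x"
    by (rule ring_realization_type)
  have "set (adjacent_word N \<sigma>) \<subseteq> {1..<N} \<and> adj_prod (adjacent_word N \<sigma>) = \<sigma>"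
    unfolding adjacent_word_def adj_prod_def
    by (rule someI_ex) (use permutes_adjacent_word[OF assms(2)] in \<open>simp add: adj_prod_def\<close>)
  moreover have "Pq_perm q N \<sigma> I J
      = tprodc N N (map (\<lambda>a. in_copiesc N a (a + 1) (Pq q)) (adjacent_word N \<sigma>)) I J"
    unfolding Pq_perm_def
    by (rule tprod_eq[THEN conjunct1, OF _ assms(3,4)])
      (auto simp: list_all2_map1 list_all2_map2 list_all2_same in_copies_def in_copiesc_def
        ring_of_type_algebra_def)
  ultimately show ?thesis
    using Pq_word[OF assms(1) _ assms(3,4), of "adjacent_word N \<sigma>"] by simp
qed

lemma Aq_eq:
  assumes "q \<noteq> 0" "I \<in> tidx N N" "J \<in> tidx N N"
  shows "Aq q N I J = inv_weight q N I / inv_weight q N J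
    * (\<Sum>\<sigma> | \<sigma> permutes {1..N}. if J = I \<circ> \<sigma> then of_int (sign \<sigma>) else 0)"
  unfolding Aq_def sum_distrib_left
  by (intro sum.cong refl) (auto simp: Pq_perm_eq[OF assms(1) _ assms(2,3)])

text \<open>Composing the summation variable with the adjacent transposition reverses every sign,
  and the quotient of weights supplies the factor q: each row is antisymmetric with respect to
  P^q.\<close>

lemma Aq_swap:
  assumes q: "q \<noteq> 0" and a: "a \<in> {1..<N}" and I: "I \<in> tidx N N" and J: "J \<in> tidx N N"
  shows "J a = J (a + 1) \<Longrightarrow> Aq q N I J = 0"
    and "J a < J (a + 1) \<Longrightarrow> Aq q N I J = - (q * Aq q N I (J \<circ> Transposition.transpose a (a + 1)))"
proof -
  let ?s = "Transposition.transpose a (a + 1)"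
  let ?S = "\<lambda>J. \<Sum>\<sigma> | \<sigma> permutes {1..N}. if J = I \<circ> \<sigma> then of_int (sign \<sigma>) else (0::complex)"
  have p: "?s permutes {1..N}"
    using a by (intro permutes_swap_id) auto
  have "?S (J \<circ> ?s) = (\<Sum>\<sigma> | \<sigma> permutes {1..N}. if J \<circ> ?s = I \<circ> (\<sigma> \<circ> ?s) then of_int (sign (\<sigma> \<circ> ?s)) else 0)"
    by (rule sum_permutations_compose_right[OF p])
  also have "\<dots> = (\<Sum>\<sigma> | \<sigma> permutes {1..N}. - (if J = I \<circ> \<sigma> then of_int (sign \<sigma>) else 0))"
  proof (intro sum.cong refl)
    fix \<sigma> assume "\<sigma> \<in> {\<sigma>. \<sigma> permutes {1..N}}"
    then have "permutation \<sigma>" "permutation ?s"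
      using p permutes_imp_permutation[of "{1..N}"] by auto
    then have "sign (\<sigma> \<circ> ?s) = - sign \<sigma>"
      by (simp add: sign_compose sign_swap_id)
    moreover have "J \<circ> ?s = I \<circ> (\<sigma> \<circ> ?s) \<longleftrightarrow> J = I \<circ> \<sigma>"
      by (metis comp_assoc comp_id transpose_comp_involutory)
    ultimately show "(if J \<circ> ?s = I \<circ> (\<sigma> \<circ> ?s) then of_int (sign (\<sigma> \<circ> ?s)) else 0)
        = - (if J = I \<circ> \<sigma> then of_int (sign \<sigma>) else (0::complex))"
      by simp
  qed
  finally have S: "?S (J \<circ> ?s) = - ?S J"
    by (simp add: sum_negf)
  show "Aq q N I J = 0" if "J a = J (a + 1)"
  proof -
    have e: "J \<circ> ?s = J"
      using that by (auto simp: fun_eq_iff Transposition.transpose_def)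
    have "x = - x \<Longrightarrow> x = 0" for x :: complex
      by (simp add: complex_eq_iff)
    from this[OF S[unfolded e]] have z: "?S J = 0" .
    show ?thesis
      unfolding Aq_eq[OF q I J] z by simp
  qed
  show "Aq q N I J = - (q * Aq q N I (J \<circ> ?s))" if "J a < J (a + 1)"
  proof -
    have "inv_weight q N J / inv_weight q N (J \<circ> ?s) = inverse q"
      using inv_weight_swap[OF a q, of J] that by simp
    then have w: "inv_weight q N (J \<circ> ?s) = q * inv_weight q N J"
      using q inv_weight_nonzero[OF q, of N "J \<circ> ?s"] by (simp add: field_simps)
    show ?thesis
      unfolding Aq_eq[OF q I J] Aq_eq[OF q I tidx_comp[OF J p]] S w
      using q by (simp add: field_simps)
  qed
qed

definition id_idx :: "nat \<Rightarrow> nat \<Rightarrow> nat" where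
  "id_idx N = restrict (\<lambda>c. c) {1..N}"

lemma id_idx_tidx: "id_idx N \<in> tidx N N"
  by (auto simp: id_idx_def tidx_def)

text \<open>This entry normalizes the eigenvector and makes the Sklyanin determinant unique, since
  the series can be read off there without division.\<close>

lemma Aq_id: "q \<noteq> 0 \<Longrightarrow> Aq q N (id_idx N) (id_idx N) = 1"
proof -
  assume q: "q \<noteq> 0"
  have "id_idx N = id_idx N \<circ> \<sigma> \<longleftrightarrow> \<sigma> = id" if "\<sigma> permutes {1..N}" for \<sigma>
  proof
    assume eq: "id_idx N = id_idx N \<circ> \<sigma>"
    show "\<sigma> = id"
    proof
      fix c
      show "\<sigma> c = id c"
        using fun_cong[OF eq, of c] permutes_in_image[OF that, of c] permutes_not_in[OF that, of c]
        by (cases "c \<in> {1..N}") (auto simp: id_idx_def)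
    qed
  qed simp
  then have "(\<Sum>\<sigma> | \<sigma> permutes {1..N}. if id_idx N = id_idx N \<circ> \<sigma> then of_int (sign \<sigma>) else (0::complex))
      = (\<Sum>\<sigma> | \<sigma> permutes {1..N}. if \<sigma> = id then of_int (sign \<sigma>) else 0)"
    by (intro sum.cong refl) auto
  also have "\<dots> = 1"
    by (simp add: sum.delta finite_permutations permutes_id)
  finally show ?thesis
    using Aq_eq[OF q id_idx_tidx id_idx_tidx] inv_weight_nonzero[OF q] by simp
qed

section \<open>Complex algebras as factors of a type\<close>

definition calg :: "'a ring \<Rightarrow> (complex \<Rightarrow> 'a) \<Rightarrow> bool" where
  "calg R \<iota> \<longleftrightarrow> ring R \<and> (\<forall>c. \<iota> c \<in> carrier R) \<and> (\<forall>c d. \<iota> (c + d) = \<iota> c \<oplus>\<^bsub>R\<^esub> \<iota> d)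
     \<and> (\<forall>c d. \<iota> (c * d) = \<iota> c \<otimes>\<^bsub>R\<^esub> \<iota> d) \<and> \<iota> 1 = \<one>\<^bsub>R\<^esub>
     \<and> (\<forall>c. \<forall>x\<in>carrier R. x \<otimes>\<^bsub>R\<^esub> \<iota> c = \<iota> c \<otimes>\<^bsub>R\<^esub> x)"

lemma calg_ring: "calg R \<iota> \<Longrightarrow> ring R"
  by (simp add: calg_def)

lemma calg_closed: "calg R \<iota> \<Longrightarrow> \<iota> c \<in> carrier R"
  unfolding calg_def by blast

lemma calg_hom:
  "calg R \<iota> \<Longrightarrow> \<iota> (c + d) = \<iota> c \<oplus>\<^bsub>R\<^esub> \<iota> d" "calg R \<iota> \<Longrightarrow> \<iota> (c * d) = \<iota> c \<otimes>\<^bsub>R\<^esub> \<iota> d"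
  "calg R \<iota> \<Longrightarrow> \<iota> 1 = \<one>\<^bsub>R\<^esub>" "calg R \<iota> \<Longrightarrow> x \<in> carrier R \<Longrightarrow> x \<otimes>\<^bsub>R\<^esub> \<iota> c = \<iota> c \<otimes>\<^bsub>R\<^esub> x"
  unfolding calg_def by blast+

lemma calg_zero:
  assumes "calg R \<iota>"
  shows "\<iota> 0 = \<zero>\<^bsub>R\<^esub>"
proof -
  interpret ring R by (rule calg_ring[OF assms])
  have "\<iota> 0 \<oplus>\<^bsub>R\<^esub> \<iota> 0 = \<iota> 0"
    using calg_hom(1)[OF assms, of 0 0] by simp
  then show ?thesis using calg_closed[OF assms, of 0] by (simp add: add.r_cancel_one)
qed

text \<open>The product of all complex algebras with elements in \<open>'a\<close>, together with the complex numbers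
  to make it nontrivial. Every such algebra is a factor of one and the same type of class \<open>ring_1\<close>, so
  identities proved in type-class rings can be applied to it.\<close>

typedef 'a algprod = "{(f :: 'a ring \<times> (complex \<Rightarrow> 'a) \<Rightarrow> 'a, z :: complex).
    \<forall>R \<iota>. if calg R \<iota> then f (R, \<iota>) \<in> carrier R else f (R, \<iota>) = undefined}"
proof -
  have "(\<lambda>(R, \<iota>). if calg R \<iota> then \<zero>\<^bsub>R\<^esub> else undefined, 0) \<in> {(f :: 'a ring \<times> (complex \<Rightarrow> 'a) \<Rightarrow> 'a, z :: complex).
    \<forall>R \<iota>. if calg R \<iota> then f (R, \<iota>) \<in> carrier R else f (R, \<iota>) = undefined}"
    by (auto dest: calg_ring simp: ring.ring_simprules)
  then show ?thesis by blast
qed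

definition comp_at :: "'a algprod \<Rightarrow> 'a ring \<Rightarrow> (complex \<Rightarrow> 'a) \<Rightarrow> 'a" where
  "comp_at x R \<iota> = fst (Rep_algprod x) (R, \<iota>)"

definition aug :: "'a algprod \<Rightarrow> complex" where
  "aug x = snd (Rep_algprod x)"

definition mk_algprod :: "('a ring \<Rightarrow> (complex \<Rightarrow> 'a) \<Rightarrow> 'a) \<Rightarrow> complex \<Rightarrow> 'a algprod" where
  "mk_algprod f z = Abs_algprod (\<lambda>(R, \<iota>). if calg R \<iota> then f R \<iota> else undefined, z)"

lemma comp_at_closed: "calg R \<iota> \<Longrightarrow> comp_at x R \<iota> \<in> carrier R"
  using Rep_algprod[of x] by (auto simp: comp_at_def case_prod_unfold split: if_splits)

lemma algprod_eqI:
  assumes "\<And>R \<iota>. calg R \<iota> \<Longrightarrow> comp_at x R \<iota> = comp_at y R \<iota>" "aug x = aug y"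
  shows "x = y"
proof -
  have "fst (Rep_algprod x) (R, \<iota>) = fst (Rep_algprod y) (R, \<iota>)" for R \<iota>
    using assms(1)[of R \<iota>] Rep_algprod[of x] Rep_algprod[of y]
    by (cases "calg R \<iota>") (auto simp: comp_at_def case_prod_unfold)
  then have "Rep_algprod x = Rep_algprod y"
    using assms(2) by (auto simp: aug_def prod_eq_iff fun_eq_iff)
  then show ?thesis by (simp add: Rep_algprod_inject)
qed

lemma mk_algprod:
  assumes "\<And>R \<iota>. calg R \<iota> \<Longrightarrow> f R \<iota> \<in> carrier R"
  shows "calg R \<iota> \<Longrightarrow> comp_at (mk_algprod f z) R \<iota> = f R \<iota>" "aug (mk_algprod f z) = z"
  unfolding comp_at_def aug_def mk_algprod_def
  by (subst Abs_algprod_inverse; use assms in force)+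

instantiation algprod :: (type) ring_1
begin

definition zero_algprod :: "'a algprod" where "0 = mk_algprod (\<lambda>R \<iota>. \<zero>\<^bsub>R\<^esub>) 0"
definition one_algprod :: "'a algprod" where "1 = mk_algprod (\<lambda>R \<iota>. \<one>\<^bsub>R\<^esub>) 1"
definition plus_algprod :: "'a algprod \<Rightarrow> 'a algprod \<Rightarrow> 'a algprod" where
  "x + y = mk_algprod (\<lambda>R \<iota>. comp_at x R \<iota> \<oplus>\<^bsub>R\<^esub> comp_at y R \<iota>) (aug x + aug y)"
definition uminus_algprod :: "'a algprod \<Rightarrow> 'a algprod" where
  "- x = mk_algprod (\<lambda>R \<iota>. \<ominus>\<^bsub>R\<^esub> comp_at x R \<iota>) (- aug x)"
definition minus_algprod :: "'a algprod \<Rightarrow> 'a algprod \<Rightarrow> 'a algprod" where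
  "x - y = x + - (y :: 'a algprod)"
definition times_algprod :: "'a algprod \<Rightarrow> 'a algprod \<Rightarrow> 'a algprod" where
  "x * y = mk_algprod (\<lambda>R \<iota>. comp_at x R \<iota> \<otimes>\<^bsub>R\<^esub> comp_at y R \<iota>) (aug x * aug y)"

lemma comp_at_simps [simp]:
  assumes "calg R \<iota>"
  shows "comp_at 0 R \<iota> = \<zero>\<^bsub>R\<^esub>" "comp_at 1 R \<iota> = \<one>\<^bsub>R\<^esub>"
    "comp_at (x + y) R \<iota> = comp_at x R \<iota> \<oplus>\<^bsub>R\<^esub> comp_at y R \<iota>"
    "comp_at (- x) R \<iota> = \<ominus>\<^bsub>R\<^esub> comp_at x R \<iota>"
    "comp_at (x * y) R \<iota> = comp_at x R \<iota> \<otimes>\<^bsub>R\<^esub> comp_at y R \<iota>"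
  unfolding zero_algprod_def one_algprod_def plus_algprod_def uminus_algprod_def times_algprod_def
  by (subst mk_algprod; use assms comp_at_closed calg_ring in \<open>force simp: ring.ring_simprules\<close>)+

lemma aug_simps [simp]:
  "aug (0 :: 'a algprod) = 0" "aug (1 :: 'a algprod) = 1" "aug (x + y) = aug x + aug y"
  "aug (- x) = - aug x" "aug (x * y) = aug x * aug y" for x y :: "'a algprod"
  unfolding zero_algprod_def one_algprod_def plus_algprod_def uminus_algprod_def times_algprod_def
  by (subst mk_algprod; use comp_at_closed calg_ring in \<open>force simp: ring.ring_simprules\<close>)+

instance
proof
  fix x y z :: "'a algprod"
  show "x + y + z = x + (y + z)" "x + y = y + x" "0 + x = x" "- x + x = 0"
    "x * y * z = x * (y * z)" "1 * x = x" "x * 1 = x" "(x + y) * z = x * z + y * z" "x * (y + z) = x * y + x * z"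
    by (rule algprod_eqI; simp add: algebra_simps ring.ring_simprules[OF calg_ring] monoid.r_one[OF ring.is_monoid[OF calg_ring]] comp_at_closed)+
  show "x - y = x + - y"
    by (simp add: minus_algprod_def)
  show "(0 :: 'a algprod) \<noteq> 1"
    using aug_simps(1,2) by (metis zero_neq_one)
qed

end

lemma ring_realization_comp_at:
  assumes "calg R \<iota>"
  shows "ring_realization R UNIV (\<lambda>x. comp_at x R \<iota>)"
proof -
  interpret ring R by (rule calg_ring[OF assms])
  show ?thesis
    by unfold_locales (simp_all add: assms comp_at_closed)
qed

definition iotab :: "complex \<Rightarrow> 'a algprod" where
  "iotab c = mk_algprod (\<lambda>R \<iota>. \<iota> c) c"

lemma iotab_simps [simp]:
  "calg R \<iota> \<Longrightarrow> comp_at (iotab c) R \<iota> = \<iota> c" "aug (iotab c :: 'a algprod) = c"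
proof -
  show "comp_at (iotab c) R \<iota> = \<iota> c" if "calg R \<iota>"
    unfolding iotab_def by (rule mk_algprod(1)[of "\<lambda>R \<iota>. \<iota> c"]) (rule calg_closed, assumption, rule that)
  show "aug (iotab c :: 'a algprod) = c"
    unfolding iotab_def by (rule mk_algprod(2)[of "\<lambda>R \<iota>. \<iota> c"]) (rule calg_closed)
qed

lemma central_scalars_iotab: "central_scalars (iotab :: complex \<Rightarrow> 'a algprod)"
proof
  fix s t :: complex and x :: "'a algprod"
  show "iotab (s + t) = (iotab s + iotab t :: 'a algprod)" "iotab (s * t) = (iotab s * iotab t :: 'a algprod)"
    "iotab 1 = (1 :: 'a algprod)"
    by (rule algprod_eqI; simp add: calg_hom(1-3))+
  show "x * iotab s = iotab s * x"
    by (rule algprod_eqI) (simp_all add: calg_hom(4) comp_at_closed)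
qed

text \<open>Extension by 0 to all other factors of the product. It respects sums, products and
  multiplication by scalars but not the unit, so it is applied to generators, while scalars enter
  through \<open>iotab\<close>.\<close>

definition lift_at :: "'a ring \<Rightarrow> (complex \<Rightarrow> 'a) \<Rightarrow> 'a \<Rightarrow> 'a algprod" where
  "lift_at R \<iota> a = mk_algprod (\<lambda>R' \<iota>'. if R' = R \<and> \<iota>' = \<iota> then a else \<zero>\<^bsub>R'\<^esub>) 0"

lemma lift_at_simps:
  assumes "a \<in> carrier R"
  shows "calg R' \<iota>' \<Longrightarrow> comp_at (lift_at R \<iota> a) R' \<iota>' = (if R' = R \<and> \<iota>' = \<iota> then a else \<zero>\<^bsub>R'\<^esub>)"
    "aug (lift_at R \<iota> a) = 0"
proof -
  have *: "(if R' = R \<and> \<iota>' = \<iota> then a else \<zero>\<^bsub>R'\<^esub>) \<in> carrier R'" if "calg R' \<iota>'" for R' \<iota>'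
    using assms calg_ring[OF that] by (auto simp: ring.ring_simprules)
  let ?f = "\<lambda>R' \<iota>'. if R' = R \<and> \<iota>' = \<iota> then a else \<zero>\<^bsub>R'\<^esub>"
  show "comp_at (lift_at R \<iota> a) R' \<iota>' = (if R' = R \<and> \<iota>' = \<iota> then a else \<zero>\<^bsub>R'\<^esub>)" if "calg R' \<iota>'"
    unfolding lift_at_def by (rule mk_algprod(1)[of ?f]) (use that * in auto)
  show "aug (lift_at R \<iota> a) = 0"
    unfolding lift_at_def by (rule mk_algprod(2)[of ?f]) (rule *)
qed

lemma lift_at_hom:
  assumes c: "calg R \<iota>" and a: "a \<in> carrier R" and b: "b \<in> carrier R"
  shows "lift_at R \<iota> (a \<oplus>\<^bsub>R\<^esub> b) = lift_at R \<iota> a + lift_at R \<iota> b"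
    and "lift_at R \<iota> (a \<otimes>\<^bsub>R\<^esub> b) = lift_at R \<iota> a * lift_at R \<iota> b"
    and "lift_at R \<iota> (\<iota> s \<otimes>\<^bsub>R\<^esub> a) = iotab s * lift_at R \<iota> a"
    and "lift_at R \<iota> \<zero>\<^bsub>R\<^esub> = 0"
proof -
  interpret ring R by (rule calg_ring[OF c])
  have s: "\<iota> s \<in> carrier R" using c by (rule calg_closed)
  have z: "\<zero>\<^bsub>R'\<^esub> \<oplus>\<^bsub>R'\<^esub> \<zero>\<^bsub>R'\<^esub> = \<zero>\<^bsub>R'\<^esub>" "\<zero>\<^bsub>R'\<^esub> \<otimes>\<^bsub>R'\<^esub> \<zero>\<^bsub>R'\<^esub> = \<zero>\<^bsub>R'\<^esub>" "\<iota>' s \<otimes>\<^bsub>R'\<^esub> \<zero>\<^bsub>R'\<^esub> = \<zero>\<^bsub>R'\<^esub>"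
    if "calg R' \<iota>'" for R' :: "'a ring" and \<iota>'
    using ring.ring_simprules[OF calg_ring[OF that]] calg_closed[OF that, of s] by auto
  show "lift_at R \<iota> (a \<oplus>\<^bsub>R\<^esub> b) = lift_at R \<iota> a + lift_at R \<iota> b"
    by (rule algprod_eqI) (use a b z in \<open>simp_all add: lift_at_simps\<close>)
  show "lift_at R \<iota> (a \<otimes>\<^bsub>R\<^esub> b) = lift_at R \<iota> a * lift_at R \<iota> b"
    by (rule algprod_eqI) (use a b z in \<open>simp_all add: lift_at_simps\<close>)
  show "lift_at R \<iota> (\<iota> s \<otimes>\<^bsub>R\<^esub> a) = iotab s * lift_at R \<iota> a"
    by (rule algprod_eqI) (use a s z in \<open>simp_all add: lift_at_simps\<close>)
  show "lift_at R \<iota> \<zero>\<^bsub>R\<^esub> = 0"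
    by (rule algprod_eqI) (simp_all add: lift_at_simps)
qed

section \<open>Laurent polynomials over the product of algebras\<close>

lemma lookup_times_int:
  fixes f g :: "int \<Rightarrow>\<^sub>0 'b::ring_1"
  assumes "finite A" "Poly_Mapping.keys f \<subseteq> A"
  shows "Poly_Mapping.lookup (f * g) k = (\<Sum>i\<in>A. Poly_Mapping.lookup f i * Poly_Mapping.lookup g (k - i))"
proof -
  have "(\<Sum>j. Poly_Mapping.lookup g j when k = i + j) = Poly_Mapping.lookup g (k - i)" for i
  proof -
    have "(k = i + j) = (j = k - i)" for j by auto
    then show ?thesis by simp
  qed
  then have "Poly_Mapping.lookup (f * g) k = (\<Sum>i. Poly_Mapping.lookup f i * Poly_Mapping.lookup g (k - i))"
    by (simp add: times_poly_mapping.rep_eq prod_fun_def)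
  also have "\<dots> = (\<Sum>i\<in>A. Poly_Mapping.lookup f i * Poly_Mapping.lookup g (k - i))"
  proof (rule Sum_any.expand_superset[OF assms(1)])
    have "Poly_Mapping.lookup f i = 0" if "i \<notin> A" for i
      using subsetD[OF assms(2), of i] that by (auto simp: in_keys_iff)
    then show "{i. Poly_Mapping.lookup f i * Poly_Mapping.lookup g (k - i) \<noteq> 0} \<subseteq> A"
      using mult_zero_left by (metis (mono_tags, lifting) mem_Collect_eq subsetI)
  qed
  finally show ?thesis .
qed

definition iotaL :: "(int \<Rightarrow>\<^sub>0 complex) \<Rightarrow> (int \<Rightarrow>\<^sub>0 'a algprod)" where
  "iotaL p = Poly_Mapping.map iotab p"

lemma lookup_iotaL [simp]: "Poly_Mapping.lookup (iotaL p) k = iotab (Poly_Mapping.lookup p k)"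
proof -
  interpret central_scalars "iotab :: complex \<Rightarrow> 'a algprod" by (rule central_scalars_iotab)
  show ?thesis by (simp add: iotaL_def Poly_Mapping.map.rep_eq when_def)
qed

lemma central_scalars_iotaL: "central_scalars (iotaL :: (int \<Rightarrow>\<^sub>0 complex) \<Rightarrow> (int \<Rightarrow>\<^sub>0 'a algprod))"
proof
  interpret b: central_scalars "iotab :: complex \<Rightarrow> 'a algprod" by (rule central_scalars_iotab)
  fix s t :: "int \<Rightarrow>\<^sub>0 complex" and x :: "int \<Rightarrow>\<^sub>0 'a algprod"
  show "iotaL (s + t) = (iotaL s + iotaL t :: int \<Rightarrow>\<^sub>0 'a algprod)"
    by (rule poly_mapping_eqI) (simp add: lookup_add b.iota_add)
  show "iotaL 1 = (1 :: int \<Rightarrow>\<^sub>0 'a algprod)"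
    by (rule poly_mapping_eqI) (simp add: lookup_one when_def)
  have k: "Poly_Mapping.keys (iotaL s :: int \<Rightarrow>\<^sub>0 'a algprod) \<subseteq> Poly_Mapping.keys s" for s
  proof
    fix i assume "i \<in> Poly_Mapping.keys (iotaL s :: int \<Rightarrow>\<^sub>0 'a algprod)"
    then have "iotab (Poly_Mapping.lookup s i) \<noteq> (0 :: 'a algprod)"
      by (simp add: in_keys_iff)
    then have "Poly_Mapping.lookup s i \<noteq> 0"
      by (metis b.iota_zero)
    then show "i \<in> Poly_Mapping.keys s" by (simp add: in_keys_iff)
  qed
  show "iotaL (s * t) = (iotaL s * iotaL t :: int \<Rightarrow>\<^sub>0 'a algprod)"
  proof (rule poly_mapping_eqI)
    fix n
    show "Poly_Mapping.lookup (iotaL (s * t) :: int \<Rightarrow>\<^sub>0 'a algprod) n = Poly_Mapping.lookup (iotaL s * iotaL t) n"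
      unfolding lookup_times_int[OF finite_keys k, of s "iotaL t"] lookup_iotaL
        lookup_times_int[OF finite_keys order_refl, of s t] b.iota_sum b.iota_mult ..
  qed
  show "x * iotaL s = iotaL s * x"
  proof (rule poly_mapping_eqI)
    fix n
    \<comment> \<open>\<open>?A\<close> covers the support of x and its reflection \<open>?B\<close>
      that of the scalar, so both products can be expanded over one sum, reindexed by i to n -
      i.\<close>
    let ?A = "Poly_Mapping.keys x \<union> (\<lambda>j. n - j) ` Poly_Mapping.keys s"
    let ?B = "(\<lambda>j. n - j) ` ?A"
    have B: "Poly_Mapping.keys (iotaL s :: int \<Rightarrow>\<^sub>0 'a algprod) \<subseteq> ?B"
      using k[of s] by (force simp: image_Un image_image)
    have "Poly_Mapping.lookup (x * iotaL s) n
        = (\<Sum>i\<in>?A. Poly_Mapping.lookup x i * iotab (Poly_Mapping.lookup s (n - i)))"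
      by (subst lookup_times_int[of ?A]) auto
    also have "\<dots> = (\<Sum>j\<in>?B. Poly_Mapping.lookup x (n - j) * iotab (Poly_Mapping.lookup s j))"
      by (rule sum.reindex_bij_witness[of _ "\<lambda>j. n - j" "\<lambda>i. n - i"]) auto
    also have "\<dots> = (\<Sum>j\<in>?B. iotab (Poly_Mapping.lookup s j) * Poly_Mapping.lookup x (n - j))"
      by (simp only: b.iota_comm)
    also have "\<dots> = Poly_Mapping.lookup (iotaL s * x) n"
      by (subst lookup_times_int[OF _ B]) auto
    finally show "Poly_Mapping.lookup (x * iotaL s) n = Poly_Mapping.lookup (iotaL s * x) n" .
  qed
qed

lemma laurent_simps [simp]:
  "\<zero>\<^bsub>laurent R\<^esub> = (\<lambda>k. \<zero>\<^bsub>R\<^esub>)" "\<one>\<^bsub>laurent R\<^esub> = (\<lambda>k. if k = 0 then \<one>\<^bsub>R\<^esub> else \<zero>\<^bsub>R\<^esub>)"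
  "f \<oplus>\<^bsub>laurent R\<^esub> g = (\<lambda>k. f k \<oplus>\<^bsub>R\<^esub> g k)"
  "f \<otimes>\<^bsub>laurent R\<^esub> g = (\<lambda>k. \<Oplus>\<^bsub>R\<^esub>i\<in>{i. f i \<noteq> \<zero>\<^bsub>R\<^esub> \<and> g (k - i) \<noteq> \<zero>\<^bsub>R\<^esub>}. f i \<otimes>\<^bsub>R\<^esub> g (k - i))"
  by (simp_all add: laurent_def)

lemma carrier_laurent:
  "f \<in> carrier (laurent R) \<longleftrightarrow> (\<forall>k. f k \<in> carrier R) \<and> (\<exists>K. \<forall>k>K. f k = \<zero>\<^bsub>R\<^esub>)"
  by (simp add: laurent_def)

lemma abelian_group_laurent:
  assumes "ring R"
  shows "abelian_group (laurent R)"
proof -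
  interpret ring R by fact
  show ?thesis
  proof (rule abelian_groupI)
    fix f g assume f: "f \<in> carrier (laurent R)" and g: "g \<in> carrier (laurent R)"
    then obtain K K' where "\<forall>k>K. f k = \<zero>\<^bsub>R\<^esub>" "\<forall>k>K'. g k = \<zero>\<^bsub>R\<^esub>"
      by (auto simp: carrier_laurent)
    then have "\<forall>k>max K K'. f k \<oplus>\<^bsub>R\<^esub> g k = \<zero>\<^bsub>R\<^esub>" by simp
    then show "f \<oplus>\<^bsub>laurent R\<^esub> g \<in> carrier (laurent R)"
      using f g unfolding carrier_laurent by (auto intro!: exI[of _ "max K K'"])
    show "f \<oplus>\<^bsub>laurent R\<^esub> g = g \<oplus>\<^bsub>laurent R\<^esub> f"
      using f g by (simp add: carrier_laurent a_comm)
    have "(\<lambda>k. \<ominus>\<^bsub>R\<^esub> f k) \<in> carrier (laurent R)"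
      using f unfolding carrier_laurent by auto
    then show "\<exists>h\<in>carrier (laurent R). h \<oplus>\<^bsub>laurent R\<^esub> f = \<zero>\<^bsub>laurent R\<^esub>"
      using f by (intro bexI[of _ "\<lambda>k. \<ominus>\<^bsub>R\<^esub> f k"]) (simp_all add: carrier_laurent l_neg)
    show "\<zero>\<^bsub>laurent R\<^esub> \<oplus>\<^bsub>laurent R\<^esub> f = f"
      using f by (simp add: carrier_laurent)
  next
    show "\<zero>\<^bsub>laurent R\<^esub> \<in> carrier (laurent R)"
      by (simp add: carrier_laurent)
  next
    fix f g h assume "f \<in> carrier (laurent R)" "g \<in> carrier (laurent R)" "h \<in> carrier (laurent R)"
    then show "(f \<oplus>\<^bsub>laurent R\<^esub> g) \<oplus>\<^bsub>laurent R\<^esub> h = f \<oplus>\<^bsub>laurent R\<^esub> (g \<oplus>\<^bsub>laurent R\<^esub> h)"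
      by (simp add: carrier_laurent a_assoc)
  qed
qed

text \<open>Laurent polynomials suffice as a source, because S(u) and all the R^t involve finitely
  many powers of u; the Laurent series needed for uniqueness are only the target.\<close>

definition coeffs_at :: "'a ring \<Rightarrow> (complex \<Rightarrow> 'a) \<Rightarrow> (int \<Rightarrow>\<^sub>0 'a algprod) \<Rightarrow> int \<Rightarrow> 'a" where
  "coeffs_at R \<iota> p = (\<lambda>k. comp_at (Poly_Mapping.lookup p k) R \<iota>)"

lemma ring_realization_coeffs_at:
  assumes c: "calg R \<iota>"
  shows "ring_realization (laurent R) UNIV (coeffs_at R \<iota>)"
proof -
  interpret ring R by (rule calg_ring[OF c])
  interpret L: abelian_group "laurent R" by (rule abelian_group_laurent) (rule calg_ring[OF c])
  interpret cr: ring_realization R UNIV "\<lambda>x. comp_at x R \<iota>" by (rule ring_realization_comp_at[OF c])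
  show ?thesis
  proof
    fix x y :: "int \<Rightarrow>\<^sub>0 'a algprod"
    have "\<forall>k>Max (insert 0 (Poly_Mapping.keys x)). Poly_Mapping.lookup x k = 0"
      by (metis Max_ge finite_insert finite_keys in_keys_iff insertI2 linorder_not_less)
    then show "coeffs_at R \<iota> x \<in> carrier (laurent R)"
      using c unfolding carrier_laurent coeffs_at_def
      by (auto simp: comp_at_closed intro!: exI[of _ "Max (insert 0 (Poly_Mapping.keys x))"])
    show "coeffs_at R \<iota> (x + y) = coeffs_at R \<iota> x \<oplus>\<^bsub>laurent R\<^esub> coeffs_at R \<iota> y"
      using c by (simp add: coeffs_at_def lookup_add)
    show "coeffs_at R \<iota> (x * y) = coeffs_at R \<iota> x \<otimes>\<^bsub>laurent R\<^esub> coeffs_at R \<iota> y"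
    proof
      fix k
      let ?f = "\<lambda>i. comp_at (Poly_Mapping.lookup x i) R \<iota>" and ?g = "\<lambda>i. comp_at (Poly_Mapping.lookup y i) R \<iota>"
      have "coeffs_at R \<iota> (x * y) k = (\<Oplus>\<^bsub>R\<^esub>i\<in>Poly_Mapping.keys x. ?f i \<otimes>\<^bsub>R\<^esub> ?g (k - i))"
        unfolding coeffs_at_def lookup_times_int[OF finite_keys order_refl]
        by (subst cr.phi_sum) (simp_all add: c)
      \<comment> \<open>An element of the product may be nonzero while its component in this factor
        vanishes, so the support in R can be smaller than
        \<open>Poly_Mapping.keys x\<close>.\<close>
      also have "\<dots> = (\<Oplus>\<^bsub>R\<^esub>i\<in>{i. ?f i \<noteq> \<zero>\<^bsub>R\<^esub> \<and> ?g (k - i) \<noteq> \<zero>\<^bsub>R\<^esub>}. ?f i \<otimes>\<^bsub>R\<^esub> ?g (k - i))"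
      proof (rule add.finprod_mono_neutral_cong_right)
        show "{i. ?f i \<noteq> \<zero>\<^bsub>R\<^esub> \<and> ?g (k - i) \<noteq> \<zero>\<^bsub>R\<^esub>} \<subseteq> Poly_Mapping.keys x"
          using c by (auto simp: in_keys_iff)
      qed (use c comp_at_closed[OF c] in auto)
      finally show "coeffs_at R \<iota> (x * y) k = (coeffs_at R \<iota> x \<otimes>\<^bsub>laurent R\<^esub> coeffs_at R \<iota> y) k"
        by (simp add: coeffs_at_def)
    qed
  next
    show "coeffs_at R \<iota> 0 = \<zero>\<^bsub>laurent R\<^esub>" "coeffs_at R \<iota> 1 = \<one>\<^bsub>laurent R\<^esub>"
      using c by (auto simp: coeffs_at_def lookup_one when_def)
  qed auto
qed

lemma coeffs_at_diff:
  assumes c: "calg R \<iota>"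
  shows "coeffs_at R \<iota> (x - y) = coeffs_at R \<iota> x \<ominus>\<^bsub>laurent R\<^esub> coeffs_at R \<iota> y"
proof -
  interpret L: abelian_group "laurent R" by (rule abelian_group_laurent) (rule calg_ring[OF c])
  interpret r: ring_realization "laurent R" UNIV "coeffs_at R \<iota>" by (rule ring_realization_coeffs_at[OF c])
  have cl: "coeffs_at R \<iota> z \<in> carrier (laurent R)" for z
    by (rule r.phi_closed) simp
  have "coeffs_at R \<iota> (- y) \<oplus>\<^bsub>laurent R\<^esub> coeffs_at R \<iota> y = \<zero>\<^bsub>laurent R\<^esub>"
    using r.phi_add[of "- y" y] r.phi_zero by simp
  then have "\<ominus>\<^bsub>laurent R\<^esub> coeffs_at R \<iota> y = coeffs_at R \<iota> (- y)"
    by (intro L.minus_equality cl)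
  then show ?thesis
    using r.phi_add[of x "- y"] by (simp add: a_minus_def)
qed

lemma prod_list_concat: "prod_list (concat xss) = prod_list (map prod_list xss)"
  for xss :: "'a::monoid_mult list list"
  by (induction xss) simp_all

lemma list_all2_concatI: "list_all2 (list_all2 P) xss yss \<Longrightarrow> list_all2 P (concat xss) (concat yss)"
  by (induction rule: list_all2_induct) (auto intro: list_all2_appendI)

section \<open>The Sklyanin product as a product of operators\<close>

context sklyanin_operators
begin

definition rtK :: "nat \<Rightarrow> nat \<Rightarrow> 'c mat2" where
  "rtK i j = (\<lambda>a b k l. iota (U' i - U j) * iota (transpose_fst rK a b k l)
     + iota (- (U' i * h)) * iota (transpose_fst pK a b k l))"

definition factors :: "'c tmat list" where
  "factors = concat (map (\<lambda>i. in_copyc N i (Su (U' i))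
     # map (\<lambda>j. in_copiesc N i j (rtK i j)) [i + 1..<N + 1]) [1..<N + 1])"

lemma factors_linked:
  "list_all2 (linked N) factors (concat (map (\<lambda>i. St i # map (Rij i) [i + 1..<N + 1]) [1..<N + 1]))"
  unfolding factors_def
proof (rule list_all2_concatI)
  have 1: "linked N (in_copyc N i (Su (U' i))) (St i)" if "i \<in> {1..N}" for i
    unfolding St_def using that N_pos by (intro linked_opS) auto
  have 2: "linked N (in_copiesc N i j (rtK i j)) (Rij i j)" if "i \<in> {1..N}" "j \<in> {1..N}" "i \<noteq> j" for i j
    unfolding Rij_def opRtxy_op2s rtK_def[symmetric]
    using that N_pos by (intro linked_op2) auto
  show "list_all2 (list_all2 (linked N))
      (map (\<lambda>i. in_copyc N i (Su (U' i)) # map (\<lambda>j. in_copiesc N i j (rtK i j)) [i + 1..<N + 1]) [1..<N + 1])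
      (map (\<lambda>i. St i # map (Rij i) [i + 1..<N + 1]) [1..<N + 1])"
    by (auto simp: list_all2_map1 list_all2_map2 list_all2_same simp del: upt_Suc intro!: 1 2)
qed

lemma prod_list_Xb: "prod_list (concat (map (\<lambda>i. St i # map (Rij i) [i + 1..<N + 1]) [1..<N + 1])) = Xb 1"
  by (simp add: prod_list_concat Xb_def Cb_def o_def del: upt_Suc)

context
  fixes qc :: complex and emb :: "complex \<Rightarrow> 's"
  assumes qc: "qc \<noteq> 0" and emb_q: "emb qc = q"
    and emb_mult: "\<And>x y. emb (x * y) = emb x * emb y" and emb_uminus: "\<And>x. emb (- x) = - emb x"
    and emb_zero: "emb 0 = 0" and emb_one: "emb 1 = 1"
begin

text \<open>The restriction makes a row of A^q a vector on all copies that ignores those outside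
  1,...,N, in particular copy 0.\<close>

definition Arow :: "(nat \<Rightarrow> nat) \<Rightarrow> (nat \<Rightarrow> nat) \<Rightarrow> 's" where
  "Arow I J = emb (Aq qc N I (restrict J {1..N}))"

lemma restrict_in_range: "in_range J \<Longrightarrow> restrict J {1..N} \<in> tidx N N"
  using in_rangeD(1) by (auto simp: tidx_def)

lemma qalt_all_Arow:
  assumes I: "I \<in> tidx N N"
  shows "qalt_all (\<lambda>J. iota (Arow I J))"
  unfolding qalt_all_def qalt_def
proof (intro ballI allI impI conjI)
  fix a J assume a: "a \<in> {1..<N}" and J: "in_range J"
  note sw = Aq_swap[OF qc a I restrict_in_range[OF J]]
  have r: "restrict J {1..N} a = J a" "restrict J {1..N} (a + 1) = J (Suc a)"
    using a by auto
  show "iota (Arow I J) = 0" if "J a = J (Suc a)"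
    using sw(1) r that by (simp add: Arow_def emb_zero)
  have c: "restrict J {1..N} \<circ> Transposition.transpose a (a + 1)
      = restrict (J(a := J (Suc a), Suc a := J a)) {1..N}"
    using a by (auto simp: fun_eq_iff Transposition.transpose_def restrict_def)
  show "iota (Arow I J) = - (iota q * iota (Arow I (J(a := J (Suc a), Suc a := J a))))" if "J a < J (Suc a)"
  proof -
    have "Aq qc N I (restrict J {1..N}) = - (qc * Aq qc N I (restrict (J(a := J (Suc a), Suc a := J a)) {1..N}))"
      using sw(2) r that unfolding c by simp
    then show ?thesis
      unfolding Arow_def by (simp only: emb_uminus emb_mult emb_q iota_uminus iota_mult)
  qed
qed

lemma Arow_id: "Arow (id_idx N) (idx_id J) = 1"
proof -
  have "restrict (idx_id J) {1..N} = id_idx N"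
    by (auto simp: id_idx_def idx_id_def)
  then show ?thesis by (simp add: Arow_def Aq_id[OF qc] emb_one)
qed

lemma Arow_indep: "Arow I (J(0 := k)) = Arow I J"
proof -
  have "restrict (J(0 := k)) {1..N} = restrict J {1..N}" by auto
  then show ?thesis by (simp add: Arow_def)
qed

definition sk :: 'c where "sk = eigval (Arow (id_idx N))"

lemma sk_central: "p \<in> {1..N} \<Longrightarrow> r \<in> {1..N} \<Longrightarrow> sk * Sm p r = Sm p r * sk"
  unfolding sk_def
  by (rule eigval_central) (auto intro: qalt_all_Arow id_idx_tidx simp: Arow_id Arow_indep)

text \<open>By rank one every row of A^q is a scalar multiple of the row at the identity index, so
  all rows have the same eigenvalue; as the scalars are central, it can be written on the
  right.\<close>

lemma tprodc_sklyanin: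
  assumes I: "I \<in> tidx N N" and J: "J \<in> tidx N N"
  shows "tprodc N N ((\<lambda>I J. iota (emb (Aq qc N I J))) # factors) I J = iota (emb (Aq qc N I J)) * sk"
proof -
  let ?w = "\<lambda>J. iota (Arow I J)" and ?eta = "\<lambda>J. iota (Arow (id_idx N) J)"
  have ext: "restrict (ext_idx N K) {1..N} = K" if "K \<in> tidx N N" for K
    using that by (auto simp: ext_idx_def tidx_def PiE_def extensional_def fun_eq_iff)
  have eta: "qalt_all ?eta"
    by (rule qalt_all_Arow[OF id_idx_tidx])
  have w: "?w K = iota (Arow I (id_idx N)) * ?eta K" if "in_range K" for K
  proof (rule qalt_all_eqI[OF qalt_all_Arow[OF I] _ that])
    show "qalt_all (\<lambda>J. iota (Arow I (id_idx N)) * ?eta J)"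
      using eta by (auto simp: qalt_all_def qalt_scale)
    have "restrict (idx_id K) {1..N} = restrict (id_idx N) {1..N}"
      by (auto simp: id_idx_def idx_id_def)
    then have "Arow I (idx_id K) = Arow I (id_idx N)" by (simp add: Arow_def)
    then show "iota (Arow I (idx_id K)) = iota (Arow I (id_idx N)) * iota (Arow (id_idx N) (idx_id K))"
      by (simp add: Arow_id)
  qed
  have fr: "framed (ext_idx N J)"
    using in_range_ext_idx[OF J N_pos] by (auto simp: framed_def ext_idx_def)
  have "tprodc N N ((\<lambda>I J. iota (emb (Aq qc N I J))) # factors) I J
      = (\<Sum>K\<in>tidx N N. ?w (ext_idx N K) * tprodc N N factors K J)"
    unfolding tprodc_Cons tmulc_def by (intro sum.cong refl) (simp only: Arow_def ext)
  also have "\<dots> = (?w \<triangleleft> Xb 1) (ext_idx N J)"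
    unfolding prod_list_Xb[symmetric] by (rule tprodc_linked[OF factors_linked J])
  also have "\<dots> = ((\<lambda>K. iota (Arow I (id_idx N)) * ?eta K) \<triangleleft> Xb 1) (ext_idx N J)"
    by (rule local_opD[OF local_op_X _ fr]) (rule w, simp add: framed_def)
  also have "\<dots> = iota (Arow I (id_idx N)) * (?eta \<triangleleft> Xb 1) (ext_idx N J)"
    by (rule llin_act_apply[OF llin_X])
  also have "(?eta \<triangleleft> Xb 1) (ext_idx N J) = sk * ?eta (ext_idx N J)"
    unfolding sk_def by (rule X_eigen[OF eta _ _ fr]) (simp_all add: Arow_id Arow_indep)
  also have "iota (Arow I (id_idx N)) * (sk * ?eta (ext_idx N J)) = ?w (ext_idx N J) * sk"
    using w[of "ext_idx N J"] fr by (simp add: framed_def iota_comm[of sk] mult.assoc)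
  finally show ?thesis
    by (simp only: Arow_def ext[OF J])
qed

end

end

section \<open>From the free algebra to U_q(gl_N)\<close>

lemma fscal_hom:
  "fscal (c + d) = fscal c + fscal d" "fscal (c * d) = fscal c * fscal d" "fscal 1 = 1"
  by (simp_all add: fscal_def single_add mult_single)

lemma fscal_central: "p * fscal c = fscal c * p" for p :: "'g fpoly"
proof (rule poly_mapping_eqI)
  fix k :: "'g fmon"
  have 1: "Sum_any (\<lambda>j. (c when 0 = j) when k = i + j) = (c when i = k)" for i
  proof -
    have "Sum_any (\<lambda>j. (c when 0 = j) when k = i + j) = Sum_any (\<lambda>j :: 'g fmon. (c when k = i) when j = 0)"
      by (intro arg_cong[of _ _ Sum_any] ext) (auto simp: when_def)
    then show ?thesis by (simp add: when_def)
  qed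
  have "Poly_Mapping.lookup (p * fscal c) k = Sum_any (\<lambda>i. Poly_Mapping.lookup p i * c when i = k)"
    unfolding fscal_def times_poly_mapping.rep_eq prod_fun_def lookup_single 1 mult_when ..
  then have "Poly_Mapping.lookup (p * fscal c) k = Poly_Mapping.lookup p k * c"
    by simp
  moreover have "Poly_Mapping.lookup (fscal c * p) k
      = Sum_any (\<lambda>i. c * Sum_any (\<lambda>j. Poly_Mapping.lookup p j when k = i + j) when i = 0)"
    unfolding fscal_def times_poly_mapping.rep_eq prod_fun_def lookup_single
    by (intro arg_cong[of _ _ Sum_any] ext) (auto simp: when_def)
  ultimately show "Poly_Mapping.lookup (p * fscal c) k = Poly_Mapping.lookup (fscal c * p) k"
    by (simp add: mult.commute)
qed

lemma central_scalars_fscal: "central_scalars (fscal :: complex \<Rightarrow> 'g fpoly)"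
  by unfold_locales (rule fscal_hom fscal_central)+

lemma ring_realization_free:
  "ring_realization (free_algebra A) (carrier (free_algebra A)) (\<lambda>x. x)"
proof -
  interpret ring "free_algebra A" by (rule ring_free_algebra)
  show ?thesis
    by unfold_locales (simp_all add: free_algebra_closed)
qed

lemma uq_class_hom: "uq_class q N \<in> ring_hom (uq_free N) (Uq_gl q N)"
  unfolding uq_class_def[abs_def] Uq_gl_def by (rule ideal.rcos_ring_hom[OF ideal_uq_ideal])

lemma uq_class_closed: "x \<in> carrier (uq_free N) \<Longrightarrow> uq_class q N x \<in> carrier (Uq_gl q N)"
  by (rule ring_hom_memE(1)[OF uq_class_hom])

lemma uq_class_simps:
  assumes "x \<in> carrier (uq_free N)" "y \<in> carrier (uq_free N)"
  shows "uq_class q N (x + y) = uq_class q N x \<oplus>\<^bsub>Uq_gl q N\<^esub> uq_class q N y"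
    and "uq_class q N (x * y) = uq_class q N x \<otimes>\<^bsub>Uq_gl q N\<^esub> uq_class q N y"
  using ring_hom_memE[OF uq_class_hom[of q N]] assms by auto

lemma uq_class_one: "uq_class q N 1 = \<one>\<^bsub>Uq_gl q N\<^esub>"
  using ring_hom_memE(4)[OF uq_class_hom[of q N]] by simp

lemma uq_class_surj: "x \<in> carrier (Uq_gl q N) \<Longrightarrow> \<exists>p\<in>carrier (uq_free N). x = uq_class q N p"
  by (auto simp: Uq_gl_def FactRing_def A_RCOSETS_def' uq_class_def)

lemma uq_class_eq:
  assumes "x \<in> carrier (uq_free N)" "y \<in> carrier (uq_free N)" "x - y \<in> uq_relators q N"
  shows "uq_class q N x = uq_class q N y"
proof -
  interpret U: ring "Uq_gl q N" by (rule ring_Uq_gl)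
  interpret I: ideal "uq_ideal q N" "uq_free N" by (rule ideal_uq_ideal)
  have m: "x - y \<in> uq_ideal q N"
    unfolding uq_ideal_def
    using ring.genideal_self[OF ring_free_algebra uq_relators_closed] assms(3) by blast
  then have c: "x - y \<in> carrier (uq_free N)"
    by (rule I.Icarr)
  have "uq_class q N (x - y) = \<zero>\<^bsub>Uq_gl q N\<^esub>"
    unfolding uq_class_def Uq_gl_def using I.a_rcos_const[OF m] by (simp add: FactRing_def)
  then have "uq_class q N ((x - y) + y) = uq_class q N y"
    using c assms by (simp only: uq_class_simps uq_class_closed U.l_zero)
  then show ?thesis by simp
qed

lemma calg_Uq_gl: "calg (Uq_gl q N) (uq_scal q N)"
  unfolding calg_def
proof (intro conjI allI ballI)
  show "ring (Uq_gl q N)" by (rule ring_Uq_gl)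
  fix c d
  show "uq_scal q N c \<in> carrier (Uq_gl q N)"
    "uq_scal q N (c + d) = uq_scal q N c \<oplus>\<^bsub>Uq_gl q N\<^esub> uq_scal q N d"
    "uq_scal q N (c * d) = uq_scal q N c \<otimes>\<^bsub>Uq_gl q N\<^esub> uq_scal q N d"
    "uq_scal q N 1 = \<one>\<^bsub>Uq_gl q N\<^esub>"
    by (simp_all add: uq_scal_def fscal_hom uq_class_simps uq_class_closed fscal_closed uq_class_one)
  fix x assume "x \<in> carrier (Uq_gl q N)"
  then obtain p where p: "p \<in> carrier (uq_free N)" "x = uq_class q N p"
    using uq_class_surj by blast
  show "x \<otimes>\<^bsub>Uq_gl q N\<^esub> uq_scal q N c = uq_scal q N c \<otimes>\<^bsub>Uq_gl q N\<^esub> x"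
    unfolding uq_scal_def p(2) uq_class_simps(2)[OF p(1) fscal_closed, symmetric]
      uq_class_simps(2)[OF fscal_closed p(1), symmetric] fscal_central ..
qed

lemma fT_closed:
  "i \<in> {1..N} \<Longrightarrow> j \<in> {1..N} \<Longrightarrow> fT i j \<in> carrier (uq_free N)"
  "i \<in> {1..N} \<Longrightarrow> j \<in> {1..N} \<Longrightarrow> fTb i j \<in> carrier (uq_free N)"
  by (auto intro!: fgen_closed simp: uq_gens_def)

definition lift_class :: "complex \<Rightarrow> nat \<Rightarrow> uq_gen fpoly \<Rightarrow> uq_elem algprod" where
  "lift_class q N p = lift_at (Uq_gl q N) (uq_scal q N) (uq_class q N p)"

lemma lift_class_hom:
  assumes "x \<in> carrier (uq_free N)" "y \<in> carrier (uq_free N)"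
  shows "lift_class q N (x + y) = lift_class q N x + lift_class q N y"
    and "lift_class q N (x * y) = lift_class q N x * lift_class q N y"
    and "lift_class q N (fscal c * x) = iotab c * lift_class q N x"
  unfolding lift_class_def uq_class_simps(1,2)[OF assms] uq_class_simps(2)[OF fscal_closed assms(1)]
    uq_scal_def[symmetric]
  using lift_at_hom[OF calg_Uq_gl uq_class_closed[OF assms(1)] uq_class_closed[OF assms(2)]] by auto

abbreviation emb :: "'a::zero \<Rightarrow> int \<Rightarrow>\<^sub>0 'a" where "emb \<equiv> Poly_Mapping.single 0"

lemma emb_hom:
  "emb (x + y) = emb x + emb y" "emb (x * y) = emb x * emb y" "emb (x - y) = emb x - emb y"
  "emb (- x) = - emb x" for x y :: "'a::ring_1"
  by (simp_all add: single_add mult_single single_diff single_uminus)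

lemma iotaL_emb: "iotaL (emb c) = emb (iotab c)"
proof (rule poly_mapping_eqI)
  fix k
  interpret central_scalars "iotab :: complex \<Rightarrow> 'a algprod" by (rule central_scalars_iotab)
  show "Poly_Mapping.lookup (iotaL (emb c) :: int \<Rightarrow>\<^sub>0 'a algprod) k = Poly_Mapping.lookup (emb (iotab c)) k"
    by (simp add: lookup_single when_def)
qed

lemma hecke_iotaL:
  "q \<noteq> 0 \<Longrightarrow> hecke_operators (iotaL :: _ \<Rightarrow> int \<Rightarrow>\<^sub>0 'a algprod) (emb q) (emb (inverse q))"
  by (intro hecke_operators.intro tensor_operators.intro central_scalars_iotaL hecke_operators_axioms.intro)
    (simp flip: emb_hom)

lemma hecke_fscal:
  "q \<noteq> 0 \<Longrightarrow> hecke_operators (fscal :: _ \<Rightarrow> 'g fpoly) q (inverse q)"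
  by (intro hecke_operators.intro tensor_operators.intro central_scalars_fscal hecke_operators_axioms.intro)
    simp

text \<open>The operator calculus applies to the free algebra itself, with \<open>fscal\<close> as
  scalars, and computes the entries of the relators by the same kernel rules as before.\<close>

lemma rtt_entries:
  assumes q: "q \<noteq> 0" and N: "N \<ge> 1"
    and A: "\<And>i j. i \<in> {1..N} \<Longrightarrow> j \<in> {1..N} \<Longrightarrow> A i j \<in> carrier (uq_free N)"
    and B: "\<And>i j. i \<in> {1..N} \<Longrightarrow> j \<in> {1..N} \<Longrightarrow> B i j \<in> carrier (uq_free N)"
    and ij: "i \<in> {1..N}" "j \<in> {1..N}" "a \<in> {1..N}" "b \<in> {1..N}"
  shows "(fscal (if i = j then q else 1) * (A i a * B j b)
        + (if i < j then fscal (q - inverse q) * (A j a * B i b) else 0))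
      - (fscal (if a = b then q else 1) * (B j b * A i a)
        + (if b < a then fscal (q - inverse q) * (B j a * A i b) else 0)) \<in> rtt_relators q N A B"
proof -
  interpret f: hecke_operators "fscal :: complex \<Rightarrow> uq_gen fpoly" N q "inverse q" by (rule hecke_fscal[OF q])
  interpret r: ring_realization "uq_free N" "carrier (uq_free N)" "\<lambda>x. x" by (rule ring_realization_free)
  define I J where "I = (\<lambda>c\<in>{1..2::nat}. if c = 1 then i else j)" and "J = (\<lambda>c\<in>{1..2::nat}. if c = 1 then a else b)"
  have I: "I \<in> tidx 2 N" and J: "J \<in> tidx 2 N"
    using ij by (auto simp: I_def J_def tidx_def)
  have IJ: "I 1 = i" "I 2 = j" "J 1 = a" "J 2 = b"
    by (simp_all add: I_def J_def)
  let ?R = "in_copies (uq_free N) 2 1 2 (\<lambda>i j k l. fscal (Rmat q i j k l))"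
  let ?Rc = "in_copiesc 2 1 2 (\<lambda>i j k l. fscal (f.rK i j k l))"
  have rK: "f.rK = Rmat q"
    by (simp add: f.rK_def Rmat_def f.h_def fun_eq_iff)
  \<comment> \<open>Acting on the delta vector at \<open>I\<close> extracts one entry of the
    product.\<close>
  have kernel: "tprodc 2 N Ms I J = M i a j b"
    if "list_all2 (f.linked 2) Ms Zs" "prod_list Zs = f.op2 1 2 M" for Ms Zs M
  proof -
    define w :: "(nat \<Rightarrow> nat) \<Rightarrow> uq_gen fpoly" where "w K = (if K = ext_idx 2 I then 1 else 0)" for K
    have inj: "ext_idx 2 K = ext_idx 2 I \<longleftrightarrow> K = I" if "K \<in> tidx 2 N" for K
    proof
      assume eq: "ext_idx 2 K = ext_idx 2 I"
      show "K = I"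
      proof
        fix c
        show "K c = I c"
          using fun_cong[OF eq, of c] that I
          by (cases "c \<in> {1..2}") (auto simp: ext_idx_def tidx_def PiE_def extensional_def)
      qed
    qed simp
    have "(\<Sum>K\<in>tidx 2 N. w (ext_idx 2 K) * tprodc 2 N Ms K J) = (\<Sum>K\<in>tidx 2 N. if K = I then tprodc 2 N Ms K J else 0)"
      by (intro sum.cong refl) (auto simp: w_def inj)
    then have "tprodc 2 N Ms I J = (\<Sum>K\<in>tidx 2 N. w (ext_idx 2 K) * tprodc 2 N Ms K J)"
      using I by (simp add: sum.delta)
    also have "\<dots> = (w \<triangleleft> f.op2 1 2 M) (ext_idx 2 J)"
      using f.tprodc_linked[OF that(1) J, of w] that(2) by simp
    also have "\<dots> = (\<Sum>k=1..N. \<Sum>l=1..N. if k = i \<and> l = j then M k a l b else 0)"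
    proof -
      have e: "(ext_idx 2 J)(1 := k, 2 := l) = ext_idx 2 I \<longleftrightarrow> k = i \<and> l = j" for k l
      proof
        assume eq: "(ext_idx 2 J)(1 := k, 2 := l) = ext_idx 2 I"
        show "k = i \<and> l = j"
          using fun_cong[OF eq, of 1] fun_cong[OF eq, of 2] IJ by (simp add: ext_idx_def)
      next
        assume "k = i \<and> l = j"
        then show "(ext_idx 2 J)(1 := k, 2 := l) = ext_idx 2 I"
          using IJ by (auto simp: ext_idx_def fun_eq_iff le_Suc_eq numeral_2_eq_2)
      qed
      have v: "ext_idx 2 J 1 = a" "ext_idx 2 J 2 = b"
        using IJ by (simp_all add: ext_idx_def)
      show ?thesis
        unfolding f.act_op2 if_P[OF f.in_range_ext_idx[OF J N]] v w_def e
        by (intro sum.cong refl) simp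
    qed
    also have "\<dots> = M i a j b"
      by (rule f.sum2_single[OF ij(1,2)])
    finally show ?thesis .
  qed
  have two: "(1::nat) \<noteq> 2" "(1::nat) \<in> {1..2}" "(2::nat) \<in> {1..2}" by auto
  note l1 = f.linked_opS[OF two(2) N] and l2 = f.linked_opS[OF two(3) N]
    and lR = f.linked_op2[OF two(2,3,1) N, of "\<lambda>i j k l. fscal (f.rK i j k l)"]
  have opR: "f.op2 1 2 (\<lambda>i j k l. fscal (f.rK i j k l)) = f.opR 1 2"
    by (simp add: f.opR_def f.op2s_def)
  have L: "tprodc 2 N [?Rc, in_copyc 2 1 A, in_copyc 2 2 B] I J
      = fscal (f.qd i j) * (A i a * B j b) + (if i < j then fscal f.h * (A j a * B i b) else 0)"
    by (rule kernel[of _ "[f.opR 1 2, f.opS 1 A, f.opS 2 B]"])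
      (use l1 l2 lR in \<open>simp_all add: opR f.opS_opS[OF two(1)] f.opR_op2[OF two(1)] del: One_nat_def\<close>)
  have R: "tprodc 2 N [in_copyc 2 2 B, in_copyc 2 1 A, ?Rc] I J
      = fscal (f.qd a b) * (B j b * A i a) + (if b < a then fscal f.h * (B j a * A i b) else 0)"
    by (rule kernel[of _ "[f.opS 2 B, f.opS 1 A, f.opR 1 2]"])
      (use l1 l2 lR in \<open>simp_all add: opR f.opS_opS[OF two(1)] f.op2_opR[OF two(1)] del: One_nat_def
        flip: mult.assoc\<close>)
  have rg: "K 1 \<in> {1..N}" "K 2 \<in> {1..N}" if "K \<in> tidx 2 N" for K
    using tidx_range[OF that] by auto
  have cR: "\<forall>I\<in>tidx 2 N. \<forall>J\<in>tidx 2 N. ?Rc I J \<in> carrier (uq_free N) \<and> ?R I J = ?Rc I J"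
    by (simp add: in_copies_def in_copiesc_def rK fscal_closed free_algebra_closed)
  have cA: "\<forall>I\<in>tidx 2 N. \<forall>J\<in>tidx 2 N. in_copyc 2 1 A I J \<in> carrier (uq_free N)
      \<and> in_copy (uq_free N) 2 1 A I J = in_copyc 2 1 A I J"
    using A rg by (auto simp: in_copy_def in_copyc_def free_algebra_closed simp del: One_nat_def)
  have cB: "\<forall>I\<in>tidx 2 N. \<forall>J\<in>tidx 2 N. in_copyc 2 2 B I J \<in> carrier (uq_free N)
      \<and> in_copy (uq_free N) 2 2 B I J = in_copyc 2 2 B I J"
    using B rg by (auto simp: in_copy_def in_copyc_def free_algebra_closed)
  have e1: "tprod (uq_free N) 2 N [?R, in_copy (uq_free N) 2 1 A, in_copy (uq_free N) 2 2 B] I J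
      = tprodc 2 N [?Rc, in_copyc 2 1 A, in_copyc 2 2 B] I J"
    by (rule r.tprod_eq[THEN conjunct1, OF _ I J]) (use cR cA cB in simp)
  have e2: "tprod (uq_free N) 2 N [in_copy (uq_free N) 2 2 B, in_copy (uq_free N) 2 1 A, ?R] I J
      = tprodc 2 N [in_copyc 2 2 B, in_copyc 2 1 A, ?Rc] I J"
    by (rule r.tprod_eq[THEN conjunct1, OF _ I J]) (use cR cA cB in simp)
  have "tprod (uq_free N) 2 N [?R, in_copy (uq_free N) 2 1 A, in_copy (uq_free N) 2 2 B] I J
      - tprod (uq_free N) 2 N [in_copy (uq_free N) 2 2 B, in_copy (uq_free N) 2 1 A, ?R] I J
      \<in> rtt_relators q N A B"
    unfolding rtt_relators_def Let_def using I J by (intro CollectI exI conjI) (rule refl)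
  then show ?thesis
    unfolding e1 e2 L R f.qd_def f.h_def .
qed

text \<open>The relations are homogeneous of degree 2 in the generators, so they survive the
  extension by 0 although it does not preserve the unit.\<close>

lemma RTT_lift:
  assumes q: "q \<noteq> 0" and N: "N \<ge> 1"
    and A: "\<And>i j. i \<in> {1..N} \<Longrightarrow> j \<in> {1..N} \<Longrightarrow> A i j \<in> carrier (uq_free N)"
    and B: "\<And>i j. i \<in> {1..N} \<Longrightarrow> j \<in> {1..N} \<Longrightarrow> B i j \<in> carrier (uq_free N)"
    and sub: "rtt_relators q N A B \<subseteq> uq_relators q N"
  shows "hecke_operators.RTT iotaL N (emb q) (emb (inverse q))
    (\<lambda>i j. emb (lift_class q N (A i j))) (\<lambda>i j. emb (lift_class q N (B i j)))"
proof -
  interpret L: hecke_operators "iotaL :: _ \<Rightarrow> int \<Rightarrow>\<^sub>0 uq_elem algprod" N "emb q" "emb (inverse q)"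
    by (rule hecke_iotaL[OF q])
  have qd: "L.qd i j = emb (if i = j then q else 1)" for i j
    by (simp add: L.qd_def)
  have h: "L.h = emb (q - inverse q)"
    by (simp add: L.h_def emb_hom)
  show ?thesis
    unfolding L.RTT_def
  proof (intro ballI)
    fix i j a b assume ij: "i \<in> {1..N}" "j \<in> {1..N}" "a \<in> {1..N}" "b \<in> {1..N}"
    let ?x = "fscal (if i = j then q else 1) * (A i a * B j b)
        + (if i < j then fscal (q - inverse q) * (A j a * B i b) else 0)"
    let ?y = "fscal (if a = b then q else 1) * (B j b * A i a)
        + (if b < a then fscal (q - inverse q) * (B j a * A i b) else 0)"
    have c: "A k l \<in> carrier (uq_free N)" "B k l \<in> carrier (uq_free N)" if "k \<in> {i, j}" "l \<in> {a, b}" for k l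
      using that ij A B by auto
    have xy: "?x \<in> carrier (uq_free N)" "?y \<in> carrier (uq_free N)"
      using c by (auto intro!: free_algebra_closed fscal_closed)
    have "?x - ?y \<in> rtt_relators q N A B"
      by (rule rtt_entries) (use q N A B ij in auto)
    from uq_class_eq[OF xy subsetD[OF sub this]] have "lift_class q N ?x = lift_class q N ?y"
      unfolding lift_class_def by (rule arg_cong)
    moreover have m: "lift_class q N (fscal s * (x * y)) = iotab s * (lift_class q N x * lift_class q N y)"
      "fscal s * (x * y) \<in> carrier (uq_free N)"
      if "x \<in> carrier (uq_free N)" "y \<in> carrier (uq_free N)" for s x y
      using lift_class_hom(3)[OF free_algebra_closed(5)[OF that] that(1)] lift_class_hom(2)[OF that] that
      by (auto intro!: free_algebra_closed fscal_closed)
    have lx: "lift_class q N (fscal s * (x * y) + (if P then fscal t * (x' * y') else 0))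
        = iotab s * (lift_class q N x * lift_class q N y)
          + (if P then iotab t * (lift_class q N x' * lift_class q N y') else 0)"
      if "x \<in> carrier (uq_free N)" "y \<in> carrier (uq_free N)" "x' \<in> carrier (uq_free N)" "y' \<in> carrier (uq_free N)"
      for s t x y x' y' P
      using m[OF that(1,2), of s] m[OF that(3,4), of t] lift_class_hom(1)[of "fscal s * (x * y)" N]
      by (cases P) simp_all
    ultimately have eq: "iotab (if i = j then q else 1) * (lift_class q N (A i a) * lift_class q N (B j b))
        + (if i < j then iotab (q - inverse q) * (lift_class q N (A j a) * lift_class q N (B i b)) else 0)
      = iotab (if a = b then q else 1) * (lift_class q N (B j b) * lift_class q N (A i a))
        + (if b < a then iotab (q - inverse q) * (lift_class q N (B j a) * lift_class q N (A i b)) else 0)"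
      using c by (simp only: lx insert_iff simp_thms)
    show "iotaL (L.qd i j) * (emb (lift_class q N (A i a)) * emb (lift_class q N (B j b)))
        + (if i < j then iotaL L.h * (emb (lift_class q N (A j a)) * emb (lift_class q N (B i b))) else 0)
      = iotaL (L.qd a b) * (emb (lift_class q N (B j b)) * emb (lift_class q N (A i a)))
        + (if b < a then iotaL L.h * (emb (lift_class q N (B j a)) * emb (lift_class q N (A i b))) else 0)"
      unfolding qd h iotaL_emb using arg_cong[OF eq, of emb]
      by (simp only: emb_hom(1,2) if_distrib[of emb] single_zero)
  qed
qed

section \<open>The twisted algebras\<close>

definition reflection_matrix :: "complex \<Rightarrow> complex mat \<Rightarrow> nat \<Rightarrow> nat \<Rightarrow> nat \<Rightarrow> nat \<Rightarrow> bool" where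
  "reflection_matrix q G i j k l \<longleftrightarrow> (let h = q - inverse q; qd = (\<lambda>x y::nat. if x = y then q else 1) in
      qd i k * (qd j k * (G i j * G k l) + (if j < k then h * (G i k * G j l) else 0))
      + (if i < k then h * (qd j i * (G k j * G i l) + (if j < i then h * (G k i * G j l) else 0)) else 0)
      = qd j l * (qd l i * (G k l * G i j) + (if l < i then h * (G k i * G l j) else 0))
      + (if l < j then h * (qd j i * (G k j * G i l) + (if j < i then h * (G k i * G j l) else 0)) else 0))"

lemma reflection_matrix_one: "reflection_matrix q (\<lambda>i j. if i = j then 1 else 0) i j k l"
  unfolding reflection_matrix_def Let_def
  by (cases "i = j"; cases "k = l"; cases "i = k"; cases "j = l"; cases "j = k"; cases "i = l"; simp)

text \<open>G has a single nonzero entry in each row, at the partner \<open>pr\<close> of the row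
  index within its pair {2m-1, 2m}. This leaves few index patterns, on which only the order and the
  parities matter.\<close>

lemma reflection_matrix_Gmat:
  assumes "q \<noteq> 0" "i \<ge> 1" "j \<ge> 1" "k \<ge> 1" "l \<ge> 1"
  shows "reflection_matrix q (Gmat q) i j k l"
proof -
  define pr where "pr x = (if odd x then x + 1 else x - 1)" for x :: nat
  define g where "g x = (if odd x then q else - 1)" for x :: nat
  have G: "Gmat q x y = (if y = pr x then g x else 0)" if "x \<ge> 1" "y \<ge> 1" for x y
    using that by (auto simp: Gmat_def pr_def g_def elim!: oddE evenE)
  have pp: "pr (pr x) = x" "pr x \<ge> 1" "odd (pr x) = even x" "pr x \<noteq> x" if "x \<ge> 1" for x
    using that by (auto simp: pr_def)
  \<comment> \<open>For indices from different pairs the order does not change when one of them is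
    replaced by its partner.\<close>
  have lt: "pr x < y \<longleftrightarrow> x < y" "y < pr x \<longleftrightarrow> y < x" if "x \<ge> 1" "y \<ge> 1" "x \<noteq> y" "y \<noteq> pr x" for x y
    using that by (auto simp: pr_def split: if_splits)
  have ps: "y = pr x \<longleftrightarrow> x = pr y" if "x \<ge> 1" "y \<ge> 1" for x y
    using pp that by metis
  have lo: "x < pr x \<longleftrightarrow> odd x" "pr x < x \<longleftrightarrow> even x" if "x \<ge> 1" for x
    using that by (auto simp: pr_def)
  have gg: "g (pr x) = (if odd x then - 1 else q)" if "x \<ge> 1" for x
    using pp that by (simp add: g_def)
  \<comment> \<open>The row indices coincide, are partners, or belong to different pairs; in the
    last case the terms with \<open>G i k\<close> and \<open>G k i\<close> vanish.\<close>
  have "i = k \<or> k = pr i \<or> (i \<noteq> k \<and> k \<noteq> pr i)" by blast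
  then consider "i = k" | "k = pr i" | "i \<noteq> k" "k \<noteq> pr i" by blast
  then show ?thesis
  proof cases
    case 1
    then show ?thesis
      unfolding reflection_matrix_def Let_def using assms pp[of i]
      by (cases "j = pr i"; cases "l = pr i"; simp add: G)
  next
    case 2
    have k: "k \<ge> 1" "pr k = i" "k \<noteq> i" using 2 pp[of i] assms by auto
    consider "j = k" | "j = i" | "j \<noteq> k" "j \<noteq> i" by blast
    then show ?thesis
    proof cases
      case 1
      then show ?thesis
        unfolding reflection_matrix_def Let_def using assms k 2[symmetric] lo[of i] ps[of l k]
        by (cases "l = i"; simp add: G)
    next
      case b: 2
      show ?thesis
        unfolding reflection_matrix_def Let_def using assms k 2[symmetric] lo[of i] b gg[of i] ps[of l i]
        by (cases "l = k"; cases "odd i"; simp add: G g_def field_simps)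
    next
      case b: 3
      have e: "j < k \<longleftrightarrow> j < i" "pr j < i \<longleftrightarrow> j < i"
        using lt[of i j] lt[of j i] assms b 2 k ps[of i j] by auto
      have n: "pr j \<noteq> i" "pr j \<noteq> k" "pr j \<noteq> j"
        using b 2 k pp assms by metis+
      have z: "Gmat q i j = 0" "Gmat q k j = 0" "Gmat q i k = g i" "Gmat q k i = g k"
        using G assms b 2 k by auto
      show ?thesis
      proof (cases "l = pr j")
        case True
        have l: "l \<ge> 1" "pr l = j" "l \<noteq> j" using True pp[of j] assms by auto
        have w: "Gmat q j l = g j" "Gmat q l j = g l"
          using G assms True l by auto
        have lj: "l < j \<longleftrightarrow> even j" "l < i \<longleftrightarrow> j < i" "i < k \<longleftrightarrow> odd i"
          using lo[of j] lo[of i] e True 2 assms by auto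
        have gv: "g i = (if odd i then q else - 1)" "g k = (if odd i then - 1 else q)"
          "g j = (if odd j then q else - 1)" "g l = (if odd j then - 1 else q)"
          using gg[of i] gg[of j] assms 2 True by (simp_all add: g_def)
        show ?thesis
          unfolding reflection_matrix_def Let_def z w lj gv e using k(3) l(3) assms(1)
          by (cases "odd i"; cases "odd j"; cases "j < i"; simp add: field_simps)
      next
        case False
        then have "Gmat q j l = 0" "Gmat q l j = 0"
          using G assms ps[of j l] by auto
        then show ?thesis
          unfolding reflection_matrix_def Let_def z by simp
      qed
    qed
  next
    case 3
    have n: "pr i \<noteq> k" "pr k \<noteq> i" "pr i \<noteq> pr k"
      using 3 pp(1)[OF assms(2)] pp(1)[OF assms(4)] by auto
    have p1: "pr i \<ge> 1" "pr k \<ge> 1"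
      using pp(2) assms by auto
    have "pr i < pr k \<longleftrightarrow> pr i < k"
      using lt(2)[of k "pr i"] assms n p1 by auto
    also have "\<dots> \<longleftrightarrow> i < k"
      using lt(1)[of i k] assms 3 by auto
    finally have e: "pr i < pr k \<longleftrightarrow> i < k" .
    have z: "Gmat q i k = 0" "Gmat q k i = 0"
      using G assms 3 n by auto
    consider "j = pr i" "l = pr k" | "j = pr k" "l = pr i" | "j \<noteq> pr i \<or> l \<noteq> pr k" "j \<noteq> pr k \<or> l \<noteq> pr i"
      by blast
    then show ?thesis
    proof cases
      case 1
      then have "Gmat q k j = 0" "j \<noteq> k" "j \<noteq> l" "l \<noteq> i"
        using G assms n by auto
      then show ?thesis
        unfolding reflection_matrix_def Let_def z using 3(1) by simp
    next
      case 2
      then have "Gmat q i j = 0" "j \<noteq> i" "l < j \<longleftrightarrow> i < k"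
        using G assms n e by auto
      then show ?thesis
        unfolding reflection_matrix_def Let_def z using 3(1) by simp
    next
      case 3
      then have "Gmat q i j = 0 \<or> Gmat q k l = 0" "Gmat q k j = 0 \<or> Gmat q i l = 0"
        using G assms by auto
      then show ?thesis
        unfolding reflection_matrix_def Let_def z by auto
    qed
  qed
qed

lemma lookup_times_emb:
  fixes x :: "int \<Rightarrow>\<^sub>0 'b::ring_1"
  shows "Poly_Mapping.lookup (x * emb s) k = Poly_Mapping.lookup x k * s"
    and "Poly_Mapping.lookup (emb s * x) k = s * Poly_Mapping.lookup x k"
proof -
  have "Poly_Mapping.lookup (x * emb s) k
      = (\<Sum>i\<in>insert k (Poly_Mapping.keys x). if i = k then Poly_Mapping.lookup x i * s else 0)"
    by (subst lookup_times_int[of "insert k (Poly_Mapping.keys x)"];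
        (rule sum.cong)?; auto simp: lookup_single when_def)
  then show "Poly_Mapping.lookup (x * emb s) k = Poly_Mapping.lookup x k * s"
    by (simp add: sum.delta)
  show "Poly_Mapping.lookup (emb s * x) k = s * Poly_Mapping.lookup x k"
    by (subst lookup_times_int[of "{0}"]) auto
qed

text \<open>Multiplication sums over the joint support, which is {0} or empty; it is empty also if R
  is the zero ring, where \<open>d k\<close> is 0 anyway.\<close>

lemma lmonom_one_mult:
  assumes "ring R" "d \<in> carrier (laurent R)"
  shows "lmonom R \<one>\<^bsub>R\<^esub> 0 \<otimes>\<^bsub>laurent R\<^esub> d = d"
proof
  fix k
  interpret ring R by fact
  have d: "d k \<in> carrier R" using assms(2) by (simp add: carrier_laurent)
  let ?D = "{i. lmonom R \<one>\<^bsub>R\<^esub> 0 i \<noteq> \<zero>\<^bsub>R\<^esub> \<and> d (k - i) \<noteq> \<zero>\<^bsub>R\<^esub>}"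
  have "(lmonom R \<one>\<^bsub>R\<^esub> 0 \<otimes>\<^bsub>laurent R\<^esub> d) k = (\<Oplus>\<^bsub>R\<^esub>i\<in>?D. lmonom R \<one>\<^bsub>R\<^esub> 0 i \<otimes>\<^bsub>R\<^esub> d (k - i))"
    by simp
  also have "\<dots> = d k"
  proof (cases "\<one>\<^bsub>R\<^esub> \<noteq> \<zero>\<^bsub>R\<^esub> \<and> d k \<noteq> \<zero>\<^bsub>R\<^esub>")
    case True
    then have "?D = {0}"
      by (auto simp: lmonom_def split: if_splits)
    then show ?thesis
      using d by (simp add: lmonom_def)
  next
    case False
    then have "?D = {}"
      by (auto simp: lmonom_def split: if_splits)
    moreover have "d k = \<zero>\<^bsub>R\<^esub>"
      using False d by (metis l_null l_one)
    ultimately show ?thesis by (simp only: finsum_empty)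
  qed
  finally show "(lmonom R \<one>\<^bsub>R\<^esub> 0 \<otimes>\<^bsub>laurent R\<^esub> d) k = d k" .
qed

lemma (in ring) generate_ring_commute:
  assumes z: "z \<in> carrier R" and H: "H \<subseteq> carrier R"
    and comm: "\<And>x. x \<in> H \<Longrightarrow> z \<otimes> x = x \<otimes> z" and x: "x \<in> generate_ring R H"
  shows "z \<otimes> x = x \<otimes> z"
  using x
proof induction
  case (a_inv x)
  then show ?case
    using z generate_ring_in_carrier[OF H] by (simp add: r_minus l_minus)
next
  case (eng_add x y)
  then show ?case
    using z generate_ring_in_carrier[OF H] by (simp add: r_distr l_distr)
next
  case (eng_mult x y)
  have c: "x \<in> carrier R" "y \<in> carrier R"
    using eng_mult generate_ring_in_carrier[OF H] by auto
  have "z \<otimes> (x \<otimes> y) = (z \<otimes> x) \<otimes> y"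
    using z c by (simp add: m_assoc)
  also have "\<dots> = x \<otimes> (z \<otimes> y)"
    using z c by (simp add: eng_mult m_assoc)
  also have "\<dots> = x \<otimes> y \<otimes> z"
    using z c by (simp add: eng_mult m_assoc)
  finally show ?case .
qed (use z comm in auto)

lemma (in ring) commute_inv:
  assumes "z \<in> carrier R" "x \<in> Units R" "z \<otimes> x = x \<otimes> z"
  shows "z \<otimes> inv x = inv x \<otimes> z"
proof -
  have x: "x \<in> carrier R" "inv x \<in> carrier R" "inv x \<otimes> x = \<one>" "x \<otimes> inv x = \<one>"
    using assms(2) by auto
  have "z \<otimes> inv x = (inv x \<otimes> x) \<otimes> (z \<otimes> inv x)"
    using x assms(1) by simp
  also have "\<dots> = inv x \<otimes> (x \<otimes> z) \<otimes> inv x"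
    using x(1,2) assms(1) by (simp add: m_assoc)
  also have "\<dots> = inv x \<otimes> z \<otimes> (x \<otimes> inv x)"
    using x(1,2) assms(1) by (simp add: m_assoc flip: assms(3))
  finally show ?thesis
    using x assms(1) by simp
qed

text \<open>A common frame for both families, with G the identity in the orthogonal case. The matrix
  equations are restricted to the index range because the orthogonal S and Sbar are defined without
  a factor G, and inserting the identity is harmless only there.\<close>

locale twisted_algebra =
  fixes q :: complex and N :: nat and G :: "complex mat" and \<kappa> \<kappa>' c :: complex
    and S Sb :: "uq_elem mat"
  assumes q0: "q \<noteq> 0" and q2: "q * q \<noteq> 1" and N1: "N \<ge> 1"
    and G_sym: "\<And>x y. x \<in> {1..N} \<Longrightarrow> y \<in> {1..N} \<Longrightarrow>
      (if x = y then q else 1) * G y x + (if y < x then (q - inverse q) * G x y else 0) = \<kappa> * G x y"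
    and G_refl: "\<And>i j k l. i \<in> {1..N} \<Longrightarrow> j \<in> {1..N} \<Longrightarrow> k \<in> {1..N} \<Longrightarrow> l \<in> {1..N} \<Longrightarrow>
      reflection_matrix q G i j k l"
    and kappa: "\<kappa> * \<kappa>' = 1" and ck: "c * c * \<kappa> = \<kappa>'"
    and S_eq: "\<And>i j. i \<in> {1..N} \<Longrightarrow> j \<in> {1..N} \<Longrightarrow> S i j = mat_mul (Uq_gl q N) N
      (mat_mul (Uq_gl q N) N (Tmat q N) (\<lambda>i j. uq_scal q N (G i j))) (mat_transpose (Tbmat q N)) i j"
    and Sb_eq: "\<And>i j. i \<in> {1..N} \<Longrightarrow> j \<in> {1..N} \<Longrightarrow> Sb i j = mat_mul (Uq_gl q N) N
      (mat_mul (Uq_gl q N) N (Tbmat q N) (\<lambda>i j. uq_scal q N (G i j))) (mat_transpose (Tmat q N)) i j"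
begin

abbreviation R :: "uq_elem ring" where "R \<equiv> Uq_gl q N"
abbreviation \<iota> :: "complex \<Rightarrow> uq_elem" where "\<iota> \<equiv> uq_scal q N"
abbreviation tau :: "uq_gen fpoly \<Rightarrow> uq_elem algprod" where "tau \<equiv> lift_class q N"
abbreviation ui :: "nat \<Rightarrow> complex" where "ui i \<equiv> q powi (2 - 2 * int i)"

lemma ui_nonzero: "ui i \<noteq> 0"
  using q0 by simp

text \<open>The u_i are Laurent monomials, hence invertible, with consecutive quotient q^{-2}. The
  last parameter is the inverse of 2 (1 - q^{-2}), available since q^2 \<noteq> 1.\<close>

lemma sklyanin_locale:
  "sklyanin_operators iotaL N (emb q) (emb (inverse q)) (\<lambda>i j. emb (tau (fT i j))) (\<lambda>i j. emb (tau (fTb i j)))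
    (\<lambda>i j. emb (G i j)) (emb \<kappa>) (emb \<kappa>') (emb c)
    (\<lambda>i. Poly_Mapping.single 1 (ui i)) (\<lambda>i. Poly_Mapping.single (- 1) (inverse (ui i)))
    (emb (1 / (2 * (1 - inverse q * inverse q))))"
proof -
  interpret L: hecke_operators "iotaL :: _ \<Rightarrow> int \<Rightarrow>\<^sub>0 uq_elem algprod" N "emb q" "emb (inverse q)"
    by (rule hecke_iotaL[OF q0])
  have qd: "L.qd i j = emb (if i = j then q else 1)" for i j
    by (simp add: L.qd_def)
  have h: "L.h = emb (q - inverse q)"
    by (simp add: L.h_def emb_hom)
  have sub: "rtt_relators q N fT fT \<subseteq> uq_relators q N" "rtt_relators q N fTb fTb \<subseteq> uq_relators q N"
    "rtt_relators q N fTb fT \<subseteq> uq_relators q N"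
    unfolding uq_relators_def by blast+
  have two: "(2 :: int \<Rightarrow>\<^sub>0 complex) = emb 2"
    by (metis one_add_one single_add single_one)
  show ?thesis
  proof
    show "L.RTT (\<lambda>i j. emb (tau (fT i j))) (\<lambda>i j. emb (tau (fT i j)))"
      "L.RTT (\<lambda>i j. emb (tau (fTb i j))) (\<lambda>i j. emb (tau (fTb i j)))"
      "L.RTT (\<lambda>i j. emb (tau (fTb i j))) (\<lambda>i j. emb (tau (fT i j)))"
      by (intro RTT_lift q0 N1 fT_closed sub; assumption)+
    show "emb \<kappa> * emb \<kappa>' = 1" "emb c * emb c * emb \<kappa> = emb \<kappa>'"
      by (simp_all add: kappa ck flip: emb_hom)
    show "1 \<le> N" by (rule N1)
    fix i
    show "Poly_Mapping.single (1::int) (ui i) * Poly_Mapping.single (- 1) (inverse (ui i)) = 1"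
      by (simp only: mult_single right_minus right_inverse[OF ui_nonzero] single_one)
    have u: "ui (Suc i) = inverse q * inverse q * ui i"
    proof -
      have "2 - 2 * int (Suc i) = (2 - 2 * int i) + (- 2)" by simp
      then have "ui (Suc i) = ui i * q powi (- 2)"
        by (simp only: power_int_add[OF disjI1[OF q0]])
      also have "q powi (- 2) = inverse q * inverse q"
        by (simp add: power_int_minus power2_eq_square)
      finally show ?thesis by simp
    qed
    show "Poly_Mapping.single (1::int) (ui (Suc i)) = emb (inverse q) * emb (inverse q) * Poly_Mapping.single 1 (ui i)"
      unfolding u by (simp add: mult_single)
    show "Poly_Mapping.single (- 1 :: int) (inverse (ui (Suc i)))
        = emb q * emb q * Poly_Mapping.single (- 1) (inverse (ui i))"
      unfolding u by (simp add: mult_single)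
  next
    have "1 - inverse q * inverse q \<noteq> 0"
      using q0 q2 by (simp add: field_simps)
    then have "1 / (2 * (1 - inverse q * inverse q)) * (2 * (1 - inverse q * inverse q)) = 1"
      by simp
    from arg_cong[OF this, of emb]
    show "emb (1 / (2 * (1 - inverse q * inverse q))) * (2 * (1 - emb (inverse q) * emb (inverse q))) = 1"
      by (simp only: emb_hom two single_one)
  next
    fix x y assume "x \<in> {1..N}" "y \<in> {1..N}"
    from arg_cong[OF G_sym[OF this], of emb]
    show "L.qd x y * emb (G y x) + (if y < x then L.h * emb (G x y) else 0) = emb \<kappa> * emb (G x y)"
      unfolding qd h by (simp only: emb_hom(1,2) if_distrib[of emb] single_zero)
  next
    fix i j k l assume "i \<in> {1..N}" "j \<in> {1..N}" "k \<in> {1..N}" "l \<in> {1..N}"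
    from arg_cong[OF G_refl[OF this, unfolded reflection_matrix_def Let_def], of emb]
    show "L.qd i k * (L.qd j k * (emb (G i j) * emb (G k l)) + (if j < k then L.h * (emb (G i k) * emb (G j l)) else 0))
      + (if i < k then L.h * (L.qd j i * (emb (G k j) * emb (G i l))
          + (if j < i then L.h * (emb (G k i) * emb (G j l)) else 0)) else 0)
      = L.qd j l * (L.qd l i * (emb (G k l) * emb (G i j)) + (if l < i then L.h * (emb (G k i) * emb (G l j)) else 0))
      + (if l < j then L.h * (L.qd j i * (emb (G k j) * emb (G i l))
          + (if j < i then L.h * (emb (G k i) * emb (G j l)) else 0)) else 0)"
      unfolding qd h by (simp only: emb_hom(1,2) if_distrib[of emb] single_zero)
  qed
qed

interpretation L: sklyanin_operators "iotaL :: _ \<Rightarrow> int \<Rightarrow>\<^sub>0 uq_elem algprod" N "emb q" "emb (inverse q)"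
    "\<lambda>i j. emb (tau (fT i j))" "\<lambda>i j. emb (tau (fTb i j))" "\<lambda>i j. emb (G i j)" "emb \<kappa>" "emb \<kappa>'" "emb c"
    "\<lambda>i. Poly_Mapping.single 1 (ui i)" "\<lambda>i. Poly_Mapping.single (- 1) (inverse (ui i))"
    "emb (1 / (2 * (1 - inverse q * inverse q)))"
  by (rule sklyanin_locale)

interpretation U: ring R by (rule ring_Uq_gl)

interpretation cr: ring_realization R UNIV "\<lambda>x. comp_at x R \<iota>"
  by (rule ring_realization_comp_at[OF calg_Uq_gl])

interpretation rr: ring_realization "laurent R" UNIV "coeffs_at R \<iota>"
  by (rule ring_realization_coeffs_at[OF calg_Uq_gl])

definition sB :: "(uq_gen fpoly) mat \<Rightarrow> (uq_gen fpoly) mat \<Rightarrow> uq_elem algprod mat" where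
  "sB A B = (\<lambda>i j. \<Sum>k=1..N. (\<Sum>m=1..N. tau (A i m) * iotab (G m k)) * tau (B j k))"

lemma emb_sum: "emb (sum f A) = (\<Sum>x\<in>A. emb (f x))" for f :: "_ \<Rightarrow> 'b::ring_1"
  by (induction A rule: infinite_finite_induct) (simp_all add: emb_hom)

lemma Sm_emb: "L.Sm i j = emb (sB fT fTb i j)" and Sbm_emb: "L.Sbm i j = emb (sB fTb fT i j)"
  by (simp_all add: L.Sm_def L.Sbm_def sB_def emb_sum emb_hom iotaL_emb)

lemma comp_tau: "p \<in> carrier (uq_free N) \<Longrightarrow> comp_at (tau p) R \<iota> = uq_class q N p"
  unfolding lift_class_def by (simp add: lift_at_simps uq_class_closed calg_Uq_gl)

lemma comp_sB:
  assumes "\<And>i j. i \<in> {1..N} \<Longrightarrow> j \<in> {1..N} \<Longrightarrow> A i j \<in> carrier (uq_free N)"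
    and "\<And>i j. i \<in> {1..N} \<Longrightarrow> j \<in> {1..N} \<Longrightarrow> B i j \<in> carrier (uq_free N)"
    and "i \<in> {1..N}" "j \<in> {1..N}"
  shows "comp_at (sB A B i j) R \<iota> = mat_mul R N (mat_mul R N (\<lambda>i j. uq_class q N (A i j)) (\<lambda>i j. \<iota> (G i j)))
      (mat_transpose (\<lambda>i j. uq_class q N (B i j))) i j"
proof -
  have cl: "uq_class q N (A i k) \<in> carrier R" "uq_class q N (B j k) \<in> carrier R" "\<iota> s \<in> carrier R"
    if "k \<in> {1..N}" for k s
    using that assms by (auto intro: uq_class_closed calg_closed[OF calg_Uq_gl])
  have inner: "comp_at (\<Sum>m=1..N. tau (A i m) * iotab (G m k)) R \<iota>
      = (\<Oplus>\<^bsub>R\<^esub>m\<in>{1..N}. uq_class q N (A i m) \<otimes>\<^bsub>R\<^esub> \<iota> (G m k))" for k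
  proof -
    have "comp_at (\<Sum>m=1..N. tau (A i m) * iotab (G m k)) R \<iota>
        = (\<Oplus>\<^bsub>R\<^esub>m\<in>{1..N}. comp_at (tau (A i m) * iotab (G m k)) R \<iota>)"
      by (rule cr.phi_sum) simp_all
    also have "\<dots> = (\<Oplus>\<^bsub>R\<^esub>m\<in>{1..N}. uq_class q N (A i m) \<otimes>\<^bsub>R\<^esub> \<iota> (G m k))"
      using cl assms by (intro U.finsum_cong') (auto simp: calg_Uq_gl comp_tau simp del: One_nat_def)
    finally show ?thesis .
  qed
  have "comp_at (sB A B i j) R \<iota> = (\<Oplus>\<^bsub>R\<^esub>k\<in>{1..N}. comp_at ((\<Sum>m=1..N. tau (A i m) * iotab (G m k)) * tau (B j k)) R \<iota>)"
    unfolding sB_def by (rule cr.phi_sum) simp_all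
  also have "\<dots> = (\<Oplus>\<^bsub>R\<^esub>k\<in>{1..N}. (\<Oplus>\<^bsub>R\<^esub>m\<in>{1..N}. uq_class q N (A i m) \<otimes>\<^bsub>R\<^esub> \<iota> (G m k)) \<otimes>\<^bsub>R\<^esub> uq_class q N (B j k))"
  proof (rule U.finsum_cong')
    show "(\<lambda>k. (\<Oplus>\<^bsub>R\<^esub>m\<in>{1..N}. uq_class q N (A i m) \<otimes>\<^bsub>R\<^esub> \<iota> (G m k)) \<otimes>\<^bsub>R\<^esub> uq_class q N (B j k)) \<in> {1..N} \<rightarrow> carrier R"
      using cl by (auto intro!: U.finsum_closed simp del: One_nat_def)
    fix k assume k: "k \<in> {1..N}"
    have "comp_at (tau (B j k)) R \<iota> = uq_class q N (B j k)"
      using comp_tau assms k by blast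
    then show "comp_at ((\<Sum>m=1..N. tau (A i m) * iotab (G m k)) * tau (B j k)) R \<iota>
      = (\<Oplus>\<^bsub>R\<^esub>m\<in>{1..N}. uq_class q N (A i m) \<otimes>\<^bsub>R\<^esub> \<iota> (G m k)) \<otimes>\<^bsub>R\<^esub> uq_class q N (B j k)"
      unfolding comp_at_simps(5)[OF calg_Uq_gl] inner by simp
  qed simp
  finally show ?thesis
    by (simp add: mat_mul_def mat_transpose_def)
qed

lemma comp_S:
  assumes "i \<in> {1..N}" "j \<in> {1..N}"
  shows "comp_at (sB fT fTb i j) R \<iota> = S i j" "comp_at (sB fTb fT i j) R \<iota> = Sb i j"
  using comp_sB[of fT fTb i j] comp_sB[of fTb fT i j] assms fT_closed
  by (simp_all add: S_eq Sb_eq Tmat_def[abs_def] Tbmat_def[abs_def])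

lemma S_closed: "i \<in> {1..N} \<Longrightarrow> j \<in> {1..N} \<Longrightarrow> S i j \<in> carrier R"
  "i \<in> {1..N} \<Longrightarrow> j \<in> {1..N} \<Longrightarrow> Sb i j \<in> carrier R"
  using comp_S comp_at_closed[OF calg_Uq_gl] by metis+

lemma coeffs_at_iotaL_single: "coeffs_at R \<iota> (iotaL (Poly_Mapping.single n z)) = lmonom R (\<iota> z) n"
  by (rule ext) (simp add: coeffs_at_def lmonom_def lookup_single when_def calg_Uq_gl calg_zero[OF calg_Uq_gl])

lemma coeffs_Su:
  assumes "a \<in> {1..N}" "b \<in> {1..N}"
  shows "lscale R \<iota> (ui i) (S_series R \<iota> c S Sb a b)
    = coeffs_at R \<iota> (L.Su (Poly_Mapping.single (- 1) (inverse (ui i))) a b)"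
proof
  fix k :: int
  have z: "\<iota> x \<in> carrier R" for x by (rule calg_closed[OF calg_Uq_gl])
  have "L.Su (Poly_Mapping.single (- 1) (inverse (ui i))) a b = emb (sB fT fTb a b)
      + iotaL (Poly_Mapping.single (- 1) (c * inverse (ui i))) * emb (sB fTb fT a b)"
    by (simp add: L.Su_def Sm_emb Sbm_emb mult_single)
  then have e: "coeffs_at R \<iota> (L.Su (Poly_Mapping.single (- 1) (inverse (ui i))) a b) k
      = (if k = 0 then S a b else \<zero>\<^bsub>R\<^esub>) \<oplus>\<^bsub>R\<^esub> (\<iota> (if k = - 1 then c * inverse (ui i) else 0) \<otimes>\<^bsub>R\<^esub> Sb a b)"
    by (simp add: coeffs_at_def lookup_add lookup_times_emb calg_Uq_gl comp_S[OF assms] lookup_single when_def)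
  note i0 = calg_zero[OF calg_Uq_gl, of q N]
  have l: "lscale R \<iota> (ui i) (S_series R \<iota> c S Sb a b) k
      = \<iota> (ui i powi k) \<otimes>\<^bsub>R\<^esub> ((if k = 0 then S a b else \<zero>\<^bsub>R\<^esub>) \<oplus>\<^bsub>R\<^esub> (if k = - 1 then \<iota> c \<otimes>\<^bsub>R\<^esub> Sb a b else \<zero>\<^bsub>R\<^esub>))"
    by (simp add: lscale_def S_series_def lmonom_def)
  consider "k = 0" | "k = - 1" | "k \<noteq> 0" "k \<noteq> - 1" by blast
  then show "lscale R \<iota> (ui i) (S_series R \<iota> c S Sb a b) k
      = coeffs_at R \<iota> (L.Su (Poly_Mapping.single (- 1) (inverse (ui i))) a b) k"
  proof cases
    case 1
    then show ?thesis
      unfolding e l using S_closed assms by (simp add: i0 calg_hom(3)[OF calg_Uq_gl])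
  next
    case 2
    have "\<iota> (c * inverse (ui i)) = \<iota> (inverse (ui i)) \<otimes>\<^bsub>R\<^esub> \<iota> c"
      using calg_hom(2)[OF calg_Uq_gl, of q N "inverse (ui i)" c] by (simp add: mult.commute)
    then show ?thesis
      unfolding e l using 2 S_closed assms z by (simp add: power_int_minus U.m_assoc)
  next
    case 3
    then show ?thesis
      unfolding e l using S_closed assms z by (simp add: i0)
  qed
qed

text \<open>Matches the expression (x - y) R^t - x h Q with the entries of R(x,y) in the definition;
  on the diagonal, for instance, (x - y) q - x (q - q^{-1}) = q^{-1} x - q y.\<close>

lemma rtK_eq:
  "L.rtK i j a b k l = (if b = a \<and> k = l then
       (if b = k then iotaL (emb (inverse q)) * iotaL (Poly_Mapping.single (- 1) (inverse (ui i)))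
          - iotaL (emb q) * iotaL (Poly_Mapping.single 1 (ui j))
        else iotaL (Poly_Mapping.single (- 1) (inverse (ui i))) - iotaL (Poly_Mapping.single 1 (ui j)))
     else if k = a \<and> l = b then
       (if b > a then iotaL (emb (inverse q - q)) * iotaL (Poly_Mapping.single (- 1) (inverse (ui i)))
        else iotaL (emb (inverse q - q)) * iotaL (Poly_Mapping.single 1 (ui j)))
     else 0)"
proof -
  let ?r = "\<lambda>e e' x y :: int \<Rightarrow>\<^sub>0 complex. (x - y) * (if b = a \<and> k = l then (if b = k then e else 1)
      else if k = a \<and> l = b \<and> b < a then e - e' else 0) - x * (e - e') * (if k = a \<and> l = b then 1 else 0)"
  have r: "?r e e' x y = (if b = a \<and> k = l then (if b = k then e' * x - e * y else x - y)
      else if k = a \<and> l = b then (if b > a then (e' - e) * x else (e' - e) * y) else 0)" for e e' x y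
  proof -
    consider "b = a \<and> k = l" "b = k" | "b = a \<and> k = l" "b \<noteq> k" | "\<not> (b = a \<and> k = l)" "k = a \<and> l = b" "b < a"
      | "\<not> (b = a \<and> k = l)" "k = a \<and> l = b" "a < b" | "\<not> (b = a \<and> k = l)" "\<not> (k = a \<and> l = b)"
      by (metis linorder_neqE_nat)
    then show ?thesis
    proof cases
      case 1
      then show ?thesis by (simp add: algebra_simps)
    next
      case 2
      then have "\<not> (k = a \<and> l = b)" by auto
      then show ?thesis using 2 by (simp only: if_True if_False) simp
    next
      case 3
      then show ?thesis by (simp only: if_True if_False simp_thms) (simp add: algebra_simps)
    next
      case 4
      then have "\<not> (k = a \<and> l = b \<and> b < a)" by simp
      then show ?thesis using 4 by (simp only: if_True if_False) (simp add: algebra_simps)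
    next
      case 5
      then have "\<not> (k = a \<and> l = b \<and> b < a)" by blast
      then show ?thesis using 5 by (simp only: if_True if_False) simp
    qed
  qed
  have "L.rtK i j a b k l
      = iotaL (?r (emb q) (emb (inverse q)) (Poly_Mapping.single (- 1) (inverse (ui i))) (Poly_Mapping.single 1 (ui j)))"
    unfolding L.rtK_def transpose_fst_def L.rK_def L.pK_def L.h_def L.iota_mult[symmetric] L.iota_add[symmetric]
    by (intro arg_cong[where f = iotaL]) (simp only: mult_minus_left diff_conv_add_uminus)
  then show ?thesis
    unfolding r by (simp only: L.iota_mult L.iota_diff emb_hom(3) if_distrib[of iotaL] L.iota_zero)
qed

lemma coeffs_rtK:
  "transpose_fst (Ruv (laurent R) (\<lambda>c. lmonom R (\<iota> c) 0) q (lmonom R (\<iota> (inverse (ui i))) (- 1))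
      (lmonom R (\<iota> (ui j)) 1)) a b k l = coeffs_at R \<iota> (L.rtK i j a b k l)"
  unfolding rtK_eq transpose_fst_def Ruv_def if_distrib[of "coeffs_at R \<iota>"] coeffs_at_diff[OF calg_Uq_gl]
    rr.phi_mult[OF UNIV_I UNIV_I] coeffs_at_iotaL_single rr.phi_zero ..

text \<open>Besides computing the determinant, the product is traced inside \<open>W\<close>, so its
  coefficients are seen to lie in the generated subring. The witness is the eigenvalue
  \<open>L.sk q emb\<close>, whose commutation with S is already known.\<close>

lemma sdet_coeffs:
  assumes A: "A \<subseteq> carrier R" and SA: "\<And>i j. i \<in> {1..N} \<Longrightarrow> j \<in> {1..N} \<Longrightarrow> S i j \<in> A"
  shows "\<exists>D. sdet R \<iota> q N (S_series R \<iota> c S Sb) = coeffs_at R \<iota> D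
    \<and> (\<forall>k. coeffs_at R \<iota> D k \<in> generate_ring R (range \<iota> \<union> A))
    \<and> (\<forall>i\<in>{1..N}. \<forall>j\<in>{1..N}. D * L.Sm i j = L.Sm i j * D)"
proof -
  define H where "H = generate_ring R (range \<iota> \<union> A)"
  have H0: "\<zero>\<^bsub>R\<^esub> \<in> H" unfolding H_def by (rule U.zero_in_generate)
  define W where "W = {p :: int \<Rightarrow>\<^sub>0 uq_elem algprod. \<forall>k. comp_at (Poly_Mapping.lookup p k) R \<iota> \<in> H}"
  have Wsum: "comp_at (sum f B) R \<iota> \<in> H" if "\<And>x. x \<in> B \<Longrightarrow> comp_at (f x) R \<iota> \<in> H" for f :: "int \<Rightarrow> _" and B
    using that by (induction B rule: infinite_finite_induct)
      (auto simp: calg_Uq_gl H0, auto simp: H_def intro: generate_ring.eng_add)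
  have Wadd: "x + y \<in> W" if "x \<in> W" "y \<in> W" for x y
    using that by (auto simp: W_def lookup_add calg_Uq_gl H_def intro: generate_ring.eng_add)
  have Wmult: "x * y \<in> W" if "x \<in> W" "y \<in> W" for x y
    using that unfolding W_def mem_Collect_eq lookup_times_int[OF finite_keys order_refl]
    by (intro allI Wsum) (auto simp: calg_Uq_gl H_def intro: generate_ring.eng_mult)
  have Wiota: "iotaL s \<in> W" for s
    by (auto simp: W_def calg_Uq_gl H_def intro: generate_ring.incl)
  have W01: "0 \<in> W" "1 \<in> W"
    using Wiota[of 0] Wiota[of 1] by simp_all
  have Wdiff: "x - y \<in> W" if "x \<in> W" "y \<in> W" for x y
  proof -
    have "x - y = x + iotaL (- 1) * y"
      by (simp add: L.iota_uminus)
    then show ?thesis using that Wadd Wmult Wiota by metis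
  qed
  have WS: "L.Sm i j \<in> W" if "i \<in> {1..N}" "j \<in> {1..N}" for i j
    unfolding W_def Sm_emb using that SA
    by (auto simp: lookup_single when_def comp_S[OF that] calg_Uq_gl H0 simp del: One_nat_def)
      (auto simp: H_def intro: generate_ring.incl)
  have qd: "iotaL (L.qd i i) = iotaL (emb q)" for i by (simp add: L.qd_def)
  \<comment> \<open>The relation between Sbar and S is triangular: on and below the diagonal it
    gives an entry of Sbar as a scalar multiple of one entry of S.\<close>
  have WSb0: "L.Sbm i j \<in> W" if "i \<in> {1..N}" "j \<in> {1..N}" "j \<le> i" for i j
  proof (cases "i = j")
    case True
    have "iotaL (emb q) * L.Sbm i i = iotaL (emb \<kappa>) * L.Sm i i"
      using L.Sbm_symmetry[OF that(1,1)] by (simp add: qd)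
    then have "iotaL (emb (inverse q)) * (iotaL (emb q) * L.Sbm i i) = iotaL (emb (inverse q)) * (iotaL (emb \<kappa>) * L.Sm i i)"
      by simp
    then have "L.Sbm i i = iotaL (emb (inverse q)) * (iotaL (emb \<kappa>) * L.Sm i i)"
      by simp
    then show ?thesis
      unfolding True[symmetric] using WS[OF that(1,1)] Wiota Wmult by metis
  next
    case False
    then have "L.Sbm i j = iotaL (emb \<kappa>) * L.Sm j i"
      using L.Sbm_symmetry[OF that(1,2)] that(3) by (simp add: L.qd_def)
    then show ?thesis
      using WS[OF that(2,1)] Wiota Wmult by metis
  qed
  have WSb: "L.Sbm i j \<in> W" if "i \<in> {1..N}" "j \<in> {1..N}" for i j
  proof (cases "j \<le> i")
    case True
    then show ?thesis using WSb0 that by blast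
  next
    case False
    \<comment> \<open>Above the diagonal the additional term is an entry below the diagonal, which
      is already in \<open>W\<close>.\<close>
    then have "L.Sbm i j = iotaL (emb \<kappa>) * L.Sm j i - iotaL L.h * L.Sbm j i"
      using L.Sbm_symmetry[OF that] by (simp add: L.qd_def eq_diff_eq)
    moreover have "iotaL (emb \<kappa>) * L.Sm j i \<in> W" "iotaL L.h * L.Sbm j i \<in> W"
      using WS[OF that(2,1)] WSb0[OF that(2,1)] False by (auto intro: Wmult Wiota)
    ultimately show ?thesis
      using Wdiff by metis
  qed
  interpret w: ring_realization "laurent R" W "coeffs_at R \<iota>"
  proof (rule ring_realization.intro[OF rr.abelian])
    show "x \<in> W \<Longrightarrow> coeffs_at R \<iota> x \<in> carrier (laurent R)" for x by (rule rr.phi_closed[OF UNIV_I])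
    show "coeffs_at R \<iota> (x + y) = coeffs_at R \<iota> x \<oplus>\<^bsub>laurent R\<^esub> coeffs_at R \<iota> y"
      "coeffs_at R \<iota> (x * y) = coeffs_at R \<iota> x \<otimes>\<^bsub>laurent R\<^esub> coeffs_at R \<iota> y" for x y
      by (rule rr.phi_add[OF UNIV_I UNIV_I], rule rr.phi_mult[OF UNIV_I UNIV_I])
  qed (fact W01 Wadd Wmult rr.phi_zero rr.phi_one)+

  let ?u = "\<lambda>i. Poly_Mapping.single (- 1) (inverse (ui i)) :: int \<Rightarrow>\<^sub>0 complex"
  have WSu: "L.Su (?u i) a b \<in> W" if "a \<in> {1..N}" "b \<in> {1..N}" for i a b
    unfolding L.Su_def using that by (intro Wadd Wmult Wiota WS WSb)
  have Wrt: "L.rtK i j a b k l \<in> W" for i j a b k l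
    unfolding L.rtK_def by (intro Wadd Wmult Wiota)

  note sk_assms = q0 refl emb_hom(2) emb_hom(4) single_zero single_one
  define D where "D = L.sk q emb"
  let ?Si = "\<lambda>i. in_copy (laurent R) N i (\<lambda>a b. lscale R \<iota> (ui i) (S_series R \<iota> c S Sb a b))"
  let ?Rt = "\<lambda>i j. in_copies (laurent R) N i j (transpose_fst (Ruv (laurent R) (\<lambda>c. lmonom R (\<iota> c) 0) q
      (lmonom R (\<iota> (inverse (ui i))) (- 1)) (lmonom R (\<iota> (ui j)) 1)))"
  have sk: "sklyanin_product R \<iota> q N (S_series R \<iota> c S Sb) I J
      = coeffs_at R \<iota> (iotaL (emb (Aq q N I J)) * D) \<and> iotaL (emb (Aq q N I J)) * D \<in> W"
    if I: "I \<in> tidx N N" and J: "J \<in> tidx N N" for I J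
  proof -
    have zero: "\<zero>\<^bsub>laurent R\<^esub> = coeffs_at R \<iota> 0" by (rule rr.phi_zero[symmetric])
    have l1: "\<forall>I\<in>tidx N N. \<forall>J\<in>tidx N N. in_copyc N i (L.Su (?u i)) I J \<in> W
        \<and> ?Si i I J = coeffs_at R \<iota> (in_copyc N i (L.Su (?u i)) I J)" if "i \<in> {1..N}" for i
    proof (intro ballI)
      fix I J assume "I \<in> tidx N N" "J \<in> tidx N N"
      then have "I i \<in> {1..N}" "J i \<in> {1..N}" using tidx_range that by blast+
      then show "in_copyc N i (L.Su (?u i)) I J \<in> W \<and> ?Si i I J = coeffs_at R \<iota> (in_copyc N i (L.Su (?u i)) I J)"
        unfolding in_copy_def in_copyc_def zero using WSu W01 coeffs_Su by simp
    qed
    have l2: "\<forall>I\<in>tidx N N. \<forall>J\<in>tidx N N. in_copiesc N i j (L.rtK i j) I J \<in> W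
        \<and> ?Rt i j I J = coeffs_at R \<iota> (in_copiesc N i j (L.rtK i j) I J)" for i j
      unfolding in_copies_def in_copiesc_def zero coeffs_rtK using Wrt W01 by simp
    have l0: "\<forall>I\<in>tidx N N. \<forall>J\<in>tidx N N. iotaL (emb (Aq q N I J)) \<in> W
        \<and> lmonom R (\<iota> (Aq q N I J)) 0 = coeffs_at R \<iota> (iotaL (emb (Aq q N I J)))"
      using Wiota by (simp add: coeffs_at_iotaL_single)
    have "list_all2 (\<lambda>A B. \<forall>I\<in>tidx N N. \<forall>J\<in>tidx N N. B I J \<in> W \<and> A I J = coeffs_at R \<iota> (B I J))
        ((\<lambda>I J. lmonom R (\<iota> (Aq q N I J)) 0) # concat (map (\<lambda>i. ?Si i # map (?Rt i) [i + 1..<N + 1]) [1..<N + 1]))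
        ((\<lambda>I J. iotaL (emb (Aq q N I J))) # L.factors)"
      unfolding L.factors_def
    proof (rule list_all2_Cons[THEN iffD2], rule conjI[OF l0], rule list_all2_concatI)
      show "list_all2 (list_all2 (\<lambda>A B. \<forall>I\<in>tidx N N. \<forall>J\<in>tidx N N. B I J \<in> W \<and> A I J = coeffs_at R \<iota> (B I J)))
        (map (\<lambda>i. ?Si i # map (?Rt i) [i + 1..<N + 1]) [1..<N + 1])
        (map (\<lambda>i. in_copyc N i (L.Su (?u i)) # map (\<lambda>j. in_copiesc N i j (L.rtK i j)) [i + 1..<N + 1]) [1..<N + 1])"
        unfolding list_all2_map1 list_all2_map2 list_all2_same list_all2_Cons
        by (rule ballI, rule conjI, rule l1, force, rule ballI, rule l2)
    qed
    from w.tprod_eq[OF this I J] show ?thesis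
      unfolding sklyanin_product_def Let_def D_def L.tprodc_sklyanin[OF sk_assms I J] .
  qed
  \<comment> \<open>The entry of A^q at the identity index is 1, so D occurs itself as an entry of
    the product. Membership in \<open>W\<close> and uniqueness of the series both follow.\<close>
  have D1: "iotaL (emb (Aq q N (id_idx N) (id_idx N))) * D = D"
    by (simp add: Aq_id[OF q0])
  have DW: "D \<in> W"
    using sk[OF id_idx_tidx id_idx_tidx] unfolding D1 by blast
  have "sdet R \<iota> q N (S_series R \<iota> c S Sb) = coeffs_at R \<iota> D"
    unfolding sdet_def
  proof (rule the_equality)
    show "coeffs_at R \<iota> D \<in> carrier (laurent R) \<and> (\<forall>I\<in>tidx N N. \<forall>J\<in>tidx N N.
        sklyanin_product R \<iota> q N (S_series R \<iota> c S Sb) I J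
        = lmonom R (\<iota> (Aq q N I J)) 0 \<otimes>\<^bsub>laurent R\<^esub> coeffs_at R \<iota> D)"
      using sk rr.phi_closed[OF UNIV_I] rr.phi_mult[OF UNIV_I UNIV_I] coeffs_at_iotaL_single
      by (metis (no_types, lifting))
  next
    fix d
    assume d: "d \<in> carrier (laurent R) \<and> (\<forall>I\<in>tidx N N. \<forall>J\<in>tidx N N.
        sklyanin_product R \<iota> q N (S_series R \<iota> c S Sb) I J = lmonom R (\<iota> (Aq q N I J)) 0 \<otimes>\<^bsub>laurent R\<^esub> d)"
    then have "sklyanin_product R \<iota> q N (S_series R \<iota> c S Sb) (id_idx N) (id_idx N)
        = lmonom R (\<iota> 1) 0 \<otimes>\<^bsub>laurent R\<^esub> d"
      using id_idx_tidx Aq_id[OF q0] by metis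
    then show "d = coeffs_at R \<iota> D"
      using sk[OF id_idx_tidx id_idx_tidx] d lmonom_one_mult[OF ring_Uq_gl]
      unfolding D1 calg_hom(3)[OF calg_Uq_gl] by metis
  qed
  moreover have "\<forall>k. coeffs_at R \<iota> D k \<in> H"
    using DW by (simp add: W_def coeffs_at_def)
  moreover have "\<forall>i\<in>{1..N}. \<forall>j\<in>{1..N}. D * L.Sm i j = L.Sm i j * D"
    unfolding D_def using L.sk_central[OF sk_assms] by blast
  ultimately show ?thesis
    unfolding H_def by blast
qed

theorem sdet_member_commute:
  assumes "A \<subseteq> carrier R" "\<And>i j. i \<in> {1..N} \<Longrightarrow> j \<in> {1..N} \<Longrightarrow> S i j \<in> A"
  shows "sdet R \<iota> q N (S_series R \<iota> c S Sb) k \<in> generate_ring R (range \<iota> \<union> A)"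
    and "i \<in> {1..N} \<Longrightarrow> j \<in> {1..N} \<Longrightarrow> sdet R \<iota> q N (S_series R \<iota> c S Sb) k \<otimes>\<^bsub>R\<^esub> S i j
      = S i j \<otimes>\<^bsub>R\<^esub> sdet R \<iota> q N (S_series R \<iota> c S Sb) k"
proof -
  obtain D where D: "sdet R \<iota> q N (S_series R \<iota> c S Sb) = coeffs_at R \<iota> D"
    "\<forall>k. coeffs_at R \<iota> D k \<in> generate_ring R (range \<iota> \<union> A)"
    "\<forall>i\<in>{1..N}. \<forall>j\<in>{1..N}. D * L.Sm i j = L.Sm i j * D"
    using sdet_coeffs[OF assms] by blast
  show "sdet R \<iota> q N (S_series R \<iota> c S Sb) k \<in> generate_ring R (range \<iota> \<union> A)"
    using D by simp
  show "sdet R \<iota> q N (S_series R \<iota> c S Sb) k \<otimes>\<^bsub>R\<^esub> S i j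
      = S i j \<otimes>\<^bsub>R\<^esub> sdet R \<iota> q N (S_series R \<iota> c S Sb) k" if "i \<in> {1..N}" "j \<in> {1..N}"
  proof -
    have "D * emb (sB fT fTb i j) = emb (sB fT fTb i j) * D"
      using D(3) that unfolding Sm_emb by blast
    \<comment> \<open>S has degree 0 in u, so commuting with it is a condition on each coefficient
      separately.\<close>
    from arg_cong[OF this, of "\<lambda>x. Poly_Mapping.lookup x k"]
    have "Poly_Mapping.lookup D k * sB fT fTb i j = sB fT fTb i j * Poly_Mapping.lookup D k"
      unfolding lookup_times_emb .
    from arg_cong[OF this, of "\<lambda>x. comp_at x R \<iota>"] show ?thesis
      unfolding D(1) coeffs_at_def by (simp add: calg_Uq_gl comp_S[OF that])
  qed
qed

end

section \<open>The orthogonal and the symplectic algebra\<close>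

lemma subalgebra_center:
  assumes "ring R" "A \<subseteq> carrier R" "\<And>s. \<iota> s \<in> carrier R"
    and "\<And>s x. x \<in> carrier R \<Longrightarrow> x \<otimes>\<^bsub>R\<^esub> \<iota> s = \<iota> s \<otimes>\<^bsub>R\<^esub> x"
    and z: "z \<in> generate_ring R (range \<iota> \<union> A)" and "\<And>x. x \<in> A \<Longrightarrow> z \<otimes>\<^bsub>R\<^esub> x = x \<otimes>\<^bsub>R\<^esub> z"
  shows "z \<in> ring_center (subalgebra_generated R \<iota> A)"
proof -
  interpret ring R by fact
  have H: "range \<iota> \<union> A \<subseteq> carrier R" using assms by auto
  have "z \<in> carrier R" using generate_ring_in_carrier[OF H z] .
  then have "z \<otimes>\<^bsub>R\<^esub> x = x \<otimes>\<^bsub>R\<^esub> z" if "x \<in> range \<iota> \<union> A" for x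
    using that assms(4)[of z] assms(6) by auto
  then have "z \<otimes>\<^bsub>R\<^esub> x = x \<otimes>\<^bsub>R\<^esub> z" if "x \<in> generate_ring R (range \<iota> \<union> A)" for x
    using generate_ring_commute[OF \<open>z \<in> carrier R\<close> H _ that] by blast
  then show ?thesis
    using z by (simp add: ring_center_def subalgebra_generated_def)
qed

lemma mat_mul_one:
  assumes "calg R \<iota>" "\<And>m. m \<in> {1..N} \<Longrightarrow> A i m \<in> carrier R" "k \<in> {1..N}"
  shows "mat_mul R N A (\<lambda>i j. \<iota> (if i = j then 1 else 0)) i k = A i k"
proof -
  interpret ring R by (rule calg_ring[OF assms(1)])
  note i0 = calg_zero[OF assms(1)]
  have "mat_mul R N A (\<lambda>i j. \<iota> (if i = j then 1 else 0)) i k = (\<Oplus>\<^bsub>R\<^esub>m\<in>{1..N}. if k = m then A i m else \<zero>\<^bsub>R\<^esub>)"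
    unfolding mat_mul_def
    by (rule finsum_cong') (use assms in \<open>auto simp: i0 calg_hom(3)[OF assms(1)] simp del: One_nat_def\<close>)
  also have "\<dots> = A i k"
    by (rule finsum_singleton) (use assms in auto)
  finally show ?thesis .
qed

lemma Tmat_closed:
  "i \<in> {1..N} \<Longrightarrow> j \<in> {1..N} \<Longrightarrow> Tmat q N i j \<in> carrier (Uq_gl q N)"
  "i \<in> {1..N} \<Longrightarrow> j \<in> {1..N} \<Longrightarrow> Tbmat q N i j \<in> carrier (Uq_gl q N)"
  unfolding Tmat_def Tbmat_def by (intro uq_class_closed fT_closed; assumption)+

text \<open>For G = 1 the symmetry relation reduces to q = \<open>\<kappa>\<close> on the diagonal,
  and then c = q^{-1} satisfies \<open>c * c * \<kappa> = \<kappa>'\<close>.\<close>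

lemma twisted_o:
  assumes "q \<noteq> 0" "q * q \<noteq> 1" "N \<ge> 1"
  shows "twisted_algebra q N (\<lambda>i j. if i = j then 1 else 0) q (inverse q) (inverse q) (S_o q N) (Sb_o q N)"
proof
  have m: "mat_mul (Uq_gl q N) N (mat_mul (Uq_gl q N) N A (\<lambda>i j. uq_scal q N (if i = j then 1 else 0))) B i j
      = mat_mul (Uq_gl q N) N A B i j"
    if "\<And>i j. i \<in> {1..N} \<Longrightarrow> j \<in> {1..N} \<Longrightarrow> A i j \<in> carrier (Uq_gl q N)"
      "\<And>i j. i \<in> {1..N} \<Longrightarrow> j \<in> {1..N} \<Longrightarrow> B i j \<in> carrier (Uq_gl q N)" "i \<in> {1..N}" "j \<in> {1..N}" for A B i j
  proof -
    interpret ring "Uq_gl q N" by (rule ring_Uq_gl)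
    have "mat_mul (Uq_gl q N) N A (\<lambda>i j. uq_scal q N (if i = j then 1 else 0)) i k = A i k" if "k \<in> {1..N}" for k
      using \<open>i \<in> {1..N}\<close> that \<open>\<And>i j. i \<in> {1..N} \<Longrightarrow> j \<in> {1..N} \<Longrightarrow> A i j \<in> carrier (Uq_gl q N)\<close>
      by (intro mat_mul_one calg_Uq_gl)
    then show ?thesis
      unfolding mat_mul_def[of _ _ _ B] using that by (intro finsum_cong') (auto simp del: One_nat_def)
  qed
  show "S_o q N i j = mat_mul (Uq_gl q N) N (mat_mul (Uq_gl q N) N (Tmat q N)
      (\<lambda>i j. uq_scal q N (if i = j then 1 else 0))) (mat_transpose (Tbmat q N)) i j"
    "Sb_o q N i j = mat_mul (Uq_gl q N) N (mat_mul (Uq_gl q N) N (Tbmat q N)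
      (\<lambda>i j. uq_scal q N (if i = j then 1 else 0))) (mat_transpose (Tmat q N)) i j"
    if "i \<in> {1..N}" "j \<in> {1..N}" for i j
    unfolding S_o_def Sb_o_def using that
    by (intro m[symmetric]; simp add: mat_transpose_def Tmat_closed)+
  show "reflection_matrix q (\<lambda>i j. if i = j then 1 else 0) i j k l" for i j k l
    by (rule reflection_matrix_one)
qed (use assms in auto)

text \<open>At (2k-1, 2k) the symmetry relation reads -1 = \<open>\<kappa>\<close> q, and at (2k,
  2k-1) it reads q - (q - q^{-1}) = -\<open>\<kappa>\<close>. Both give \<open>\<kappa>\<close> =
  -q^{-1}, and c = q fits.\<close>

lemma twisted_sp:
  assumes "q \<noteq> 0" "q * q \<noteq> 1" "n \<ge> 1"
  shows "twisted_algebra q (2 * n) (Gmat q) (- inverse q) (- q) q (S_sp q n) (Sb_sp q n)"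
proof
  show "reflection_matrix q (Gmat q) i j k l"
    if "i \<in> {1..2 * n}" "j \<in> {1..2 * n}" "k \<in> {1..2 * n}" "l \<in> {1..2 * n}" for i j k l
    using that assms by (intro reflection_matrix_Gmat) auto
  show "(if x = y then q else 1) * Gmat q y x + (if y < x then (q - inverse q) * Gmat q x y else 0)
      = - inverse q * Gmat q x y" for x y
  proof -
    consider "x = y" | "odd x" "y = x + 1" | "odd y" "x = y + 1"
      | "x \<noteq> y" "\<not> (odd x \<and> y = x + 1)" "\<not> (odd y \<and> x = y + 1)" by blast
    then show ?thesis
      by cases (use assms in \<open>auto simp: Gmat_def field_simps\<close>)
  qed
qed (use assms in \<open>auto simp: S_sp_def Sb_sp_def Let_def\<close>)

text \<open>T is lower and Tbar upper triangular, and G couples an index up to 2k-1 with one from 2k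
  on only at (2k-1, 2k). So the entry collapses to q times a diagonal entry of T times a diagonal
  entry of Tbar, all of them units.\<close>

lemma S_sp_unit:
  assumes q: "q \<noteq> 0" and k: "k \<in> {1..n}"
  shows "S_sp q n (2 * k - 1) (2 * k) \<in> Units (Uq_gl q (2 * n))"
proof -
  let ?N = "2 * n" and ?R = "Uq_gl q (2 * n)" and ?i = "uq_scal q (2 * n)"
  interpret ring ?R by (rule ring_Uq_gl)
  note c = calg_Uq_gl[of q ?N]
  let ?T = "Tmat q ?N" and ?Tb = "Tbmat q ?N"
  have rel0: "uq_class q ?N x = \<zero>\<^bsub>?R\<^esub>" if "x \<in> uq_relators q ?N" for x
  proof -
    have "uq_class q ?N x = uq_class q ?N 0"
      using that uq_relators_closed by (intro uq_class_eq) (auto simp: free_algebra_closed)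
    moreover have "uq_class q ?N 0 \<oplus>\<^bsub>?R\<^esub> uq_class q ?N 0 = uq_class q ?N 0"
      using uq_class_simps(1)[of 0 ?N 0 q] by (simp add: free_algebra_closed)
    then have "uq_class q ?N 0 = \<zero>\<^bsub>?R\<^esub>"
      using uq_class_closed[of 0 ?N q] by (simp add: free_algebra_closed add.r_cancel_one)
    ultimately show ?thesis by simp
  qed
  have T0: "?T i j = \<zero>\<^bsub>?R\<^esub>" "?Tb j i = \<zero>\<^bsub>?R\<^esub>" if "i \<in> {1..?N}" "j \<in> {1..?N}" "i < j" for i j
  proof -
    have "fT i j \<in> uq_relators q ?N" "fTb j i \<in> uq_relators q ?N"
      unfolding uq_relators_def using that by blast+
    then show "?T i j = \<zero>\<^bsub>?R\<^esub>" "?Tb j i = \<zero>\<^bsub>?R\<^esub>"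
      unfolding Tmat_def Tbmat_def by (simp_all only: rel0)
  qed
  have inv: "?T i i \<otimes>\<^bsub>?R\<^esub> ?Tb i i = \<one>\<^bsub>?R\<^esub>" "?Tb i i \<otimes>\<^bsub>?R\<^esub> ?T i i = \<one>\<^bsub>?R\<^esub>" if i: "i \<in> {1..?N}" for i
  proof -
    have "uq_class q ?N (fT i i * fTb i i) = uq_class q ?N 1" "uq_class q ?N (fTb i i * fT i i) = uq_class q ?N 1"
      using i fT_closed[OF i i]
      by (intro uq_class_eq; force simp: uq_relators_def intro!: free_algebra_closed)+
    then show "?T i i \<otimes>\<^bsub>?R\<^esub> ?Tb i i = \<one>\<^bsub>?R\<^esub>" "?Tb i i \<otimes>\<^bsub>?R\<^esub> ?T i i = \<one>\<^bsub>?R\<^esub>"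
      using fT_closed[OF i i] by (simp_all add: uq_class_simps uq_class_one Tmat_def Tbmat_def)
  qed
  have units: "?T i i \<in> Units ?R" "?Tb i i \<in> Units ?R" if i: "i \<in> {1..?N}" for i
    using inv[OF i] Tmat_closed[OF i i] by (auto simp: Units_def)
  have sq: "?i s \<in> Units ?R" if "s \<noteq> 0" for s
  proof -
    have "?i s \<otimes>\<^bsub>?R\<^esub> ?i (inverse s) = \<one>\<^bsub>?R\<^esub>" "?i (inverse s) \<otimes>\<^bsub>?R\<^esub> ?i s = \<one>\<^bsub>?R\<^esub>"
      using that by (simp_all add: calg_hom(3)[OF c] flip: calg_hom(2)[OF c])
    then show ?thesis
      using calg_closed[OF c] by (auto simp: Units_def)
  qed
  note i0 = calg_zero[OF c]
  let ?a = "2 * k - 1" and ?b = "2 * k"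
  have ab: "?a \<in> {1..?N}" "?b \<in> {1..?N}" "odd ?a" "?b = ?a + 1" using k by auto
  note cl = Tmat_closed calg_closed[OF c]
  let ?in = "\<lambda>y. mat_mul ?R ?N ?T (\<lambda>i j. ?i (Gmat q i j)) ?a y"
  have in_cl: "?in y \<in> carrier ?R" for y
    unfolding mat_mul_def using cl ab by (intro finsum_closed) auto
  have in_b: "?in ?b = ?T ?a ?a \<otimes>\<^bsub>?R\<^esub> ?i q"
  proof -
    have "?in ?b = (\<Oplus>\<^bsub>?R\<^esub>m\<in>{1..?N}. if ?a = m then ?T ?a m \<otimes>\<^bsub>?R\<^esub> ?i q else \<zero>\<^bsub>?R\<^esub>)"
      unfolding mat_mul_def
    proof (rule finsum_cong')
      fix m assume m: "m \<in> {1..?N}"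
      have "Gmat q m ?b = (if m = ?a then q else 0)" if "m \<le> ?a"
        using that ab by (auto simp: Gmat_def)
      then show "?T ?a m \<otimes>\<^bsub>?R\<^esub> ?i (Gmat q m ?b) = (if ?a = m then ?T ?a m \<otimes>\<^bsub>?R\<^esub> ?i q else \<zero>\<^bsub>?R\<^esub>)"
        using T0(1)[OF ab(1) m] cl ab m by (cases "m \<le> ?a") (auto simp: i0)
    qed (use cl ab in auto)
    also have "\<dots> = ?T ?a ?a \<otimes>\<^bsub>?R\<^esub> ?i q"
      by (rule finsum_singleton) (use cl ab in auto)
    finally show ?thesis .
  qed
  have in_y: "?in y = \<zero>\<^bsub>?R\<^esub>" if "y > ?b" for y
  proof -
    have "?in y = (\<Oplus>\<^bsub>?R\<^esub>m\<in>{1..?N}. \<zero>\<^bsub>?R\<^esub>)"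
      unfolding mat_mul_def
    proof (rule finsum_cong')
      fix m assume m: "m \<in> {1..?N}"
      have "Gmat q m y = 0" if "m \<le> ?a"
        using that ab \<open>y > ?b\<close> by (auto simp: Gmat_def)
      then show "?T ?a m \<otimes>\<^bsub>?R\<^esub> ?i (Gmat q m y) = \<zero>\<^bsub>?R\<^esub>"
        using T0(1)[OF ab(1) m] cl ab m by (cases "m \<le> ?a") (auto simp: i0)
    qed auto
    then show ?thesis by simp
  qed
  have "S_sp q n ?a ?b = (\<Oplus>\<^bsub>?R\<^esub>y\<in>{1..?N}. ?in y \<otimes>\<^bsub>?R\<^esub> ?Tb ?b y)"
    unfolding S_sp_def Let_def mat_mul_def[of _ _ _ "mat_transpose _"] by (simp only: mat_transpose_def)
  also have "\<dots> = (\<Oplus>\<^bsub>?R\<^esub>y\<in>{1..?N}. if ?b = y then ?in y \<otimes>\<^bsub>?R\<^esub> ?Tb ?b y else \<zero>\<^bsub>?R\<^esub>)"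
  proof (rule finsum_cong')
    fix y assume y: "y \<in> {1..?N}"
    consider "y < ?b" | "y = ?b" | "y > ?b" by linarith
    then show "?in y \<otimes>\<^bsub>?R\<^esub> ?Tb ?b y = (if ?b = y then ?in y \<otimes>\<^bsub>?R\<^esub> ?Tb ?b y else \<zero>\<^bsub>?R\<^esub>)"
      using T0(2)[OF y ab(2)] in_y in_cl cl y ab by cases auto
  qed (use cl ab in_cl in auto)
  also have "\<dots> = ?in ?b \<otimes>\<^bsub>?R\<^esub> ?Tb ?b ?b"
    by (rule finsum_singleton) (use cl ab in_cl in auto)
  finally have "S_sp q n ?a ?b = ?T ?a ?a \<otimes>\<^bsub>?R\<^esub> ?i q \<otimes>\<^bsub>?R\<^esub> ?Tb ?b ?b"
    unfolding in_b .
  then show ?thesis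
    using units[OF ab(1)] units[OF ab(2)] sq[OF q] by simp
qed

theorem proposition4p5:
  fixes q :: complex
  assumes "q \<noteq> 0"
    and "\<forall>k::nat. k > 0 \<longrightarrow> q ^ k \<noteq> 1"
  shows "(\<forall>N\<ge>1. \<forall>k. sdet_o q N k \<in> ring_center (Utw_o q N)) \<and>
         (\<forall>n\<ge>1. \<forall>k. sdet_sp q n k \<in> ring_center (Utw_sp q n))"
proof (intro conjI allI impI)
  have q2: "q * q \<noteq> 1"
    using assms(2)[rule_format, of 2] by (simp add: power2_eq_square)
  note center = subalgebra_center[OF ring_Uq_gl, where \<iota> = "uq_scal q M" for M]
  note scal = calg_closed[OF calg_Uq_gl] calg_hom(4)[OF calg_Uq_gl]
  {
    fix N :: nat and k :: int assume N: "1 \<le> N"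
    interpret t: twisted_algebra q N "\<lambda>i j. if i = j then 1 else 0" q "inverse q" "inverse q" "S_o q N" "Sb_o q N"
      by (rule twisted_o[OF assms(1) q2 N])
    let ?A = "{S_o q N i j | i j. i \<in> {1..N} \<and> j \<in> {1..N}}"
    have A: "?A \<subseteq> carrier (Uq_gl q N)"
      using t.S_closed(1) by blast
    have SA: "S_o q N i j \<in> ?A" if "i \<in> {1..N}" "j \<in> {1..N}" for i j
      using that by blast
    have mem: "sdet_o q N k \<in> generate_ring (Uq_gl q N) (range (uq_scal q N) \<union> ?A)"
      unfolding sdet_o_def by (rule t.sdet_member_commute(1)[OF A], rule SA)
    have comm: "sdet_o q N k \<otimes>\<^bsub>Uq_gl q N\<^esub> S_o q N i j = S_o q N i j \<otimes>\<^bsub>Uq_gl q N\<^esub> sdet_o q N k"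
      if "i \<in> {1..N}" "j \<in> {1..N}" for i j
      unfolding sdet_o_def by (rule t.sdet_member_commute(2)[OF A _ that], rule SA)
    show "sdet_o q N k \<in> ring_center (Utw_o q N)"
      unfolding Utw_o_def using comm by (intro center[OF A scal mem]) blast+
  }
  {
    fix n :: nat and k :: int assume n: "1 \<le> n"
    interpret t: twisted_algebra q "2 * n" "Gmat q" "- inverse q" "- q" q "S_sp q n" "Sb_sp q n"
      by (rule twisted_sp[OF assms(1) q2 n])
    let ?R = "Uq_gl q (2 * n)"
    interpret ring ?R by (rule ring_Uq_gl)
    let ?A = "{S_sp q n i j | i j. i \<in> {1..2*n} \<and> j \<in> {1..2*n}} \<union>
        {inv\<^bsub>?R\<^esub> (S_sp q n (2*k - 1) (2*k)) | k. k \<in> {1..n}}"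
    have A: "?A \<subseteq> carrier ?R"
      using t.S_closed(1) S_sp_unit[OF assms(1)] Units_inv_closed by blast
    have SA: "S_sp q n i j \<in> ?A" if "i \<in> {1..2*n}" "j \<in> {1..2*n}" for i j
      using that by blast
    have mem: "sdet_sp q n k \<in> generate_ring ?R (range (uq_scal q (2 * n)) \<union> ?A)"
      unfolding sdet_sp_def by (rule t.sdet_member_commute(1)[OF A], rule SA)
    have comm: "sdet_sp q n k \<otimes>\<^bsub>?R\<^esub> S_sp q n i j = S_sp q n i j \<otimes>\<^bsub>?R\<^esub> sdet_sp q n k"
      if "i \<in> {1..2*n}" "j \<in> {1..2*n}" for i j
      unfolding sdet_sp_def by (rule t.sdet_member_commute(2)[OF A _ that], rule SA)
    have "range (uq_scal q (2 * n)) \<union> ?A \<subseteq> carrier ?R"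
      using A scal(1) by blast
    from generate_ring_in_carrier[OF this mem]
    have z: "sdet_sp q n k \<in> carrier ?R" .
    \<comment> \<open>The adjoined inverses are generators as well; what commutes with a unit
      commutes with its inverse.\<close>
    have "sdet_sp q n k \<otimes>\<^bsub>?R\<^esub> inv\<^bsub>?R\<^esub> (S_sp q n (2*j - 1) (2*j)) = inv\<^bsub>?R\<^esub> (S_sp q n (2*j - 1) (2*j)) \<otimes>\<^bsub>?R\<^esub> sdet_sp q n k"
      if "j \<in> {1..n}" for j
      using that by (intro commute_inv[OF z S_sp_unit[OF assms(1) that]] comm) auto
    then show "sdet_sp q n k \<in> ring_center (Utw_sp q n)"
      unfolding Utw_sp_def using comm by (intro center[OF A scal mem]) blast+
  }
qed

end
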